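(* If $\mathbf{V}$ is a dagger compact category with dagger biproducts, then so is $\mathrm{CP}^*[\mathbf{V}]$.
   Context: $\mathbf{V}$ has symmetry $\sigma$ and duals $\eta_A\colon I\to A^*\otimes A$, $\varepsilon_A\colon A\otimes A^*\to I$, where $\varepsilon_A=\eta_A^\dagger\circ\sigma_{A,A^*}$; we use $(A\otimes B)^*=B^*\otimes A^*$ and suppress coherence isomorphisms. For $g\colon A\to B$ put $g_*=(g^\dagger)^*\colon A^*\to B^*$. A category has dagger biproducts when it has a zero object and, for any two objects, a biproduct $A\oplus B$ with injections $i_A,i_B$ and projections $p_A,p_B$ (simultaneously a product and a coproduct, with $p_A i_A=1$, $p_B i_B=1$, $p_A i_B=0$, $p_B i_A=0$) such that $p_A=i_A^\dagger$ and $p_B=i_B^\dagger$. Completely positive: a morphism $f\colon A^*\otimes A\to B^*\otimes B$ is completely positive if $f=(1_{B^*}\otimes\eta_X^\dagger\otimes 1_B)\circ(g_*\otimes g)$ for some object $X$ and some $g\colon A\to X\otimes B$. Dagger Frobenius algebra: an object $A$ with $m\colon A\otimes A\to A$ and $u\colon I\to A$ such that $m$ is associative with two-sided unit $u$ and $(m\otimes 1)\circ(1\otimes m^\dagger)=m^\dagger\circ m=(1\otimes m)\circ(m^\dagger\otimes 1)$. A map $z\colon A\to A$ is central if $z\circ m=m\circ(z\otimes 1)=m\circ(1\otimes z)$, and positive if $z=h^\dagger\circ h$ for some $h$. The action is $\alpha_A=(1_{A^*}\otimes m)\circ(\eta_A\otimes 1_A)\colon A\to A^*\otimes A$, and the coaction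 is $\alpha_A^\dagger$. Normalisable: $(A,m,u)$ comes with a central positive isomorphism $z\colon A\to A$ (the normaliser) such that $\eta_A^\dagger\circ\alpha_A\circ z\circ z=u^\dagger$. $\mathrm{CP}^*[\mathbf{V}]$: objects are normalisable dagger Frobenius algebras $(A,m,u,z)$ in $\mathbf{V}$; morphisms $(A,m_A,u_A,z_A)\to(B,m_B,u_B,z_B)$ are morphisms $f\colon A\to B$ of $\mathbf{V}$ such that $\alpha_B\circ f\circ\alpha_A^\dagger$ is completely positive; composition, identities, dagger and tensor of morphisms are those of $\mathbf{V}$; the tensor of objects is $(A\otimes B,(m_A\otimes m_B)\circ(1\otimes\sigma\otimes1),u_A\otimes u_B,z_A\otimes z_B)$. It is already known that, with this structure, $\mathrm{CP}^*[\mathbf{V}]$ is dagger compact whenever $\mathbf{V}$ is. *)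

theory Defs
  imports Main
begin

section \<open>Dagger symmetric monoidal categories\<close>

text \<open>
  Categories are given by hom-sets. The hom-sets need not be disjoint, so that an element of
  \<open>'a\<close> may be a morphism between several pairs of objects; the operations on morphisms do
  not depend on the chosen pair. This is what allows the morphisms of CP* to be morphisms of the
  underlying category. All axioms are relative to the carriers \<open>Obj\<close> and \<open>Hom\<close>.

  Monoidal structure is not assumed to be strict: the coherence isomorphisms are explicit.
  They are required to be unitary, so their daggers serve as their inverses throughout.
\<close>

record ('o, 'a) dsm_structure =
  Obj :: "'o set"
  Hom :: "'o \<Rightarrow> 'o \<Rightarrow> 'a set"
  Id :: "'o \<Rightarrow> 'a" ("\<one>\<index>")
  Comp :: "'a \<Rightarrow> 'a \<Rightarrow> 'a" (infixr "\<cdot>\<index>" 55)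
  Dag :: "'a \<Rightarrow> 'a" ("_\<^sup>\<dagger>\<index>" [1000] 999)
  TensorObj :: "'o \<Rightarrow> 'o \<Rightarrow> 'o" (infixr "\<odot>\<index>" 70)
  TensorHom :: "'a \<Rightarrow> 'a \<Rightarrow> 'a" (infixr "\<otimes>\<index>" 70)
  Unit :: "'o" ("\<I>\<index>")
  Assoc :: "'o \<Rightarrow> 'o \<Rightarrow> 'o \<Rightarrow> 'a" ("\<a>\<index>")
  LeftUnit :: "'o \<Rightarrow> 'a" ("\<l>\<index>")
  RightUnit :: "'o \<Rightarrow> 'a" ("\<r>\<index>")
  Sym :: "'o \<Rightarrow> 'o \<Rightarrow> 'a" ("\<sigma>\<index>")

locale category =
  fixes C :: "('o, 'a) dsm_structure" (structure)
  assumes Id_in_Hom: "A \<in> Obj C \<Longrightarrow> \<one> A \<in> Hom C A A"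
    and Comp_in_Hom: "\<lbrakk>A \<in> Obj C; B \<in> Obj C; D \<in> Obj C; f \<in> Hom C A B; g \<in> Hom C B D\<rbrakk>
      \<Longrightarrow> g \<cdot> f \<in> Hom C A D"
    and Comp_assoc: "\<lbrakk>A \<in> Obj C; B \<in> Obj C; D \<in> Obj C; E \<in> Obj C;
      f \<in> Hom C A B; g \<in> Hom C B D; h \<in> Hom C D E\<rbrakk> \<Longrightarrow> (h \<cdot> g) \<cdot> f = h \<cdot> (g \<cdot> f)"
    and Id_left: "\<lbrakk>A \<in> Obj C; B \<in> Obj C; f \<in> Hom C A B\<rbrakk> \<Longrightarrow> \<one> B \<cdot> f = f"
    and Id_right: "\<lbrakk>A \<in> Obj C; B \<in> Obj C; f \<in> Hom C A B\<rbrakk> \<Longrightarrow> f \<cdot> \<one> A = f"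

locale dagger_category = category +
  assumes Dag_in_Hom: "\<lbrakk>A \<in> Obj C; B \<in> Obj C; f \<in> Hom C A B\<rbrakk> \<Longrightarrow> f\<^sup>\<dagger> \<in> Hom C B A"
    and Dag_Dag: "\<lbrakk>A \<in> Obj C; B \<in> Obj C; f \<in> Hom C A B\<rbrakk> \<Longrightarrow> (f\<^sup>\<dagger>)\<^sup>\<dagger> = f"
    and Dag_Id: "A \<in> Obj C \<Longrightarrow> (\<one> A)\<^sup>\<dagger> = \<one> A"
    and Dag_Comp: "\<lbrakk>A \<in> Obj C; B \<in> Obj C; D \<in> Obj C; f \<in> Hom C A B; g \<in> Hom C B D\<rbrakk>
      \<Longrightarrow> (g \<cdot> f)\<^sup>\<dagger> = f\<^sup>\<dagger> \<cdot> g\<^sup>\<dagger>"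

definition unitary :: "('o, 'a) dsm_structure \<Rightarrow> 'o \<Rightarrow> 'o \<Rightarrow> 'a \<Rightarrow> bool" where
  "unitary C A B v \<longleftrightarrow> v \<in> Hom C A B \<and> Dag C v \<cdot>\<^bsub>C\<^esub> v = \<one>\<^bsub>C\<^esub> A \<and> v \<cdot>\<^bsub>C\<^esub> Dag C v = \<one>\<^bsub>C\<^esub> B"

locale dagger_symmetric_monoidal_category = dagger_category +
  assumes Unit_in_Obj: "\<I> \<in> Obj C"
    and TensorObj_in_Obj: "\<lbrakk>A \<in> Obj C; B \<in> Obj C\<rbrakk> \<Longrightarrow> A \<odot> B \<in> Obj C"
    and TensorHom_in_Hom: "\<lbrakk>A \<in> Obj C; B \<in> Obj C; A' \<in> Obj C; B' \<in> Obj C;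
      f \<in> Hom C A B; g \<in> Hom C A' B'\<rbrakk> \<Longrightarrow> f \<otimes> g \<in> Hom C (A \<odot> A') (B \<odot> B')"
    and TensorHom_Id: "\<lbrakk>A \<in> Obj C; B \<in> Obj C\<rbrakk> \<Longrightarrow> \<one> A \<otimes> \<one> B = \<one> (A \<odot> B)"
    and TensorHom_Comp: "\<lbrakk>A \<in> Obj C; B \<in> Obj C; D \<in> Obj C; A' \<in> Obj C; B' \<in> Obj C; D' \<in> Obj C;
      f \<in> Hom C A B; g \<in> Hom C B D; f' \<in> Hom C A' B'; g' \<in> Hom C B' D'\<rbrakk>
      \<Longrightarrow> (g \<cdot> f) \<otimes> (g' \<cdot> f') = (g \<otimes> g') \<cdot> (f \<otimes> f')"
    and Dag_TensorHom: "\<lbrakk>A \<in> Obj C; B \<in> Obj C; A' \<in> Obj C; B' \<in> Obj C;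
      f \<in> Hom C A B; g \<in> Hom C A' B'\<rbrakk> \<Longrightarrow> (f \<otimes> g)\<^sup>\<dagger> = f\<^sup>\<dagger> \<otimes> g\<^sup>\<dagger>"
    and Assoc_unitary: "\<lbrakk>A \<in> Obj C; B \<in> Obj C; D \<in> Obj C\<rbrakk>
      \<Longrightarrow> unitary C ((A \<odot> B) \<odot> D) (A \<odot> (B \<odot> D)) (\<a> A B D)"
    and LeftUnit_unitary: "A \<in> Obj C \<Longrightarrow> unitary C (\<I> \<odot> A) A (\<l> A)"
    and RightUnit_unitary: "A \<in> Obj C \<Longrightarrow> unitary C (A \<odot> \<I>) A (\<r> A)"
    and Sym_unitary: "\<lbrakk>A \<in> Obj C; B \<in> Obj C\<rbrakk> \<Longrightarrow> unitary C (A \<odot> B) (B \<odot> A) (\<sigma> A B)"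
    and Assoc_natural: "\<lbrakk>A \<in> Obj C; B \<in> Obj C; D \<in> Obj C; A' \<in> Obj C; B' \<in> Obj C; D' \<in> Obj C;
      f \<in> Hom C A A'; g \<in> Hom C B B'; h \<in> Hom C D D'\<rbrakk>
      \<Longrightarrow> \<a> A' B' D' \<cdot> ((f \<otimes> g) \<otimes> h) = (f \<otimes> (g \<otimes> h)) \<cdot> \<a> A B D"
    and LeftUnit_natural: "\<lbrakk>A \<in> Obj C; B \<in> Obj C; f \<in> Hom C A B\<rbrakk>
      \<Longrightarrow> \<l> B \<cdot> (\<one> \<I> \<otimes> f) = f \<cdot> \<l> A"
    and RightUnit_natural: "\<lbrakk>A \<in> Obj C; B \<in> Obj C; f \<in> Hom C A B\<rbrakk>
      \<Longrightarrow> \<r> B \<cdot> (f \<otimes> \<one> \<I>) = f \<cdot> \<r> A"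
    and Sym_natural: "\<lbrakk>A \<in> Obj C; B \<in> Obj C; A' \<in> Obj C; B' \<in> Obj C;
      f \<in> Hom C A A'; g \<in> Hom C B B'\<rbrakk> \<Longrightarrow> \<sigma> A' B' \<cdot> (f \<otimes> g) = (g \<otimes> f) \<cdot> \<sigma> A B"
    and pentagon: "\<lbrakk>A \<in> Obj C; B \<in> Obj C; D \<in> Obj C; E \<in> Obj C\<rbrakk>
      \<Longrightarrow> \<a> A B (D \<odot> E) \<cdot> \<a> (A \<odot> B) D E
        = (\<one> A \<otimes> \<a> B D E) \<cdot> \<a> A (B \<odot> D) E \<cdot> (\<a> A B D \<otimes> \<one> E)"
    and triangle: "\<lbrakk>A \<in> Obj C; B \<in> Obj C\<rbrakk>
      \<Longrightarrow> (\<one> A \<otimes> \<l> B) \<cdot> \<a> A \<I> B = \<r> A \<otimes> \<one> B"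
    and hexagon: "\<lbrakk>A \<in> Obj C; B \<in> Obj C; D \<in> Obj C\<rbrakk>
      \<Longrightarrow> \<a> B D A \<cdot> \<sigma> A (B \<odot> D) \<cdot> \<a> A B D
        = (\<one> B \<otimes> \<sigma> A D) \<cdot> \<a> B A D \<cdot> (\<sigma> A B \<otimes> \<one> D)"
    and Sym_Sym: "\<lbrakk>A \<in> Obj C; B \<in> Obj C\<rbrakk> \<Longrightarrow> \<sigma> B A \<cdot> \<sigma> A B = \<one> (A \<odot> B)"


section \<open>Duals\<close>

definition counit ::
    "('o, 'a) dsm_structure \<Rightarrow> ('o \<Rightarrow> 'o) \<Rightarrow> ('o \<Rightarrow> 'a) \<Rightarrow> 'o \<Rightarrow> 'a" where
  "counit C dual \<eta> A = Dag C (\<eta> A) \<cdot>\<^bsub>C\<^esub> \<sigma>\<^bsub>C\<^esub> A (dual A)"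

text \<open>A dagger symmetric monoidal category together with chosen dagger duals.\<close>

locale dagger_compact_structure = dagger_symmetric_monoidal_category C
  for C :: "('o, 'a) dsm_structure" (structure) +
  fixes dual :: "'o \<Rightarrow> 'o" and \<eta> :: "'o \<Rightarrow> 'a"
  assumes dual_in_Obj: "A \<in> Obj C \<Longrightarrow> dual A \<in> Obj C"
    and unit_in_Hom: "A \<in> Obj C \<Longrightarrow> \<eta> A \<in> Hom C \<I> (dual A \<odot> A)"
    and snake: "A \<in> Obj C \<Longrightarrow>
      \<l> A \<cdot> (counit C dual \<eta> A \<otimes> \<one> A) \<cdot> (\<a> A (dual A) A)\<^sup>\<dagger> \<cdot> (\<one> A \<otimes> \<eta> A) \<cdot> (\<r> A)\<^sup>\<dagger> = \<one> A"
    and snake_dual: "A \<in> Obj C \<Longrightarrow>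
      \<r> (dual A) \<cdot> (\<one> (dual A) \<otimes> counit C dual \<eta> A) \<cdot> \<a> (dual A) A (dual A)
        \<cdot> (\<eta> A \<otimes> \<one> (dual A)) \<cdot> (\<l> (dual A))\<^sup>\<dagger> = \<one> (dual A)"

definition dagger_compact_category :: "('o, 'a) dsm_structure \<Rightarrow> bool" where
  "dagger_compact_category C \<longleftrightarrow> (\<exists>dual \<eta>. dagger_compact_structure C dual \<eta>)"


section \<open>Dagger biproducts\<close>

context
  fixes C :: "('o, 'a) dsm_structure" (structure)
begin

definition zero_object :: "'o \<Rightarrow> bool" where
  "zero_object Z \<longleftrightarrow> Z \<in> Obj C \<and>
    (\<forall>A\<in>Obj C. (\<exists>!f. f \<in> Hom C A Z) \<and> (\<exists>!f. f \<in> Hom C Z A))"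

definition zero_morphism :: "'o \<Rightarrow> 'o \<Rightarrow> 'a \<Rightarrow> bool" where
  "zero_morphism A B f \<longleftrightarrow>
    (\<exists>Z g h. zero_object Z \<and> g \<in> Hom C A Z \<and> h \<in> Hom C Z B \<and> f = h \<cdot> g)"

definition biproduct :: "'o \<Rightarrow> 'o \<Rightarrow> 'o \<Rightarrow> 'a \<Rightarrow> 'a \<Rightarrow> 'a \<Rightarrow> 'a \<Rightarrow> bool" where
  "biproduct A B S i\<^sub>A i\<^sub>B p\<^sub>A p\<^sub>B \<longleftrightarrow>
    S \<in> Obj C \<and> i\<^sub>A \<in> Hom C A S \<and> i\<^sub>B \<in> Hom C B S \<and> p\<^sub>A \<in> Hom C S A \<and> p\<^sub>B \<in> Hom C S B \<and>
    (\<forall>X\<in>Obj C. \<forall>f\<in>Hom C X A. \<forall>g\<in>Hom C X B. \<exists>!h. h \<in> Hom C X S \<and> p\<^sub>A \<cdot> h = f \<and> p\<^sub>B \<cdot> h = g) \<and>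
    (\<forall>X\<in>Obj C. \<forall>f\<in>Hom C A X. \<forall>g\<in>Hom C B X. \<exists>!h. h \<in> Hom C S X \<and> h \<cdot> i\<^sub>A = f \<and> h \<cdot> i\<^sub>B = g) \<and>
    p\<^sub>A \<cdot> i\<^sub>A = \<one> A \<and> p\<^sub>B \<cdot> i\<^sub>B = \<one> B \<and>
    zero_morphism B A (p\<^sub>A \<cdot> i\<^sub>B) \<and> zero_morphism A B (p\<^sub>B \<cdot> i\<^sub>A)"

definition has_dagger_biproducts :: bool where
  "has_dagger_biproducts \<longleftrightarrow> (\<exists>Z. zero_object Z) \<and>
    (\<forall>A\<in>Obj C. \<forall>B\<in>Obj C. \<exists>S i\<^sub>A i\<^sub>B p\<^sub>A p\<^sub>B.
      biproduct A B S i\<^sub>A i\<^sub>B p\<^sub>A p\<^sub>B \<and> p\<^sub>A = i\<^sub>A\<^sup>\<dagger> \<and> p\<^sub>B = i\<^sub>B\<^sup>\<dagger>)"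

end


section \<open>Completely positive morphisms and Frobenius algebras\<close>

context
  fixes V :: "('o, 'a) dsm_structure" (structure)
    and dual :: "'o \<Rightarrow> 'o" and \<eta> :: "'o \<Rightarrow> 'a"
begin

text \<open>The transpose \<open>f\<^sup>*: B\<^sup>* \<rightarrow> A\<^sup>*\<close> of \<open>f: A \<rightarrow> B\<close>, and \<open>g\<^sub>* = (g\<^sup>\<dagger>)\<^sup>*: A\<^sup>* \<rightarrow> B\<^sup>*\<close> for \<open>g: A \<rightarrow> B\<close>.\<close>

definition transpose :: "'o \<Rightarrow> 'o \<Rightarrow> 'a \<Rightarrow> 'a" where
  "transpose A B f =
    \<r> (dual A) \<cdot> (\<one> (dual A) \<otimes> counit V dual \<eta> B) \<cdot> (\<one> (dual A) \<otimes> (f \<otimes> \<one> (dual B)))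
      \<cdot> \<a> (dual A) A (dual B) \<cdot> (\<eta> A \<otimes> \<one> (dual B)) \<cdot> (\<l> (dual B))\<^sup>\<dagger>"

definition conjugate :: "'o \<Rightarrow> 'o \<Rightarrow> 'a \<Rightarrow> 'a" where
  "conjugate A B g = transpose B A (g\<^sup>\<dagger>)"

text \<open>
  The chosen dual of a tensor product need not equal the reversed tensor product of the duals, so
  the convention \<open>(A \<otimes> B)\<^sup>* = B\<^sup>* \<otimes> A\<^sup>*\<close> is replaced by the canonical isomorphism. The map
  \<open>nested_unit A B: I \<rightarrow> (B\<^sup>* \<otimes> A\<^sup>*) \<otimes> (A \<otimes> B)\<close> is
  \<open>(1 \<otimes> \<eta>\<^sub>A \<otimes> 1) \<circ> \<eta>\<^sub>B\<close> up to coherence and exhibits \<open>B\<^sup>* \<otimes> A\<^sup>*\<close> as a dual of \<open>A \<otimes> B\<close>;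
  \<open>dual_tensor A B: (A \<otimes> B)\<^sup>* \<rightarrow> B\<^sup>* \<otimes> A\<^sup>*\<close> is the comparison of the two duals. It is
  the identity if the convention holds strictly, with \<open>\<eta>\<^bsub>A \<otimes> B\<^esub> = nested_unit A B\<close>.
\<close>

definition nested_unit :: "'o \<Rightarrow> 'o \<Rightarrow> 'a" where
  "nested_unit A B =
    (\<a> (dual B) (dual A) (A \<odot> B))\<^sup>\<dagger> \<cdot> (\<one> (dual B) \<otimes> \<a> (dual A) A B)
      \<cdot> (\<one> (dual B) \<otimes> (\<eta> A \<otimes> \<one> B)) \<cdot> (\<one> (dual B) \<otimes> (\<l> B)\<^sup>\<dagger>) \<cdot> \<eta> B"

definition dual_tensor :: "'o \<Rightarrow> 'o \<Rightarrow> 'a" where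
  "dual_tensor A B =
    \<r> (dual B \<odot> dual A) \<cdot> (\<one> (dual B \<odot> dual A) \<otimes> counit V dual \<eta> (A \<odot> B))
      \<cdot> \<a> (dual B \<odot> dual A) (A \<odot> B) (dual (A \<odot> B))
      \<cdot> (nested_unit A B \<otimes> \<one> (dual (A \<odot> B))) \<cdot> (\<l> (dual (A \<odot> B)))\<^sup>\<dagger>"

text \<open>The map \<open>1 \<otimes> \<eta>\<^sub>X\<^sup>\<dagger> \<otimes> 1: (B\<^sup>* \<otimes> X\<^sup>*) \<otimes> (X \<otimes> B) \<rightarrow> B\<^sup>* \<otimes> B\<close>.\<close>

definition contract :: "'o \<Rightarrow> 'o \<Rightarrow> 'a" where
  "contract X B =
    (\<one> (dual B) \<otimes> \<l> B) \<cdot> (\<one> (dual B) \<otimes> ((\<eta> X)\<^sup>\<dagger> \<otimes> \<one> B))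
      \<cdot> (\<one> (dual B) \<otimes> (\<a> (dual X) X B)\<^sup>\<dagger>) \<cdot> \<a> (dual B) (dual X) (X \<odot> B)"

definition completely_positive :: "'o \<Rightarrow> 'o \<Rightarrow> 'a \<Rightarrow> bool" where
  "completely_positive A B f \<longleftrightarrow> f \<in> Hom V (dual A \<odot> A) (dual B \<odot> B) \<and>
    (\<exists>X\<in>Obj V. \<exists>g\<in>Hom V A (X \<odot> B).
      f = contract X B \<cdot> ((dual_tensor X B \<cdot> conjugate A (X \<odot> B) g) \<otimes> g))"

definition dagger_frobenius_algebra :: "'o \<Rightarrow> 'a \<Rightarrow> 'a \<Rightarrow> bool" where
  "dagger_frobenius_algebra A m u \<longleftrightarrow>
    A \<in> Obj V \<and> m \<in> Hom V (A \<odot> A) A \<and> u \<in> Hom V \<I> A \<and>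
    m \<cdot> (m \<otimes> \<one> A) = m \<cdot> (\<one> A \<otimes> m) \<cdot> \<a> A A A \<and>
    m \<cdot> (u \<otimes> \<one> A) = \<l> A \<and> m \<cdot> (\<one> A \<otimes> u) = \<r> A \<and>
    (m \<otimes> \<one> A) \<cdot> (\<a> A A A)\<^sup>\<dagger> \<cdot> (\<one> A \<otimes> m\<^sup>\<dagger>) = m\<^sup>\<dagger> \<cdot> m \<and>
    m\<^sup>\<dagger> \<cdot> m = (\<one> A \<otimes> m) \<cdot> \<a> A A A \<cdot> (m\<^sup>\<dagger> \<otimes> \<one> A)"

definition central :: "'o \<Rightarrow> 'a \<Rightarrow> 'a \<Rightarrow> bool" where
  "central A m z \<longleftrightarrow>
    z \<in> Hom V A A \<and> z \<cdot> m = m \<cdot> (z \<otimes> \<one> A) \<and> z \<cdot> m = m \<cdot> (\<one> A \<otimes> z)"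

definition positive :: "'o \<Rightarrow> 'a \<Rightarrow> bool" where
  "positive A z \<longleftrightarrow> (\<exists>B\<in>Obj V. \<exists>h\<in>Hom V A B. z = h\<^sup>\<dagger> \<cdot> h)"

definition isomorphism :: "'o \<Rightarrow> 'o \<Rightarrow> 'a \<Rightarrow> bool" where
  "isomorphism A B f \<longleftrightarrow>
    f \<in> Hom V A B \<and> (\<exists>g\<in>Hom V B A. g \<cdot> f = \<one> A \<and> f \<cdot> g = \<one> B)"

definition action :: "'o \<Rightarrow> 'a \<Rightarrow> 'a" where
  "action A m = (\<one> (dual A) \<otimes> m) \<cdot> \<a> (dual A) A A \<cdot> (\<eta> A \<otimes> \<one> A) \<cdot> (\<l> A)\<^sup>\<dagger>"

definition normaliser :: "'o \<Rightarrow> 'a \<Rightarrow> 'a \<Rightarrow> 'a \<Rightarrow> bool" where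
  "normaliser A m u z \<longleftrightarrow>
    central A m z \<and> positive A z \<and> isomorphism A A z \<and>
    (\<eta> A)\<^sup>\<dagger> \<cdot> action A m \<cdot> z \<cdot> z = u\<^sup>\<dagger>"


section \<open>The CP* construction\<close>

type_synonym ('p, 'b) algebra = "'p \<times> 'b \<times> 'b \<times> 'b"

definition cpstar_obj :: "('o, 'a) algebra set" where
  "cpstar_obj = {(A, m, u, z). dagger_frobenius_algebra A m u \<and> normaliser A m u z}"

definition cpstar_hom :: "('o, 'a) algebra \<Rightarrow> ('o, 'a) algebra \<Rightarrow> 'a set" where
  "cpstar_hom = (\<lambda>(A, m\<^sub>A, u\<^sub>A, z\<^sub>A) (B, m\<^sub>B, u\<^sub>B, z\<^sub>B).
    {f \<in> Hom V A B. completely_positive A B (action B m\<^sub>B \<cdot> f \<cdot> (action A m\<^sub>A)\<^sup>\<dagger>)})"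

text \<open>The map \<open>1 \<otimes> \<sigma> \<otimes> 1: (A \<otimes> B) \<otimes> (A \<otimes> B) \<rightarrow> (A \<otimes> A) \<otimes> (B \<otimes> B)\<close>.\<close>

definition interchange :: "'o \<Rightarrow> 'o \<Rightarrow> 'a" where
  "interchange A B =
    (\<a> A A (B \<odot> B))\<^sup>\<dagger> \<cdot> (\<one> A \<otimes> \<a> A B B) \<cdot> (\<one> A \<otimes> (\<sigma> B A \<otimes> \<one> B))
      \<cdot> (\<one> A \<otimes> (\<a> B A B)\<^sup>\<dagger>) \<cdot> \<a> A B (A \<odot> B)"

definition cpstar_tensor :: "('o, 'a) algebra \<Rightarrow> ('o, 'a) algebra \<Rightarrow> ('o, 'a) algebra" where
  "cpstar_tensor = (\<lambda>(A, m\<^sub>A, u\<^sub>A, z\<^sub>A) (B, m\<^sub>B, u\<^sub>B, z\<^sub>B).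
    (A \<odot> B, (m\<^sub>A \<otimes> m\<^sub>B) \<cdot> interchange A B, (u\<^sub>A \<otimes> u\<^sub>B) \<cdot> (\<l> \<I>)\<^sup>\<dagger>, z\<^sub>A \<otimes> z\<^sub>B))"

text \<open>
  The monoidal unit is the tensor unit with its trivial algebra structure; the coherence
  isomorphisms are those of the underlying category.
\<close>

definition cpstar :: "(('o, 'a) algebra, 'a) dsm_structure" where
  "cpstar =
    \<lparr> Obj = cpstar_obj,
      Hom = cpstar_hom,
      Id = (\<lambda>P. \<one> (fst P)),
      Comp = Comp V,
      Dag = Dag V,
      TensorObj = cpstar_tensor,
      TensorHom = TensorHom V,
      Unit = (\<I>, \<l> \<I>, \<one> \<I>, \<one> \<I>),
      Assoc = (\<lambda>P Q R. \<a> (fst P) (fst Q) (fst R)),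
      LeftUnit = (\<lambda>P. \<l> (fst P)),
      RightUnit = (\<lambda>P. \<r> (fst P)),
      Sym = (\<lambda>P Q. \<sigma> (fst P) (fst Q)) \<rparr>"

end

end

theory Submission
  imports Defs
begin

text \<open>
  Coherence is dealt with by strictification: the morphisms between tensor words of objects of
  \<open>V\<close> form a strict dagger symmetric monoidal category, in which string diagrams can be
  manipulated as equations.

  For a dagger Frobenius algebra with a central positive \<open>z\<close>, the normalisation condition
  says exactly that the algebra is symmetric and that \<open>m \<circ> m\<^sup>\<dagger> \<circ> z \<circ> z = 1\<close>. Symmetry makes the
  self-duality of the algebra compatible with the chosen dual, so that bending wires turns the CP*
  condition on \<open>f: A \<rightarrow> B\<close> into positivity of its Choi morphism
  \<open>(1 \<otimes> m\<^sub>B) \<circ> (1 \<otimes> f \<otimes> 1) \<circ> (m\<^sub>A\<^sup>\<dagger> \<otimes> 1): A \<otimes> B \<rightarrow> A \<otimes> B\<close>, in which no duals occur.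
  Composites, tensor products, daggers and unitary homomorphisms are then seen to satisfy the
  condition by exhibiting the Choi morphism as a square. The dual of an algebra is the opposite
  algebra on the same object, with unit \<open>m\<^sup>\<dagger> \<circ> u\<close>.

  A biproduct \<open>A \<oplus> B\<close> carries the algebra whose multiplication has components
  \<open>m\<^sub>A \<circ> (p\<^sub>A \<otimes> p\<^sub>A)\<close> and \<open>m\<^sub>B \<circ> (p\<^sub>B \<otimes> p\<^sub>B)\<close>. Tensoring has a right adjoint, so it preserves
  zero objects and jointly epic injections, and everything can be checked blockwise.
\<close>

section \<open>Strict dagger symmetric monoidal categories\<close>

text \<open>Squares \<open>h\<^sup>\<circ> \<bullet> h\<close> are stable under tensor products and
  under sandwiching \<open>p\<close> to \<open>v\<^sup>\<circ> \<bullet> p \<bullet> v\<close>, so a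
  closure property is won as soon as the new Choi morphism is a sandwich of old ones. For
  composition the sandwich joins the two Choi morphisms by a cup on the middle algebra, and a loop
  \<open>m \<bullet> m\<^sup>\<circ>\<close> is left on the wire between them. A copy of
  \<open>z\<close> in the cup and one in the adjoint cap are the two factors that cancel it; this is
  the origin of the square of the normaliser in the normalisation condition. For the dagger of a
  morphism the root of the square itself has to be bent, and its codomain is an arbitrary word;
  hence duals of all words are provided. The obstacle for biproducts is that a sum of squares is not
  visibly a square. Its root is the pairing of the single roots into the biproduct of their
  codomains, so biproducts of arbitrary words are used even to treat one fixed biproduct of
  algebras. What must be shown then is that Choi morphisms into the biproduct algebra have no
  off-diagonal blocks.\<close>

locale strict_dsmc =
  fixes obj :: "'x list \<Rightarrow> bool" and arr :: "'m \<Rightarrow> bool"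
    and dom cod :: "'m \<Rightarrow> 'x list" and idt :: "'x list \<Rightarrow> 'm" ("\<iota>")
    and comp :: "'m \<Rightarrow> 'm \<Rightarrow> 'm" (infixr "\<bullet>" 55)
    and tens :: "'m \<Rightarrow> 'm \<Rightarrow> 'm" (infixr "\<parallel>" 70)
    and dag :: "'m \<Rightarrow> 'm" ("_\<^sup>\<circ>" [1000] 999)
    and sym :: "'x list \<Rightarrow> 'x list \<Rightarrow> 'm" ("\<gamma>")
  assumes obj_Nil [simp]: "obj []"
    and obj_append [simp]: "obj (a @ b) \<longleftrightarrow> obj a \<and> obj b"
    and obj_dom [simp]: "arr f \<Longrightarrow> obj (dom f)"
    and obj_cod [simp]: "arr f \<Longrightarrow> obj (cod f)"
    and arr_idt [simp]: "obj a \<Longrightarrow> arr (\<iota> a)"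
    and dom_idt [simp]: "dom (\<iota> a) = a"
    and cod_idt [simp]: "cod (\<iota> a) = a"
    and arr_comp [simp]: "\<lbrakk>arr f; arr g; cod f = dom g\<rbrakk> \<Longrightarrow> arr (g \<bullet> f)"
    and dom_comp [simp]: "dom (g \<bullet> f) = dom f"
    and cod_comp [simp]: "cod (g \<bullet> f) = cod g"
    and comp_assoc: "\<lbrakk>arr f; arr g; arr h; cod f = dom g; cod g = dom h\<rbrakk>
      \<Longrightarrow> (h \<bullet> g) \<bullet> f = h \<bullet> g \<bullet> f"
    and idt_left: "\<lbrakk>arr f; cod f = a\<rbrakk> \<Longrightarrow> \<iota> a \<bullet> f = f"
    and idt_right: "\<lbrakk>arr f; dom f = a\<rbrakk> \<Longrightarrow> f \<bullet> \<iota> a = f"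
    and arr_dag [simp]: "arr f \<Longrightarrow> arr (f\<^sup>\<circ>)"
    and dom_dag [simp]: "dom (f\<^sup>\<circ>) = cod f"
    and cod_dag [simp]: "cod (f\<^sup>\<circ>) = dom f"
    and dag_dag [simp]: "arr f \<Longrightarrow> (f\<^sup>\<circ>)\<^sup>\<circ> = f"
    and dag_idt [simp]: "obj a \<Longrightarrow> (\<iota> a)\<^sup>\<circ> = \<iota> a"
    and dag_comp: "\<lbrakk>arr f; arr g; cod f = dom g\<rbrakk> \<Longrightarrow> (g \<bullet> f)\<^sup>\<circ> = f\<^sup>\<circ> \<bullet> g\<^sup>\<circ>"
    and arr_tens [simp]: "\<lbrakk>arr f; arr g\<rbrakk> \<Longrightarrow> arr (f \<parallel> g)"
    and dom_tens [simp]: "dom (f \<parallel> g) = dom f @ dom g"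
    and cod_tens [simp]: "cod (f \<parallel> g) = cod f @ cod g"
    and dag_tens: "\<lbrakk>arr f; arr g\<rbrakk> \<Longrightarrow> (f \<parallel> g)\<^sup>\<circ> = f\<^sup>\<circ> \<parallel> g\<^sup>\<circ>"
    and idt_tens: "\<lbrakk>obj a; obj b\<rbrakk> \<Longrightarrow> \<iota> a \<parallel> \<iota> b = \<iota> (a @ b)"
    and tens_comp: "\<lbrakk>arr f; arr g; arr f'; arr g'; cod f = dom g; cod f' = dom g'\<rbrakk>
      \<Longrightarrow> (g \<parallel> g') \<bullet> (f \<parallel> f') = (g \<bullet> f) \<parallel> (g' \<bullet> f')"
    and tens_assoc: "\<lbrakk>arr f; arr g; arr h\<rbrakk> \<Longrightarrow> (f \<parallel> g) \<parallel> h = f \<parallel> g \<parallel> h"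
    and Nil_tens [simp]: "arr f \<Longrightarrow> \<iota> [] \<parallel> f = f"
    and tens_Nil [simp]: "arr f \<Longrightarrow> f \<parallel> \<iota> [] = f"
    and arr_sym [simp]: "\<lbrakk>obj a; obj b\<rbrakk> \<Longrightarrow> arr (\<gamma> a b)"
    and dom_sym [simp]: "dom (\<gamma> a b) = a @ b"
    and cod_sym [simp]: "cod (\<gamma> a b) = b @ a"
    and dag_sym [simp]: "\<lbrakk>obj a; obj b\<rbrakk> \<Longrightarrow> (\<gamma> a b)\<^sup>\<circ> = \<gamma> b a"
    and sym_sym: "\<lbrakk>obj a; obj b\<rbrakk> \<Longrightarrow> \<gamma> b a \<bullet> \<gamma> a b = \<iota> (a @ b)"
    and sym_natural: "\<lbrakk>arr f; arr g\<rbrakk>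
      \<Longrightarrow> \<gamma> (cod f) (cod g) \<bullet> (f \<parallel> g) = (g \<parallel> f) \<bullet> \<gamma> (dom f) (dom g)"
    and sym_append: "\<lbrakk>obj a; obj b; obj c\<rbrakk>
      \<Longrightarrow> \<gamma> a (b @ c) = (\<iota> b \<parallel> \<gamma> a c) \<bullet> (\<gamma> a b \<parallel> \<iota> c)"
begin

text \<open>Composites are kept nested to the right, so a rule whose left side is
  \<open>g \<bullet> f\<close> does not match inside a longer composite. Used as
  \<open>[THEN comp_eq_tail]\<close>, this turns such an equation into one that does.\<close>

lemma comp_eq_tail: "\<lbrakk>g \<bullet> f = h; arr f; arr g; cod f = dom g; arr e; cod e = dom f\<rbrakk>
    \<Longrightarrow> g \<bullet> f \<bullet> e = h \<bullet> e"
  by (metis comp_assoc)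

lemma tens_comp_tail: "\<lbrakk>arr f; arr g; arr f'; arr g'; cod f = dom g; cod f' = dom g';
     arr e; cod e = dom f @ dom f'\<rbrakk>
      \<Longrightarrow> (g \<parallel> g') \<bullet> (f \<parallel> f') \<bullet> e = ((g \<bullet> f) \<parallel> (g' \<bullet> f')) \<bullet> e"
  by (simp add: tens_comp[symmetric] comp_assoc)

lemma idt_tens_tail: "\<lbrakk>obj a; obj b; arr f\<rbrakk> \<Longrightarrow> \<iota> a \<parallel> \<iota> b \<parallel> f = \<iota> (a @ b) \<parallel> f"
  by (simp add: tens_assoc[symmetric] idt_tens)

lemma whisker_left: "\<lbrakk>obj a; arr f; arr g; cod f = dom g\<rbrakk>
    \<Longrightarrow> \<iota> a \<parallel> (g \<bullet> f) = (\<iota> a \<parallel> g) \<bullet> (\<iota> a \<parallel> f)"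
  by (simp add: tens_comp idt_left)

lemma whisker_right: "\<lbrakk>obj a; arr f; arr g; cod f = dom g\<rbrakk>
    \<Longrightarrow> (g \<bullet> f) \<parallel> \<iota> a = (g \<parallel> \<iota> a) \<bullet> (f \<parallel> \<iota> a)"
  by (simp add: tens_comp idt_left)

text \<open>Together with \<open>slide2\<close> this moves two boxes on disjoint wires past each
  other. The endpoints are separate variables with equations as side conditions, so that the
  simplifier can match concrete words.\<close>

lemma slide1: "\<lbrakk>arr f; arr g; cod g = b; dom f = a\<rbrakk> \<Longrightarrow> (f \<parallel> \<iota> b) \<bullet> (\<iota> a \<parallel> g) = f \<parallel> g"
  by (auto simp add: tens_comp idt_left idt_right)

lemma slide2: "\<lbrakk>arr f; arr g; dom g = b; cod f = a\<rbrakk> \<Longrightarrow> (\<iota> a \<parallel> g) \<bullet> (f \<parallel> \<iota> b) = f \<parallel> g"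
  by (auto simp add: tens_comp idt_left idt_right)

text \<open>\<open>sym_append\<close> at empty words makes \<open>\<gamma> a []\<close> idempotent,
  and an invertible idempotent is an identity.\<close>

lemma sym_Nil_right [simp]: assumes "obj a" shows "\<gamma> a [] = \<iota> a"
proof -
  have "\<gamma> a [] = \<gamma> a [] \<bullet> \<gamma> a []"
    using sym_append[of a "[]" "[]"] assms by simp
  then have "\<gamma> [] a \<bullet> \<gamma> a [] = \<gamma> [] a \<bullet> \<gamma> a [] \<bullet> \<gamma> a []" by simp
  then show ?thesis
    using assms by (simp add: comp_assoc[symmetric] sym_sym idt_left)
qed

lemma sym_Nil_left [simp]: assumes "obj a" shows "\<gamma> [] a = \<iota> a"
  using arg_cong[OF sym_Nil_right[OF assms], of dag] assms by (simp del: sym_Nil_right)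

text \<open>Adjoints reverse crossings, so the second hexagon is the adjoint of the first.\<close>

lemma sym_append_left: "\<lbrakk>obj a; obj b; obj c\<rbrakk>
    \<Longrightarrow> \<gamma> (a @ b) c = (\<gamma> a c \<parallel> \<iota> b) \<bullet> (\<iota> a \<parallel> \<gamma> b c)"
  using arg_cong[OF sym_append[of c a b], of dag] by (simp add: dag_comp dag_tens)

subsection \<open>Frobenius algebras and Choi morphisms\<close>

definition positive_arr :: "'m \<Rightarrow> bool" where
  "positive_arr f \<longleftrightarrow> (\<exists>h. arr h \<and> f = h\<^sup>\<circ> \<bullet> h)"

definition frob :: "'x list \<Rightarrow> 'm \<Rightarrow> 'm \<Rightarrow> bool" where
  "frob a m u \<longleftrightarrow> obj a \<and> arr m \<and> dom m = a @ a \<and> cod m = a \<and> arr u \<and> dom u = [] \<and> cod u = a \<and>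
    m \<bullet> (m \<parallel> \<iota> a) = m \<bullet> (\<iota> a \<parallel> m) \<and> m \<bullet> (u \<parallel> \<iota> a) = \<iota> a \<and> m \<bullet> (\<iota> a \<parallel> u) = \<iota> a \<and>
    (m \<parallel> \<iota> a) \<bullet> (\<iota> a \<parallel> m\<^sup>\<circ>) = m\<^sup>\<circ> \<bullet> m \<and> (\<iota> a \<parallel> m) \<bullet> (m\<^sup>\<circ> \<parallel> \<iota> a) = m\<^sup>\<circ> \<bullet> m"

lemma frob_typing:
  assumes "frob a m u"
  shows "obj a" "arr m" "dom m = a @ a" "cod m = a" "arr u" "dom u = []" "cod u = a"
  using assms by (simp_all add: frob_def)

lemma frob_laws:
  assumes "frob a m u"
  shows "m \<bullet> (m \<parallel> \<iota> a) = m \<bullet> (\<iota> a \<parallel> m)" "m \<bullet> (u \<parallel> \<iota> a) = \<iota> a" "m \<bullet> (\<iota> a \<parallel> u) = \<iota> a"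
    "(m \<parallel> \<iota> a) \<bullet> (\<iota> a \<parallel> m\<^sup>\<circ>) = m\<^sup>\<circ> \<bullet> m" "(\<iota> a \<parallel> m) \<bullet> (m\<^sup>\<circ> \<parallel> \<iota> a) = m\<^sup>\<circ> \<bullet> m"
  using assms by (simp_all add: frob_def)

abbreviation cup :: "'m \<Rightarrow> 'm \<Rightarrow> 'm" where "cup m u \<equiv> m\<^sup>\<circ> \<bullet> u"
abbreviation cap :: "'m \<Rightarrow> 'm \<Rightarrow> 'm" where "cap m u \<equiv> u\<^sup>\<circ> \<bullet> m"

lemma frob_colaws:
  assumes "frob a m u"
  shows "(m\<^sup>\<circ> \<parallel> \<iota> a) \<bullet> m\<^sup>\<circ> = (\<iota> a \<parallel> m\<^sup>\<circ>) \<bullet> m\<^sup>\<circ>"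
    "(u\<^sup>\<circ> \<parallel> \<iota> a) \<bullet> m\<^sup>\<circ> = \<iota> a" "(\<iota> a \<parallel> u\<^sup>\<circ>) \<bullet> m\<^sup>\<circ> = \<iota> a"
proof -
  note [simp] = frob_typing[OF assms] and laws = frob_laws[OF assms]
  show "(m\<^sup>\<circ> \<parallel> \<iota> a) \<bullet> m\<^sup>\<circ> = (\<iota> a \<parallel> m\<^sup>\<circ>) \<bullet> m\<^sup>\<circ>"
    using arg_cong[OF laws(1), of dag] by (simp add: dag_comp dag_tens)
  show "(u\<^sup>\<circ> \<parallel> \<iota> a) \<bullet> m\<^sup>\<circ> = \<iota> a"
    using arg_cong[OF laws(2), of dag] by (simp add: dag_comp dag_tens)
  show "(\<iota> a \<parallel> u\<^sup>\<circ>) \<bullet> m\<^sup>\<circ> = \<iota> a"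
    using arg_cong[OF laws(3), of dag] by (simp add: dag_comp dag_tens)
qed

text \<open>Plugging the unit into one leg of a Frobenius law turns the multiplication into its
  adjoint. Cancelling one more leg by the counit law then leaves a straight wire, so the algebra is
  its own dual.\<close>

lemma bend:
  assumes "frob a m u"
  shows bend_cup_left: "(\<iota> a \<parallel> m) \<bullet> (cup m u \<parallel> \<iota> a) = m\<^sup>\<circ>"
    and bend_cup_right: "(m \<parallel> \<iota> a) \<bullet> (\<iota> a \<parallel> cup m u) = m\<^sup>\<circ>"
    and bend_cap_left: "(cap m u \<parallel> \<iota> a) \<bullet> (\<iota> a \<parallel> m\<^sup>\<circ>) = m"
    and snake_left: "(\<iota> a \<parallel> cap m u) \<bullet> (cup m u \<parallel> \<iota> a) = \<iota> a"
    and snake_right: "(cap m u \<parallel> \<iota> a) \<bullet> (\<iota> a \<parallel> cup m u) = \<iota> a"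
proof -
  note [simp] = frob_typing[OF assms] and laws = frob_laws[OF assms]
  have "(\<iota> a \<parallel> m) \<bullet> (cup m u \<parallel> \<iota> a) = ((\<iota> a \<parallel> m) \<bullet> (m\<^sup>\<circ> \<parallel> \<iota> a)) \<bullet> (u \<parallel> \<iota> a)"
    by (simp add: whisker_right comp_assoc)
  also have "\<dots> = m\<^sup>\<circ> \<bullet> m \<bullet> (u \<parallel> \<iota> a)"
    by (simp add: laws(5) comp_assoc)
  finally show 1: "(\<iota> a \<parallel> m) \<bullet> (cup m u \<parallel> \<iota> a) = m\<^sup>\<circ>" by (simp add: laws idt_right)
  have "(m \<parallel> \<iota> a) \<bullet> (\<iota> a \<parallel> cup m u) = ((m \<parallel> \<iota> a) \<bullet> (\<iota> a \<parallel> m\<^sup>\<circ>)) \<bullet> (\<iota> a \<parallel> u)"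
    by (simp add: whisker_left comp_assoc)
  also have "\<dots> = m\<^sup>\<circ> \<bullet> m \<bullet> (\<iota> a \<parallel> u)"
    by (simp add: laws(4) comp_assoc)
  finally show 2: "(m \<parallel> \<iota> a) \<bullet> (\<iota> a \<parallel> cup m u) = m\<^sup>\<circ>" by (simp add: laws idt_right)
  show "(cap m u \<parallel> \<iota> a) \<bullet> (\<iota> a \<parallel> m\<^sup>\<circ>) = m"
    using arg_cong[OF 1, of dag] by (simp add: dag_comp dag_tens)
  have "(\<iota> a \<parallel> cap m u) \<bullet> (cup m u \<parallel> \<iota> a) = (\<iota> a \<parallel> u\<^sup>\<circ>) \<bullet> (\<iota> a \<parallel> m) \<bullet> (cup m u \<parallel> \<iota> a)"
    by (simp add: whisker_left comp_assoc)
  then show "(\<iota> a \<parallel> cap m u) \<bullet> (cup m u \<parallel> \<iota> a) = \<iota> a"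
    by (simp add: 1 frob_colaws[OF assms])
  have "(cap m u \<parallel> \<iota> a) \<bullet> (\<iota> a \<parallel> cup m u) = (u\<^sup>\<circ> \<parallel> \<iota> a) \<bullet> (m \<parallel> \<iota> a) \<bullet> (\<iota> a \<parallel> cup m u)"
    by (simp add: whisker_right comp_assoc)
  then show "(cap m u \<parallel> \<iota> a) \<bullet> (\<iota> a \<parallel> cup m u) = \<iota> a"
    by (simp add: 2 frob_colaws[OF assms])
qed

definition choi :: "'m \<Rightarrow> 'm \<Rightarrow> 'm \<Rightarrow> 'm" where
  "choi m n f = (\<iota> (dom f) \<parallel> n) \<bullet> (\<iota> (dom f) \<parallel> f \<parallel> \<iota> (cod f)) \<bullet> (m\<^sup>\<circ> \<parallel> \<iota> (cod f))"

text \<open>Normalisable algebras; \<open>normaliser_iff\<close> below relates this to the trace condition.\<close>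

definition nalg :: "'x list \<Rightarrow> 'm \<Rightarrow> 'm \<Rightarrow> 'm \<Rightarrow> bool" where
  "nalg a m u z \<longleftrightarrow> frob a m u \<and> cap m u \<bullet> \<gamma> a a = cap m u \<and> arr z \<and> dom z = a \<and> cod z = a \<and>
     z \<bullet> m = m \<bullet> (z \<parallel> \<iota> a) \<and> z \<bullet> m = m \<bullet> (\<iota> a \<parallel> z) \<and> positive_arr z \<and> m \<bullet> m\<^sup>\<circ> \<bullet> z \<bullet> z = \<iota> a"

lemma positive_arr_dag: "positive_arr f \<Longrightarrow> f\<^sup>\<circ> = f"
  by (auto simp: positive_arr_def dag_comp)

lemma nalg_typing:
  assumes "nalg a m u z"
  shows "frob a m u" "obj a" "arr m" "dom m = a @ a" "cod m = a" "arr u" "dom u = []" "cod u = a"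
   "arr z" "dom z = a" "cod z = a" "z\<^sup>\<circ> = z"
  using assms positive_arr_dag by (auto simp add: nalg_def frob_def)

lemma nalg_laws:
  assumes "nalg a m u z"
  shows "cap m u \<bullet> \<gamma> a a = cap m u" "m \<bullet> (z \<parallel> \<iota> a) = z \<bullet> m" "m \<bullet> (\<iota> a \<parallel> z) = z \<bullet> m"
    "m \<bullet> m\<^sup>\<circ> \<bullet> z \<bullet> z = \<iota> a" "\<gamma> a a \<bullet> cup m u = cup m u" "(z \<parallel> \<iota> a) \<bullet> m\<^sup>\<circ> = m\<^sup>\<circ> \<bullet> z"
    "(\<iota> a \<parallel> z) \<bullet> m\<^sup>\<circ> = m\<^sup>\<circ> \<bullet> z"
proof -
  note [simp] = nalg_typing[OF assms]
  show 1: "cap m u \<bullet> \<gamma> a a = cap m u" and 2: "m \<bullet> (z \<parallel> \<iota> a) = z \<bullet> m"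
    and 3: "m \<bullet> (\<iota> a \<parallel> z) = z \<bullet> m" and "m \<bullet> m\<^sup>\<circ> \<bullet> z \<bullet> z = \<iota> a"
    using assms by (auto simp: nalg_def)
  show "\<gamma> a a \<bullet> cup m u = cup m u" using arg_cong[OF 1, of dag] by (simp add: dag_comp)
  show "(z \<parallel> \<iota> a) \<bullet> m\<^sup>\<circ> = m\<^sup>\<circ> \<bullet> z" using arg_cong[OF 2, of dag] by (simp add: dag_comp dag_tens)
  show "(\<iota> a \<parallel> z) \<bullet> m\<^sup>\<circ> = m\<^sup>\<circ> \<bullet> z" using arg_cong[OF 3, of dag] by (simp add: dag_comp dag_tens)
qed

lemma choi_typing [simp]:
  assumes "arr f" "arr m" "arr n" "cod m = dom f" "dom m = dom f @ dom f" "cod n = cod f"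
    "dom n = cod f @ cod f"
  shows "arr (choi m n f)" "dom (choi m n f) = dom f @ cod f" "cod (choi m n f) = dom f @ cod f"
  using assms by (auto simp: choi_def)

lemma choi_split:
  assumes "arr f" "arr m" "arr n" "cod m = dom f" "dom m = dom f @ dom f" "cod n = cod f"
    "dom n = cod f @ cod f"
  shows choi_left: "choi m n f = (\<iota> (dom f) \<parallel> n) \<bullet> (((\<iota> (dom f) \<parallel> f) \<bullet> m\<^sup>\<circ>) \<parallel> \<iota> (cod f))"
    and choi_right: "choi m n f = (\<iota> (dom f) \<parallel> (n \<bullet> (f \<parallel> \<iota> (cod f)))) \<bullet> (m\<^sup>\<circ> \<parallel> \<iota> (cod f))"
  using assms by (simp_all add: choi_def whisker_left whisker_right comp_assoc tens_assoc)

text \<open>This is what remains of a composition at the middle algebra. Associativity and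
  coassociativity move a multiplication and a comultiplication onto the same wire, where they form
  the loop \<open>q\<close>. Centrality makes \<open>q\<close> commute with \<open>z\<close>, so the
  \<open>z\<close> of the cup and the \<open>z\<close> of the cap can be brought to its two sides
  and cancel it; a snake equation is left.\<close>

lemma comp_core:
  assumes "nalg b m u z"
  defines "cz \<equiv> m\<^sup>\<circ> \<bullet> z \<bullet> u"
  shows "((cz\<^sup>\<circ> \<bullet> (m \<parallel> \<iota> b)) \<parallel> \<iota> b) \<bullet> (\<iota> b \<parallel> ((\<iota> b \<parallel> m\<^sup>\<circ>) \<bullet> cz)) = \<iota> b"
proof -
  note [simp] = nalg_typing[OF assms(1)]
  note laws = nalg_laws[OF assms(1)] and fl = frob_laws[OF nalg_typing(1)[OF assms(1)]]
    and cl = frob_colaws[OF nalg_typing(1)[OF assms(1)]]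
  have [simp]: "arr cz" "dom cz = []" "cod cz = b @ b" "cz\<^sup>\<circ> = u\<^sup>\<circ> \<bullet> z \<bullet> m"
    by (simp_all add: cz_def dag_comp comp_assoc)
  define q where "q = m \<bullet> m\<^sup>\<circ>"
  have [simp]: "arr q" "dom q = b" "cod q = b" by (simp_all add: q_def)
  have q: "q \<bullet> z \<bullet> z = \<iota> b" using laws(4) by (simp add: q_def comp_assoc)
  have qz: "q \<bullet> z = z \<bullet> q"
  proof -
    have "q \<bullet> z = m \<bullet> (z \<parallel> \<iota> b) \<bullet> m\<^sup>\<circ>" by (simp add: q_def comp_assoc laws(6))
    also have "\<dots> = z \<bullet> q" by (simp add: laws(2)[THEN comp_eq_tail] comp_assoc q_def)
    finally show ?thesis .
  qed
  have zqz: "z \<bullet> q \<bullet> z = \<iota> b"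
    using q qz by (metis comp_assoc \<open>arr q\<close> \<open>cod q = b\<close> \<open>dom q = b\<close> nalg_typing(9-11)[OF assms(1)])
  have L: "cz\<^sup>\<circ> \<bullet> (m \<parallel> \<iota> b) = (u\<^sup>\<circ> \<bullet> z \<bullet> m) \<bullet> (\<iota> b \<parallel> m)"
    by (simp add: comp_assoc fl)
  have R: "(\<iota> b \<parallel> m\<^sup>\<circ>) \<bullet> cz = (m\<^sup>\<circ> \<parallel> \<iota> b) \<bullet> cz"
    by (simp add: cz_def cl(1)[THEN comp_eq_tail] comp_assoc)
  have "((cz\<^sup>\<circ> \<bullet> (m \<parallel> \<iota> b)) \<parallel> \<iota> b) \<bullet> (\<iota> b \<parallel> ((\<iota> b \<parallel> m\<^sup>\<circ>) \<bullet> cz))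
      = ((u\<^sup>\<circ> \<bullet> z \<bullet> m) \<parallel> \<iota> b) \<bullet> ((\<iota> b \<parallel> m \<parallel> \<iota> b) \<bullet> (\<iota> b \<parallel> m\<^sup>\<circ> \<parallel> \<iota> b)) \<bullet> (\<iota> b \<parallel> cz)"
    unfolding L R by (simp add: whisker_left whisker_right tens_assoc comp_assoc)
  also have "\<dots> = ((u\<^sup>\<circ> \<bullet> z \<bullet> m) \<parallel> \<iota> b) \<bullet> (\<iota> b \<parallel> ((q \<parallel> \<iota> b) \<bullet> cz))"
    by (simp add: tens_comp idt_left q_def comp_assoc)
  also have "(q \<parallel> \<iota> b) \<bullet> cz = ((q \<bullet> z) \<parallel> \<iota> b) \<bullet> cup m u"
    by (simp add: cz_def whisker_right comp_assoc laws(6)[THEN comp_eq_tail])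
  also have "((u\<^sup>\<circ> \<bullet> z \<bullet> m) \<parallel> \<iota> b) \<bullet> (\<iota> b \<parallel> (((q \<bullet> z) \<parallel> \<iota> b) \<bullet> cup m u))
     = ((u\<^sup>\<circ> \<bullet> m) \<parallel> \<iota> b) \<bullet> (((\<iota> b \<parallel> z) \<parallel> \<iota> b) \<bullet> (\<iota> b \<parallel> (q \<bullet> z) \<parallel> \<iota> b)) \<bullet> (\<iota> b \<parallel> cup m u)"
    by (simp add: whisker_left whisker_right comp_assoc laws(3)[symmetric] tens_assoc)
  also have "((\<iota> b \<parallel> z) \<parallel> \<iota> b) \<bullet> (\<iota> b \<parallel> (q \<bullet> z) \<parallel> \<iota> b) = \<iota> (b @ b @ b)"
    by (simp add: tens_assoc tens_comp idt_left zqz idt_tens)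
  finally show ?thesis by (simp add: snake_right[OF nalg_typing(1)[OF assms(1)]] idt_left)
qed

text \<open>The cup in \<open>v\<close> joins the \<open>b\<close> wire of
  \<open>choi ma mb f\<close> to that of \<open>choi mb mc g\<close>. The names \<open>L\<close> and
  \<open>R\<close> collect what touches this junction, \<open>F\<close> and \<open>G\<close> what
  does not; sliding \<open>G\<close> and \<open>F\<close> outwards isolates exactly the composite of
  \<open>comp_core\<close>.\<close>

lemma choi_comp:
  assumes "nalg a ma ua za" "nalg b mb ub zb" "nalg c mc uc zc"
    and [simp]: "arr f" "dom f = a" "cod f = b" "arr g" "dom g = b" "cod g = c"
  defines "v \<equiv> \<iota> a \<parallel> (mb\<^sup>\<circ> \<bullet> zb \<bullet> ub) \<parallel> \<iota> c"
  shows "choi ma mc (g \<bullet> f) = v\<^sup>\<circ> \<bullet> (choi ma mb f \<parallel> choi mb mc g) \<bullet> v"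
proof -
  note [simp] = nalg_typing[OF assms(1)] nalg_typing[OF assms(2)] nalg_typing[OF assms(3)]
  define cz where "cz = mb\<^sup>\<circ> \<bullet> zb \<bullet> ub"
  have [simp]: "arr cz" "dom cz = []" "cod cz = b @ b"
    by (simp_all add: cz_def)
  define F where "F = (\<iota> a \<parallel> f) \<bullet> ma\<^sup>\<circ>"
  define G where "G = mc \<bullet> (g \<parallel> \<iota> c)"
  define L where "L = cz\<^sup>\<circ> \<bullet> (mb \<parallel> \<iota> b)"
  define R where "R = (\<iota> b \<parallel> mb\<^sup>\<circ>) \<bullet> cz"
  have [simp]: "arr F" "dom F = a" "cod F = a @ b" "arr G" "dom G = b @ c" "cod G = c"
    "arr L" "dom L = b @ b @ b" "cod L = []" "arr R" "dom R = []" "cod R = b @ b @ b"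
    by (simp_all add: F_def G_def L_def R_def)
  have LR: "(L \<parallel> \<iota> b) \<bullet> (\<iota> b \<parallel> R) = \<iota> b"
    using comp_core[OF assms(2)] by (simp add: L_def R_def cz_def)
  have "(\<iota> a \<parallel> cz\<^sup>\<circ> \<parallel> \<iota> c) \<bullet> (choi ma mb f \<parallel> choi mb mc g) \<bullet> (\<iota> a \<parallel> cz \<parallel> \<iota> c)
    = ((\<iota> a \<parallel> cz\<^sup>\<circ> \<parallel> \<iota> c) \<bullet> (\<iota> a \<parallel> (mb \<parallel> \<iota> b) \<parallel> G)) \<bullet>
      ((F \<parallel> (\<iota> b \<parallel> mb\<^sup>\<circ>) \<parallel> \<iota> c) \<bullet> (\<iota> a \<parallel> cz \<parallel> \<iota> c))"
    by (simp add: choi_left[of f] choi_right[of g] F_def[symmetric] G_def[symmetric]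
        tens_comp[symmetric] tens_assoc comp_assoc)
  also have "\<dots> = (\<iota> a \<parallel> L \<parallel> G) \<bullet> (F \<parallel> R \<parallel> \<iota> c)"
    by (simp add: tens_comp idt_left idt_right L_def[symmetric] R_def[symmetric])
  also have "\<iota> a \<parallel> L \<parallel> G = (\<iota> a \<parallel> G) \<bullet> (\<iota> a \<parallel> (L \<parallel> \<iota> b) \<parallel> \<iota> c)"
    using slide2[of L G] by (simp add: tens_assoc tens_comp idt_tens idt_left)
  also have "F \<parallel> R \<parallel> \<iota> c = (\<iota> a \<parallel> (\<iota> b \<parallel> R) \<parallel> \<iota> c) \<bullet> (F \<parallel> \<iota> c)"
    using tens_comp[of F "\<iota> (a@b)" "\<iota> c" "R \<parallel> \<iota> c"]
    by (simp add: tens_assoc idt_left idt_right idt_tens_tail)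
  also have "((\<iota> a \<parallel> G) \<bullet> (\<iota> a \<parallel> (L \<parallel> \<iota> b) \<parallel> \<iota> c)) \<bullet> (\<iota> a \<parallel> (\<iota> b \<parallel> R) \<parallel> \<iota> c) \<bullet> (F \<parallel> \<iota> c)
     = (\<iota> a \<parallel> G) \<bullet> ((\<iota> a \<parallel> (L \<parallel> \<iota> b) \<parallel> \<iota> c) \<bullet> (\<iota> a \<parallel> (\<iota> b \<parallel> R) \<parallel> \<iota> c)) \<bullet> (F \<parallel> \<iota> c)"
    by (simp add: comp_assoc)
  also have "(\<iota> a \<parallel> (L \<parallel> \<iota> b) \<parallel> \<iota> c) \<bullet> (\<iota> a \<parallel> (\<iota> b \<parallel> R) \<parallel> \<iota> c) = \<iota> (a @ b @ c)"
    by (simp add: tens_comp LR idt_left idt_tens)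
  also have "(\<iota> a \<parallel> G) \<bullet> \<iota> (a @ b @ c) \<bullet> (F \<parallel> \<iota> c) = choi ma mc (g \<bullet> f)"
    by (simp add: choi_def F_def G_def idt_left whisker_left whisker_right comp_assoc tens_assoc)
  finally show ?thesis by (simp add: v_def cz_def[symmetric] dag_tens)
qed

section \<open>Closure properties of squares\<close>

lemma positive_sandwich:
  assumes "positive_arr p" "arr v" "cod v = dom p"
  shows "positive_arr (v\<^sup>\<circ> \<bullet> p \<bullet> v)"
proof -
  obtain h where [simp]: "arr h" and p: "p = h\<^sup>\<circ> \<bullet> h" using assms by (auto simp: positive_arr_def)
  have "v\<^sup>\<circ> \<bullet> p \<bullet> v = (h \<bullet> v)\<^sup>\<circ> \<bullet> (h \<bullet> v)"
    using assms by (simp add: p dag_comp comp_assoc)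
  then show ?thesis using assms p unfolding positive_arr_def by (intro exI[of _ "h \<bullet> v"]) simp
qed

lemma positive_tens:
  assumes "positive_arr p" "positive_arr q"
  shows "positive_arr (p \<parallel> q)"
proof -
  obtain h k where [simp]: "arr h" "arr k" and p: "p = h\<^sup>\<circ> \<bullet> h" "q = k\<^sup>\<circ> \<bullet> k"
    using assms by (auto simp: positive_arr_def)
  have "p \<parallel> q = (h \<parallel> k)\<^sup>\<circ> \<bullet> (h \<parallel> k)" by (simp add: p dag_tens tens_comp)
  then show ?thesis unfolding positive_arr_def by (intro exI[of _ "h \<parallel> k"]) simp
qed

lemma positive_arr_square: "arr h \<Longrightarrow> positive_arr (h\<^sup>\<circ> \<bullet> h)"
  by (auto simp: positive_arr_def)

lemma choi_comp_positive:
  assumes "nalg a ma ua za" "nalg b mb ub zb" "nalg c mc uc zc"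
    and [simp]: "arr f" "dom f = a" "cod f = b" "arr g" "dom g = b" "cod g = c"
    and "positive_arr (choi ma mb f)" "positive_arr (choi mb mc g)"
  shows "positive_arr (choi ma mc (g \<bullet> f))"
proof -
  note [simp] = nalg_typing[OF assms(1)] nalg_typing[OF assms(2)] nalg_typing[OF assms(3)]
  show ?thesis
    unfolding choi_comp[OF assms(1-3) assms(4-9)]
    by (rule positive_sandwich) (simp_all add: positive_tens assms)
qed

subsection \<open>Tensor products, opposites and homomorphisms of algebras\<close>

definition exchange :: "'x list \<Rightarrow> 'x list \<Rightarrow> 'x list \<Rightarrow> 'x list \<Rightarrow> 'm" where
  "exchange a c a' c' = \<iota> a \<parallel> \<gamma> c a' \<parallel> \<iota> c'"

lemma exchange_typing [simp]:
  "\<lbrakk>obj a; obj c; obj a'; obj c'\<rbrakk> \<Longrightarrow> arr (exchange a c a' c')"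
  "dom (exchange a c a' c') = a @ c @ a' @ c'" "cod (exchange a c a' c') = a @ a' @ c @ c'"
  "\<lbrakk>obj a; obj c; obj a'; obj c'\<rbrakk> \<Longrightarrow> (exchange a c a' c')\<^sup>\<circ> = exchange a a' c c'"
  by (auto simp: exchange_def dag_tens)

lemma exchange_tw:
  "\<lbrakk>obj a; obj c; obj a'; obj c'\<rbrakk> \<Longrightarrow> exchange a a' c c' \<bullet> exchange a c a' c' = \<iota> (a @ c @ a' @ c')"
  by (simp add: exchange_def tens_comp idt_left sym_sym idt_tens)

lemma exchange_natural:
  assumes [simp]: "arr f" "arr g" "arr f'" "arr g'"
  shows "exchange (cod f) (cod g) (cod f') (cod g') \<bullet> (f \<parallel> g \<parallel> f' \<parallel> g')
    = (f \<parallel> f' \<parallel> g \<parallel> g') \<bullet> exchange (dom f) (dom g) (dom f') (dom g')"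
proof -
  have "exchange (cod f) (cod g) (cod f') (cod g') \<bullet> (f \<parallel> g \<parallel> f' \<parallel> g')
     = f \<parallel> (\<gamma> (cod g) (cod f') \<bullet> (g \<parallel> f')) \<parallel> g'"
    using tens_comp[of f "\<iota> (cod f)" "(g \<parallel> f') \<parallel> g'" "\<gamma> (cod g) (cod f') \<parallel> \<iota> (cod g')"]
      tens_comp[of "g \<parallel> f'" "\<gamma> (cod g) (cod f')" g' "\<iota> (cod g')"]
    by (simp add: exchange_def tens_comp idt_left tens_assoc)
  also have "\<dots> = (f \<parallel> f' \<parallel> g \<parallel> g') \<bullet> exchange (dom f) (dom g) (dom f') (dom g')"
    unfolding sym_natural[OF assms(2,3)] exchange_def
    using tens_comp[of "\<gamma> (dom g) (dom f')" "f' \<parallel> g" "\<iota> (dom g')" g']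
    by (simp add: tens_comp idt_right tens_assoc)
  finally show ?thesis .
qed

text \<open>Both sides sort three pairs into their first and their second components. Each is
  brought to the diagram in which \<open>c\<close> crosses \<open>a'\<close> while \<open>c'\<close>
  crosses \<open>a''\<close>, and \<open>c\<close> crosses \<open>a''\<close> afterwards.\<close>

lemma exchange_assoc:
  assumes [simp]: "obj a" "obj c" "obj a'" "obj c'" "obj a''" "obj c''"
  shows "exchange (a @ a') (c @ c') a'' c'' \<bullet> (exchange a c a' c' \<parallel> \<iota> (a'' @ c''))
      = exchange a c (a' @ a'') (c' @ c'') \<bullet> (\<iota> (a @ c) \<parallel> exchange a' c' a'' c'')"
proof -
  have "exchange (a @ a') (c @ c') a'' c'' \<bullet> (exchange a c a' c' \<parallel> \<iota> (a'' @ c''))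
    = \<iota> a \<parallel> ((\<iota> a' \<parallel> \<gamma> c a'' \<parallel> \<iota> c') \<bullet> (\<gamma> c a' \<parallel> \<gamma> c' a'')) \<parallel> \<iota> c''"
  proof -
    have "exchange (a @ a') (c @ c') a'' c'' \<bullet> (exchange a c a' c' \<parallel> \<iota> (a'' @ c''))
      = (\<iota> a \<parallel> (\<iota> a' \<parallel> ((\<gamma> c a'' \<parallel> \<iota> c') \<bullet> (\<iota> c \<parallel> \<gamma> c' a''))) \<parallel> \<iota> c'')
        \<bullet> (\<iota> a \<parallel> (\<gamma> c a' \<parallel> \<iota> (c' @ a'')) \<parallel> \<iota> c'')"
      by (simp add: exchange_def sym_append_left idt_tens[symmetric] tens_assoc)
    also have "\<dots> = \<iota> a \<parallel> ((\<iota> a' \<parallel> \<gamma> c a'' \<parallel> \<iota> c') \<bullet> (\<iota> (a' @ c) \<parallel> \<gamma> c' a'') \<bullet> (\<gamma> c a' \<parallel> \<iota> (c' @ a''))) \<parallel> \<iota> c''"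
      by (simp add: tens_comp idt_left whisker_left comp_assoc idt_tens_tail)
    finally show ?thesis by (simp add: slide2)
  qed
  moreover have "exchange a c (a' @ a'') (c' @ c'') \<bullet> (\<iota> (a @ c) \<parallel> exchange a' c' a'' c'')
    = \<iota> a \<parallel> ((\<iota> a' \<parallel> \<gamma> c a'' \<parallel> \<iota> c') \<bullet> (\<gamma> c a' \<parallel> \<gamma> c' a'')) \<parallel> \<iota> c''"
  proof -
    have "exchange a c (a' @ a'') (c' @ c'') \<bullet> (\<iota> (a @ c) \<parallel> exchange a' c' a'' c'')
      = (\<iota> a \<parallel> (((\<iota> a' \<parallel> \<gamma> c a'') \<bullet> (\<gamma> c a' \<parallel> \<iota> a'')) \<parallel> \<iota> c') \<parallel> \<iota> c'')
        \<bullet> (\<iota> a \<parallel> (\<iota> (c @ a') \<parallel> \<gamma> c' a'') \<parallel> \<iota> c'')"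
      by (simp add: exchange_def sym_append idt_tens[symmetric] tens_assoc)
    also have "\<dots> = \<iota> a \<parallel> ((\<iota> a' \<parallel> \<gamma> c a'' \<parallel> \<iota> c') \<bullet> (\<gamma> c a' \<parallel> \<iota> (a'' @ c')) \<bullet> (\<iota> (c @ a') \<parallel> \<gamma> c' a'')) \<parallel> \<iota> c''"
      by (simp add: tens_comp idt_left whisker_right comp_assoc tens_assoc idt_tens)
    finally show ?thesis by (simp add: slide1)
  qed
  ultimately show ?thesis by simp
qed

text \<open>The crossing of two pairs consists of the four crossings of their components; the last
  of these is undone by the \<open>exchange\<close> that follows it.\<close>

lemma exchange_sym:
  assumes [simp]: "obj a" "obj c" "obj a'" "obj c'"
  shows "exchange a' c' a c \<bullet> \<gamma> (a @ c) (a' @ c') = (\<gamma> a a' \<parallel> \<gamma> c c') \<bullet> exchange a c a' c'"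
proof -
  have "\<gamma> (a @ c) (a' @ c') = (\<iota> a' \<parallel> \<gamma> a c' \<parallel> \<iota> c) \<bullet> ((\<iota> (a' @ a) \<parallel> \<gamma> c c') \<bullet> (\<gamma> a a' \<parallel> \<iota> (c @ c'))) \<bullet> exchange a c a' c'"
    unfolding sym_append[of "a @ c" a' c', simplified]
    by (simp add: sym_append_left exchange_def whisker_left whisker_right comp_assoc
        idt_tens tens_assoc idt_tens_tail)
  also have "\<dots> = exchange a' a c' c \<bullet> (\<gamma> a a' \<parallel> \<gamma> c c') \<bullet> exchange a c a' c'"
    by (simp add: slide2 exchange_def)
  finally show ?thesis by (simp add: exchange_tw[THEN comp_eq_tail] idt_left)
qed

text \<open>\<open>P\<close> and \<open>Q\<close> sort three pairs when the first two, respectively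
  the last two, are already grouped. Naturality carries the multiplications through these sortings,
  after which each law is the tensor product of the laws of the factors.\<close>

lemma frob_tens:
  assumes "frob a m u" "frob c n v"
  defines "M \<equiv> (m \<parallel> n) \<bullet> exchange a c a c"
  shows "frob (a @ c) M (u \<parallel> v)"
proof -
  note [simp] = frob_typing[OF assms(1)] frob_typing[OF assms(2)]
  note l1 = frob_laws[OF assms(1)] and l2 = frob_laws[OF assms(2)]
  define P where "P = exchange (a @ a) (c @ c) a c"
  define Q where "Q = exchange a c (a @ a) (c @ c)"
  have [simp]: "arr P" "arr Q" "dom P = a @ a @ c @ c @ a @ c" "dom Q = a @ c @ a @ a @ c @ c"
      "cod P = a @ a @ a @ c @ c @ c" "cod Q = a @ a @ a @ c @ c @ c"
    by (simp_all add: P_def Q_def)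
  have [simp]: "arr M" "dom M = a @ c @ a @ c" "cod M = a @ c" by (simp_all add: M_def)
  have Md: "M\<^sup>\<circ> = exchange a a c c \<bullet> (m\<^sup>\<circ> \<parallel> n\<^sup>\<circ>)" by (simp add: M_def dag_comp dag_tens)
  have PQ: "P \<bullet> (exchange a c a c \<parallel> \<iota> (a @ c)) = Q \<bullet> (\<iota> (a @ c) \<parallel> exchange a c a c)"
    unfolding P_def Q_def by (rule exchange_assoc) simp_all
  have PP: "P\<^sup>\<circ> \<bullet> P = \<iota> (a @ a @ c @ c @ a @ c)" "Q\<^sup>\<circ> \<bullet> Q = \<iota> (a @ c @ a @ a @ c @ c)"
    using exchange_tw[of "a @ a" "c @ c" a c] exchange_tw[of a c "a @ a" "c @ c"] by (simp_all add: P_def Q_def)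
  have tt: "exchange a c a c \<bullet> exchange a a c c = \<iota> (a @ a @ c @ c)" using exchange_tw[of a a c c] by simp
  \<comment> \<open>A Frobenius law puts a multiplication after a comultiplication, so one sorting
    is performed and another undone. Unitarity converts \<open>PQ\<close> into this mixed
    form.\<close>
  have PQ1: "(exchange a c a c \<parallel> \<iota> (a @ c)) \<bullet> (\<iota> (a @ c) \<parallel> exchange a a c c) = P\<^sup>\<circ> \<bullet> Q"
  proof -
    have "P \<bullet> (exchange a c a c \<parallel> \<iota> (a @ c)) \<bullet> (\<iota> (a @ c) \<parallel> exchange a a c c)
       = Q \<bullet> (\<iota> (a @ c) \<parallel> exchange a c a c) \<bullet> (\<iota> (a @ c) \<parallel> exchange a a c c)"
      using PQ[THEN comp_eq_tail] by (simp add: comp_assoc)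
    also have "\<dots> = Q" by (simp add: tens_comp idt_left tt idt_tens idt_right)
    finally have "P\<^sup>\<circ> \<bullet> P \<bullet> (exchange a c a c \<parallel> \<iota> (a @ c)) \<bullet> (\<iota> (a @ c) \<parallel> exchange a a c c) = P\<^sup>\<circ> \<bullet> Q" by simp
    then show ?thesis by (simp add: PP[THEN comp_eq_tail] idt_left)
  qed
  have PQ2: "(\<iota> (a @ c) \<parallel> exchange a c a c) \<bullet> (exchange a a c c \<parallel> \<iota> (a @ c)) = Q\<^sup>\<circ> \<bullet> P"
    using arg_cong[OF PQ1, of dag] by (simp add: dag_comp dag_tens)
  have nP: "exchange a c a c \<bullet> (m \<parallel> n \<parallel> \<iota> (a @ c)) = ((m \<parallel> \<iota> a) \<parallel> (n \<parallel> \<iota> c)) \<bullet> P"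
    using exchange_natural[of m n "\<iota> a" "\<iota> c"] by (simp add: P_def idt_tens tens_assoc)
  have nQ: "exchange a c a c \<bullet> (\<iota> (a @ c) \<parallel> m \<parallel> n) = ((\<iota> a \<parallel> m) \<parallel> (\<iota> c \<parallel> n)) \<bullet> Q"
    using exchange_natural[of "\<iota> a" "\<iota> c" m n] by (simp add: Q_def idt_tens_tail tens_assoc)
  have nP2: "(m \<parallel> n \<parallel> \<iota> (a @ c)) \<bullet> P\<^sup>\<circ> = exchange a a c c \<bullet> ((m \<parallel> \<iota> a) \<parallel> (n \<parallel> \<iota> c))"
    using exchange_natural[of m "\<iota> a" n "\<iota> c"] by (simp add: P_def idt_tens tens_assoc)
  have nQ2: "(\<iota> (a @ c) \<parallel> m \<parallel> n) \<bullet> Q\<^sup>\<circ> = exchange a a c c \<bullet> ((\<iota> a \<parallel> m) \<parallel> (\<iota> c \<parallel> n))"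
    using exchange_natural[of "\<iota> a" m "\<iota> c" n] by (simp add: Q_def idt_tens_tail tens_assoc)
  have nP3: "P \<bullet> (m\<^sup>\<circ> \<parallel> n\<^sup>\<circ> \<parallel> \<iota> (a @ c)) = ((m\<^sup>\<circ> \<parallel> \<iota> a) \<parallel> (n\<^sup>\<circ> \<parallel> \<iota> c)) \<bullet> exchange a c a c"
    using arg_cong[OF nP2, of dag] by (simp add: dag_comp dag_tens)
  have nQ3: "Q \<bullet> (\<iota> (a @ c) \<parallel> m\<^sup>\<circ> \<parallel> n\<^sup>\<circ>) = ((\<iota> a \<parallel> m\<^sup>\<circ>) \<parallel> (\<iota> c \<parallel> n\<^sup>\<circ>)) \<bullet> exchange a c a c"
    using arg_cong[OF nQ2, of dag] by (simp add: dag_comp dag_tens)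
  have 1: "M \<bullet> (M \<parallel> \<iota> (a @ c)) = M \<bullet> (\<iota> (a @ c) \<parallel> M)"
  proof -
    have "M \<bullet> (M \<parallel> \<iota> (a @ c)) = (m \<parallel> n) \<bullet> ((m \<parallel> \<iota> a) \<parallel> (n \<parallel> \<iota> c)) \<bullet> P \<bullet> (exchange a c a c \<parallel> \<iota> (a @ c))"
      unfolding M_def by (simp add: whisker_right comp_assoc tens_assoc nP[THEN comp_eq_tail])
    also have "\<dots> = ((m \<bullet> (m \<parallel> \<iota> a)) \<parallel> (n \<bullet> (n \<parallel> \<iota> c))) \<bullet> Q \<bullet> (\<iota> (a @ c) \<parallel> exchange a c a c)"
      unfolding PQ by (simp add: tens_comp_tail)
    also have "\<dots> = (m \<parallel> n) \<bullet> ((\<iota> a \<parallel> m) \<parallel> (\<iota> c \<parallel> n)) \<bullet> Q \<bullet> (\<iota> (a @ c) \<parallel> exchange a c a c)"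
      by (simp add: tens_comp_tail l1 l2)
    also have "\<dots> = M \<bullet> (\<iota> (a @ c) \<parallel> M)"
      unfolding M_def by (simp add: whisker_left comp_assoc nQ[THEN comp_eq_tail])
    finally show ?thesis .
  qed
  have 2: "M \<bullet> ((u \<parallel> v) \<parallel> \<iota> (a @ c)) = \<iota> (a @ c)"
  proof -
    have "M \<bullet> ((u \<parallel> v) \<parallel> \<iota> (a @ c)) = (m \<parallel> n) \<bullet> (u \<parallel> \<iota> a \<parallel> v \<parallel> \<iota> c)"
      using exchange_natural[of u v "\<iota> a" "\<iota> c"]
      by (simp add: M_def comp_assoc tens_assoc idt_tens[symmetric, of a c])
        (simp add: exchange_def idt_right tens_assoc idt_tens)
    also have "\<dots> = (m \<parallel> n) \<bullet> ((u \<parallel> \<iota> a) \<parallel> (v \<parallel> \<iota> c))" by (simp add: tens_assoc)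
    also have "\<dots> = \<iota> (a @ c)" by (simp add: tens_comp l1 l2 idt_tens)
    finally show ?thesis .
  qed
  have 3: "M \<bullet> (\<iota> (a @ c) \<parallel> u \<parallel> v) = \<iota> (a @ c)"
  proof -
    have "M \<bullet> (\<iota> (a @ c) \<parallel> u \<parallel> v) = (m \<parallel> n) \<bullet> (\<iota> a \<parallel> u \<parallel> \<iota> c \<parallel> v)"
      using exchange_natural[of "\<iota> a" "\<iota> c" u v]
      by (simp add: M_def comp_assoc tens_assoc idt_tens_tail)
        (simp add: exchange_def idt_right tens_assoc idt_tens)
    also have "\<dots> = (m \<parallel> n) \<bullet> ((\<iota> a \<parallel> u) \<parallel> (\<iota> c \<parallel> v))" by (simp add: tens_assoc)
    also have "\<dots> = \<iota> (a @ c)" by (simp add: tens_comp l1 l2 idt_tens)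
    finally show ?thesis .
  qed
  have 4: "(M \<parallel> \<iota> (a @ c)) \<bullet> (\<iota> (a @ c) \<parallel> M\<^sup>\<circ>) = M\<^sup>\<circ> \<bullet> M"
  proof -
    have "(M \<parallel> \<iota> (a @ c)) \<bullet> (\<iota> (a @ c) \<parallel> M\<^sup>\<circ>)
       = (m \<parallel> n \<parallel> \<iota> (a @ c)) \<bullet> P\<^sup>\<circ> \<bullet> Q \<bullet> (\<iota> (a @ c) \<parallel> m\<^sup>\<circ> \<parallel> n\<^sup>\<circ>)"
      unfolding Md by (simp add: M_def whisker_left whisker_right comp_assoc tens_assoc
          PQ1[THEN comp_eq_tail])
    also have "\<dots> = exchange a a c c \<bullet> ((m \<parallel> \<iota> a) \<parallel> (n \<parallel> \<iota> c)) \<bullet> ((\<iota> a \<parallel> m\<^sup>\<circ>) \<parallel> (\<iota> c \<parallel> n\<^sup>\<circ>)) \<bullet> exchange a c a c"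
      unfolding nQ3 by (simp add: nP2[THEN comp_eq_tail] comp_assoc)
    also have "\<dots> = M\<^sup>\<circ> \<bullet> M" unfolding Md by (simp add: M_def tens_comp_tail l1 l2 comp_assoc)
    finally show ?thesis .
  qed
  have 5: "(\<iota> (a @ c) \<parallel> M) \<bullet> (M\<^sup>\<circ> \<parallel> \<iota> (a @ c)) = M\<^sup>\<circ> \<bullet> M"
  proof -
    have "(\<iota> (a @ c) \<parallel> M) \<bullet> (M\<^sup>\<circ> \<parallel> \<iota> (a @ c))
       = (\<iota> (a @ c) \<parallel> m \<parallel> n) \<bullet> Q\<^sup>\<circ> \<bullet> P \<bullet> (m\<^sup>\<circ> \<parallel> n\<^sup>\<circ> \<parallel> \<iota> (a @ c))"
      unfolding Md by (simp add: M_def whisker_left whisker_right comp_assoc tens_assoc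
          PQ2[THEN comp_eq_tail])
    also have "\<dots> = exchange a a c c \<bullet> ((\<iota> a \<parallel> m) \<parallel> (\<iota> c \<parallel> n)) \<bullet> ((m\<^sup>\<circ> \<parallel> \<iota> a) \<parallel> (n\<^sup>\<circ> \<parallel> \<iota> c)) \<bullet> exchange a c a c"
      unfolding nP3 by (simp add: nQ2[THEN comp_eq_tail] comp_assoc)
    also have "\<dots> = M\<^sup>\<circ> \<bullet> M" unfolding Md by (simp add: M_def tens_comp_tail l1 l2 comp_assoc)
    finally show ?thesis .
  qed
  show ?thesis unfolding frob_def using 1 2 3 4 5 by simp
qed

lemma nalg_tens:
  assumes "nalg a m u z" "nalg c n v w"
  defines "M \<equiv> (m \<parallel> n) \<bullet> exchange a c a c"
  shows "nalg (a @ c) M (u \<parallel> v) (z \<parallel> w)"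
proof -
  note [simp] = nalg_typing[OF assms(1)] nalg_typing[OF assms(2)]
  note l1 = nalg_laws[OF assms(1)] and l2 = nalg_laws[OF assms(2)]
  have [simp]: "arr M" "dom M = a @ c @ a @ c" "cod M = a @ c" by (simp_all add: M_def)
  have Md: "M\<^sup>\<circ> = exchange a a c c \<bullet> (m\<^sup>\<circ> \<parallel> n\<^sup>\<circ>)" by (simp add: M_def dag_comp dag_tens)
  have tt: "exchange a c a c \<bullet> exchange a a c c = \<iota> (a @ a @ c @ c)" using exchange_tw[of a a c c] by simp
  have cap: "cap M (u \<parallel> v) = (cap m u \<parallel> cap n v) \<bullet> exchange a c a c"
    by (simp add: M_def dag_tens tens_comp tens_comp_tail)
  have 1: "cap M (u \<parallel> v) \<bullet> \<gamma> (a @ c) (a @ c) = cap M (u \<parallel> v)"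
    unfolding cap by (simp add: comp_assoc exchange_sym) (simp add: tens_comp_tail comp_assoc l1 l2)
  have 2: "(z \<parallel> w) \<bullet> M = M \<bullet> ((z \<parallel> w) \<parallel> \<iota> (a @ c))"
  proof -
    have "(z \<parallel> w) \<bullet> M = ((m \<bullet> (z \<parallel> \<iota> a)) \<parallel> (n \<bullet> (w \<parallel> \<iota> c))) \<bullet> exchange a c a c"
      by (simp add: M_def tens_comp_tail l1 l2)
    also have "\<dots> = (m \<parallel> n) \<bullet> ((z \<parallel> \<iota> a) \<parallel> (w \<parallel> \<iota> c)) \<bullet> exchange a c a c" by (simp add: tens_comp_tail)
    also have "\<dots> = M \<bullet> ((z \<parallel> w) \<parallel> \<iota> (a @ c))"
      using exchange_natural[of z w "\<iota> a" "\<iota> c"] by (simp add: M_def tens_assoc comp_assoc idt_tens)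
    finally show ?thesis .
  qed
  have 3: "(z \<parallel> w) \<bullet> M = M \<bullet> (\<iota> (a @ c) \<parallel> (z \<parallel> w))"
  proof -
    have "(z \<parallel> w) \<bullet> M = ((m \<bullet> (\<iota> a \<parallel> z)) \<parallel> (n \<bullet> (\<iota> c \<parallel> w))) \<bullet> exchange a c a c"
      by (simp add: M_def tens_comp_tail l1 l2)
    also have "\<dots> = (m \<parallel> n) \<bullet> ((\<iota> a \<parallel> z) \<parallel> (\<iota> c \<parallel> w)) \<bullet> exchange a c a c" by (simp add: tens_comp_tail)
    also have "\<dots> = M \<bullet> (\<iota> (a @ c) \<parallel> (z \<parallel> w))"
      using exchange_natural[of "\<iota> a" "\<iota> c" z w] by (simp add: M_def tens_assoc comp_assoc idt_tens_tail)
    finally show ?thesis .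
  qed
  have 4: "positive_arr (z \<parallel> w)"
    using assms by (intro positive_tens) (simp_all add: nalg_def)
  have 5: "M \<bullet> M\<^sup>\<circ> \<bullet> (z \<parallel> w) \<bullet> (z \<parallel> w) = \<iota> (a @ c)"
  proof -
    have "M \<bullet> M\<^sup>\<circ> \<bullet> (z \<parallel> w) \<bullet> (z \<parallel> w) = (m \<parallel> n) \<bullet> (m\<^sup>\<circ> \<parallel> n\<^sup>\<circ>) \<bullet> (z \<parallel> w) \<bullet> (z \<parallel> w)"
      unfolding Md by (simp add: M_def comp_assoc tt[THEN comp_eq_tail] idt_left)
    then show ?thesis by (simp add: tens_comp l1 l2 idt_tens)
  qed
  show ?thesis unfolding nalg_def
    using frob_tens[of a m u c n v] 1 2 3 4 5 by (simp flip: M_def)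
qed

text \<open>Both diagrams are reduced to the crossings \<open>mid\<close> between the
  comultiplications below and the multiplications above. On the right the wires \<open>b\<close> and
  \<open>c\<close> cross one extra time and cross back; removing this pair is the content of
  \<open>m3\<close>.\<close>

lemma choi_tens:
  assumes "frob a ma ua" "frob b mb ub" "frob c mc uc" "frob d md ud"
    and [simp]: "arr f" "dom f = a" "cod f = b" "arr g" "dom g = c" "cod g = d"
  shows "choi ((ma \<parallel> mc) \<bullet> exchange a c a c) ((mb \<parallel> md) \<bullet> exchange b d b d) (f \<parallel> g)
    = (exchange a c b d)\<^sup>\<circ> \<bullet> (choi ma mb f \<parallel> choi mc md g) \<bullet> exchange a c b d"
proof -
  note [simp] = frob_typing[OF assms(1)] frob_typing[OF assms(2)] frob_typing[OF assms(3)]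
    frob_typing[OF assms(4)]
  define F where "F = (\<iota> a \<parallel> f) \<bullet> ma\<^sup>\<circ>"
  define G where "G = (\<iota> c \<parallel> g) \<bullet> mc\<^sup>\<circ>"
  have [simp]: "arr F" "dom F = a" "cod F = a @ b" "arr G" "dom G = c" "cod G = c @ d"
    by (simp_all add: F_def G_def)
  define mid where "mid = \<iota> a \<parallel> \<gamma> b c \<parallel> \<gamma> d b \<parallel> \<iota> d"
  have [simp]: "arr mid" "dom mid = a @ b @ c @ d @ b @ d" "cod mid = a @ c @ b @ b @ d @ d"
    by (simp_all add: mid_def)
  have "choi ((ma \<parallel> mc) \<bullet> exchange a c a c) ((mb \<parallel> md) \<bullet> exchange b d b d) (f \<parallel> g)
    = (\<iota> (a @ c) \<parallel> mb \<parallel> md) \<bullet> (\<iota> (a @ c) \<parallel> exchange b d b d) \<bullet>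
      ((\<iota> (a @ c) \<parallel> f \<parallel> g \<parallel> \<iota> (b @ d)) \<bullet> (exchange a a c c \<parallel> \<iota> (b @ d))) \<bullet> (ma\<^sup>\<circ> \<parallel> mc\<^sup>\<circ> \<parallel> \<iota> (b @ d))"
    by (simp add: choi_def dag_comp dag_tens whisker_left whisker_right comp_assoc tens_assoc)
  also have "(\<iota> (a @ c) \<parallel> f \<parallel> g \<parallel> \<iota> (b @ d)) \<bullet> (exchange a a c c \<parallel> \<iota> (b @ d))
      = (exchange a b c d \<parallel> \<iota> (b @ d)) \<bullet> (\<iota> a \<parallel> f \<parallel> \<iota> c \<parallel> g \<parallel> \<iota> (b @ d))"
    using arg_cong[OF exchange_natural[of "\<iota> a" f "\<iota> c" g], of "\<lambda>x. x \<parallel> \<iota> (b @ d)"]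
    by (simp add: whisker_right tens_assoc idt_tens_tail)
  also have "(\<iota> (a @ c) \<parallel> mb \<parallel> md) \<bullet> (\<iota> (a @ c) \<parallel> exchange b d b d) \<bullet>
      ((exchange a b c d \<parallel> \<iota> (b @ d)) \<bullet> (\<iota> a \<parallel> f \<parallel> \<iota> c \<parallel> g \<parallel> \<iota> (b @ d))) \<bullet> (ma\<^sup>\<circ> \<parallel> mc\<^sup>\<circ> \<parallel> \<iota> (b @ d))
     = (\<iota> (a @ c) \<parallel> mb \<parallel> md) \<bullet> ((\<iota> (a @ c) \<parallel> exchange b d b d) \<bullet> (exchange a b c d \<parallel> \<iota> (b @ d))) \<bullet>
        ((\<iota> a \<parallel> f \<parallel> \<iota> c \<parallel> g \<parallel> \<iota> (b @ d)) \<bullet> (ma\<^sup>\<circ> \<parallel> mc\<^sup>\<circ> \<parallel> \<iota> (b @ d)))"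
    by (simp add: comp_assoc)
  also have "(\<iota> (a @ c) \<parallel> exchange b d b d) \<bullet> (exchange a b c d \<parallel> \<iota> (b @ d)) = mid"
  proof -
    have "(\<iota> (a @ c) \<parallel> exchange b d b d) \<bullet> (exchange a b c d \<parallel> \<iota> (b @ d)) =
      (\<iota> a \<parallel> (\<iota> (c @ b) \<parallel> \<gamma> d b) \<parallel> \<iota> d) \<bullet> (\<iota> a \<parallel> (\<gamma> b c \<parallel> \<iota> (d @ b)) \<parallel> \<iota> d)"
      by (simp add: exchange_def tens_assoc idt_tens_tail idt_tens)
    also have "\<dots> = mid" by (simp add: tens_comp idt_left idt_right mid_def tens_assoc slide2)
    finally show ?thesis .
  qed
  also have "(\<iota> a \<parallel> f \<parallel> \<iota> c \<parallel> g \<parallel> \<iota> (b @ d)) \<bullet> (ma\<^sup>\<circ> \<parallel> mc\<^sup>\<circ> \<parallel> \<iota> (b @ d)) = F \<parallel> G \<parallel> \<iota> (b @ d)"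
    using tens_comp[of "ma\<^sup>\<circ>" "\<iota> a \<parallel> f" "mc\<^sup>\<circ> \<parallel> \<iota> (b @ d)" "(\<iota> c \<parallel> g) \<parallel> \<iota> (b @ d)"]
    by (simp add: tens_assoc F_def G_def whisker_right)
  also have "(\<iota> (a @ c) \<parallel> mb \<parallel> md) \<bullet> mid \<bullet> (F \<parallel> G \<parallel> \<iota> (b @ d))
     = (exchange a c b d)\<^sup>\<circ> \<bullet> (choi ma mb f \<parallel> choi mc md g) \<bullet> exchange a c b d"
  proof -
    have m1: "(exchange a c b d)\<^sup>\<circ> \<bullet> (\<iota> a \<parallel> mb \<parallel> \<iota> c \<parallel> md) = (\<iota> (a @ c) \<parallel> mb \<parallel> md) \<bullet> exchange a (b @ b) c (d @ d)"
      using exchange_natural[of "\<iota> a" mb "\<iota> c" md] by (simp add: idt_tens_tail)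
    have m2: "(F \<parallel> \<iota> b \<parallel> G \<parallel> \<iota> d) \<bullet> exchange a c b d = exchange (a @ b) (c @ d) b d \<bullet> (F \<parallel> G \<parallel> \<iota> (b @ d))"
      using exchange_natural[of F G "\<iota> b" "\<iota> d"] by (simp add: idt_tens)
    have m3: "exchange a (b @ b) c (d @ d) \<bullet> exchange (a @ b) (c @ d) b d = mid"
    proof -
      have "exchange a (b @ b) c (d @ d) \<bullet> exchange (a @ b) (c @ d) b d =
         \<iota> a \<parallel> ((((\<gamma> b c \<parallel> \<iota> b) \<bullet> (\<iota> b \<parallel> \<gamma> b c)) \<parallel> \<iota> d) \<bullet> (\<iota> b \<parallel> ((\<gamma> c b \<parallel> \<iota> d) \<bullet> (\<iota> c \<parallel> \<gamma> d b)))) \<parallel> \<iota> d"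
        by (simp add: exchange_def sym_append_left whisker_left whisker_right comp_assoc tens_assoc
           idt_tens idt_tens_tail)
      also have "(((\<gamma> b c \<parallel> \<iota> b) \<bullet> (\<iota> b \<parallel> \<gamma> b c)) \<parallel> \<iota> d) \<bullet> (\<iota> b \<parallel> ((\<gamma> c b \<parallel> \<iota> d) \<bullet> (\<iota> c \<parallel> \<gamma> d b)))
         = (\<gamma> b c \<parallel> \<iota> (b @ d)) \<bullet> (\<iota> b \<parallel> ((\<gamma> b c \<bullet> \<gamma> c b) \<parallel> \<iota> d)) \<bullet> (\<iota> (b @ c) \<parallel> \<gamma> d b)"
        by (simp add: whisker_left whisker_right comp_assoc tens_assoc idt_tens idt_tens_tail)
      also have "\<dots> = \<gamma> b c \<parallel> \<gamma> d b" by (simp add: sym_sym idt_tens idt_left slide1)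
      finally show ?thesis by (simp add: mid_def tens_assoc)
    qed
    have "choi ma mb f \<parallel> choi mc md g = (\<iota> a \<parallel> mb \<parallel> \<iota> c \<parallel> md) \<bullet> (F \<parallel> \<iota> b \<parallel> G \<parallel> \<iota> d)"
      using tens_comp[of "F \<parallel> \<iota> b" "\<iota> a \<parallel> mb" "G \<parallel> \<iota> d" "\<iota> c \<parallel> md"]
      by (simp add: choi_left[of f] choi_left[of g] flip: F_def G_def) (simp add: tens_assoc)
    then have "(exchange a c b d)\<^sup>\<circ> \<bullet> (choi ma mb f \<parallel> choi mc md g) \<bullet> exchange a c b d
      = ((exchange a c b d)\<^sup>\<circ> \<bullet> (\<iota> a \<parallel> mb \<parallel> \<iota> c \<parallel> md)) \<bullet> ((F \<parallel> \<iota> b \<parallel> G \<parallel> \<iota> d) \<bullet> exchange a c b d)"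
      by (simp add: comp_assoc)
    also have "\<dots> = (\<iota> (a @ c) \<parallel> mb \<parallel> md) \<bullet> mid \<bullet> (F \<parallel> G \<parallel> \<iota> (b @ d))"
      unfolding m1 m2 by (simp add: comp_assoc m3[THEN comp_eq_tail])
    finally show ?thesis by simp
  qed
  finally show ?thesis .
qed

lemma choi_tens_positive:
  assumes "frob a ma ua" "frob b mb ub" "frob c mc uc" "frob d md ud"
    and [simp]: "arr f" "dom f = a" "cod f = b" "arr g" "dom g = c" "cod g = d"
    and "positive_arr (choi ma mb f)" "positive_arr (choi mc md g)"
  shows "positive_arr (choi ((ma \<parallel> mc) \<bullet> exchange a c a c) ((mb \<parallel> md) \<bullet> exchange b d b d) (f \<parallel> g))"
proof -
  note [simp] = frob_typing[OF assms(1)] frob_typing[OF assms(2)] frob_typing[OF assms(3)]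
    frob_typing[OF assms(4)]
  show ?thesis
    unfolding choi_tens[OF assms(1-10)]
    by (rule positive_sandwich) (simp_all add: positive_tens assms)
qed

section \<open>Crossings of three equal wires, and opposite algebras\<close>

lemma sym_reversal:
  assumes [simp]: "obj a"
  shows "(\<gamma> a a \<parallel> \<iota> a) \<bullet> (\<iota> a \<parallel> \<gamma> a a) \<bullet> (\<gamma> a a \<parallel> \<iota> a) = (\<iota> a \<parallel> \<gamma> a a) \<bullet> (\<gamma> a a \<parallel> \<iota> a) \<bullet> (\<iota> a \<parallel> \<gamma> a a)"
proof -
  \<comment> \<open>Naturality of the block crossing at a crossing is the Yang-Baxter
    equation.\<close>
  have "\<gamma> a (a @ a) \<bullet> (\<iota> a \<parallel> \<gamma> a a) = (\<gamma> a a \<parallel> \<iota> a) \<bullet> \<gamma> a (a @ a)"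
    using sym_natural[of "\<iota> a" "\<gamma> a a"] by simp
  then show ?thesis by (simp add: sym_append comp_assoc)
qed

text \<open>A cyclic rotation of three equal wires has order three, so the inverse rotation is its
  square. This form matters because a multiplication can be pulled through a block crossing by
  naturality, one rotation for each of the two multiplications in a Frobenius law.\<close>

lemma sym_rotate:
  assumes [simp]: "obj a"
  shows "(\<gamma> a a \<parallel> \<iota> a) \<bullet> (\<iota> a \<parallel> \<gamma> a a) = \<gamma> a (a @ a) \<bullet> \<gamma> a (a @ a)"
     "(\<iota> a \<parallel> \<gamma> a a) \<bullet> (\<gamma> a a \<parallel> \<iota> a) = \<gamma> (a @ a) a \<bullet> \<gamma> (a @ a) a"
proof -
  have rr: "(\<gamma> a a \<parallel> \<iota> a) \<bullet> (\<gamma> a a \<parallel> \<iota> a) = \<iota> (a @ a @ a)"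
     "(\<iota> a \<parallel> \<gamma> a a) \<bullet> (\<iota> a \<parallel> \<gamma> a a) = \<iota> (a @ a @ a)"
    by (simp_all add: tens_comp idt_left idt_tens sym_sym)
  have "\<gamma> a (a @ a) \<bullet> \<gamma> a (a @ a) = ((\<iota> a \<parallel> \<gamma> a a) \<bullet> (\<gamma> a a \<parallel> \<iota> a) \<bullet> (\<iota> a \<parallel> \<gamma> a a)) \<bullet> (\<gamma> a a \<parallel> \<iota> a)"
    by (simp add: sym_append comp_assoc)
  also have "\<dots> = (\<gamma> a a \<parallel> \<iota> a) \<bullet> (\<iota> a \<parallel> \<gamma> a a) \<bullet> (\<gamma> a a \<parallel> \<iota> a) \<bullet> (\<gamma> a a \<parallel> \<iota> a)"
    unfolding sym_reversal[OF assms, symmetric] by (simp add: comp_assoc)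
  finally show "(\<gamma> a a \<parallel> \<iota> a) \<bullet> (\<iota> a \<parallel> \<gamma> a a) = \<gamma> a (a @ a) \<bullet> \<gamma> a (a @ a)"
    by (simp add: rr idt_right)
  have "\<gamma> (a @ a) a \<bullet> \<gamma> (a @ a) a = ((\<gamma> a a \<parallel> \<iota> a) \<bullet> (\<iota> a \<parallel> \<gamma> a a) \<bullet> (\<gamma> a a \<parallel> \<iota> a)) \<bullet> (\<iota> a \<parallel> \<gamma> a a)"
    by (simp add: sym_append_left comp_assoc)
  also have "\<dots> = (\<iota> a \<parallel> \<gamma> a a) \<bullet> (\<gamma> a a \<parallel> \<iota> a) \<bullet> (\<iota> a \<parallel> \<gamma> a a) \<bullet> (\<iota> a \<parallel> \<gamma> a a)"
    unfolding sym_reversal[OF assms] by (simp add: comp_assoc)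
  finally show "(\<iota> a \<parallel> \<gamma> a a) \<bullet> (\<gamma> a a \<parallel> \<iota> a) = \<gamma> (a @ a) a \<bullet> \<gamma> (a @ a) a"
    by (simp add: rr idt_right)
  qed

text \<open>Reversal exchanges the two Frobenius laws: the crossings between the two multiplications
  form a double rotation, and each rotation is absorbed by one of them. The loop
  \<open>m \<bullet> m\<^sup>\<circ>\<close> is unchanged because its two crossings cancel, so the
  same \<open>z\<close> normalises the opposite algebra.\<close>

lemma nalg_opposite:
  assumes "nalg a m u z"
  shows "nalg a (m \<bullet> \<gamma> a a) u z"
proof -
  note [simp] = nalg_typing[OF assms]
  note l = frob_laws[OF nalg_typing(1)[OF assms]] nalg_laws[OF assms]
  let ?s = "\<gamma> a a"
  have [simp]: "?s \<bullet> ?s = \<iota> (a @ a)" by (simp add: sym_sym)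
  have n1: "?s \<bullet> (m \<parallel> \<iota> a) = (\<iota> a \<parallel> m) \<bullet> \<gamma> (a @ a) a" "?s \<bullet> (\<iota> a \<parallel> m) = (m \<parallel> \<iota> a) \<bullet> \<gamma> a (a @ a)"
    "\<gamma> (a @ a) a \<bullet> (m\<^sup>\<circ> \<parallel> \<iota> a) = (\<iota> a \<parallel> m\<^sup>\<circ>) \<bullet> ?s" "\<gamma> a (a @ a) \<bullet> (\<iota> a \<parallel> m\<^sup>\<circ>) = (m\<^sup>\<circ> \<parallel> \<iota> a) \<bullet> ?s"
    using sym_natural[of m "\<iota> a"] sym_natural[of "\<iota> a" m] sym_natural[of "m\<^sup>\<circ>" "\<iota> a"]
      sym_natural[of "\<iota> a" "m\<^sup>\<circ>"] by simp_all
  note yb = sym_rotate[OF nalg_typing(2)[OF assms]]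
  let ?m = "m \<bullet> ?s"
  have 1: "?m \<bullet> (?m \<parallel> \<iota> a) = ?m \<bullet> (\<iota> a \<parallel> ?m)"
  proof -
    have "?m \<bullet> (?m \<parallel> \<iota> a) = m \<bullet> (\<iota> a \<parallel> m) \<bullet> \<gamma> (a @ a) a \<bullet> (?s \<parallel> \<iota> a)"
      by (simp add: whisker_right comp_assoc n1[THEN comp_eq_tail])
    also have "\<dots> = m \<bullet> (m \<parallel> \<iota> a) \<bullet> \<gamma> a (a @ a) \<bullet> (\<iota> a \<parallel> ?s)"
      by (simp add: sym_append_left) (simp add: sym_append comp_assoc sym_reversal l(1)[symmetric, THEN comp_eq_tail])
    also have "\<dots> = ?m \<bullet> (\<iota> a \<parallel> ?m)"
      by (simp add: whisker_left comp_assoc n1[THEN comp_eq_tail])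
    finally show ?thesis .
  qed
  have 2: "?m \<bullet> (u \<parallel> \<iota> a) = \<iota> a" "?m \<bullet> (\<iota> a \<parallel> u) = \<iota> a"
    using sym_natural[of u "\<iota> a"] sym_natural[of "\<iota> a" u] by (simp_all add: comp_assoc l idt_right)
  have md: "?m\<^sup>\<circ> = ?s \<bullet> m\<^sup>\<circ>" by (simp add: dag_comp)
  have 3: "(?m \<parallel> \<iota> a) \<bullet> (\<iota> a \<parallel> ?m\<^sup>\<circ>) = ?m\<^sup>\<circ> \<bullet> ?m"
  proof -
    have "(?m \<parallel> \<iota> a) \<bullet> (\<iota> a \<parallel> ?m\<^sup>\<circ>) = (m \<parallel> \<iota> a) \<bullet> \<gamma> a (a @ a) \<bullet> \<gamma> a (a @ a) \<bullet> (\<iota> a \<parallel> m\<^sup>\<circ>)"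
      unfolding md by (simp add: whisker_left whisker_right comp_assoc yb[THEN comp_eq_tail])
    also have "\<dots> = ?s \<bullet> (\<iota> a \<parallel> m) \<bullet> (m\<^sup>\<circ> \<parallel> \<iota> a) \<bullet> ?s"
      by (simp add: n1(4) n1(2)[symmetric, THEN comp_eq_tail] comp_assoc)
    also have "\<dots> = ?m\<^sup>\<circ> \<bullet> ?m" unfolding md by (simp add: l(5)[THEN comp_eq_tail] comp_assoc)
    finally show ?thesis .
  qed
  have 4: "(\<iota> a \<parallel> ?m) \<bullet> (?m\<^sup>\<circ> \<parallel> \<iota> a) = ?m\<^sup>\<circ> \<bullet> ?m"
  proof -
    have "(\<iota> a \<parallel> ?m) \<bullet> (?m\<^sup>\<circ> \<parallel> \<iota> a) = (\<iota> a \<parallel> m) \<bullet> \<gamma> (a @ a) a \<bullet> \<gamma> (a @ a) a \<bullet> (m\<^sup>\<circ> \<parallel> \<iota> a)"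
      unfolding md by (simp add: whisker_left whisker_right comp_assoc yb[THEN comp_eq_tail])
    also have "\<dots> = ?s \<bullet> (m \<parallel> \<iota> a) \<bullet> (\<iota> a \<parallel> m\<^sup>\<circ>) \<bullet> ?s"
      by (simp add: n1(3) n1(1)[symmetric, THEN comp_eq_tail] comp_assoc)
    also have "\<dots> = ?m\<^sup>\<circ> \<bullet> ?m" unfolding md by (simp add: l(4)[THEN comp_eq_tail] comp_assoc)
    finally show ?thesis .
  qed
  have 5: "cap ?m u \<bullet> ?s = cap ?m u" using l(6) by (simp add: comp_assoc idt_right)
  have 6: "z \<bullet> ?m = ?m \<bullet> (z \<parallel> \<iota> a)" "z \<bullet> ?m = ?m \<bullet> (\<iota> a \<parallel> z)"
    using sym_natural[of z "\<iota> a"] sym_natural[of "\<iota> a" z]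
    by (simp_all add: comp_assoc l(7,8)[THEN comp_eq_tail])
  have 7: "?m \<bullet> ?m\<^sup>\<circ> \<bullet> z \<bullet> z = \<iota> a"
    unfolding md using l(9) by (simp add: comp_assoc sym_sym[THEN comp_eq_tail] idt_left)
  have 8: "positive_arr z" using assms by (simp add: nalg_def)
  show ?thesis unfolding nalg_def frob_def using 1 2 3 4 5 6 7 8 by simp
qed

text \<open>Unitarity makes a homomorphism of multiplications compatible with comultiplications too.
  The Choi morphism is therefore a sandwich of that of the identity on \<open>b\<close>, which a
  Frobenius law rewrites to \<open>n\<^sup>\<circ> \<bullet> n\<close>.\<close>

lemma choi_unitary_hom:
  assumes "frob a m u" "frob b n v" "arr k" "dom k = a" "cod k = b" "k\<^sup>\<circ> \<bullet> k = \<iota> a" "k \<bullet> k\<^sup>\<circ> = \<iota> b"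
    and hom: "k \<bullet> m = n \<bullet> (k \<parallel> k)"
  shows "positive_arr (choi m n k)"
proof -
  note [simp] = frob_typing[OF assms(1)] frob_typing[OF assms(2)] assms(3-5)
  have "m\<^sup>\<circ> \<bullet> k\<^sup>\<circ> = (k\<^sup>\<circ> \<parallel> k\<^sup>\<circ>) \<bullet> n\<^sup>\<circ>" using arg_cong[OF hom, of dag] by (simp add: dag_comp dag_tens)
  from arg_cong[OF this, of "\<lambda>x. x \<bullet> k"] have md: "m\<^sup>\<circ> = (k\<^sup>\<circ> \<parallel> k\<^sup>\<circ>) \<bullet> n\<^sup>\<circ> \<bullet> k"
    by (simp add: comp_assoc assms(6) idt_right)
  have "(\<iota> a \<parallel> k) \<bullet> m\<^sup>\<circ> = (k\<^sup>\<circ> \<parallel> \<iota> b) \<bullet> n\<^sup>\<circ> \<bullet> k"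
    unfolding md by (simp add: tens_comp_tail idt_left assms(7))
  then have "choi m n k = ((\<iota> a \<parallel> n) \<bullet> (k\<^sup>\<circ> \<parallel> \<iota> (b @ b))) \<bullet> (n\<^sup>\<circ> \<parallel> \<iota> b) \<bullet> (k \<parallel> \<iota> b)"
    by (simp add: choi_left whisker_right comp_assoc tens_assoc idt_tens)
  also have "(\<iota> a \<parallel> n) \<bullet> (k\<^sup>\<circ> \<parallel> \<iota> (b @ b)) = (k\<^sup>\<circ> \<parallel> \<iota> b) \<bullet> (\<iota> b \<parallel> n)"
    by (simp add: slide1 slide2)
  finally have "choi m n k = (k \<parallel> \<iota> b)\<^sup>\<circ> \<bullet> (n\<^sup>\<circ> \<bullet> n) \<bullet> (k \<parallel> \<iota> b)"
    by (simp add: dag_tens comp_assoc frob_laws(5)[OF assms(2), THEN comp_eq_tail])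
  then show ?thesis by (simp only:) (rule positive_sandwich, simp_all add: positive_arr_square)
qed

text \<open>The unit object carries the algebra \<open>\<iota> []\<close>, so this Choi morphism
  multiplies by the cup in the tensor product of the opposite algebra with the algebra. The crossing
  from the opposite multiplication and the one in \<open>exchange\<close> combine to a block
  crossing, which slides the cup between the two inputs; the rest is bending and a Frobenius
  law.\<close>

lemma choi_cup:
  assumes "nalg a m u z"
  shows "choi (\<iota> []) (((m \<bullet> \<gamma> a a) \<parallel> m) \<bullet> exchange a a a a) (cup m u) = m\<^sup>\<circ> \<bullet> m"
proof -
  note [simp] = nalg_typing[OF assms]
  note l = frob_laws[OF nalg_typing(1)[OF assms]] nalg_laws[OF assms] bend[OF nalg_typing(1)[OF assms]]
  have "choi (\<iota> []) (((m \<bullet> \<gamma> a a) \<parallel> m) \<bullet> exchange a a a a) (cup m u) =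
     (m \<parallel> m) \<bullet> (\<gamma> a a \<parallel> \<iota> (a @ a)) \<bullet> exchange a a a a \<bullet> (cup m u \<parallel> \<iota> (a @ a))"
  proof -
    have "(m \<bullet> \<gamma> a a) \<parallel> m = (m \<parallel> m) \<bullet> (\<gamma> a a \<parallel> \<iota> (a @ a))" by (simp add: tens_comp idt_right)
    then show ?thesis by (simp add: choi_def idt_right comp_assoc)
  qed
  also have "(\<gamma> a a \<parallel> \<iota> (a @ a)) \<bullet> exchange a a a a \<bullet> (cup m u \<parallel> \<iota> (a @ a)) =
     ((\<gamma> (a @ a) a \<bullet> (cup m u \<parallel> \<iota> a)) \<parallel> \<iota> a)"
    by (simp add: exchange_def sym_append_left whisker_right comp_assoc tens_assoc idt_tens)
  also have "\<gamma> (a @ a) a \<bullet> (cup m u \<parallel> \<iota> a) = \<iota> a \<parallel> cup m u"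
    using sym_natural[of "cup m u" "\<iota> a"] by (simp add: idt_right)
  also have "(m \<parallel> m) \<bullet> ((\<iota> a \<parallel> cup m u) \<parallel> \<iota> a) = (\<iota> a \<parallel> m) \<bullet> (((m \<parallel> \<iota> a) \<bullet> (\<iota> a \<parallel> cup m u)) \<parallel> \<iota> a)"
    using slide2[of m m "a @ a" a] by (simp add: whisker_right tens_assoc comp_assoc idt_tens comp_eq_tail)
  finally show ?thesis by (simp add: l)
qed

subsection \<open>Duals\<close>

definition dual_pair :: "'x list \<Rightarrow> 'x list \<Rightarrow> 'm \<Rightarrow> bool" where
  "dual_pair d a \<eta> \<longleftrightarrow> obj d \<and> obj a \<and> arr \<eta> \<and> dom \<eta> = [] \<and> cod \<eta> = d @ a \<and>
    ((\<eta>\<^sup>\<circ> \<bullet> \<gamma> a d) \<parallel> \<iota> a) \<bullet> (\<iota> a \<parallel> \<eta>) = \<iota> a \<and> (\<iota> d \<parallel> (\<eta>\<^sup>\<circ> \<bullet> \<gamma> a d)) \<bullet> (\<eta> \<parallel> \<iota> d) = \<iota> d"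

lemma dual_pair_typing:
  assumes "dual_pair d a \<eta>"
  shows "obj d" "obj a" "arr \<eta>" "dom \<eta> = []" "cod \<eta> = d @ a"
  using assms by (auto simp: dual_pair_def)

lemma dual_pair_counit:
  assumes "dual_pair d a \<eta>"
  obtains \<epsilon> where "\<epsilon> = \<eta>\<^sup>\<circ> \<bullet> \<gamma> a d" "arr \<epsilon>" "dom \<epsilon> = a @ d" "cod \<epsilon> = []"
    "(\<epsilon> \<parallel> \<iota> a) \<bullet> (\<iota> a \<parallel> \<eta>) = \<iota> a" "(\<iota> d \<parallel> \<epsilon>) \<bullet> (\<eta> \<parallel> \<iota> d) = \<iota> d"
    "(\<iota> a \<parallel> \<eta>\<^sup>\<circ>) \<bullet> (\<epsilon>\<^sup>\<circ> \<parallel> \<iota> a) = \<iota> a" "(\<eta>\<^sup>\<circ> \<parallel> \<iota> d) \<bullet> (\<iota> d \<parallel> \<epsilon>\<^sup>\<circ>) = \<iota> d"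
    "\<eta>\<^sup>\<circ> = \<epsilon> \<bullet> \<gamma> d a" "\<epsilon>\<^sup>\<circ> = \<gamma> d a \<bullet> \<eta>"
proof -
  note [simp] = dual_pair_typing[OF assms]
  define \<epsilon> where "\<epsilon> = \<eta>\<^sup>\<circ> \<bullet> \<gamma> a d"
  have [simp]: "arr \<epsilon>" "dom \<epsilon> = a @ d" "cod \<epsilon> = []" by (simp_all add: \<epsilon>_def)
  have 1: "(\<epsilon> \<parallel> \<iota> a) \<bullet> (\<iota> a \<parallel> \<eta>) = \<iota> a" and 2: "(\<iota> d \<parallel> \<epsilon>) \<bullet> (\<eta> \<parallel> \<iota> d) = \<iota> d"
    using assms by (simp_all add: dual_pair_def \<epsilon>_def)
  have 3: "(\<iota> a \<parallel> \<eta>\<^sup>\<circ>) \<bullet> (\<epsilon>\<^sup>\<circ> \<parallel> \<iota> a) = \<iota> a"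
    using arg_cong[OF 1, of dag] by (simp add: dag_comp dag_tens)
  have 4: "(\<eta>\<^sup>\<circ> \<parallel> \<iota> d) \<bullet> (\<iota> d \<parallel> \<epsilon>\<^sup>\<circ>) = \<iota> d"
    using arg_cong[OF 2, of dag] by (simp add: dag_comp dag_tens)
  have 5: "\<eta>\<^sup>\<circ> = \<epsilon> \<bullet> \<gamma> d a" "\<epsilon>\<^sup>\<circ> = \<gamma> d a \<bullet> \<eta>"
    by (simp_all add: \<epsilon>_def comp_assoc sym_sym idt_right dag_comp)
  show thesis using that[OF \<epsilon>_def] 1 2 3 4 5 by simp
qed

text \<open>The block crossing turns the nest of caps inside out. Each cap is pulled off the other
  by naturality, and the crossing of a cap with itself that remains is absorbed because both forms
  are symmetric.\<close>

lemma cap_pair_sym: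
  assumes "frob a m u" "frob b n v" "cap m u \<bullet> \<gamma> a a = cap m u" "cap n v \<bullet> \<gamma> b b = cap n v"
  shows "cap m u \<bullet> (\<iota> a \<parallel> cap n v \<parallel> \<iota> a) \<bullet> \<gamma> (b @ a) (a @ b) = cap n v \<bullet> (\<iota> b \<parallel> cap m u \<parallel> \<iota> b)"
proof -
  note [simp] = frob_typing[OF assms(1)] frob_typing[OF assms(2)]
  define p where "p = cap m u"
  define q where "q = cap n v"
  have [simp]: "arr p" "dom p = a @ a" "cod p = []" "arr q" "dom q = b @ b" "cod q = []"
    by (simp_all add: p_def q_def)
  have p: "p \<bullet> \<gamma> a a = p" and q: "q \<bullet> \<gamma> b b = q" using assms by (simp_all add: p_def q_def)
  have q1: "(q \<parallel> \<iota> a) \<bullet> (\<iota> b \<parallel> \<gamma> a b) = (\<iota> a \<parallel> q) \<bullet> (\<gamma> b a \<parallel> \<iota> b)"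
  proof -
    have "(q \<parallel> \<iota> a) \<bullet> \<gamma> a (b @ b) = \<iota> a \<parallel> q"
      using sym_natural[of "\<iota> a" q] by (simp add: idt_left)
    from arg_cong[OF this, of "\<lambda>x. x \<bullet> (\<gamma> b a \<parallel> \<iota> b)"]
    show ?thesis by (simp add: sym_append comp_assoc tens_comp sym_sym idt_left idt_right idt_tens)
  qed
  have "p \<bullet> (\<iota> a \<parallel> q \<parallel> \<iota> a) \<bullet> \<gamma> (b @ a) (a @ b) =
    p \<bullet> (\<iota> a \<parallel> (((q \<bullet> \<gamma> b b) \<parallel> \<iota> a) \<bullet> (\<iota> b \<parallel> \<gamma> a b))) \<bullet> (\<gamma> b a \<parallel> \<iota> (a @ b)) \<bullet> (\<iota> b \<parallel> \<gamma> a a \<parallel> \<iota> b)"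
    unfolding sym_append[of "b @ a" a b, simplified]
    by (simp add: sym_append_left whisker_left whisker_right comp_assoc tens_assoc idt_tens idt_tens_tail)
  also have "\<dots> = p \<bullet> (\<iota> (a @ a) \<parallel> q) \<bullet> (\<gamma> b (a @ a) \<parallel> \<iota> b) \<bullet> (\<iota> b \<parallel> \<gamma> a a \<parallel> \<iota> b)"
    unfolding q q1
    by (simp add: sym_append whisker_left whisker_right comp_assoc tens_assoc idt_tens idt_tens_tail)
  also have "\<dots> = q \<bullet> (p \<parallel> \<iota> (b @ b)) \<bullet> (\<gamma> b (a @ a) \<parallel> \<iota> b) \<bullet> (\<iota> b \<parallel> \<gamma> a a \<parallel> \<iota> b)"
    using slide1[of p q "[]" "a @ a"] slide2[of p q "b @ b" "[]"] by (simp flip: comp_assoc)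
  also have "\<dots> = q \<bullet> (((p \<parallel> \<iota> b) \<bullet> \<gamma> b (a @ a)) \<parallel> \<iota> b) \<bullet> (\<iota> b \<parallel> \<gamma> a a \<parallel> \<iota> b)"
    by (simp add: whisker_right comp_assoc tens_assoc idt_tens)
  also have "(p \<parallel> \<iota> b) \<bullet> \<gamma> b (a @ a) = \<iota> b \<parallel> p"
    using sym_natural[of "\<iota> b" p] by (simp add: idt_left)
  also have "q \<bullet> ((\<iota> b \<parallel> p) \<parallel> \<iota> b) \<bullet> (\<iota> b \<parallel> \<gamma> a a \<parallel> \<iota> b) = q \<bullet> (\<iota> b \<parallel> p \<parallel> \<iota> b)"
    by (simp add: tens_assoc tens_comp idt_left p)
  finally show ?thesis by (simp add: p_def q_def)
qed

text \<open>If \<open>choi m n f\<close> is the square of \<open>h\<close>, then \<open>choi n m (f\<^sup>\<dagger>)\<close> is the square of the transpose of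
  \<open>h\<^sup>\<dagger>\<close>, bent with the duality of \<open>cod h\<close> and with the self-dualities of the two algebras.\<close>

lemma choi_dag:
  assumes "frob a m u" "frob b n v" "cap m u \<bullet> \<gamma> a a = cap m u" "cap n v \<bullet> \<gamma> b b = cap n v"
    and [simp]: "arr f" "dom f = a" "cod f = b"
    and h: "arr h" "choi m n f = h\<^sup>\<circ> \<bullet> h" and dp: "dual_pair d (cod h) \<eta>"
  shows "positive_arr (choi n m (f\<^sup>\<circ>))"
proof -
  note [simp] = frob_typing[OF assms(1)] frob_typing[OF assms(2)] h(1)
  define x where "x = cod h"
  have dp: "dual_pair d x \<eta>" using dp by (simp add: x_def)
  note [simp] = dual_pair_typing[OF dp]
  have [simp]: "cod h = x" by (simp add: x_def)
  have "dom (choi m n f) = a @ b" by simp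
  then have [simp]: "dom h = a @ b" by (simp add: h)
  obtain \<epsilon> where [simp]: "arr \<epsilon>" "dom \<epsilon> = x @ d" "cod \<epsilon> = []"
    and sn: "(\<epsilon> \<parallel> \<iota> x) \<bullet> (\<iota> x \<parallel> \<eta>) = \<iota> x" and ee: "\<eta>\<^sup>\<circ> = \<epsilon> \<bullet> \<gamma> d x"
    using dual_pair_counit[OF dp] by metis
  define p where "p = cap m u"
  define q where "q = cap n v"
  have [simp]: "arr p" "dom p = a @ a" "cod p = []" "arr q" "dom q = b @ b" "cod q = []"
    by (simp_all add: p_def q_def)
  define c where "c = p \<bullet> (\<iota> a \<parallel> q \<parallel> \<iota> a)"
  have [simp]: "arr c" "dom c = a @ b @ b @ a" "cod c = []" by (simp_all add: c_def)
  have csym: "c \<bullet> \<gamma> (b @ a) (a @ b) = q \<bullet> (\<iota> b \<parallel> p \<parallel> \<iota> b)"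
    using cap_pair_sym[OF assms(1-4)] by (simp add: c_def p_def q_def comp_assoc)
  define W where "W = c \<bullet> (h\<^sup>\<circ> \<parallel> \<iota> (b @ a))"
  have [simp]: "arr W" "dom W = x @ b @ a" "cod W = []" by (simp_all add: W_def)
  define K where "K = (\<iota> d \<parallel> W) \<bullet> (\<eta> \<parallel> \<iota> (b @ a))"
  have [simp]: "arr K" "dom K = b @ a" "cod K = d" by (simp_all add: K_def)
  define T where "T = choi m n f"
  have [simp]: "arr T" "dom T = a @ b" "cod T = a @ b" by (simp_all add: T_def)
  \<comment> \<open>The unit inside \<open>K\<close> and the counit straighten the wire
    \<open>x\<close>. In \<open>K\<^sup>\<circ> \<bullet> K\<close> this brings the two copies of
    the root next to each other, so that their product can be replaced by \<open>T\<close>.\<close>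
  have KW: "\<eta>\<^sup>\<circ> \<bullet> (K \<parallel> \<iota> x) = W \<bullet> \<gamma> (b @ a) x"
  proof -
    have "\<eta>\<^sup>\<circ> \<bullet> (K \<parallel> \<iota> x) = \<epsilon> \<bullet> (\<iota> x \<parallel> K) \<bullet> \<gamma> (b @ a) x"
      using sym_natural[of K "\<iota> x"] by (simp add: ee comp_assoc)
    also have "\<dots> = (\<epsilon> \<bullet> (\<iota> (x @ d) \<parallel> W)) \<bullet> (\<iota> x \<parallel> \<eta> \<parallel> \<iota> (b @ a)) \<bullet> \<gamma> (b @ a) x"
      by (simp add: K_def whisker_left comp_assoc idt_tens_tail)
    also have "\<epsilon> \<bullet> (\<iota> (x @ d) \<parallel> W) = W \<bullet> (\<epsilon> \<parallel> \<iota> (x @ b @ a))"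
      using slide1[of \<epsilon> W "[]"] slide2[of \<epsilon> W _ "[]"] by simp
    also have "(W \<bullet> (\<epsilon> \<parallel> \<iota> (x @ b @ a))) \<bullet> (\<iota> x \<parallel> \<eta> \<parallel> \<iota> (b @ a)) \<bullet> \<gamma> (b @ a) x
      = W \<bullet> (((\<epsilon> \<parallel> \<iota> x) \<bullet> (\<iota> x \<parallel> \<eta>)) \<parallel> \<iota> (b @ a)) \<bullet> \<gamma> (b @ a) x"
      by (simp add: whisker_right comp_assoc tens_assoc idt_tens)
    finally show ?thesis by (simp add: sn idt_left idt_tens)
  qed
  have "K\<^sup>\<circ> \<bullet> K = (\<eta>\<^sup>\<circ> \<parallel> \<iota> (b @ a)) \<bullet> (\<iota> d \<parallel> W\<^sup>\<circ>) \<bullet> K"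
    by (simp add: K_def dag_comp dag_tens comp_assoc)
  also have "(\<iota> d \<parallel> W\<^sup>\<circ>) \<bullet> K = (K \<parallel> \<iota> (x @ b @ a)) \<bullet> (\<iota> (b @ a) \<parallel> W\<^sup>\<circ>)"
    using slide2[of K "W\<^sup>\<circ>" "[]"] by (simp add: slide1)
  also have "(\<eta>\<^sup>\<circ> \<parallel> \<iota> (b @ a)) \<bullet> (K \<parallel> \<iota> (x @ b @ a)) \<bullet> (\<iota> (b @ a) \<parallel> W\<^sup>\<circ>)
     = ((\<eta>\<^sup>\<circ> \<bullet> (K \<parallel> \<iota> x)) \<parallel> \<iota> (b @ a)) \<bullet> (\<iota> (b @ a) \<parallel> W\<^sup>\<circ>)"
    by (simp add: whisker_right comp_assoc tens_assoc idt_tens)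
  also have "\<dots> = ((W \<bullet> \<gamma> (b @ a) x \<bullet> (\<iota> (b @ a) \<parallel> h)) \<parallel> \<iota> (b @ a)) \<bullet> (\<iota> (b @ a) \<parallel> c\<^sup>\<circ>)"
    unfolding KW by (simp add: W_def dag_comp dag_tens whisker_left whisker_right comp_assoc tens_assoc)
  also have "W \<bullet> \<gamma> (b @ a) x \<bullet> (\<iota> (b @ a) \<parallel> h) = q \<bullet> (\<iota> b \<parallel> p \<parallel> \<iota> b) \<bullet> (\<iota> (b @ a) \<parallel> T)"
  proof -
    have "W \<bullet> \<gamma> (b @ a) x \<bullet> (\<iota> (b @ a) \<parallel> h) = c \<bullet> ((h\<^sup>\<circ> \<bullet> h) \<parallel> \<iota> (b @ a)) \<bullet> \<gamma> (b @ a) (a @ b)"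
      using sym_natural[of "\<iota> (b @ a)" h] by (simp add: W_def comp_assoc whisker_right)
    also have "\<dots> = c \<bullet> \<gamma> (b @ a) (a @ b) \<bullet> (\<iota> (b @ a) \<parallel> T)"
      using sym_natural[of "\<iota> (b @ a)" T] by (simp add: T_def[symmetric] h(2)[symmetric])
    finally show ?thesis using csym[THEN comp_eq_tail] by (simp add: comp_assoc)
  qed
  also have "((q \<bullet> (\<iota> b \<parallel> p \<parallel> \<iota> b) \<bullet> (\<iota> (b @ a) \<parallel> T)) \<parallel> \<iota> (b @ a)) \<bullet> (\<iota> (b @ a) \<parallel> c\<^sup>\<circ>)
     = (q \<parallel> \<iota> (b @ a)) \<bullet> (\<iota> b \<parallel> p \<parallel> \<iota> (b @ b @ a)) \<bullet> (\<iota> (b @ a) \<parallel> ((T \<parallel> \<iota> (b @ a)) \<bullet> c\<^sup>\<circ>))"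
    by (simp add: whisker_left whisker_right comp_assoc tens_assoc idt_tens)
  also have "(T \<parallel> \<iota> (b @ a)) \<bullet> c\<^sup>\<circ> = (\<iota> a \<parallel> (((n\<^sup>\<circ> \<bullet> f) \<parallel> \<iota> a) \<bullet> m\<^sup>\<circ>)) \<bullet> cup m u"
  proof -
    define F where "F = (\<iota> a \<parallel> f) \<bullet> m\<^sup>\<circ>"
    have [simp]: "arr F" "dom F = a" "cod F = a @ b" by (simp_all add: F_def)
    have pd: "p\<^sup>\<circ> = cup m u" "q\<^sup>\<circ> = cup n v" by (simp_all add: p_def q_def dag_comp)
    have "(T \<parallel> \<iota> (b @ a)) \<bullet> c\<^sup>\<circ> =
      (\<iota> a \<parallel> n \<parallel> \<iota> (b @ a)) \<bullet> ((F \<parallel> \<iota> (b @ b @ a)) \<bullet> (\<iota> a \<parallel> (q\<^sup>\<circ> \<parallel> \<iota> a))) \<bullet> p\<^sup>\<circ>"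
      by (simp add: T_def c_def dag_comp dag_tens choi_left F_def[symmetric] whisker_right
          comp_assoc tens_assoc idt_tens)
    also have "(F \<parallel> \<iota> (b @ b @ a)) \<bullet> (\<iota> a \<parallel> (q\<^sup>\<circ> \<parallel> \<iota> a)) = (\<iota> (a @ b) \<parallel> (q\<^sup>\<circ> \<parallel> \<iota> a)) \<bullet> (F \<parallel> \<iota> a)"
      by (simp add: slide1 slide2)
    also have "(\<iota> a \<parallel> n \<parallel> \<iota> (b @ a)) \<bullet> ((\<iota> (a @ b) \<parallel> (q\<^sup>\<circ> \<parallel> \<iota> a)) \<bullet> (F \<parallel> \<iota> a)) \<bullet> p\<^sup>\<circ>
       = (\<iota> a \<parallel> (((n \<parallel> \<iota> b) \<bullet> (\<iota> b \<parallel> q\<^sup>\<circ>)) \<parallel> \<iota> a)) \<bullet> (F \<parallel> \<iota> a) \<bullet> p\<^sup>\<circ>"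
      by (simp add: whisker_left whisker_right comp_assoc tens_assoc idt_tens idt_tens_tail)
    also have "(n \<parallel> \<iota> b) \<bullet> (\<iota> b \<parallel> q\<^sup>\<circ>) = n\<^sup>\<circ>"
      unfolding pd by (rule bend_cup_right[OF assms(2)])
    also have "(F \<parallel> \<iota> a) \<bullet> p\<^sup>\<circ> = (\<iota> a \<parallel> ((f \<parallel> \<iota> a) \<bullet> m\<^sup>\<circ>)) \<bullet> cup m u"
      unfolding pd by (simp add: F_def whisker_left whisker_right comp_assoc tens_assoc
         frob_colaws(1)[OF assms(1), THEN comp_eq_tail])
    finally show ?thesis
      by (simp add: whisker_left whisker_right comp_assoc tens_assoc)
  qed
  also have "(q \<parallel> \<iota> (b @ a)) \<bullet> (\<iota> b \<parallel> p \<parallel> \<iota> (b @ b @ a)) \<bullet>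
      (\<iota> (b @ a) \<parallel> ((\<iota> a \<parallel> (((n\<^sup>\<circ> \<bullet> f) \<parallel> \<iota> a) \<bullet> m\<^sup>\<circ>)) \<bullet> cup m u)) = (choi n m (f\<^sup>\<circ>))\<^sup>\<circ>"
  proof -
    define Y where "Y = ((n\<^sup>\<circ> \<bullet> f) \<parallel> \<iota> a) \<bullet> m\<^sup>\<circ>"
    have [simp]: "arr Y" "dom Y = a" "cod Y = b @ b @ a" by (simp_all add: Y_def)
    have "(q \<parallel> \<iota> (b @ a)) \<bullet> (\<iota> b \<parallel> p \<parallel> \<iota> (b @ b @ a)) \<bullet> (\<iota> (b @ a) \<parallel> ((\<iota> a \<parallel> Y) \<bullet> cup m u))
      = (q \<parallel> \<iota> (b @ a)) \<bullet> (\<iota> b \<parallel> ((p \<parallel> \<iota> (b @ b @ a)) \<bullet> (\<iota> (a @ a) \<parallel> Y))) \<bullet> (\<iota> (b @ a) \<parallel> cup m u)"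
      by (simp add: whisker_left comp_assoc tens_assoc idt_tens_tail)
    also have "(p \<parallel> \<iota> (b @ b @ a)) \<bullet> (\<iota> (a @ a) \<parallel> Y) = Y \<bullet> (p \<parallel> \<iota> a)"
      using slide2[of p Y a "[]"] by (simp add: slide1)
    also have "(q \<parallel> \<iota> (b @ a)) \<bullet> (\<iota> b \<parallel> (Y \<bullet> (p \<parallel> \<iota> a))) \<bullet> (\<iota> (b @ a) \<parallel> cup m u)
       = (q \<parallel> \<iota> (b @ a)) \<bullet> (\<iota> b \<parallel> Y) \<bullet> (\<iota> b \<parallel> ((p \<parallel> \<iota> a) \<bullet> (\<iota> a \<parallel> cup m u)))"
      by (simp add: whisker_left comp_assoc tens_assoc idt_tens_tail)
    also have "\<dots> = (((q \<parallel> \<iota> b) \<bullet> (\<iota> b \<parallel> n\<^sup>\<circ>)) \<parallel> \<iota> a) \<bullet> (\<iota> b \<parallel> ((f \<parallel> \<iota> a) \<bullet> m\<^sup>\<circ>))"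
      by (simp add: p_def snake_right[OF assms(1)] idt_right Y_def)
        (simp add: whisker_left whisker_right comp_assoc tens_assoc idt_tens idt_right)
    also have "\<dots> = (choi n m (f\<^sup>\<circ>))\<^sup>\<circ>"
      by (simp add: q_def bend_cap_left[OF assms(2)] choi_def dag_comp dag_tens whisker_left comp_assoc tens_assoc)
    finally show ?thesis unfolding Y_def .
  qed
  finally have e: "K\<^sup>\<circ> \<bullet> K = (choi n m (f\<^sup>\<circ>))\<^sup>\<circ>" .
  \<comment> \<open>The bending has produced the adjoint of the wanted Choi morphism; a square is
    self-adjoint.\<close>
  have "choi n m (f\<^sup>\<circ>) = ((choi n m (f\<^sup>\<circ>))\<^sup>\<circ>)\<^sup>\<circ>" by simp
  also have "\<dots> = K\<^sup>\<circ> \<bullet> K" unfolding e[symmetric] by (simp add: dag_comp)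
  finally show ?thesis by (simp only:) (simp add: positive_arr_square)
qed

definition act :: "'x list \<Rightarrow> 'x list \<Rightarrow> 'm \<Rightarrow> 'm \<Rightarrow> 'm" where
  "act d a \<eta> m = (\<iota> d \<parallel> m) \<bullet> (\<eta> \<parallel> \<iota> a)"

text \<open>The object \<open>a\<close> has two duals, the given \<open>d\<close> and, through the
  cup, itself. The arrow \<open>w\<close> is the canonical comparison between them: the Frobenius
  cup followed by the counit of the given duality. It allows \<open>d\<close> to be traded for
  \<open>a\<close> in any diagram that contains the unit.\<close>

lemma frob_dual_transfer:
  assumes "dual_pair d a \<eta>" "frob a m u"
  obtains w where "arr w" "dom w = d" "cod w = a" "(w \<parallel> \<iota> a) \<bullet> \<eta> = cup m u"
    "\<eta>\<^sup>\<circ> = cap m u \<bullet> \<gamma> a a \<bullet> (w \<parallel> \<iota> a)"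
    "(\<iota> d \<parallel> cap m u) \<bullet> (\<eta> \<parallel> w) = \<iota> d"
proof -
  note [simp] = dual_pair_typing[OF assms(1)] frob_typing[OF assms(2)]
  obtain \<epsilon> where [simp]: "arr \<epsilon>" "dom \<epsilon> = a @ d" "cod \<epsilon> = []"
    and sn: "(\<epsilon> \<parallel> \<iota> a) \<bullet> (\<iota> a \<parallel> \<eta>) = \<iota> a" "(\<iota> d \<parallel> \<epsilon>) \<bullet> (\<eta> \<parallel> \<iota> d) = \<iota> d"
    and ee: "\<eta>\<^sup>\<circ> = \<epsilon> \<bullet> \<gamma> d a"
    using dual_pair_counit[OF assms(1)] by metis
  define c where "c = cup m u"
  define p where "p = cap m u"
  have [simp]: "arr c" "dom c = []" "cod c = a @ a" "arr p" "dom p = a @ a" "cod p = []"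
    by (simp_all add: c_def p_def)
  define w where "w = (\<iota> a \<parallel> \<epsilon>) \<bullet> (c \<parallel> \<iota> d)"
  have [simp]: "arr w" "dom w = d" "cod w = a" by (simp_all add: w_def)
  have 1: "(w \<parallel> \<iota> a) \<bullet> \<eta> = c"
  proof -
    have "(w \<parallel> \<iota> a) \<bullet> \<eta> = (\<iota> a \<parallel> \<epsilon> \<parallel> \<iota> a) \<bullet> ((c \<parallel> \<iota> (d @ a)) \<bullet> \<eta>)"
      by (simp add: w_def whisker_right comp_assoc tens_assoc idt_tens)
    also have "(c \<parallel> \<iota> (d @ a)) \<bullet> \<eta> = (\<iota> (a @ a) \<parallel> \<eta>) \<bullet> c"
      using slide1[of c \<eta> _ "[]"] slide2[of c \<eta> "[]"] by simp
    also have "(\<iota> a \<parallel> \<epsilon> \<parallel> \<iota> a) \<bullet> (\<iota> (a @ a) \<parallel> \<eta>) \<bullet> c = (\<iota> a \<parallel> ((\<epsilon> \<parallel> \<iota> a) \<bullet> (\<iota> a \<parallel> \<eta>))) \<bullet> c"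
      by (simp add: whisker_left comp_assoc tens_assoc idt_tens_tail)
    finally show ?thesis by (simp add: sn idt_tens idt_left)
  qed
  have 2: "p \<bullet> (\<iota> a \<parallel> w) = \<epsilon>"
  proof -
    have "p \<bullet> (\<iota> a \<parallel> w) = (p \<bullet> (\<iota> (a @ a) \<parallel> \<epsilon>)) \<bullet> (\<iota> a \<parallel> c \<parallel> \<iota> d)"
      by (simp add: w_def whisker_left comp_assoc idt_tens_tail)
    also have "p \<bullet> (\<iota> (a @ a) \<parallel> \<epsilon>) = \<epsilon> \<bullet> (p \<parallel> \<iota> (a @ d))"
      using slide1[of p \<epsilon> "[]"] slide2[of p \<epsilon> _ "[]"] by simp
    also have "(\<epsilon> \<bullet> (p \<parallel> \<iota> (a @ d))) \<bullet> (\<iota> a \<parallel> c \<parallel> \<iota> d) = \<epsilon> \<bullet> (((p \<parallel> \<iota> a) \<bullet> (\<iota> a \<parallel> c)) \<parallel> \<iota> d)"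
      by (simp add: whisker_right comp_assoc tens_assoc idt_tens)
    also have "(p \<parallel> \<iota> a) \<bullet> (\<iota> a \<parallel> c) = \<iota> a"
      unfolding p_def c_def by (rule snake_right[OF assms(2)])
    finally show ?thesis by (simp add: idt_right idt_tens)
  qed
  have 3: "\<eta>\<^sup>\<circ> = p \<bullet> \<gamma> a a \<bullet> (w \<parallel> \<iota> a)"
    using sym_natural[of w "\<iota> a"] 2[THEN comp_eq_tail] by (simp add: ee)
  have 4: "(\<iota> d \<parallel> p) \<bullet> (\<eta> \<parallel> w) = \<iota> d"
  proof -
    have "(\<iota> d \<parallel> p) \<bullet> (\<eta> \<parallel> w) = (\<iota> d \<parallel> (p \<bullet> (\<iota> a \<parallel> w))) \<bullet> (\<eta> \<parallel> \<iota> d)"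
      using slide2[of \<eta> w] by (simp add: whisker_left comp_assoc idt_tens_tail)
    then show ?thesis by (simp add: 2 sn)
  qed
  show thesis using that[of w] 1 3 4 by (simp add: c_def p_def)
qed

section \<open>The normalisation condition without duals\<close>

lemma trace_act:
  assumes "dual_pair d a \<eta>" "frob a m u"
  shows "\<eta>\<^sup>\<circ> \<bullet> act d a \<eta> m = cap m u \<bullet> \<gamma> a a \<bullet> m\<^sup>\<circ>"
proof -
  note [simp] = dual_pair_typing[OF assms(1)] frob_typing[OF assms(2)]
  obtain w where [simp]: "arr w" "dom w = d" "cod w = a" and w: "(w \<parallel> \<iota> a) \<bullet> \<eta> = cup m u"
    "\<eta>\<^sup>\<circ> = cap m u \<bullet> \<gamma> a a \<bullet> (w \<parallel> \<iota> a)"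
    using frob_dual_transfer[OF assms] by metis
  \<comment> \<open>Carried from \<open>d\<close> to \<open>a\<close> along \<open>w\<close>, the
    action is the multiplication bent by the cup, that is the comultiplication.\<close>
  have "(w \<parallel> \<iota> a) \<bullet> act d a \<eta> m = (\<iota> a \<parallel> m) \<bullet> (((w \<parallel> \<iota> a) \<bullet> \<eta>) \<parallel> \<iota> a)"
    using slide1[of w m] slide2[of w m]
    by (simp add: act_def whisker_right tens_assoc idt_tens flip: comp_assoc)
  also have "\<dots> = m\<^sup>\<circ>" unfolding w by (rule bend_cup_left[OF assms(2)])
  finally show ?thesis by (simp add: w(2) comp_assoc act_def)
qed

text \<open>A Frobenius law followed by associativity pulls the loop through a multiplication, as if
  it were a central map.\<close>

lemma mult_comult_module:
  assumes "frob a m u"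
  shows "(m \<bullet> m\<^sup>\<circ>) \<bullet> m = m \<bullet> ((m \<bullet> m\<^sup>\<circ>) \<parallel> \<iota> a)"
proof -
  note [simp] = frob_typing[OF assms] and l = frob_laws[OF assms]
  have "(m \<bullet> m\<^sup>\<circ>) \<bullet> m = m \<bullet> (\<iota> a \<parallel> m) \<bullet> (m\<^sup>\<circ> \<parallel> \<iota> a)" by (simp add: comp_assoc l(5))
  then show ?thesis by (simp add: l(1)[symmetric, THEN comp_eq_tail] whisker_right comp_assoc)
qed

text \<open>The Frobenius form is nondegenerate: bending its second input back with the cup recovers
  \<open>s\<close>.\<close>

lemma frob_cap_inj:
  assumes "frob a m u" "arr s" "dom s = a" "cod s = a" "cap m u \<bullet> (s \<parallel> \<iota> a) = cap m u"
  shows "s = \<iota> a"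
proof -
  note [simp] = frob_typing[OF assms(1)] assms(2-4)
  have "((cap m u \<bullet> (s \<parallel> \<iota> a)) \<parallel> \<iota> a) \<bullet> (\<iota> a \<parallel> cup m u) =
    (cap m u \<parallel> \<iota> a) \<bullet> ((s \<parallel> \<iota> (a @ a)) \<bullet> (\<iota> a \<parallel> cup m u))"
    by (simp add: whisker_right comp_assoc tens_assoc idt_tens)
  also have "(s \<parallel> \<iota> (a @ a)) \<bullet> (\<iota> a \<parallel> cup m u) = (\<iota> a \<parallel> cup m u) \<bullet> s"
    using slide2[of s "cup m u" "[]" a] by (simp add: slide1)
  also have "(cap m u \<parallel> \<iota> a) \<bullet> (\<iota> a \<parallel> cup m u) \<bullet> s = s"
    by (simp add: snake_right[OF assms(1), THEN comp_eq_tail] idt_left)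
  finally show ?thesis by (simp add: assms(5) snake_right[OF assms(1)])
qed

text \<open>By \<open>trace_act\<close> the condition says that the trace \<open>t\<close>, weighted
  by \<open>z \<bullet> z\<close>, is the counit. Traces are cyclic, so \<open>t \<bullet> m\<close>
  is symmetric; centrality puts the weight on either input, and the cap inherits the symmetry. Once
  the cap is symmetric, \<open>t\<close> simplifies to the counit of the loop, and nondegeneracy
  lifts the resulting equation of counits to one of endomorphisms.\<close>

lemma normaliser_iff:
  assumes "dual_pair d a \<eta>" "frob a m u" and [simp]: "arr z" "dom z = a" "cod z = a"
    and c1: "z \<bullet> m = m \<bullet> (z \<parallel> \<iota> a)" and c2: "z \<bullet> m = m \<bullet> (\<iota> a \<parallel> z)"
  shows "\<eta>\<^sup>\<circ> \<bullet> act d a \<eta> m \<bullet> z \<bullet> z = u\<^sup>\<circ> \<longleftrightarrow>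
    cap m u \<bullet> \<gamma> a a = cap m u \<and> m \<bullet> m\<^sup>\<circ> \<bullet> z \<bullet> z = \<iota> a"
proof -
  note [simp] = dual_pair_typing[OF assms(1)] frob_typing[OF assms(2)]
  note l = frob_laws[OF assms(2)]
  define t where "t = cap m u \<bullet> \<gamma> a a \<bullet> m\<^sup>\<circ>"
  have [simp]: "arr t" "dom t = a" "cod t = []" by (simp_all add: t_def)
  have act [simp]: "arr (act d a \<eta> m)" "dom (act d a \<eta> m) = a" "cod (act d a \<eta> m) = d @ a"
    by (simp_all add: act_def)
  have eq: "\<eta>\<^sup>\<circ> \<bullet> act d a \<eta> m \<bullet> z \<bullet> z = t \<bullet> z \<bullet> z"
    using trace_act[OF assms(1,2), THEN comp_eq_tail] by (simp add: t_def)
  show ?thesis unfolding eq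
  proof
    assume tz: "t \<bullet> z \<bullet> z = u\<^sup>\<circ>"
    have n: "\<gamma> a a \<bullet> (m \<parallel> \<iota> a) = (\<iota> a \<parallel> m) \<bullet> \<gamma> (a @ a) a" "\<gamma> a a \<bullet> (\<iota> a \<parallel> m) = (m \<parallel> \<iota> a) \<bullet> \<gamma> a (a @ a)"
      "\<gamma> a (a @ a) \<bullet> (\<iota> a \<parallel> m\<^sup>\<circ>) = (m\<^sup>\<circ> \<parallel> \<iota> a) \<bullet> \<gamma> a a"
      using sym_natural[of m "\<iota> a"] sym_natural[of "\<iota> a" m] sym_natural[of "\<iota> a" "m\<^sup>\<circ>"] by simp_all
    have rot: "\<gamma> (a @ a) a = \<gamma> a (a @ a) \<bullet> \<gamma> a (a @ a)"
      using sym_rotate(1)[of a] sym_append_left[of a a a] by simp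
    \<comment> \<open>Cyclicity of the trace: a multiplication is carried once around the loop. A
      Frobenius law opens the loop, the inverse rotation is replaced by two rotations, and the other
      Frobenius law closes it again.\<close>
    have "t \<bullet> m = cap m u \<bullet> \<gamma> a a \<bullet> (m \<parallel> \<iota> a) \<bullet> (\<iota> a \<parallel> m\<^sup>\<circ>)"
      by (simp add: t_def comp_assoc l(4))
    also have "\<dots> = u\<^sup>\<circ> \<bullet> (m \<bullet> (\<iota> a \<parallel> m)) \<bullet> \<gamma> (a @ a) a \<bullet> (\<iota> a \<parallel> m\<^sup>\<circ>)"
      by (simp add: n(1)[THEN comp_eq_tail] comp_assoc)
    also have "m \<bullet> (\<iota> a \<parallel> m) = m \<bullet> (m \<parallel> \<iota> a)" by (simp add: l(1))
    also have "\<gamma> (a @ a) a \<bullet> (\<iota> a \<parallel> m\<^sup>\<circ>) = \<gamma> a (a @ a) \<bullet> (m\<^sup>\<circ> \<parallel> \<iota> a) \<bullet> \<gamma> a a"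
      unfolding rot by (simp add: comp_assoc n(3))
    also have "u\<^sup>\<circ> \<bullet> (m \<bullet> (m \<parallel> \<iota> a)) \<bullet> \<gamma> a (a @ a) \<bullet> (m\<^sup>\<circ> \<parallel> \<iota> a) \<bullet> \<gamma> a a
       = cap m u \<bullet> \<gamma> a a \<bullet> (\<iota> a \<parallel> m) \<bullet> (m\<^sup>\<circ> \<parallel> \<iota> a) \<bullet> \<gamma> a a"
      by (simp add: comp_assoc n(2)[THEN comp_eq_tail])
    also have "\<dots> = t \<bullet> m \<bullet> \<gamma> a a"
      by (simp add: t_def comp_assoc l(5)[THEN comp_eq_tail])
    finally have tm: "t \<bullet> m = t \<bullet> m \<bullet> \<gamma> a a" .
    have zz1: "z \<bullet> z \<bullet> m = m \<bullet> ((z \<bullet> z) \<parallel> \<iota> a)"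
      by (simp add: c1 whisker_right comp_assoc c1[THEN comp_eq_tail])
    have zz2: "z \<bullet> z \<bullet> m = m \<bullet> (\<iota> a \<parallel> (z \<bullet> z))"
      by (simp add: c2 whisker_left comp_assoc c2[THEN comp_eq_tail])
    have "cap m u = t \<bullet> z \<bullet> z \<bullet> m" by (simp add: tz[symmetric] comp_assoc)
    then have um: "cap m u = t \<bullet> m \<bullet> (\<iota> a \<parallel> (z \<bullet> z))" and um': "cap m u = t \<bullet> m \<bullet> ((z \<bullet> z) \<parallel> \<iota> a)"
      using zz1 zz2 by simp_all
    have "cap m u \<bullet> \<gamma> a a = t \<bullet> m \<bullet> ((z \<bullet> z) \<parallel> \<iota> a) \<bullet> \<gamma> a a"
      unfolding um' by (simp add: comp_assoc)
    also have "((z \<bullet> z) \<parallel> \<iota> a) \<bullet> \<gamma> a a = \<gamma> a a \<bullet> (\<iota> a \<parallel> (z \<bullet> z))"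
      using sym_natural[of "\<iota> a" "z \<bullet> z"] by simp
    also have "t \<bullet> m \<bullet> \<gamma> a a \<bullet> (\<iota> a \<parallel> (z \<bullet> z)) = (t \<bullet> m) \<bullet> (\<iota> a \<parallel> (z \<bullet> z))"
      by (subst tm) (simp add: comp_assoc)
    also have "\<dots> = cap m u" using um by (simp add: comp_assoc)
    finally have sy: "cap m u \<bullet> \<gamma> a a = cap m u" .
    have "t = u\<^sup>\<circ> \<bullet> m \<bullet> m\<^sup>\<circ>"
      using sy[THEN comp_eq_tail, of "m\<^sup>\<circ>"] by (simp add: t_def comp_assoc)
    then have ut: "u\<^sup>\<circ> = u\<^sup>\<circ> \<bullet> m \<bullet> m\<^sup>\<circ> \<bullet> z \<bullet> z" using tz by (simp add: comp_assoc)
    have "m \<bullet> m\<^sup>\<circ> \<bullet> z \<bullet> z = \<iota> a"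
    proof (rule frob_cap_inj[OF assms(2)])
      have "cap m u \<bullet> ((m \<bullet> m\<^sup>\<circ> \<bullet> z \<bullet> z) \<parallel> \<iota> a) = u\<^sup>\<circ> \<bullet> (m \<bullet> ((m \<bullet> m\<^sup>\<circ>) \<parallel> \<iota> a)) \<bullet> ((z \<bullet> z) \<parallel> \<iota> a)"
        by (simp add: whisker_right comp_assoc)
      also have "\<dots> = u\<^sup>\<circ> \<bullet> m \<bullet> m\<^sup>\<circ> \<bullet> z \<bullet> z \<bullet> m"
        unfolding mult_comult_module[OF assms(2), symmetric] zz1 by (simp add: comp_assoc)
      also have "\<dots> = (u\<^sup>\<circ> \<bullet> m \<bullet> m\<^sup>\<circ> \<bullet> z \<bullet> z) \<bullet> m" by (simp add: comp_assoc)
      also have "\<dots> = cap m u" unfolding ut[symmetric] ..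
      finally show "cap m u \<bullet> ((m \<bullet> m\<^sup>\<circ> \<bullet> z \<bullet> z) \<parallel> \<iota> a) = cap m u" .
    qed simp_all
    with sy show "cap m u \<bullet> \<gamma> a a = cap m u \<and> m \<bullet> m\<^sup>\<circ> \<bullet> z \<bullet> z = \<iota> a" by simp
  next
    assume a: "cap m u \<bullet> \<gamma> a a = cap m u \<and> m \<bullet> m\<^sup>\<circ> \<bullet> z \<bullet> z = \<iota> a"
    have "t \<bullet> z \<bullet> z = (cap m u \<bullet> \<gamma> a a) \<bullet> m\<^sup>\<circ> \<bullet> z \<bullet> z" by (simp add: t_def comp_assoc)
    also have "\<dots> = u\<^sup>\<circ> \<bullet> m \<bullet> m\<^sup>\<circ> \<bullet> z \<bullet> z" using a by (simp add: comp_assoc)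
    finally show "t \<bullet> z \<bullet> z = u\<^sup>\<circ>" using a by (simp add: idt_right)
  qed
qed

text \<open>On the left the unit of \<open>x\<close> is nested inside that of \<open>b\<close>; the
  crossing turns the nest inside out, as \<open>cap_pair_sym\<close> does for caps. It is needed
  because the conjugate of \<open>g\<close> is described by units with the dual word on the left,
  while bending it into Choi form requires that word on the right.\<close>

lemma nested_unit_swap:
  assumes "dual_pair db b \<eta>b" "dual_pair dx x \<eta>x"
  shows "\<gamma> (db @ dx) (x @ b) \<bullet> (\<iota> db \<parallel> \<eta>x \<parallel> \<iota> b) \<bullet> \<eta>b
     = (\<iota> x \<parallel> (\<gamma> db b \<bullet> \<eta>b) \<parallel> \<iota> dx) \<bullet> \<gamma> dx x \<bullet> \<eta>x"
proof -
  note [simp] = dual_pair_typing[OF assms(1)] dual_pair_typing[OF assms(2)]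
  define e where "e = \<gamma> dx x \<bullet> \<eta>x"
  have [simp]: "arr e" "dom e = []" "cod e = x @ dx" by (simp_all add: e_def)
  have n: "(\<gamma> db x \<parallel> \<iota> dx) \<bullet> (\<iota> db \<parallel> e) = (\<iota> x \<parallel> \<gamma> dx db) \<bullet> (e \<parallel> \<iota> db)"
  proof -
    have "(\<iota> x \<parallel> \<gamma> db dx) \<bullet> (\<gamma> db x \<parallel> \<iota> dx) \<bullet> (\<iota> db \<parallel> e) = e \<parallel> \<iota> db"
      using sym_natural[of "\<iota> db" e] by (simp add: sym_append comp_assoc idt_right)
    from arg_cong[OF this, of "\<lambda>y. (\<iota> x \<parallel> \<gamma> dx db) \<bullet> y"] show ?thesis
      by (simp add: tens_comp_tail sym_sym idt_left idt_tens)
  qed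
  have "\<gamma> (db @ dx) (x @ b) \<bullet> (\<iota> db \<parallel> \<eta>x \<parallel> \<iota> b) \<bullet> \<eta>b
     = (\<iota> x \<parallel> \<gamma> (db @ dx) b) \<bullet> (((\<gamma> db x \<parallel> \<iota> dx) \<bullet> (\<iota> db \<parallel> e)) \<parallel> \<iota> b) \<bullet> \<eta>b"
    unfolding sym_append[of "db @ dx" x b, simplified]
    by (simp add: sym_append_left[of db dx x] e_def whisker_left whisker_right comp_assoc tens_assoc
      idt_tens)
  also have "\<dots> = (\<iota> x \<parallel> ((\<gamma> db b \<parallel> \<iota> dx) \<bullet> \<gamma> dx (db @ b))) \<bullet> (e \<parallel> \<eta>b)"
    unfolding n using slide1[of e \<eta>b "db @ b" "[]"]
    by (simp add: sym_append_left sym_append whisker_left whisker_right comp_assoc tens_assoc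
      idt_tens)
  also have "e \<parallel> \<eta>b = (\<iota> x \<parallel> \<iota> dx \<parallel> \<eta>b) \<bullet> e"
    using slide2[of e \<eta>b "[]"] by (simp add: idt_tens_tail)
  also have "(\<iota> x \<parallel> ((\<gamma> db b \<parallel> \<iota> dx) \<bullet> \<gamma> dx (db @ b))) \<bullet> (\<iota> x \<parallel> \<iota> dx \<parallel> \<eta>b) \<bullet> e
    = (\<iota> x \<parallel> (\<gamma> db b \<parallel> \<iota> dx)) \<bullet> (\<iota> x \<parallel> (\<gamma> dx (db @ b) \<bullet> (\<iota> dx \<parallel> \<eta>b))) \<bullet> e"
    by (simp add: whisker_left comp_assoc)
  also have "\<gamma> dx (db @ b) \<bullet> (\<iota> dx \<parallel> \<eta>b) = \<eta>b \<parallel> \<iota> dx"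
    using sym_natural[of "\<iota> dx" \<eta>b] by (simp add: idt_right)
  also have "(\<iota> x \<parallel> (\<gamma> db b \<parallel> \<iota> dx)) \<bullet> (\<iota> x \<parallel> (\<eta>b \<parallel> \<iota> dx)) \<bullet> e
     = (\<iota> x \<parallel> (\<gamma> db b \<bullet> \<eta>b) \<parallel> \<iota> dx) \<bullet> e"
    by (simp add: whisker_left whisker_right comp_assoc)
  finally show ?thesis by (simp add: e_def)
qed

text \<open>The equation for \<open>gs\<close> characterises the conjugate of \<open>g\<close>. Both sides of the equivalence are
  related by the invertible bending operation \<open>\<Psi>\<close>, which maps the left-hand morphisms to the
  right-hand ones.\<close>

lemma cp_iff_square:
  assumes A: "dual_pair da a \<eta>a" "frob a ma ua" and B: "dual_pair db b \<eta>b" "frob b mb ub"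
    and X: "dual_pair dx x \<eta>x" and symb: "cap mb ub \<bullet> \<gamma> b b = cap mb ub"
    and [simp]: "arr f" "dom f = a" "cod f = b" "arr g" "dom g = a" "cod g = x @ b"
    and gs: "arr gs" "dom gs = da" "cod gs = db @ dx"
      "(gs \<parallel> \<iota> a) \<bullet> \<eta>a = (\<iota> (db @ dx) \<parallel> g\<^sup>\<circ>) \<bullet> (\<iota> db \<parallel> \<eta>x \<parallel> \<iota> b) \<bullet> \<eta>b"
  defines "h \<equiv> (\<iota> x \<parallel> cap mb ub) \<bullet> (g \<parallel> \<iota> b)"
  shows "act db b \<eta>b mb \<bullet> f \<bullet> (act da a \<eta>a ma)\<^sup>\<circ> = (\<iota> db \<parallel> \<eta>x\<^sup>\<circ> \<parallel> \<iota> b) \<bullet> (gs \<parallel> g)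
     \<longleftrightarrow> choi ma mb f = h\<^sup>\<circ> \<bullet> h"
proof -
  note [simp] = dual_pair_typing[OF A(1)] frob_typing[OF A(2)] dual_pair_typing[OF B(1)]
    frob_typing[OF B(2)] dual_pair_typing[OF X] gs(1-3)
  obtain \<epsilon>a where [simp]: "arr \<epsilon>a" "dom \<epsilon>a = a @ da" "cod \<epsilon>a = []"
    and ea: "(\<iota> a \<parallel> \<eta>a\<^sup>\<circ>) \<bullet> (\<epsilon>a\<^sup>\<circ> \<parallel> \<iota> a) = \<iota> a" "(\<eta>a\<^sup>\<circ> \<parallel> \<iota> da) \<bullet> (\<iota> da \<parallel> \<epsilon>a\<^sup>\<circ>) = \<iota> da"
      "\<epsilon>a\<^sup>\<circ> = \<gamma> da a \<bullet> \<eta>a"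
    using dual_pair_counit[OF A(1)] by metis
  obtain \<epsilon>x where [simp]: "arr \<epsilon>x" "dom \<epsilon>x = x @ dx" "cod \<epsilon>x = []"
    and ex: "(\<iota> x \<parallel> \<eta>x\<^sup>\<circ>) \<bullet> (\<epsilon>x\<^sup>\<circ> \<parallel> \<iota> x) = \<iota> x" "\<epsilon>x\<^sup>\<circ> = \<gamma> dx x \<bullet> \<eta>x"
    using dual_pair_counit[OF X] by metis
  obtain w where [simp]: "arr w" "dom w = db" "cod w = b"
    and w: "(w \<parallel> \<iota> b) \<bullet> \<eta>b = cup mb ub" "(\<iota> db \<parallel> cap mb ub) \<bullet> (\<eta>b \<parallel> w) = \<iota> db"
    using frob_dual_transfer[OF B] by metis
  define p where "p = cap mb ub"
  define c where "c = cup mb ub"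
  have [simp]: "arr p" "dom p = b @ b" "cod p = []" "arr c" "dom c = []" "cod c = b @ b" "p\<^sup>\<circ> = c"
    by (simp_all add: p_def c_def dag_comp)
  have pc: "(p \<parallel> \<iota> b) \<bullet> (\<iota> b \<parallel> c) = \<iota> b" "(\<iota> b \<parallel> p) \<bullet> (c \<parallel> \<iota> b) = \<iota> b"
    unfolding p_def c_def by (rule snake_right[OF B(2)] snake_left[OF B(2)])+
  have "p \<bullet> \<gamma> b b = p" using symb by (simp add: p_def)
  from arg_cong[OF this, of dag] have csym: "\<gamma> b b \<bullet> c = c" by (simp add: dag_comp)
  \<comment> \<open>\<open>Y\<close> carries the output \<open>db\<close> to \<open>b\<close> along
    \<open>w\<close> and bends the other output \<open>b\<close> down to an input;
    \<open>\<Psi>\<close> then bends the input \<open>da\<close> up to an output \<open>a\<close>.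
    Each move can be undone by a snake equation, which is how \<open>inj\<close> is proved.\<close>
  define Y where "Y k = (w \<parallel> p) \<bullet> (k \<parallel> \<iota> b)" for k
  define \<Psi> where "\<Psi> k = (\<iota> a \<parallel> Y k) \<bullet> (\<epsilon>a\<^sup>\<circ> \<parallel> \<iota> (a @ b))" for k
  have Yt: "arr (Y k)" "dom (Y k) = da @ a @ b" "cod (Y k) = b"
    if "arr k" "dom k = da @ a" "cod k = db @ b" for k
    using that by (simp_all add: Y_def)
  define k1 where "k1 = act db b \<eta>b mb \<bullet> f \<bullet> (act da a \<eta>a ma)\<^sup>\<circ>"
  define k2 where "k2 = (\<iota> db \<parallel> \<eta>x\<^sup>\<circ> \<parallel> \<iota> b) \<bullet> (gs \<parallel> g)"
  have [simp]: "arr (act db b \<eta>b mb)" "dom (act db b \<eta>b mb) = b" "cod (act db b \<eta>b mb) = db @ b"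
    "arr (act da a \<eta>a ma)" "dom (act da a \<eta>a ma) = a" "cod (act da a \<eta>a ma) = da @ a"
    by (simp_all add: act_def)
  have k1t: "arr k1" "dom k1 = da @ a" "cod k1 = db @ b" by (simp_all add: k1_def)
  have k2t: "arr k2" "dom k2 = da @ a" "cod k2 = db @ b" by (simp_all add: k2_def)
  have inj: "k = k'" if k [simp]: "arr k" "dom k = da @ a" "cod k = db @ b"
    and k' [simp]: "arr k'" "dom k' = da @ a" "cod k' = db @ b" and eq: "\<Psi> k = \<Psi> k'" for k k'
  proof -
    have rY: "(\<eta>a\<^sup>\<circ> \<parallel> \<iota> b) \<bullet> (\<iota> da \<parallel> \<Psi> l) = Y l" if [simp]: "arr l" "dom l = da @ a" "cod l = db @ b" for l
    proof -
      note [simp] = Yt[OF that]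
      have "(\<eta>a\<^sup>\<circ> \<parallel> \<iota> b) \<bullet> (\<iota> da \<parallel> \<Psi> l) = ((\<eta>a\<^sup>\<circ> \<parallel> \<iota> b) \<bullet> (\<iota> (da @ a) \<parallel> Y l)) \<bullet> (\<iota> da \<parallel> \<epsilon>a\<^sup>\<circ> \<parallel> \<iota> (a @ b))"
        by (simp add: \<Psi>_def whisker_left comp_assoc idt_tens_tail)
      also have "(\<eta>a\<^sup>\<circ> \<parallel> \<iota> b) \<bullet> (\<iota> (da @ a) \<parallel> Y l) = Y l \<bullet> (\<eta>a\<^sup>\<circ> \<parallel> \<iota> (da @ a @ b))"
        using slide2[of "\<eta>a\<^sup>\<circ>" "Y l" _ "[]"] by (simp add: slide1)
      also have "(Y l \<bullet> (\<eta>a\<^sup>\<circ> \<parallel> \<iota> (da @ a @ b))) \<bullet> (\<iota> da \<parallel> \<epsilon>a\<^sup>\<circ> \<parallel> \<iota> (a @ b))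
         = Y l \<bullet> (((\<eta>a\<^sup>\<circ> \<parallel> \<iota> da) \<bullet> (\<iota> da \<parallel> \<epsilon>a\<^sup>\<circ>)) \<parallel> \<iota> (a @ b))"
        by (simp add: whisker_right comp_assoc tens_assoc idt_tens)
      finally show ?thesis by (simp add: ea(2) idt_tens idt_right)
    qed
    have rk: "(\<iota> db \<parallel> p \<parallel> \<iota> b) \<bullet> (\<eta>b \<parallel> \<iota> (b @ b)) \<bullet> (Y l \<parallel> \<iota> b) \<bullet> (\<iota> (da @ a) \<parallel> c) = l"
      if [simp]: "arr l" "dom l = da @ a" "cod l = db @ b" for l
    proof -
      have "(Y l \<parallel> \<iota> b) \<bullet> (\<iota> (da @ a) \<parallel> c) = (w \<parallel> p \<parallel> \<iota> b) \<bullet> ((l \<parallel> \<iota> (b @ b)) \<bullet> (\<iota> (da @ a) \<parallel> c))"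
        by (simp add: Y_def whisker_right comp_assoc tens_assoc idt_tens)
      also have "(l \<parallel> \<iota> (b @ b)) \<bullet> (\<iota> (da @ a) \<parallel> c) = (\<iota> db \<parallel> \<iota> b \<parallel> c) \<bullet> l"
        using slide2[of l c "[]"] by (simp add: slide1 idt_tens_tail)
      also have "(w \<parallel> p \<parallel> \<iota> b) \<bullet> (\<iota> db \<parallel> \<iota> b \<parallel> c) \<bullet> l = (w \<parallel> \<iota> b) \<bullet> l"
        by (simp add: tens_comp_tail idt_right pc)
      finally have "(\<iota> db \<parallel> p \<parallel> \<iota> b) \<bullet> (\<eta>b \<parallel> \<iota> (b @ b)) \<bullet> (Y l \<parallel> \<iota> b) \<bullet> (\<iota> (da @ a) \<parallel> c)
        = (((\<iota> db \<parallel> p) \<bullet> ((\<eta>b \<parallel> \<iota> b) \<bullet> w)) \<parallel> \<iota> b) \<bullet> l"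
        by (simp add: whisker_right comp_assoc tens_assoc idt_tens)
      also have "(\<eta>b \<parallel> \<iota> b) \<bullet> w = \<eta>b \<parallel> w"
        using slide1[of \<eta>b w _ "[]"] by simp
      finally show ?thesis by (simp add: w p_def idt_tens idt_left)
    qed
    have "Y k = Y k'" by (metis rY[OF k] rY[OF k'] eq)
    then show ?thesis by (metis rk[OF k] rk[OF k'])
  qed
  have P1: "\<Psi> k1 = choi ma mb f"
  proof -
    have a1: "(\<iota> a \<parallel> (act da a \<eta>a ma)\<^sup>\<circ>) \<bullet> (\<epsilon>a\<^sup>\<circ> \<parallel> \<iota> a) = ma\<^sup>\<circ>"
    proof -
      have "(\<iota> a \<parallel> (act da a \<eta>a ma)\<^sup>\<circ>) \<bullet> (\<epsilon>a\<^sup>\<circ> \<parallel> \<iota> a) =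
        (\<iota> a \<parallel> \<eta>a\<^sup>\<circ> \<parallel> \<iota> a) \<bullet> ((\<iota> (a @ da) \<parallel> ma\<^sup>\<circ>) \<bullet> (\<epsilon>a\<^sup>\<circ> \<parallel> \<iota> a))"
        by (simp add: act_def dag_comp dag_tens whisker_left comp_assoc idt_tens_tail)
      also have "(\<iota> (a @ da) \<parallel> ma\<^sup>\<circ>) \<bullet> (\<epsilon>a\<^sup>\<circ> \<parallel> \<iota> a) = (\<epsilon>a\<^sup>\<circ> \<parallel> \<iota> (a @ a)) \<bullet> ma\<^sup>\<circ>"
        using slide1[of "\<epsilon>a\<^sup>\<circ>" "ma\<^sup>\<circ>" _ "[]"] by (simp add: slide2)
      also have "(\<iota> a \<parallel> \<eta>a\<^sup>\<circ> \<parallel> \<iota> a) \<bullet> (\<epsilon>a\<^sup>\<circ> \<parallel> \<iota> (a @ a)) \<bullet> ma\<^sup>\<circ> = (((\<iota> a \<parallel> \<eta>a\<^sup>\<circ>) \<bullet> (\<epsilon>a\<^sup>\<circ> \<parallel> \<iota> a)) \<parallel> \<iota> a) \<bullet> ma\<^sup>\<circ>"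
        by (simp add: whisker_right comp_assoc tens_assoc idt_tens)
      finally show ?thesis by (simp add: ea(1) idt_tens idt_left)
    qed
    have a2: "(w \<parallel> p) \<bullet> (act db b \<eta>b mb \<parallel> \<iota> b) = mb"
    proof -
      have "(w \<parallel> p) \<bullet> (act db b \<eta>b mb \<parallel> \<iota> b) = (w \<parallel> (p \<bullet> (mb \<parallel> \<iota> b))) \<bullet> (\<eta>b \<parallel> \<iota> (b @ b))"
        using tens_comp_tail[of "\<iota> db" w "mb \<parallel> \<iota> b" p "\<eta>b \<parallel> \<iota> (b @ b)"]
        by (simp add: act_def whisker_right comp_assoc tens_assoc idt_tens idt_right)
      also have "p \<bullet> (mb \<parallel> \<iota> b) = p \<bullet> (\<iota> b \<parallel> mb)"
        by (simp add: p_def comp_assoc frob_laws(1)[OF B(2)])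
      also have "w \<parallel> (p \<bullet> (\<iota> b \<parallel> mb)) = (\<iota> b \<parallel> (p \<bullet> (\<iota> b \<parallel> mb))) \<bullet> (w \<parallel> \<iota> (b @ b @ b))"
        by (simp add: slide2)
      also have "((\<iota> b \<parallel> (p \<bullet> (\<iota> b \<parallel> mb))) \<bullet> (w \<parallel> \<iota> (b @ b @ b))) \<bullet> (\<eta>b \<parallel> \<iota> (b @ b))
         = (\<iota> b \<parallel> p) \<bullet> (\<iota> (b @ b) \<parallel> mb) \<bullet> (((w \<parallel> \<iota> b) \<bullet> \<eta>b) \<parallel> \<iota> (b @ b))"
        by (simp add: whisker_left whisker_right comp_assoc tens_assoc idt_tens idt_tens_tail)
      also have "(\<iota> (b @ b) \<parallel> mb) \<bullet> (((w \<parallel> \<iota> b) \<bullet> \<eta>b) \<parallel> \<iota> (b @ b)) = (c \<parallel> \<iota> b) \<bullet> mb"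
        unfolding w c_def[symmetric] using slide1[of c mb b "[]"] by (simp add: slide2)
      finally show ?thesis by (simp add: pc[THEN comp_eq_tail] idt_left)
    qed
    have "\<Psi> k1 = (\<iota> a \<parallel> ((w \<parallel> p) \<bullet> (act db b \<eta>b mb \<parallel> \<iota> b))) \<bullet> (\<iota> a \<parallel> f \<parallel> \<iota> b) \<bullet>
        (((\<iota> a \<parallel> (act da a \<eta>a ma)\<^sup>\<circ>) \<bullet> (\<epsilon>a\<^sup>\<circ> \<parallel> \<iota> a)) \<parallel> \<iota> b)"
      by (simp add: \<Psi>_def Y_def k1_def whisker_left whisker_right comp_assoc tens_assoc idt_tens)
    then show ?thesis unfolding a1 a2 by (simp add: choi_def)
  qed
  have P2: "\<Psi> k2 = h\<^sup>\<circ> \<bullet> h"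
  proof -
    define eb where "eb = \<gamma> db b \<bullet> \<eta>b"
    have [simp]: "arr eb" "dom eb = []" "cod eb = b @ db" by (simp_all add: eb_def)
    \<comment> \<open>The unit of \<open>b\<close> arrives here with its wires crossed. After
      transport along \<open>w\<close> it is the Frobenius cup, and symmetry of the algebra on
      \<open>b\<close> absorbs the crossing.\<close>
    have ew: "(\<iota> b \<parallel> w) \<bullet> eb = c"
    proof -
      have "(\<iota> b \<parallel> w) \<bullet> eb = \<gamma> b b \<bullet> (w \<parallel> \<iota> b) \<bullet> \<eta>b"
        using sym_natural[of w "\<iota> b", symmetric, THEN comp_eq_tail] by (simp add: eb_def comp_assoc)
      then show ?thesis by (simp add: w c_def[symmetric] csym)
    qed
    have b1: "(\<iota> a \<parallel> gs) \<bullet> \<epsilon>a\<^sup>\<circ> = (g\<^sup>\<circ> \<parallel> \<iota> (db @ dx)) \<bullet> (\<iota> x \<parallel> eb \<parallel> \<iota> dx) \<bullet> \<epsilon>x\<^sup>\<circ>"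
    proof -
      have "(\<iota> a \<parallel> gs) \<bullet> \<epsilon>a\<^sup>\<circ> = \<gamma> (db @ dx) a \<bullet> (gs \<parallel> \<iota> a) \<bullet> \<eta>a"
        using sym_natural[of gs "\<iota> a", symmetric, THEN comp_eq_tail] by (simp add: ea(3) comp_assoc)
      also have "\<dots> = (g\<^sup>\<circ> \<parallel> \<iota> (db @ dx)) \<bullet> \<gamma> (db @ dx) (x @ b) \<bullet> (\<iota> db \<parallel> \<eta>x \<parallel> \<iota> b) \<bullet> \<eta>b"
        using sym_natural[of "\<iota> (db @ dx)" "g\<^sup>\<circ>", THEN comp_eq_tail] by (simp add: gs(4) comp_assoc)
      finally show ?thesis by (simp add: nested_unit_swap[OF B(1) X] eb_def ex(2))
    qed
    \<comment> \<open>The ancilla wire is bent once in the conjugate and once by the contraction;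
      the two bends straighten and join the \<open>x\<close> output of \<open>g\<close> to the
      \<open>x\<close> input of its adjoint.\<close>
    have b2: "(\<iota> a \<parallel> k2) \<bullet> (\<epsilon>a\<^sup>\<circ> \<parallel> \<iota> a) = (g\<^sup>\<circ> \<parallel> \<iota> (db @ b)) \<bullet> (\<iota> x \<parallel> eb \<parallel> \<iota> b) \<bullet> g"
    proof -
      have "(\<iota> a \<parallel> k2) \<bullet> (\<epsilon>a\<^sup>\<circ> \<parallel> \<iota> a) = (\<iota> (a @ db) \<parallel> \<eta>x\<^sup>\<circ> \<parallel> \<iota> b) \<bullet> (((\<iota> a \<parallel> gs) \<bullet> \<epsilon>a\<^sup>\<circ>) \<parallel> g)"
        using tens_comp[of "\<epsilon>a\<^sup>\<circ>" "\<iota> a \<parallel> gs" "\<iota> a" g]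
        by (simp add: k2_def whisker_left comp_assoc idt_tens_tail tens_assoc idt_right)
      also have "((\<iota> a \<parallel> gs) \<bullet> \<epsilon>a\<^sup>\<circ>) \<parallel> g = (((\<iota> a \<parallel> gs) \<bullet> \<epsilon>a\<^sup>\<circ>) \<parallel> \<iota> (x @ b)) \<bullet> g"
        using slide1[of "(\<iota> a \<parallel> gs) \<bullet> \<epsilon>a\<^sup>\<circ>" g _ "[]"] by simp
      also have "(\<iota> (a @ db) \<parallel> \<eta>x\<^sup>\<circ> \<parallel> \<iota> b) \<bullet> (((\<iota> a \<parallel> gs) \<bullet> \<epsilon>a\<^sup>\<circ>) \<parallel> \<iota> (x @ b)) \<bullet> g
        = ((\<iota> (a @ db) \<parallel> (\<eta>x\<^sup>\<circ> \<parallel> \<iota> b)) \<bullet> ((g\<^sup>\<circ> \<parallel> \<iota> db) \<parallel> \<iota> (dx @ x @ b))) \<bullet>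
          (\<iota> x \<parallel> eb \<parallel> \<iota> (dx @ x @ b)) \<bullet> (\<epsilon>x\<^sup>\<circ> \<parallel> \<iota> (x @ b)) \<bullet> g"
        unfolding b1 by (simp add: whisker_right comp_assoc tens_assoc idt_tens)
      also have "(\<iota> (a @ db) \<parallel> (\<eta>x\<^sup>\<circ> \<parallel> \<iota> b)) \<bullet> ((g\<^sup>\<circ> \<parallel> \<iota> db) \<parallel> \<iota> (dx @ x @ b))
        = (g\<^sup>\<circ> \<parallel> \<iota> (db @ b)) \<bullet> (\<iota> (x @ b @ db) \<parallel> \<eta>x\<^sup>\<circ> \<parallel> \<iota> b)"
      proof -
        have "(\<iota> (a @ db) \<parallel> (\<eta>x\<^sup>\<circ> \<parallel> \<iota> b)) \<bullet> ((g\<^sup>\<circ> \<parallel> \<iota> db) \<parallel> \<iota> (dx @ x @ b)) = (g\<^sup>\<circ> \<parallel> \<iota> db) \<parallel> \<eta>x\<^sup>\<circ> \<parallel> \<iota> b"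
          by (rule slide2) simp_all
        also have "\<dots> = ((g\<^sup>\<circ> \<parallel> \<iota> db) \<parallel> \<iota> b) \<bullet> (\<iota> (x @ b @ db) \<parallel> \<eta>x\<^sup>\<circ> \<parallel> \<iota> b)"
          by (rule slide1[symmetric]) simp_all
        finally show ?thesis by (simp add: tens_assoc idt_tens)
      qed
      also have "((g\<^sup>\<circ> \<parallel> \<iota> (db @ b)) \<bullet> (\<iota> (x @ b @ db) \<parallel> \<eta>x\<^sup>\<circ> \<parallel> \<iota> b)) \<bullet>
          (\<iota> x \<parallel> eb \<parallel> \<iota> (dx @ x @ b)) \<bullet> (\<epsilon>x\<^sup>\<circ> \<parallel> \<iota> (x @ b)) \<bullet> g
        = (g\<^sup>\<circ> \<parallel> \<iota> (db @ b)) \<bullet> (\<iota> x \<parallel> ((\<iota> (b @ db) \<parallel> (\<eta>x\<^sup>\<circ> \<parallel> \<iota> b)) \<bullet> (eb \<parallel> \<iota> (dx @ x @ b)))) \<bullet>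
           (\<epsilon>x\<^sup>\<circ> \<parallel> \<iota> (x @ b)) \<bullet> g"
        by (simp add: whisker_left comp_assoc idt_tens_tail)
      also have "(\<iota> (b @ db) \<parallel> (\<eta>x\<^sup>\<circ> \<parallel> \<iota> b)) \<bullet> (eb \<parallel> \<iota> (dx @ x @ b)) = (eb \<parallel> \<iota> b) \<bullet> (\<eta>x\<^sup>\<circ> \<parallel> \<iota> b)"
        using slide1[of eb "\<eta>x\<^sup>\<circ> \<parallel> \<iota> b" b "[]"] slide2[of eb "\<eta>x\<^sup>\<circ> \<parallel> \<iota> b"] by simp
      also have "(\<iota> x \<parallel> ((eb \<parallel> \<iota> b) \<bullet> (\<eta>x\<^sup>\<circ> \<parallel> \<iota> b))) \<bullet> (\<epsilon>x\<^sup>\<circ> \<parallel> \<iota> (x @ b)) \<bullet> g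
         = (\<iota> x \<parallel> eb \<parallel> \<iota> b) \<bullet> (((\<iota> x \<parallel> \<eta>x\<^sup>\<circ>) \<bullet> (\<epsilon>x\<^sup>\<circ> \<parallel> \<iota> x)) \<parallel> \<iota> b) \<bullet> g"
        by (simp add: whisker_left whisker_right comp_assoc tens_assoc idt_tens)
      finally show ?thesis by (simp add: ex(1) idt_tens idt_left)
    qed
    have "\<Psi> k2 = (\<iota> a \<parallel> w \<parallel> p) \<bullet> (((\<iota> a \<parallel> k2) \<bullet> (\<epsilon>a\<^sup>\<circ> \<parallel> \<iota> a)) \<parallel> \<iota> b)"
      using k2t by (simp add: \<Psi>_def Y_def whisker_left whisker_right comp_assoc tens_assoc idt_tens)
    also have "\<dots> = ((\<iota> a \<parallel> w \<parallel> p) \<bullet> (g\<^sup>\<circ> \<parallel> \<iota> (db @ b @ b))) \<bullet> (\<iota> x \<parallel> eb \<parallel> \<iota> (b @ b)) \<bullet> (g \<parallel> \<iota> b)"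
      unfolding b2 by (simp add: whisker_right comp_assoc tens_assoc idt_tens)
    also have "(\<iota> a \<parallel> w \<parallel> p) \<bullet> (g\<^sup>\<circ> \<parallel> \<iota> (db @ b @ b)) = (g\<^sup>\<circ> \<parallel> \<iota> b) \<bullet> (\<iota> (x @ b) \<parallel> w \<parallel> p)"
      using slide1[of "g\<^sup>\<circ>" "w \<parallel> p"] slide2[of "g\<^sup>\<circ>" "w \<parallel> p"] by simp
    also have "((g\<^sup>\<circ> \<parallel> \<iota> b) \<bullet> (\<iota> (x @ b) \<parallel> w \<parallel> p)) \<bullet> (\<iota> x \<parallel> eb \<parallel> \<iota> (b @ b)) \<bullet> (g \<parallel> \<iota> b)
      = (g\<^sup>\<circ> \<parallel> \<iota> b) \<bullet> (\<iota> x \<parallel> (((\<iota> b \<parallel> w) \<parallel> p) \<bullet> (eb \<parallel> \<iota> (b @ b)))) \<bullet> (g \<parallel> \<iota> b)"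
      by (simp add: whisker_left comp_assoc tens_assoc idt_tens_tail)
    also have "((\<iota> b \<parallel> w) \<parallel> p) \<bullet> (eb \<parallel> \<iota> (b @ b)) = c \<bullet> p"
      using slide1[of c p "[]" "[]"] tens_comp[of eb "\<iota> b \<parallel> w" "\<iota> (b @ b)" p]
      by (simp add: ew idt_right)
    also have "(g\<^sup>\<circ> \<parallel> \<iota> b) \<bullet> (\<iota> x \<parallel> (c \<bullet> p)) \<bullet> (g \<parallel> \<iota> b) = h\<^sup>\<circ> \<bullet> h"
      by (simp add: h_def p_def[symmetric] whisker_left comp_assoc dag_comp dag_tens)
    finally show ?thesis .
  qed
  show ?thesis using inj[OF k1t k2t] P1 P2 by (auto simp flip: k1_def k2_def)
qed

text \<open>\<open>CJ\<close> is a conjugate computed with the dual \<open>d\<close> of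
  \<open>y\<close>, and \<open>DT\<close> compares \<open>d\<close> with another word
  \<open>e\<close> that is paired with \<open>y\<close> by \<open>N\<close>. Each slides across a
  unit by one snake equation, and \<open>d\<close> disappears. With \<open>N\<close> the nested unit
  this is the equation that \<open>cp_iff_square\<close> demands of \<open>gs\<close>.\<close>

lemma transpose_slide:
  assumes Y: "dual_pair d y \<eta>y" and A: "dual_pair da a \<eta>a"
    and [simp]: "obj e" "arr N" "dom N = []" "cod N = e @ y" "arr G" "dom G = a" "cod G = y"
  defines "DT \<equiv> (\<iota> e \<parallel> (\<eta>y\<^sup>\<circ> \<bullet> \<gamma> y d)) \<bullet> (N \<parallel> \<iota> d)"
    and "CJ \<equiv> (\<iota> d \<parallel> (\<eta>a\<^sup>\<circ> \<bullet> \<gamma> a da)) \<bullet> (\<iota> d \<parallel> G\<^sup>\<circ> \<parallel> \<iota> da) \<bullet> (\<eta>y \<parallel> \<iota> da)"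
  shows "((DT \<bullet> CJ) \<parallel> \<iota> a) \<bullet> \<eta>a = (\<iota> e \<parallel> G\<^sup>\<circ>) \<bullet> N"
proof -
  note [simp] = dual_pair_typing[OF A] dual_pair_typing[OF Y]
  obtain \<epsilon>a where ea: "\<epsilon>a = \<eta>a\<^sup>\<circ> \<bullet> \<gamma> a da" and [simp]: "arr \<epsilon>a" "dom \<epsilon>a = a @ da" "cod \<epsilon>a = []"
    and sa: "(\<epsilon>a \<parallel> \<iota> a) \<bullet> (\<iota> a \<parallel> \<eta>a) = \<iota> a"
    using dual_pair_counit[OF A] by metis
  obtain \<epsilon>y where ey: "\<epsilon>y = \<eta>y\<^sup>\<circ> \<bullet> \<gamma> y d" and [simp]: "arr \<epsilon>y" "dom \<epsilon>y = y @ d" "cod \<epsilon>y = []"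
    and sy: "(\<epsilon>y \<parallel> \<iota> y) \<bullet> (\<iota> y \<parallel> \<eta>y) = \<iota> y"
    using dual_pair_counit[OF Y] by metis
  have DT: "DT = (\<iota> e \<parallel> \<epsilon>y) \<bullet> (N \<parallel> \<iota> d)" and CJ: "CJ = (\<iota> d \<parallel> \<epsilon>a) \<bullet> (\<iota> d \<parallel> G\<^sup>\<circ> \<parallel> \<iota> da) \<bullet> (\<eta>y \<parallel> \<iota> da)"
    by (simp_all add: DT_def CJ_def ea ey)
  have [simp]: "arr DT" "dom DT = d" "cod DT = e" "arr CJ" "dom CJ = da" "cod CJ = d"
    by (simp_all add: DT CJ)
  have 1: "(CJ \<parallel> \<iota> a) \<bullet> \<eta>a = (\<iota> d \<parallel> G\<^sup>\<circ>) \<bullet> \<eta>y"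
  proof -
    have "(CJ \<parallel> \<iota> a) \<bullet> \<eta>a = (\<iota> d \<parallel> \<epsilon>a \<parallel> \<iota> a) \<bullet> (\<iota> d \<parallel> G\<^sup>\<circ> \<parallel> \<iota> (da @ a)) \<bullet> ((\<eta>y \<parallel> \<iota> (da @ a)) \<bullet> \<eta>a)"
      by (simp add: CJ whisker_right comp_assoc tens_assoc idt_tens)
    also have "(\<eta>y \<parallel> \<iota> (da @ a)) \<bullet> \<eta>a = (\<iota> d \<parallel> \<iota> y \<parallel> \<eta>a) \<bullet> \<eta>y"
      using slide1[of \<eta>y \<eta>a "da @ a" "[]"] slide2[of \<eta>y \<eta>a "[]"] by (simp add: idt_tens_tail)
    also have "(\<iota> d \<parallel> \<epsilon>a \<parallel> \<iota> a) \<bullet> (\<iota> d \<parallel> G\<^sup>\<circ> \<parallel> \<iota> (da @ a)) \<bullet> (\<iota> d \<parallel> \<iota> y \<parallel> \<eta>a) \<bullet> \<eta>y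
       = (\<iota> d \<parallel> ((\<epsilon>a \<parallel> \<iota> a) \<bullet> ((G\<^sup>\<circ> \<parallel> \<iota> (da @ a)) \<bullet> (\<iota> y \<parallel> \<eta>a)))) \<bullet> \<eta>y"
      by (simp add: whisker_left comp_assoc)
    also have "(G\<^sup>\<circ> \<parallel> \<iota> (da @ a)) \<bullet> (\<iota> y \<parallel> \<eta>a) = (\<iota> a \<parallel> \<eta>a) \<bullet> G\<^sup>\<circ>"
      using slide2[of "G\<^sup>\<circ>" \<eta>a "[]"] by (simp add: slide1)
    finally show ?thesis by (simp add: sa[THEN comp_eq_tail] idt_left)
  qed
  have 2: "(DT \<parallel> \<iota> y) \<bullet> \<eta>y = N"
  proof -
    have "(DT \<parallel> \<iota> y) \<bullet> \<eta>y = (\<iota> e \<parallel> \<epsilon>y \<parallel> \<iota> y) \<bullet> ((N \<parallel> \<iota> (d @ y)) \<bullet> \<eta>y)"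
      by (simp add: DT whisker_right comp_assoc tens_assoc idt_tens)
    also have "(N \<parallel> \<iota> (d @ y)) \<bullet> \<eta>y = (\<iota> e \<parallel> \<iota> y \<parallel> \<eta>y) \<bullet> N"
      using slide1[of N \<eta>y "d @ y" "[]"] slide2[of N \<eta>y "[]"] by (simp add: idt_tens_tail)
    also have "(\<iota> e \<parallel> \<epsilon>y \<parallel> \<iota> y) \<bullet> (\<iota> e \<parallel> \<iota> y \<parallel> \<eta>y) \<bullet> N = (\<iota> e \<parallel> ((\<epsilon>y \<parallel> \<iota> y) \<bullet> (\<iota> y \<parallel> \<eta>y))) \<bullet> N"
      by (simp add: whisker_left comp_assoc)
    finally show ?thesis by (simp add: sy idt_tens idt_left)
  qed
  have "((DT \<bullet> CJ) \<parallel> \<iota> a) \<bullet> \<eta>a = ((DT \<parallel> \<iota> a) \<bullet> (\<iota> d \<parallel> G\<^sup>\<circ>)) \<bullet> \<eta>y"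
    by (simp add: whisker_right comp_assoc 1)
  also have "(DT \<parallel> \<iota> a) \<bullet> (\<iota> d \<parallel> G\<^sup>\<circ>) = (\<iota> e \<parallel> G\<^sup>\<circ>) \<bullet> (DT \<parallel> \<iota> y)"
    by (simp add: slide1 slide2)
  finally show ?thesis by (simp add: comp_assoc 2)
qed

text \<open>In \<open>cp_iff_square\<close> the root \<open>h\<close> is \<open>g\<close> with its
  \<open>b\<close> output bent down. Bending it up again is inverse to this, so every root
  \<open>H\<close> of a Choi morphism, and not just one of a special shape, yields a witness of
  complete positivity.\<close>

lemma square_unbend:
  assumes "frob b n v" and [simp]: "arr H" "dom H = a @ b" "cod H = x" "obj a"
  shows "(\<iota> x \<parallel> cap n v) \<bullet> (((H \<parallel> \<iota> b) \<bullet> (\<iota> a \<parallel> cup n v)) \<parallel> \<iota> b) = H"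
proof -
  note [simp] = frob_typing[OF assms(1)]
  have [simp]: "obj x" using obj_cod[of H] by (simp del: obj_cod)
  have "(\<iota> x \<parallel> cap n v) \<bullet> (((H \<parallel> \<iota> b) \<bullet> (\<iota> a \<parallel> cup n v)) \<parallel> \<iota> b) =
    ((\<iota> x \<parallel> cap n v) \<bullet> (H \<parallel> \<iota> (b @ b))) \<bullet> (\<iota> a \<parallel> cup n v \<parallel> \<iota> b)"
    by (simp only: whisker_right comp_assoc tens_assoc idt_tens assms obj_append arr_comp arr_tens arr_idt
        arr_dag frob_typing[OF assms(1)] dom_tens cod_tens dom_comp cod_comp dom_dag cod_dag dom_idt cod_idt
        append_assoc append_Nil2 append_Nil \<open>obj x\<close>)
  also have "(\<iota> x \<parallel> cap n v) \<bullet> (H \<parallel> \<iota> (b @ b)) = H \<bullet> (\<iota> a \<parallel> \<iota> b \<parallel> cap n v)"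
    using slide1[of H "cap n v" "[]" "a @ b"] slide2[of H "cap n v" "b @ b" x] by (simp add: idt_tens_tail)
  also have "(H \<bullet> (\<iota> a \<parallel> \<iota> b \<parallel> cap n v)) \<bullet> (\<iota> a \<parallel> cup n v \<parallel> \<iota> b) = H \<bullet> (\<iota> a \<parallel> ((\<iota> b \<parallel> cap n v) \<bullet> (cup n v \<parallel> \<iota> b)))"
    by (simp add: tens_comp idt_left comp_assoc)
  finally show ?thesis by (simp add: snake_left[OF assms(1)] idt_tens idt_right)
qed

text \<open>The loop inverts \<open>z \<bullet> z\<close>, and by centrality \<open>z\<close> can be
  moved through it from one side to the other.\<close>

lemma nalg_inverse:
  assumes "nalg a m u z"
  shows "(m \<bullet> m\<^sup>\<circ> \<bullet> z) \<bullet> z = \<iota> a" "z \<bullet> (m \<bullet> m\<^sup>\<circ> \<bullet> z) = \<iota> a"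
proof -
  note [simp] = nalg_typing[OF assms] and l = nalg_laws[OF assms]
  show "(m \<bullet> m\<^sup>\<circ> \<bullet> z) \<bullet> z = \<iota> a" using l(4) by (simp add: comp_assoc)
  have "z \<bullet> (m \<bullet> m\<^sup>\<circ> \<bullet> z) = m \<bullet> m\<^sup>\<circ> \<bullet> z \<bullet> z"
    by (simp add: l(2)[symmetric, THEN comp_eq_tail] l(6)[THEN comp_eq_tail] comp_assoc)
  then show "z \<bullet> (m \<bullet> m\<^sup>\<circ> \<bullet> z) = \<iota> a" using l(4) by simp
qed

section \<open>Associativity and symmetry of tensor products of algebras\<close>

lemma exchange_tens_assoc:
  assumes [simp]: "obj a" "obj b" "obj d"
  shows "(exchange a b a b \<parallel> \<iota> (d @ d)) \<bullet> exchange (a @ b) d (a @ b) d = (\<iota> (a @ a) \<parallel> exchange b d b d) \<bullet> exchange a (b @ d) a (b @ d)"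
proof -
  have "(exchange a b a b \<parallel> \<iota> (d @ d)) \<bullet> exchange (a @ b) d (a @ b) d =
    \<iota> a \<parallel> (((\<gamma> b a \<parallel> \<iota> (b @ d)) \<bullet> (\<iota> (b @ a) \<parallel> \<gamma> d b)) \<bullet> (\<iota> b \<parallel> \<gamma> d a \<parallel> \<iota> b)) \<parallel> \<iota> d"
    by (simp add: exchange_def sym_append whisker_left whisker_right comp_assoc tens_assoc idt_tens idt_tens_tail)
  also have "(\<gamma> b a \<parallel> \<iota> (b @ d)) \<bullet> (\<iota> (b @ a) \<parallel> \<gamma> d b) = (\<iota> (a @ b) \<parallel> \<gamma> d b) \<bullet> (\<gamma> b a \<parallel> \<iota> (d @ b))"
    by (simp add: slide1 slide2)
  also have "\<iota> a \<parallel> (((\<iota> (a @ b) \<parallel> \<gamma> d b) \<bullet> (\<gamma> b a \<parallel> \<iota> (d @ b))) \<bullet> (\<iota> b \<parallel> \<gamma> d a \<parallel> \<iota> b)) \<parallel> \<iota> d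
    = (\<iota> (a @ a) \<parallel> exchange b d b d) \<bullet> exchange a (b @ d) a (b @ d)"
    by (simp add: exchange_def sym_append_left whisker_left whisker_right comp_assoc tens_assoc idt_tens idt_tens_tail)
  finally show ?thesis .
qed

text \<open>For words both bracketings live on the same object and the associator is an identity. It
  is a homomorphism exactly when the two multiplications are the same arrow.\<close>

lemma tens_mult_assoc:
  assumes "frob a m u" "frob b n v" "frob d k w"
  shows "(((m \<parallel> n) \<bullet> exchange a b a b) \<parallel> k) \<bullet> exchange (a @ b) d (a @ b) d =
    (m \<parallel> ((n \<parallel> k) \<bullet> exchange b d b d)) \<bullet> exchange a (b @ d) a (b @ d)"
proof -
  note [simp] = frob_typing[OF assms(1)] frob_typing[OF assms(2)] frob_typing[OF assms(3)]
  have "((m \<parallel> n) \<bullet> exchange a b a b) \<parallel> k = (m \<parallel> n \<parallel> k) \<bullet> (exchange a b a b \<parallel> \<iota> (d @ d))"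
    using tens_comp[of "exchange a b a b" "m \<parallel> n" "\<iota> (d @ d)" k] by (simp add: idt_right tens_assoc)
  moreover have "m \<parallel> ((n \<parallel> k) \<bullet> exchange b d b d) = (m \<parallel> n \<parallel> k) \<bullet> (\<iota> (a @ a) \<parallel> exchange b d b d)"
    using tens_comp[of "\<iota> (a @ a)" m "exchange b d b d" "n \<parallel> k"] by (simp add: idt_right tens_assoc)
  ultimately show ?thesis by (simp add: comp_assoc exchange_tens_assoc)
qed

lemma tens_mult_sym:
  assumes "frob a m u" "frob b n v"
  shows "\<gamma> a b \<bullet> (m \<parallel> n) \<bullet> exchange a b a b = ((n \<parallel> m) \<bullet> exchange b a b a) \<bullet> (\<gamma> a b \<parallel> \<gamma> a b)"
proof -
  note [simp] = frob_typing[OF assms(1)] frob_typing[OF assms(2)]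
  have "exchange b a b a \<bullet> exchange b b a a \<bullet> \<gamma> (a @ a) (b @ b) \<bullet> exchange a b a b
     = exchange b a b a \<bullet> (\<gamma> a b \<parallel> \<gamma> a b) \<bullet> exchange a a b b \<bullet> exchange a b a b"
    using exchange_sym[of a a b b, THEN comp_eq_tail] by (simp add: comp_assoc)
  then have "\<gamma> (a @ a) (b @ b) \<bullet> exchange a b a b = exchange b a b a \<bullet> (\<gamma> a b \<parallel> \<gamma> a b)"
    by (simp add: exchange_tw[THEN comp_eq_tail] exchange_tw idt_left idt_right)
  then show ?thesis using sym_natural[of m n, THEN comp_eq_tail] by (simp add: comp_assoc)
qed

lemma nalg_unit: "nalg [] (\<iota> []) (\<iota> []) (\<iota> [])"
  unfolding nalg_def frob_def using positive_arr_square[of "\<iota> []"] by (simp add: idt_left)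

subsection \<open>Biproducts of algebras\<close>

definition has_duals :: bool where
  "has_duals \<longleftrightarrow> (\<forall>c. obj c \<longrightarrow> (\<exists>d \<eta>. dual_pair d c \<eta>))"

text \<open>Bending the factor \<open>c\<close> to the output side is injective because
  \<open>c\<close> has a dual. An equation between arrows out of \<open>y @ c\<close> may therefore
  be checked on arrows out of \<open>y\<close>, which is the form in which the right adjoint of
  tensoring is used.\<close>

lemma tens_cancel_right:
  assumes has_duals and [simp]: "obj c" "obj y" "arr f" "arr g" "dom f = y @ c" "dom g = y @ c" "cod g = cod f"
    and eq: "\<And>d e. \<lbrakk>obj d; arr e; dom e = []; cod e = c @ d\<rbrakk>
      \<Longrightarrow> (f \<parallel> \<iota> d) \<bullet> (\<iota> y \<parallel> e) = (g \<parallel> \<iota> d) \<bullet> (\<iota> y \<parallel> e)"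
  shows "f = g"
proof -
  obtain d \<eta> where dp: "dual_pair d c \<eta>" using assms(1,2) unfolding has_duals_def by blast
  note [simp] = dual_pair_typing[OF dp]
  obtain \<epsilon> where [simp]: "arr \<epsilon>" "dom \<epsilon> = c @ d" "cod \<epsilon> = []"
    and sn: "(\<iota> c \<parallel> \<eta>\<^sup>\<circ>) \<bullet> (\<epsilon>\<^sup>\<circ> \<parallel> \<iota> c) = \<iota> c"
    using dual_pair_counit[OF dp] by metis
  have r: "(\<iota> (cod h) \<parallel> \<eta>\<^sup>\<circ>) \<bullet> (((h \<parallel> \<iota> d) \<bullet> (\<iota> y \<parallel> \<epsilon>\<^sup>\<circ>)) \<parallel> \<iota> c) = h"
    if [simp]: "arr h" "dom h = y @ c" for h
  proof -
    have "(\<iota> (cod h) \<parallel> \<eta>\<^sup>\<circ>) \<bullet> (((h \<parallel> \<iota> d) \<bullet> (\<iota> y \<parallel> \<epsilon>\<^sup>\<circ>)) \<parallel> \<iota> c)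
      = ((\<iota> (cod h) \<parallel> \<eta>\<^sup>\<circ>) \<bullet> (h \<parallel> \<iota> (d @ c))) \<bullet> (\<iota> y \<parallel> \<epsilon>\<^sup>\<circ> \<parallel> \<iota> c)"
      by (simp add: whisker_right comp_assoc tens_assoc idt_tens)
    also have "(\<iota> (cod h) \<parallel> \<eta>\<^sup>\<circ>) \<bullet> (h \<parallel> \<iota> (d @ c)) = h \<bullet> (\<iota> y \<parallel> \<iota> c \<parallel> \<eta>\<^sup>\<circ>)"
      using slide1[of h "\<eta>\<^sup>\<circ>" "[]" "y @ c"] slide2[of h "\<eta>\<^sup>\<circ>"] by (simp add: idt_tens_tail)
    also have "(h \<bullet> (\<iota> y \<parallel> \<iota> c \<parallel> \<eta>\<^sup>\<circ>)) \<bullet> (\<iota> y \<parallel> \<epsilon>\<^sup>\<circ> \<parallel> \<iota> c) = h \<bullet> (\<iota> y \<parallel> ((\<iota> c \<parallel> \<eta>\<^sup>\<circ>) \<bullet> (\<epsilon>\<^sup>\<circ> \<parallel> \<iota> c)))"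
      by (simp add: whisker_left comp_assoc)
    finally show ?thesis by (simp add: sn idt_tens idt_right)
  qed
  have "(f \<parallel> \<iota> d) \<bullet> (\<iota> y \<parallel> \<epsilon>\<^sup>\<circ>) = (g \<parallel> \<iota> d) \<bullet> (\<iota> y \<parallel> \<epsilon>\<^sup>\<circ>)" by (rule eq) simp_all
  with r[of f] r[of g] show ?thesis by (metis assms(4-8))
qed

section \<open>Zero objects and zero morphisms\<close>

definition zobj :: "'x list \<Rightarrow> bool" where
  "zobj z \<longleftrightarrow> obj z \<and> (\<forall>a. obj a \<longrightarrow> (\<exists>f. arr f \<and> dom f = a \<and> cod f = z)) \<and>
    (\<forall>f g. arr f \<and> arr g \<and> dom f = dom g \<and> cod f = z \<and> cod g = z \<longrightarrow> f = g)"

definition zarr :: "'m \<Rightarrow> bool" where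
  "zarr f \<longleftrightarrow> (\<exists>g h. arr g \<and> arr h \<and> zobj (cod g) \<and> dom h = cod g \<and> f = h \<bullet> g)"

lemma zobj_unique: "\<lbrakk>zobj z; arr f; arr g; dom f = dom g; cod f = z; cod g = z\<rbrakk> \<Longrightarrow> f = g"
  by (auto simp: zobj_def)

text \<open>The dagger exchanges terminal and initial objects.\<close>

lemma zobj_unique_out: assumes "zobj z" "arr f" "arr g" "cod f = cod g" "dom f = z" "dom g = z" shows "f = g"
  using zobj_unique[OF assms(1), of "f\<^sup>\<circ>" "g\<^sup>\<circ>"] assms dag_dag by (metis arr_dag cod_dag dom_dag)

lemma zobj_in: "\<lbrakk>zobj z; obj a\<rbrakk> \<Longrightarrow> \<exists>f. arr f \<and> dom f = a \<and> cod f = z"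
  by (auto simp: zobj_def)

lemma zobj_out: "\<lbrakk>zobj z; obj a\<rbrakk> \<Longrightarrow> \<exists>f. arr f \<and> dom f = z \<and> cod f = a"
  using zobj_in by (metis arr_dag cod_dag dom_dag)

lemma zarr_arr [simp]: "zarr f \<Longrightarrow> arr f"
  unfolding zarr_def by auto

text \<open>The two arrows may factor through different zero objects; the arrow \<open>e\<close>
  between these makes the factorisations agree on both halves.\<close>

lemma zarr_unique: assumes "zarr f" "zarr g" "dom f = dom g" "cod f = cod g" shows "f = g"
proof -
  obtain k h where f: "arr k" "arr h" "zobj (cod k)" "dom h = cod k" "f = h \<bullet> k"
    using assms(1) unfolding zarr_def by blast
  obtain k' h' where g: "arr k'" "arr h'" "zobj (cod k')" "dom h' = cod k'" "g = h' \<bullet> k'"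
    using assms(2) unfolding zarr_def by blast
  obtain e where e: "arr e" "dom e = cod k" "cod e = cod k'"
    using zobj_in[OF g(3), of "cod k"] f by auto
  note [simp] = f(1,2,4) g(1,2,4) e
  have d: "dom k = dom k'" "cod h = cod h'" using assms(3,4) by (simp_all add: f(5) g(5))
  have "h = h' \<bullet> e" by (rule zobj_unique_out[OF f(3)]) (simp_all add: d)
  moreover have "e \<bullet> k = k'" by (rule zobj_unique[OF g(3)]) (simp_all add: d)
  ultimately show ?thesis by (simp add: f(5) g(5) comp_assoc)
qed

lemma zarr_comp: "\<lbrakk>zarr f; arr g; cod f = dom g\<rbrakk> \<Longrightarrow> zarr (g \<bullet> f)" "\<lbrakk>zarr f; arr g; cod g = dom f\<rbrakk> \<Longrightarrow> zarr (f \<bullet> g)"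
proof -
  assume "zarr f" and g: "arr g" "cod f = dom g"
  then obtain k h where f: "arr k" "arr h" "zobj (cod k)" "dom h = cod k" "f = h \<bullet> k" unfolding zarr_def by blast
  show "zarr (g \<bullet> f)" unfolding zarr_def using f g by (intro exI[of _ k] exI[of _ "g \<bullet> h"]) (simp add: comp_assoc)
next
  assume "zarr f" and g: "arr g" "cod g = dom f"
  then obtain k h where f: "arr k" "arr h" "zobj (cod k)" "dom h = cod k" "f = h \<bullet> k" unfolding zarr_def by blast
  show "zarr (f \<bullet> g)" unfolding zarr_def using f g by (intro exI[of _ "k \<bullet> g"] exI[of _ h]) (simp add: comp_assoc)
qed

text \<open>After currying away \<open>c\<close>, both arrows start at the zero object.\<close>

lemma zobj_tens_unique:
  assumes has_duals "zobj z" "obj c" "arr f" "arr g" "dom f = z @ c" "dom g = z @ c" "cod g = cod f"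
  shows "f = g"
proof -
  have [simp]: "obj z" using assms by (simp add: zobj_def)
  show ?thesis
    by (rule tens_cancel_right[OF assms(1,3) _ assms(4-8)])
      (use assms in \<open>auto intro!: zobj_unique_out[OF assms(2)]\<close>)
qed

lemma zarr_tens:
  assumes has_duals "zarr f" "arr g"
  shows "zarr (f \<parallel> g)" "zarr (g \<parallel> f)"
proof -
  note [simp] = assms(3)
  have 1: "zarr (f \<parallel> g)"
  proof -
    obtain k h where f: "arr k" "arr h" "zobj (cod k)" "dom h = cod k" "f = h \<bullet> k"
      using assms(2) unfolding zarr_def by blast
    note [simp] = f(1,2,4)
    obtain p where p: "arr p" "dom p = cod k @ cod g" "cod p = cod k"
      using zobj_in[OF f(3), of "cod k @ cod g"] by auto
    obtain q where q: "arr q" "dom q = cod k" "cod q = cod h @ cod g"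
      using zobj_out[OF f(3), of "cod h @ cod g"] by auto
    \<comment> \<open>The word \<open>cod k @ cod g\<close> is initial without being known to be a
      zero object in the sense of \<open>zobj\<close>. Its arrows are unique, so this one may be
      rerouted through the zero object \<open>cod k\<close>.\<close>
    have "h \<parallel> \<iota> (cod g) = q \<bullet> p"
      using p q by (intro zobj_tens_unique[OF assms(1) f(3), of "cod g"]) auto
    then have "f \<parallel> g = q \<bullet> p \<bullet> (k \<parallel> g)"
      using tens_comp[of k h g "\<iota> (cod g)"] p q by (simp add: f(5) idt_left comp_assoc)
    moreover have "zarr (q \<bullet> p \<bullet> (k \<parallel> g))"
      unfolding zarr_def using p q f by (intro exI[of _ "p \<bullet> (k \<parallel> g)"] exI[of _ q]) simp
    ultimately show ?thesis by simp
  qed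
  then show "zarr (f \<parallel> g)" .
  have [simp]: "arr f" using assms by simp
  have "g \<parallel> f = \<gamma> (cod f) (cod g) \<bullet> (f \<parallel> g) \<bullet> \<gamma> (dom g) (dom f)"
    using sym_natural[of f g, THEN comp_eq_tail] by (simp add: comp_assoc sym_sym idt_right)
  then show "zarr (g \<parallel> f)" using 1 by (simp add: zarr_comp)
qed

text \<open>Indexing by \<open>bool\<close> lets one statement cover both summands. The coproduct
  half is recorded as joint epimorphy and the product half as existence of pairings; the dagger
  exchanges the two halves, since the projections are the adjoints of the injections.\<close>

definition bip :: "'x list \<Rightarrow> (bool \<Rightarrow> 'x list) \<Rightarrow> (bool \<Rightarrow> 'm) \<Rightarrow> bool" where
  "bip s a i \<longleftrightarrow> obj s \<and> (\<forall>k. obj (a k) \<and> arr (i k) \<and> dom (i k) = a k \<and> cod (i k) = s \<and> (i k)\<^sup>\<circ> \<bullet> i k = \<iota> (a k)) \<and>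
    (\<forall>j k. j \<noteq> k \<longrightarrow> zarr ((i j)\<^sup>\<circ> \<bullet> i k)) \<and>
    (\<forall>f g. arr f \<longrightarrow> arr g \<longrightarrow> dom f = s \<longrightarrow> dom g = s \<longrightarrow> cod f = cod g \<longrightarrow> (\<forall>k. f \<bullet> i k = g \<bullet> i k) \<longrightarrow> f = g) \<and>
    (\<forall>x f. obj x \<longrightarrow> (\<forall>k. arr (f k) \<and> dom (f k) = x \<and> cod (f k) = a k) \<longrightarrow>
      (\<exists>h. arr h \<and> dom h = x \<and> cod h = s \<and> (\<forall>k. (i k)\<^sup>\<circ> \<bullet> h = f k)))"

lemma bip_simps:
  assumes "bip s a i"
  shows "obj s" "obj (a k)" "arr (i k)" "dom (i k) = a k" "cod (i k) = s" "(i k)\<^sup>\<circ> \<bullet> i k = \<iota> (a k)"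
  using assms by (auto simp: bip_def)

lemma bip_zero: "\<lbrakk>bip s a i; j \<noteq> k\<rbrakk> \<Longrightarrow> zarr ((i j)\<^sup>\<circ> \<bullet> i k)"
  by (auto simp: bip_def)

lemma bip_epi: "\<lbrakk>bip s a i; arr f; arr g; dom f = s; dom g = s; cod g = cod f; \<And>k. f \<bullet> i k = g \<bullet> i k\<rbrakk> \<Longrightarrow> f = g"
  unfolding bip_def by metis

lemma bip_mono:
  assumes "bip s a i" "arr f" "arr g" "cod f = s" "cod g = s" "dom g = dom f" "\<And>k. (i k)\<^sup>\<circ> \<bullet> f = (i k)\<^sup>\<circ> \<bullet> g"
  shows "f = g"
proof -
  note [simp] = bip_simps[OF assms(1)] assms(2-6)
  have "f\<^sup>\<circ> \<bullet> i k = g\<^sup>\<circ> \<bullet> i k" for k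
    using arg_cong[OF assms(7)[of k], of dag] by (simp add: dag_comp)
  then have "f\<^sup>\<circ> = g\<^sup>\<circ>" by (rule bip_epi[OF assms(1), rotated -1]) simp_all
  then show ?thesis by (metis dag_dag assms(2,3))
qed

lemma bip_pair:
  assumes "bip s a i" "obj x" "\<And>k. arr (f k)" "\<And>k. dom (f k) = x" "\<And>k. cod (f k) = a k"
  obtains h where "arr h" "dom h = x" "cod h = s" "\<And>k. (i k)\<^sup>\<circ> \<bullet> h = f k"
  using assms unfolding bip_def by metis

text \<open>Currying away \<open>c\<close> leaves arrows out of \<open>s\<close>, where the
  injections are jointly epic; the arrow used for currying slides past the injection.\<close>

lemma bip_epi_right:
  assumes hd: has_duals and b: "bip s a i" and [simp]: "obj c" "arr f" "arr g" "dom f = s @ c" "dom g = s @ c" "cod g = cod f"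
    and eq: "\<And>k. f \<bullet> (i k \<parallel> \<iota> c) = g \<bullet> (i k \<parallel> \<iota> c)"
  shows "f = g"
proof -
  note [simp] = bip_simps[OF b]
  show ?thesis
  proof (rule tens_cancel_right[OF hd, of c s])
    fix d e assume [simp]: "obj d" "arr e" "dom e = []" "cod e = c @ d"
    show "(f \<parallel> \<iota> d) \<bullet> (\<iota> s \<parallel> e) = (g \<parallel> \<iota> d) \<bullet> (\<iota> s \<parallel> e)"
    proof (rule bip_epi[OF b])
      fix k
      have ie: "(\<iota> s \<parallel> e) \<bullet> i k = ((i k \<parallel> \<iota> c) \<parallel> \<iota> d) \<bullet> (\<iota> (a k) \<parallel> e)"
        using slide2[of "i k" e "[]" s] slide1[of "i k" e "c @ d" "a k"] by (simp add: tens_assoc idt_tens)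
      have "(f \<parallel> \<iota> d) \<bullet> (\<iota> s \<parallel> e) \<bullet> i k = ((f \<bullet> (i k \<parallel> \<iota> c)) \<parallel> \<iota> d) \<bullet> (\<iota> (a k) \<parallel> e)"
        unfolding ie by (simp add: whisker_right comp_assoc)
      also have "\<dots> = (g \<parallel> \<iota> d) \<bullet> (\<iota> s \<parallel> e) \<bullet> i k"
        unfolding ie eq by (simp add: whisker_right comp_assoc)
      finally show "((f \<parallel> \<iota> d) \<bullet> (\<iota> s \<parallel> e)) \<bullet> i k = ((g \<parallel> \<iota> d) \<bullet> (\<iota> s \<parallel> e)) \<bullet> i k"
        by (simp add: comp_assoc)
    qed simp_all
  qed simp_all
qed

lemma bip_epi_left:
  assumes hd: has_duals and b: "bip s a i" and [simp]: "obj c" "arr f" "arr g" "dom f = c @ s" "dom g = c @ s" "cod g = cod f"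
    and eq: "\<And>k. f \<bullet> (\<iota> c \<parallel> i k) = g \<bullet> (\<iota> c \<parallel> i k)"
  shows "f = g"
proof -
  note [simp] = bip_simps[OF b]
  have s: "\<gamma> s c \<bullet> (i k \<parallel> \<iota> c) = (\<iota> c \<parallel> i k) \<bullet> \<gamma> (a k) c" for k
    using sym_natural[of "i k" "\<iota> c"] by simp
  have "f \<bullet> \<gamma> s c = g \<bullet> \<gamma> s c"
    by (rule bip_epi_right[OF hd b, of c])
      (simp_all add: comp_assoc s eq[THEN comp_eq_tail])
  from arg_cong[OF this, of "\<lambda>x. x \<bullet> \<gamma> c s"] show ?thesis
    by (simp add: comp_assoc sym_sym idt_right)
qed

lemma bip_epi2:
  assumes hd: has_duals and b: "bip s a i" and [simp]: "arr f" "arr g" "dom f = s @ s" "dom g = s @ s" "cod g = cod f"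
    and eq: "\<And>j k. f \<bullet> (i j \<parallel> i k) = g \<bullet> (i j \<parallel> i k)"
  shows "f = g"
proof -
  note [simp] = bip_simps[OF b]
  show ?thesis
  proof (rule bip_epi_right[OF hd b, of s])
    fix j
    show "f \<bullet> (i j \<parallel> \<iota> s) = g \<bullet> (i j \<parallel> \<iota> s)"
    proof (rule bip_epi_left[OF hd b, of "a j"])
      fix k
      have "(i j \<parallel> \<iota> s) \<bullet> (\<iota> (a j) \<parallel> i k) = i j \<parallel> i k" by (simp add: slide1)
      then show "(f \<bullet> (i j \<parallel> \<iota> s)) \<bullet> (\<iota> (a j) \<parallel> i k) = (g \<bullet> (i j \<parallel> \<iota> s)) \<bullet> (\<iota> (a j) \<parallel> i k)"
        using eq[of j k] by (simp add: comp_assoc)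
    qed simp_all
  qed simp_all
qed

text \<open>A morphism that is block diagonal with positive blocks is positive; this replaces the
  formation of sums of positive morphisms.\<close>

lemma bip_block_positive:
  fixes e :: "bool \<Rightarrow> 'm"
  assumes b: "bip s a i" and ex: "\<And>y. (\<And>k. obj (y k)) \<Longrightarrow> \<exists>t j. bip t y j"
    and [simp]: "arr f" "dom f = x" "cod f = x"
    and e: "\<And>k. arr (e k)" "\<And>k. dom (e k) = y k" "\<And>k. cod (e k) = x"
    and epi: "\<And>g h. \<lbrakk>arr g; arr h; dom g = x; dom h = x; cod h = cod g; \<And>k. g \<bullet> e k = h \<bullet> e k\<rbrakk> \<Longrightarrow> g = h"
    and ee: "\<And>k. (e k)\<^sup>\<circ> \<bullet> e k = \<iota> (y k)" "\<And>j k. j \<noteq> k \<Longrightarrow> zarr ((e j)\<^sup>\<circ> \<bullet> e k)"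
    and diag: "\<And>k. positive_arr ((e k)\<^sup>\<circ> \<bullet> f \<bullet> e k)" and off: "\<And>j k. j \<noteq> k \<Longrightarrow> zarr ((e j)\<^sup>\<circ> \<bullet> f \<bullet> e k)"
  shows "positive_arr f"
proof -
  note [simp] = bip_simps[OF b] e
  have [simp]: "obj x" using obj_dom[OF assms(3)] by (simp del: obj_dom)
  have [simp]: "obj (y k)" for k using obj_dom[OF e(1)[of k]] by (simp del: obj_dom)
  have "\<forall>k. \<exists>h. arr h \<and> (e k)\<^sup>\<circ> \<bullet> f \<bullet> e k = h\<^sup>\<circ> \<bullet> h" using diag by (auto simp: positive_arr_def)
  from choice[OF this] obtain h where h [simp]: "\<And>k. arr (h k)"
    and hh: "\<And>k. (e k)\<^sup>\<circ> \<bullet> f \<bullet> e k = (h k)\<^sup>\<circ> \<bullet> h k" by blast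
  have [simp]: "dom (h k) = y k" for k using arg_cong[OF hh[of k], of dom] by simp
  obtain t j where c: "bip t (\<lambda>k. cod (h k)) j" using ex[of "\<lambda>k. cod (h k)"] by auto
  note [simp] = bip_simps[OF c]
  \<comment> \<open>The common root is the pairing of the roots of the blocks. Their codomains are
    not under control, so \<open>ex\<close> asks for a biproduct of any two words.\<close>
  obtain K where [simp]: "arr K" "dom K = x" "cod K = t" and K: "\<And>k. (j k)\<^sup>\<circ> \<bullet> K = h k \<bullet> (e k)\<^sup>\<circ>"
    by (rule bip_pair[OF c, of x "\<lambda>k. h k \<bullet> (e k)\<^sup>\<circ>"]) auto
  have Ke: "K \<bullet> e k = j k \<bullet> h k" for k
  proof (rule bip_mono[OF c])
    fix l
    have "(j l)\<^sup>\<circ> \<bullet> K \<bullet> e k = h l \<bullet> ((e l)\<^sup>\<circ> \<bullet> e k)" using K[THEN comp_eq_tail] by (simp add: comp_assoc)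
    also have "\<dots> = ((j l)\<^sup>\<circ> \<bullet> j k) \<bullet> h k"
    proof (cases "l = k")
      case True then show ?thesis by (simp add: ee idt_left idt_right)
    next
      case False
      show ?thesis by (rule zarr_unique)
        (use zarr_comp(1)[OF ee(2)[OF False]] zarr_comp(2)[OF bip_zero[OF c False]] in auto)
    qed
    finally show "(j l)\<^sup>\<circ> \<bullet> K \<bullet> e k = (j l)\<^sup>\<circ> \<bullet> j k \<bullet> h k" by (simp add: comp_assoc)
  qed simp_all
  have Ke': "(e k)\<^sup>\<circ> \<bullet> K\<^sup>\<circ> = (h k)\<^sup>\<circ> \<bullet> (j k)\<^sup>\<circ>" for k
    using arg_cong[OF Ke[of k], of dag] by (simp add: dag_comp)
  have blocks: "(e l)\<^sup>\<circ> \<bullet> f \<bullet> e k = (e l)\<^sup>\<circ> \<bullet> (K\<^sup>\<circ> \<bullet> K) \<bullet> e k" for l k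
  proof -
    have "(e l)\<^sup>\<circ> \<bullet> (K\<^sup>\<circ> \<bullet> K) \<bullet> e k = (h l)\<^sup>\<circ> \<bullet> ((j l)\<^sup>\<circ> \<bullet> j k) \<bullet> h k"
      by (simp add: comp_assoc Ke Ke'[THEN comp_eq_tail])
    also have "\<dots> = (e l)\<^sup>\<circ> \<bullet> f \<bullet> e k"
    proof (cases "l = k")
      case True then show ?thesis by (simp add: hh idt_left)
    next
      case False
      show ?thesis by (rule zarr_unique)
        (use zarr_comp(1)[OF zarr_comp(2)[OF bip_zero[OF c False]]] off[OF False] in auto)
    qed
    finally show ?thesis by simp
  qed
  have "f = K\<^sup>\<circ> \<bullet> K"
  proof (rule epi)
    fix k
    \<comment> \<open>Taking adjoints exchanges the two sides on which the blocks are cut out, so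
      joint epimorphy applies a second time.\<close>
    have "(f \<bullet> e k)\<^sup>\<circ> = ((K\<^sup>\<circ> \<bullet> K) \<bullet> e k)\<^sup>\<circ>"
    proof (rule epi)
      fix l
      show "(f \<bullet> e k)\<^sup>\<circ> \<bullet> e l = ((K\<^sup>\<circ> \<bullet> K) \<bullet> e k)\<^sup>\<circ> \<bullet> e l"
        using arg_cong[OF blocks[of l k], of dag] by (simp add: dag_comp comp_assoc)
    qed simp_all
    from arg_cong[OF this, of dag] show "f \<bullet> e k = (K\<^sup>\<circ> \<bullet> K) \<bullet> e k" by simp
  qed simp_all
  then show ?thesis by (simp add: positive_arr_square)
qed

section \<open>The algebra on a biproduct\<close>

definition bip_alg :: "'x list \<Rightarrow> (bool \<Rightarrow> 'm) \<Rightarrow> (bool \<Rightarrow> 'm) \<Rightarrow> (bool \<Rightarrow> 'm) \<Rightarrow> (bool \<Rightarrow> 'm) \<Rightarrow> 'm \<Rightarrow> 'm \<Rightarrow> 'm \<Rightarrow> bool" where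
  "bip_alg s i m u z M U Z \<longleftrightarrow> arr M \<and> dom M = s @ s \<and> cod M = s \<and> arr U \<and> dom U = [] \<and> cod U = s \<and>
    arr Z \<and> dom Z = s \<and> cod Z = s \<and>
    (\<forall>k. (i k)\<^sup>\<circ> \<bullet> M = m k \<bullet> ((i k)\<^sup>\<circ> \<parallel> (i k)\<^sup>\<circ>) \<and> (i k)\<^sup>\<circ> \<bullet> U = u k \<and> (i k)\<^sup>\<circ> \<bullet> Z = z k \<bullet> (i k)\<^sup>\<circ>)"

lemma bip_alg_exists:
  assumes b: "bip s a i" and n: "\<And>k. nalg (a k) (m k) (u k) (z k)"
  obtains M U Z where "bip_alg s i m u z M U Z"
proof -
  note [simp] = bip_simps[OF b] nalg_typing[OF n]
  obtain M where "arr M" "dom M = s @ s" "cod M = s" "\<And>k. (i k)\<^sup>\<circ> \<bullet> M = m k \<bullet> ((i k)\<^sup>\<circ> \<parallel> (i k)\<^sup>\<circ>)"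
    by (rule bip_pair[OF b, of "s @ s" "\<lambda>k. m k \<bullet> ((i k)\<^sup>\<circ> \<parallel> (i k)\<^sup>\<circ>)"]) auto
  moreover obtain U where "arr U" "dom U = []" "cod U = s" "\<And>k. (i k)\<^sup>\<circ> \<bullet> U = u k"
    by (rule bip_pair[OF b, of "[]" u]) auto
  moreover obtain Z where "arr Z" "dom Z = s" "cod Z = s" "\<And>k. (i k)\<^sup>\<circ> \<bullet> Z = z k \<bullet> (i k)\<^sup>\<circ>"
    by (rule bip_pair[OF b, of "s" "\<lambda>k. z k \<bullet> (i k)\<^sup>\<circ>"]) auto
  ultimately show thesis using that[of M U Z] by (simp add: bip_alg_def)
qed

text \<open>The structure is given by its projections; the new rules describe it on injections. They
  are found by comparing components, where a mismatch of indices produces a factor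
  \<open>(i l)\<^sup>\<circ> \<bullet> i k\<close> that is zero and annihilates everything tensored
  or composed with it.\<close>

lemma bip_alg_laws:
  assumes hd: has_duals and b: "bip s a i" and n: "\<And>k. nalg (a k) (m k) (u k) (z k)"
    and "bip_alg s i m u z M U Z"
  shows "arr M" "dom M = s @ s" "cod M = s" "arr U" "dom U = []" "cod U = s" "arr Z" "dom Z = s" "cod Z = s"
    "(i k)\<^sup>\<circ> \<bullet> M = m k \<bullet> ((i k)\<^sup>\<circ> \<parallel> (i k)\<^sup>\<circ>)" "(i k)\<^sup>\<circ> \<bullet> U = u k" "(i k)\<^sup>\<circ> \<bullet> Z = z k \<bullet> (i k)\<^sup>\<circ>"
    "M \<bullet> (i k \<parallel> i k) = i k \<bullet> m k" "j \<noteq> k \<Longrightarrow> zarr (M \<bullet> (i j \<parallel> i k))" "M\<^sup>\<circ> \<bullet> i k = (i k \<parallel> i k) \<bullet> (m k)\<^sup>\<circ>"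
    "U\<^sup>\<circ> \<bullet> i k = (u k)\<^sup>\<circ>" "Z \<bullet> i k = i k \<bullet> z k" "M \<bullet> (i k \<parallel> \<iota> s) = i k \<bullet> m k \<bullet> (\<iota> (a k) \<parallel> (i k)\<^sup>\<circ>)"
proof -
  note [simp] = bip_simps[OF b] nalg_typing[OF n]
  show t [simp]: "arr M" "dom M = s @ s" "cod M = s" "arr U" "dom U = []" "cod U = s" "arr Z" "dom Z = s" "cod Z = s"
    using assms(4) by (auto simp: bip_alg_def)
  have e: "\<And>k. (i k)\<^sup>\<circ> \<bullet> M = m k \<bullet> ((i k)\<^sup>\<circ> \<parallel> (i k)\<^sup>\<circ>)" "\<And>k. (i k)\<^sup>\<circ> \<bullet> U = u k"
    "\<And>k. (i k)\<^sup>\<circ> \<bullet> Z = z k \<bullet> (i k)\<^sup>\<circ>"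
    using assms(4) by (auto simp: bip_alg_def)
  show "(i k)\<^sup>\<circ> \<bullet> M = m k \<bullet> ((i k)\<^sup>\<circ> \<parallel> (i k)\<^sup>\<circ>)" "(i k)\<^sup>\<circ> \<bullet> U = u k" "(i k)\<^sup>\<circ> \<bullet> Z = z k \<bullet> (i k)\<^sup>\<circ>"
    by (rule e)+
  have IM: "(i l)\<^sup>\<circ> \<bullet> M \<bullet> (f \<parallel> g) = m l \<bullet> (((i l)\<^sup>\<circ> \<bullet> f) \<parallel> ((i l)\<^sup>\<circ> \<bullet> g))"
    if "arr f" "arr g" "cod f = s" "cod g = s" for l f g
    using that by (simp add: e(1)[THEN comp_eq_tail] comp_assoc tens_comp)
  show Mi: "M \<bullet> (i k \<parallel> i k) = i k \<bullet> m k"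
  proof (rule bip_mono[OF b])
    fix l show "(i l)\<^sup>\<circ> \<bullet> M \<bullet> (i k \<parallel> i k) = (i l)\<^sup>\<circ> \<bullet> i k \<bullet> m k"
    proof (cases "l = k")
      case True then show ?thesis
        by (simp add: IM idt_tens idt_right bip_simps(6)[OF b, THEN comp_eq_tail] idt_left)
    next
      case False
      have "zarr (((i l)\<^sup>\<circ> \<bullet> i k) \<bullet> m k)" by (rule zarr_comp(2)[OF bip_zero[OF b False]]) simp_all
      moreover have "zarr (m l \<bullet> (((i l)\<^sup>\<circ> \<bullet> i k) \<parallel> ((i l)\<^sup>\<circ> \<bullet> i k)))"
        by (rule zarr_comp(1)[OF zarr_tens(1)[OF hd bip_zero[OF b False]]]) simp_all
      ultimately show ?thesis by (intro zarr_unique) (simp_all add: IM comp_assoc)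
    qed
  qed simp_all
  show "M \<bullet> (i k \<parallel> \<iota> s) = i k \<bullet> m k \<bullet> (\<iota> (a k) \<parallel> (i k)\<^sup>\<circ>)"
  proof (rule bip_mono[OF b])
    fix l show "(i l)\<^sup>\<circ> \<bullet> M \<bullet> (i k \<parallel> \<iota> s) = (i l)\<^sup>\<circ> \<bullet> i k \<bullet> m k \<bullet> (\<iota> (a k) \<parallel> (i k)\<^sup>\<circ>)"
    proof (cases "l = k")
      case True then show ?thesis
        by (simp add: IM idt_tens idt_right bip_simps(6)[OF b, THEN comp_eq_tail] idt_left)
    next
      case False
      have "zarr (((i l)\<^sup>\<circ> \<bullet> i k) \<bullet> m k \<bullet> (\<iota> (a k) \<parallel> (i k)\<^sup>\<circ>))"
        by (rule zarr_comp(2)[OF bip_zero[OF b False]]) simp_all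
      moreover have "zarr (m l \<bullet> (((i l)\<^sup>\<circ> \<bullet> i k) \<parallel> ((i l)\<^sup>\<circ> \<bullet> \<iota> s)))"
        by (rule zarr_comp(1)[OF zarr_tens(1)[OF hd bip_zero[OF b False]]]) simp_all
      ultimately show ?thesis by (intro zarr_unique) (simp_all add: IM comp_assoc)
    qed
  qed simp_all
  show "zarr (M \<bullet> (i j \<parallel> i k))" if jk: "j \<noteq> k"
  proof -
    have "zarr ((i j)\<^sup>\<circ> \<bullet> i k)" by (rule bip_zero[OF b jk])
    then obtain zz where zz: "zobj zz" unfolding zarr_def by blast
    obtain p where p: "arr p" "dom p = a j @ a k" "cod p = zz" using zobj_in[OF zz, of "a j @ a k"] by auto
    obtain q where q: "arr q" "dom q = zz" "cod q = s" using zobj_out[OF zz, of s] by auto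
    have z0: "zarr (q \<bullet> p)" unfolding zarr_def using p q zz by (intro exI[of _ p] exI[of _ q]) simp
    have "M \<bullet> (i j \<parallel> i k) = q \<bullet> p"
    proof (rule bip_mono[OF b])
      fix l
      \<comment> \<open>With two different injections, \<open>l\<close> differs from at least one of
        \<open>j\<close> and \<open>k\<close>, so one tensor factor vanishes.\<close>
      have "zarr (m l \<bullet> (((i l)\<^sup>\<circ> \<bullet> i j) \<parallel> ((i l)\<^sup>\<circ> \<bullet> i k)))"
      proof (cases "l = j")
        case True
        then have z: "zarr ((i l)\<^sup>\<circ> \<bullet> i k)" using bip_zero[OF b] jk by simp
        show ?thesis by (rule zarr_comp(1)[OF zarr_tens(2)[OF hd z]]) simp_all
      next
        case False
        then have z: "zarr ((i l)\<^sup>\<circ> \<bullet> i j)" using bip_zero[OF b] by simp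
        show ?thesis by (rule zarr_comp(1)[OF zarr_tens(1)[OF hd z]]) simp_all
      qed
      then show "(i l)\<^sup>\<circ> \<bullet> M \<bullet> (i j \<parallel> i k) = (i l)\<^sup>\<circ> \<bullet> q \<bullet> p"
        using zarr_comp(1)[OF z0, of "(i l)\<^sup>\<circ>"] p q by (intro zarr_unique) (simp_all add: IM)
    qed (use p q in simp_all)
    then show ?thesis using z0 by simp
  qed
  show "M\<^sup>\<circ> \<bullet> i k = (i k \<parallel> i k) \<bullet> (m k)\<^sup>\<circ>"
    using arg_cong[OF e(1)[of k], of dag] by (simp add: dag_comp dag_tens)
  show "U\<^sup>\<circ> \<bullet> i k = (u k)\<^sup>\<circ>" using arg_cong[OF e(2)[of k], of dag] by (simp add: dag_comp)
  show "Z \<bullet> i k = i k \<bullet> z k"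
  proof (rule bip_mono[OF b])
    fix l show "(i l)\<^sup>\<circ> \<bullet> Z \<bullet> i k = (i l)\<^sup>\<circ> \<bullet> i k \<bullet> z k"
    proof (cases "l = k")
      case True then show ?thesis
        by (simp add: e(3)[THEN comp_eq_tail] comp_assoc bip_simps(6)[OF b, THEN comp_eq_tail] idt_left idt_right)
    next
      case False
      have "zarr (((i l)\<^sup>\<circ> \<bullet> i k) \<bullet> z k)" by (rule zarr_comp(2)[OF bip_zero[OF b False]]) simp_all
      moreover have "zarr (z l \<bullet> ((i l)\<^sup>\<circ> \<bullet> i k))"
        by (rule zarr_comp(1)[OF bip_zero[OF b False]]) simp_all
      ultimately show ?thesis
        by (intro zarr_unique) (simp_all add: e(3)[THEN comp_eq_tail] comp_assoc)
    qed
  qed simp_all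
qed

text \<open>Associativity, the unit laws and centrality are compared after projection, which is how
  \<open>M\<close> is given. The Frobenius laws and the symmetry of the cap are compared on pairs of
  injections: a mixed pair makes both sides zero, and an equal pair gives the law of the summand.
  The normaliser is block diagonal, so its positivity follows from that of its blocks.\<close>

lemma nalg_bip:
  assumes hd: has_duals and b: "bip s a i" and ex: "\<And>y. (\<And>k. obj (y k)) \<Longrightarrow> \<exists>t j. bip t y j"
    and n: "\<And>k. nalg (a k) (m k) (u k) (z k)" and ba: "bip_alg s i m u z M U Z"
  shows "nalg s M U Z"
proof -
  note [simp] = bip_simps[OF b] nalg_typing[OF n] bip_alg_laws(1-9)[OF hd b n ba]
  note e = bip_alg_laws(10-18)[OF hd b n ba]
  have fl: "\<And>k. frob (a k) (m k) (u k)" by (rule nalg_typing(1)[OF n])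
  note l = frob_laws[OF fl] nalg_laws[OF n]
  have 1: "M \<bullet> (M \<parallel> \<iota> s) = M \<bullet> (\<iota> s \<parallel> M)"
  proof (rule bip_mono[OF b])
    fix k
    have "(i k)\<^sup>\<circ> \<bullet> M \<bullet> (M \<parallel> \<iota> s) = m k \<bullet> ((m k \<bullet> ((i k)\<^sup>\<circ> \<parallel> (i k)\<^sup>\<circ>)) \<parallel> (i k)\<^sup>\<circ>)"
      by (simp add: e(1)[THEN comp_eq_tail] comp_assoc tens_comp idt_right e(1))
    also have "\<dots> = (m k \<bullet> (m k \<parallel> \<iota> (a k))) \<bullet> ((i k)\<^sup>\<circ> \<parallel> (i k)\<^sup>\<circ> \<parallel> (i k)\<^sup>\<circ>)"
      using tens_comp[of "(i k)\<^sup>\<circ> \<parallel> (i k)\<^sup>\<circ>" "m k" "(i k)\<^sup>\<circ>" "\<iota> (a k)"] by (simp add: comp_assoc idt_left tens_assoc)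
    also have "\<dots> = m k \<bullet> ((i k)\<^sup>\<circ> \<parallel> (m k \<bullet> ((i k)\<^sup>\<circ> \<parallel> (i k)\<^sup>\<circ>)))"
      using tens_comp[of "(i k)\<^sup>\<circ>" "\<iota> (a k)" "(i k)\<^sup>\<circ> \<parallel> (i k)\<^sup>\<circ>" "m k"] by (simp add: l(1) comp_assoc idt_left)
    also have "\<dots> = (i k)\<^sup>\<circ> \<bullet> M \<bullet> (\<iota> s \<parallel> M)"
      by (simp add: e(1)[THEN comp_eq_tail] comp_assoc tens_comp idt_right e(1))
    finally show "(i k)\<^sup>\<circ> \<bullet> M \<bullet> (M \<parallel> \<iota> s) = (i k)\<^sup>\<circ> \<bullet> M \<bullet> (\<iota> s \<parallel> M)" .
  qed simp_all
  have 2: "M \<bullet> (U \<parallel> \<iota> s) = \<iota> s"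
  proof (rule bip_mono[OF b])
    fix k
    have "(i k)\<^sup>\<circ> \<bullet> M \<bullet> (U \<parallel> \<iota> s) = m k \<bullet> (u k \<parallel> (i k)\<^sup>\<circ>)"
      by (simp add: e(1)[THEN comp_eq_tail] comp_assoc tens_comp idt_right e(2))
    also have "u k \<parallel> (i k)\<^sup>\<circ> = (u k \<parallel> \<iota> (a k)) \<bullet> (i k)\<^sup>\<circ>" using slide1[of "u k" "(i k)\<^sup>\<circ>" "a k" "[]"] by simp
    also have "m k \<bullet> (u k \<parallel> \<iota> (a k)) \<bullet> (i k)\<^sup>\<circ> = (i k)\<^sup>\<circ>" by (simp add: l(2)[THEN comp_eq_tail] idt_left)
    finally show "(i k)\<^sup>\<circ> \<bullet> M \<bullet> (U \<parallel> \<iota> s) = (i k)\<^sup>\<circ> \<bullet> \<iota> s" by (simp add: idt_right)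
  qed simp_all
  have 3: "M \<bullet> (\<iota> s \<parallel> U) = \<iota> s"
  proof (rule bip_mono[OF b])
    fix k
    have "(i k)\<^sup>\<circ> \<bullet> M \<bullet> (\<iota> s \<parallel> U) = m k \<bullet> ((i k)\<^sup>\<circ> \<parallel> u k)"
      by (simp add: e(1)[THEN comp_eq_tail] comp_assoc tens_comp idt_right e(2))
    also have "(i k)\<^sup>\<circ> \<parallel> u k = (\<iota> (a k) \<parallel> u k) \<bullet> (i k)\<^sup>\<circ>" using slide2[of "(i k)\<^sup>\<circ>" "u k" "[]" "a k"] by simp
    also have "m k \<bullet> (\<iota> (a k) \<parallel> u k) \<bullet> (i k)\<^sup>\<circ> = (i k)\<^sup>\<circ>" by (simp add: l(3)[THEN comp_eq_tail] idt_left)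
    finally show "(i k)\<^sup>\<circ> \<bullet> M \<bullet> (\<iota> s \<parallel> U) = (i k)\<^sup>\<circ> \<bullet> \<iota> s" by (simp add: idt_right)
  qed simp_all
  have off: "zarr (M\<^sup>\<circ> \<bullet> M \<bullet> (i j \<parallel> i k))" if "j \<noteq> k" for j k
    using zarr_comp(1)[OF e(5)[OF that], of "M\<^sup>\<circ>"] by simp
  have 4: "(M \<parallel> \<iota> s) \<bullet> (\<iota> s \<parallel> M\<^sup>\<circ>) = M\<^sup>\<circ> \<bullet> M"
  proof (rule bip_epi2[OF hd b])
    fix j k
    have *: "((M \<parallel> \<iota> s) \<bullet> (\<iota> s \<parallel> M\<^sup>\<circ>)) \<bullet> (i j \<parallel> i k) = ((M \<bullet> (i j \<parallel> i k)) \<parallel> i k) \<bullet> (\<iota> (a j) \<parallel> (m k)\<^sup>\<circ>)"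
    proof -
      have "((M \<parallel> \<iota> s) \<bullet> (\<iota> s \<parallel> M\<^sup>\<circ>)) \<bullet> (i j \<parallel> i k) = (M \<parallel> \<iota> s) \<bullet> (i j \<parallel> ((i k \<parallel> i k) \<bullet> (m k)\<^sup>\<circ>))"
        by (simp add: comp_assoc tens_comp idt_left e(6))
      also have "i j \<parallel> ((i k \<parallel> i k) \<bullet> (m k)\<^sup>\<circ>) = ((i j \<parallel> i k) \<parallel> i k) \<bullet> (\<iota> (a j) \<parallel> (m k)\<^sup>\<circ>)"
        using tens_comp[of "\<iota> (a j)" "i j" "(m k)\<^sup>\<circ>" "i k \<parallel> i k"] by (simp add: tens_assoc idt_right)
      finally show ?thesis using tens_comp_tail[of "i j \<parallel> i k" M "i k" "\<iota> s"] by (simp add: idt_left)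
    qed
    show "((M \<parallel> \<iota> s) \<bullet> (\<iota> s \<parallel> M\<^sup>\<circ>)) \<bullet> (i j \<parallel> i k) = (M\<^sup>\<circ> \<bullet> M) \<bullet> (i j \<parallel> i k)"
    proof (cases "j = k")
      case True
      have "((i k \<bullet> m k) \<parallel> i k) \<bullet> (\<iota> (a k) \<parallel> (m k)\<^sup>\<circ>) = (i k \<parallel> i k) \<bullet> (m k \<parallel> \<iota> (a k)) \<bullet> (\<iota> (a k) \<parallel> (m k)\<^sup>\<circ>)"
        by (simp add: tens_comp_tail idt_right)
      then show ?thesis unfolding * using True
        by (simp add: e(4) l(4) comp_assoc e(6)[THEN comp_eq_tail])
    next
      case False
      show ?thesis unfolding * comp_assoc[of "i j \<parallel> i k" M "M\<^sup>\<circ>", simplified]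
        by (rule zarr_unique[OF zarr_comp(2)[OF zarr_tens(1)[OF hd e(5)[OF False]]] off[OF False]]) simp_all
    qed
  qed simp_all
  have 5: "(\<iota> s \<parallel> M) \<bullet> (M\<^sup>\<circ> \<parallel> \<iota> s) = M\<^sup>\<circ> \<bullet> M"
  proof (rule bip_epi2[OF hd b])
    fix j k
    have *: "((\<iota> s \<parallel> M) \<bullet> (M\<^sup>\<circ> \<parallel> \<iota> s)) \<bullet> (i j \<parallel> i k) = (i j \<parallel> (M \<bullet> (i j \<parallel> i k))) \<bullet> ((m j)\<^sup>\<circ> \<parallel> \<iota> (a k))"
    proof -
      have "((\<iota> s \<parallel> M) \<bullet> (M\<^sup>\<circ> \<parallel> \<iota> s)) \<bullet> (i j \<parallel> i k) = (\<iota> s \<parallel> M) \<bullet> (((i j \<parallel> i j) \<bullet> (m j)\<^sup>\<circ>) \<parallel> i k)"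
        by (simp add: comp_assoc tens_comp idt_left e(6))
      also have "((i j \<parallel> i j) \<bullet> (m j)\<^sup>\<circ>) \<parallel> i k = (i j \<parallel> (i j \<parallel> i k)) \<bullet> ((m j)\<^sup>\<circ> \<parallel> \<iota> (a k))"
        using tens_comp[of "(m j)\<^sup>\<circ>" "i j \<parallel> i j" "\<iota> (a k)" "i k"] by (simp add: tens_assoc idt_right)
      finally show ?thesis using tens_comp_tail[of "i j" "\<iota> s" "i j \<parallel> i k" M] by (simp add: idt_left)
    qed
    show "((\<iota> s \<parallel> M) \<bullet> (M\<^sup>\<circ> \<parallel> \<iota> s)) \<bullet> (i j \<parallel> i k) = (M\<^sup>\<circ> \<bullet> M) \<bullet> (i j \<parallel> i k)"
    proof (cases "j = k")
      case True
      have "(i k \<parallel> (i k \<bullet> m k)) \<bullet> ((m k)\<^sup>\<circ> \<parallel> \<iota> (a k)) = (i k \<parallel> i k) \<bullet> (\<iota> (a k) \<parallel> m k) \<bullet> ((m k)\<^sup>\<circ> \<parallel> \<iota> (a k))"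
        by (simp add: tens_comp_tail idt_right)
      then show ?thesis unfolding * using True
        by (simp add: e(4) l(5) comp_assoc e(6)[THEN comp_eq_tail])
    next
      case False
      show ?thesis unfolding * comp_assoc[of "i j \<parallel> i k" M "M\<^sup>\<circ>", simplified]
        by (rule zarr_unique[OF zarr_comp(2)[OF zarr_tens(2)[OF hd e(5)[OF False]]] off[OF False]]) simp_all
    qed
  qed simp_all
  have 6: "cap M U \<bullet> \<gamma> s s = cap M U"
  proof (rule bip_epi2[OF hd b])
    fix j k
    have *: "(cap M U \<bullet> \<gamma> s s) \<bullet> (i j \<parallel> i k) = U\<^sup>\<circ> \<bullet> (M \<bullet> (i k \<parallel> i j)) \<bullet> \<gamma> (a j) (a k)"
      using sym_natural[of "i j" "i k"] by (simp add: comp_assoc)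
    show "(cap M U \<bullet> \<gamma> s s) \<bullet> (i j \<parallel> i k) = cap M U \<bullet> (i j \<parallel> i k)"
    proof (cases "j = k")
      case True
      then show ?thesis unfolding * using l(6)[of k]
        by (simp add: comp_assoc e(4) e(4)[THEN comp_eq_tail] e(7)[THEN comp_eq_tail])
    next
      case False
      have "zarr (U\<^sup>\<circ> \<bullet> (M \<bullet> (i k \<parallel> i j)) \<bullet> \<gamma> (a j) (a k))"
        using zarr_comp(1)[OF zarr_comp(2)[OF e(5)[OF False[symmetric]]]] by simp
      moreover have "zarr (U\<^sup>\<circ> \<bullet> M \<bullet> (i j \<parallel> i k))" using zarr_comp(1)[OF e(5)[OF False]] by simp
      ultimately show ?thesis unfolding * by (intro zarr_unique) (simp_all add: comp_assoc)
    qed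
  qed simp_all
  have 7: "Z \<bullet> M = M \<bullet> (Z \<parallel> \<iota> s)"
  proof (rule bip_mono[OF b])
    fix k
    have "(i k)\<^sup>\<circ> \<bullet> Z \<bullet> M = (m k \<bullet> (z k \<parallel> \<iota> (a k))) \<bullet> ((i k)\<^sup>\<circ> \<parallel> (i k)\<^sup>\<circ>)"
      by (simp add: e(3)[THEN comp_eq_tail] comp_assoc e(1) l)
    then show "(i k)\<^sup>\<circ> \<bullet> Z \<bullet> M = (i k)\<^sup>\<circ> \<bullet> M \<bullet> (Z \<parallel> \<iota> s)"
      by (simp add: e(1)[THEN comp_eq_tail] comp_assoc tens_comp idt_right idt_left e(3))
  qed simp_all
  have 8: "Z \<bullet> M = M \<bullet> (\<iota> s \<parallel> Z)"
  proof (rule bip_mono[OF b])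
    fix k
    have "(i k)\<^sup>\<circ> \<bullet> Z \<bullet> M = (m k \<bullet> (\<iota> (a k) \<parallel> z k)) \<bullet> ((i k)\<^sup>\<circ> \<parallel> (i k)\<^sup>\<circ>)"
      by (simp add: e(3)[THEN comp_eq_tail] comp_assoc e(1) l)
    then show "(i k)\<^sup>\<circ> \<bullet> Z \<bullet> M = (i k)\<^sup>\<circ> \<bullet> M \<bullet> (\<iota> s \<parallel> Z)"
      by (simp add: e(1)[THEN comp_eq_tail] comp_assoc tens_comp idt_right idt_left e(3))
  qed simp_all
  have 9: "M \<bullet> M\<^sup>\<circ> \<bullet> Z \<bullet> Z = \<iota> s"
  proof (rule bip_epi[OF b])
    fix k
    have "(M \<bullet> M\<^sup>\<circ> \<bullet> Z \<bullet> Z) \<bullet> i k = i k \<bullet> m k \<bullet> (m k)\<^sup>\<circ> \<bullet> z k \<bullet> z k"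
      by (simp add: comp_assoc e(8) e(8)[THEN comp_eq_tail] e(6)[THEN comp_eq_tail] e(4)[THEN comp_eq_tail])
    then show "(M \<bullet> M\<^sup>\<circ> \<bullet> Z \<bullet> Z) \<bullet> i k = \<iota> s \<bullet> i k" by (simp add: l(9) idt_right idt_left)
  qed simp_all
  have 10: "positive_arr Z"
  proof (rule bip_block_positive[OF b ex, of Z s i a])
    show "positive_arr ((i k)\<^sup>\<circ> \<bullet> Z \<bullet> i k)" for k
      using n[of k] by (simp add: e(8) bip_simps(6)[OF b, THEN comp_eq_tail] idt_left nalg_def)
    show "zarr ((i j)\<^sup>\<circ> \<bullet> Z \<bullet> i k)" if "j \<noteq> k" for j k
      using zarr_comp(2)[OF bip_zero[OF b that], of "z k"] by (simp add: e(8) comp_assoc)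
  qed (use bip_epi[OF b] bip_zero[OF b] in auto)
  show ?thesis unfolding nalg_def frob_def using 1 2 3 4 5 6 7 8 9 10 by simp
qed

text \<open>Multiplying by an element of one summand sees the other factor only through its
  projection to that summand. Hence the Choi morphism is that of the identity of the summand,
  sandwiched with a projection.\<close>

lemma choi_bip_injection:
  assumes hd: has_duals and b: "bip s a i"
    and n: "\<And>k. nalg (a k) (m k) (u k) (z k)" and ba: "bip_alg s i m u z M U Z"
  shows "positive_arr (choi (m k) M (i k))"
proof -
  note [simp] = bip_simps[OF b] nalg_typing[OF n] bip_alg_laws(1-9)[OF hd b n ba]
  have fl: "frob (a k) (m k) (u k)" by (rule nalg_typing(1)[OF n])
  have "choi (m k) M (i k) = (\<iota> (a k) \<parallel> i k) \<bullet> (\<iota> (a k) \<parallel> m k) \<bullet> ((\<iota> (a k @ a k) \<parallel> (i k)\<^sup>\<circ>) \<bullet> ((m k)\<^sup>\<circ> \<parallel> \<iota> s))"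
    by (simp add: choi_right bip_alg_laws(18)[OF hd b n ba] whisker_left comp_assoc idt_tens_tail)
  also have "(\<iota> (a k @ a k) \<parallel> (i k)\<^sup>\<circ>) \<bullet> ((m k)\<^sup>\<circ> \<parallel> \<iota> s) = ((m k)\<^sup>\<circ> \<parallel> \<iota> (a k)) \<bullet> (\<iota> (a k) \<parallel> (i k)\<^sup>\<circ>)"
    by (simp add: slide1 slide2)
  finally have "choi (m k) M (i k) = (\<iota> (a k) \<parallel> (i k)\<^sup>\<circ>)\<^sup>\<circ> \<bullet> ((m k)\<^sup>\<circ> \<bullet> m k) \<bullet> (\<iota> (a k) \<parallel> (i k)\<^sup>\<circ>)"
    by (simp add: dag_tens frob_laws(5)[OF fl, THEN comp_eq_tail] comp_assoc)
  then show ?thesis by (simp only:) (rule positive_sandwich, simp_all add: positive_arr_square)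
qed

text \<open>This is what makes the universal property survive in CP*: a morphism into the biproduct
  is admissible once its components are. Cut along the \<open>s\<close> wire, the Choi morphism has
  the Choi morphisms of the components as diagonal blocks, while an off-diagonal block contains
  \<open>(i j)\<^sup>\<circ> \<bullet> i k\<close> and vanishes.\<close>

lemma choi_bip_pairing:
  assumes hd: has_duals and b: "bip s a i" and ex: "\<And>y. (\<And>k. obj (y k)) \<Longrightarrow> \<exists>t j. bip t y j"
    and n: "\<And>k. nalg (a k) (m k) (u k) (z k)" and ba: "bip_alg s i m u z M U Z"
    and x: "nalg x mx ux zx" and [simp]: "arr h" "dom h = x" "cod h = s"
    and pos: "\<And>k. positive_arr (choi mx (m k) ((i k)\<^sup>\<circ> \<bullet> h))"
  shows "positive_arr (choi mx M h)"
proof -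
  note [simp] = bip_simps[OF b] nalg_typing[OF n] bip_alg_laws(1-9)[OF hd b n ba] nalg_typing[OF x]
  note e = bip_alg_laws(10-18)[OF hd b n ba]
  have blk: "(\<iota> x \<parallel> (i j)\<^sup>\<circ>) \<bullet> choi mx M h \<bullet> (\<iota> x \<parallel> i k)
     = (\<iota> x \<parallel> m j) \<bullet> (\<iota> x \<parallel> ((i j)\<^sup>\<circ> \<bullet> h) \<parallel> ((i j)\<^sup>\<circ> \<bullet> i k)) \<bullet> (mx\<^sup>\<circ> \<parallel> \<iota> (a k))" for j k
  proof -
    have "(\<iota> x \<parallel> (i j)\<^sup>\<circ>) \<bullet> choi mx M h \<bullet> (\<iota> x \<parallel> i k) =
      (\<iota> x \<parallel> ((i j)\<^sup>\<circ> \<bullet> M)) \<bullet> (\<iota> x \<parallel> h \<parallel> \<iota> s) \<bullet> ((mx\<^sup>\<circ> \<parallel> \<iota> s) \<bullet> (\<iota> x \<parallel> i k))"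
      by (simp add: choi_def whisker_left comp_assoc)
    also have "(mx\<^sup>\<circ> \<parallel> \<iota> s) \<bullet> (\<iota> x \<parallel> i k) = (\<iota> x \<parallel> \<iota> x \<parallel> i k) \<bullet> (mx\<^sup>\<circ> \<parallel> \<iota> (a k))"
      by (simp add: slide1 slide2 idt_tens_tail)
    also have "(\<iota> x \<parallel> ((i j)\<^sup>\<circ> \<bullet> M)) \<bullet> (\<iota> x \<parallel> h \<parallel> \<iota> s) \<bullet> (\<iota> x \<parallel> \<iota> x \<parallel> i k) \<bullet> (mx\<^sup>\<circ> \<parallel> \<iota> (a k))
      = (\<iota> x \<parallel> (m j \<bullet> ((i j)\<^sup>\<circ> \<parallel> (i j)\<^sup>\<circ>) \<bullet> (h \<parallel> i k))) \<bullet> (mx\<^sup>\<circ> \<parallel> \<iota> (a k))"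
      by (simp add: e(1) tens_comp tens_comp_tail idt_left idt_right comp_assoc)
    also have "\<dots> = (\<iota> x \<parallel> m j) \<bullet> (\<iota> x \<parallel> ((i j)\<^sup>\<circ> \<bullet> h) \<parallel> ((i j)\<^sup>\<circ> \<bullet> i k)) \<bullet> (mx\<^sup>\<circ> \<parallel> \<iota> (a k))"
      by (simp add: tens_comp) (simp add: whisker_left comp_assoc)
    finally show ?thesis .
  qed
  show ?thesis
  proof (rule bip_block_positive[OF b ex, of "choi mx M h" "x @ s" "\<lambda>k. \<iota> x \<parallel> i k" "\<lambda>k. x @ a k"])
    show "g = g'" if "arr g" "arr g'" "dom g = x @ s" "dom g' = x @ s" "cod g' = cod g"
      "\<And>k. g \<bullet> (\<iota> x \<parallel> i k) = g' \<bullet> (\<iota> x \<parallel> i k)" for g g'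
      using bip_epi_left[OF hd b, of x g g'] that by simp
    show "(\<iota> x \<parallel> i k)\<^sup>\<circ> \<bullet> (\<iota> x \<parallel> i k) = \<iota> (x @ a k)" for k
      by (simp add: dag_tens tens_comp idt_left idt_tens)
    show "zarr ((\<iota> x \<parallel> i j)\<^sup>\<circ> \<bullet> (\<iota> x \<parallel> i k))" if "j \<noteq> k" for j k
      using zarr_tens(2)[OF hd bip_zero[OF b that], of "\<iota> x"] by (simp add: dag_tens tens_comp idt_left)
    show "positive_arr ((\<iota> x \<parallel> i k)\<^sup>\<circ> \<bullet> choi mx M h \<bullet> (\<iota> x \<parallel> i k))" for k
      using pos[of k] by (simp add: dag_tens blk) (simp add: choi_def)
    show "zarr ((\<iota> x \<parallel> i j)\<^sup>\<circ> \<bullet> choi mx M h \<bullet> (\<iota> x \<parallel> i k))" if "j \<noteq> k" for j k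
      using zarr_comp(1)[OF zarr_comp(2)[OF zarr_tens(2)[OF hd zarr_tens(2)[OF hd bip_zero[OF b that]]]],
         of "(i j)\<^sup>\<circ> \<bullet> h" "\<iota> x" "mx\<^sup>\<circ> \<parallel> \<iota> (a k)" "\<iota> x \<parallel> m j"]
      by (simp add: dag_tens blk)
  qed simp_all
qed

text \<open>Every law equates arrows that end in \<open>z\<close> or start in a word
  \<open>z @ c\<close>, so any choice of \<open>m\<close> and \<open>u\<close> is an algebra, and
  the identity normalises it.\<close>

lemma nalg_zero:
  assumes hd: has_duals and z: "zobj z" and [simp]: "arr m" "dom m = z @ z" "cod m = z" "arr u" "dom u = []" "cod u = z"
  shows "nalg z m u (\<iota> z)"
proof -
  have [simp]: "obj z" using z by (simp add: zobj_def)
  have t: "f = g" if "arr f" "arr g" "dom f = z @ c" "dom g = z @ c" "cod g = cod f" "obj c" for f g c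
    by (rule zobj_tens_unique[OF hd z that(6,1,2,3,4,5)])
  show ?thesis unfolding nalg_def frob_def
    using positive_arr_square[of "\<iota> z"]
    by (auto simp: idt_left intro: zobj_unique[OF z] t)
qed

lemma choi_zero:
  assumes hd: has_duals and z: "zobj z" and n: "nalg z m u y" and x: "nalg x mx ux zx"
    and [simp]: "arr f" "dom f = x" "cod f = z"
  shows "positive_arr (choi m mx (f\<^sup>\<circ>))"
proof -
  note [simp] = nalg_typing[OF n] nalg_typing[OF x]
  have "choi m mx (f\<^sup>\<circ>) = \<iota> (z @ x)"
    by (rule zobj_tens_unique[OF hd z, of x]) simp_all
  then show ?thesis using positive_arr_square[of "\<iota> (z @ x)"] by (simp add: idt_left)
qed

end

section \<open>Strictification\<close>

text \<open>Hom-sets need not be disjoint, so source and target are recorded explicitly.\<close>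

datatype ('x, 'a) arrow = Arrow (src: 'x) (mor: 'a) (tgt: 'x)

context dagger_symmetric_monoidal_category
begin

section \<open>Explicitly typed arrows of the given category\<close>

definition acomp :: "('x, 'b) arrow \<Rightarrow> ('x, 'b) arrow \<Rightarrow> ('x, 'b) arrow" (infixr "\<bullet>" 55) where
  "g \<bullet> f = Arrow (src f) (mor g \<cdot> mor f) (tgt g)"
definition adag :: "('x, 'b) arrow \<Rightarrow> ('x, 'b) arrow" ("_\<^sup>\<circ>" [1000] 999) where
  "f\<^sup>\<circ> = Arrow (tgt f) ((mor f)\<^sup>\<dagger>) (src f)"
definition varr :: "('a, 'b) arrow \<Rightarrow> bool" where
  "varr f \<longleftrightarrow> src f \<in> Obj C \<and> tgt f \<in> Obj C \<and> mor f \<in> Hom C (src f) (tgt f)"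
definition vid :: "'a \<Rightarrow> ('a, 'b) arrow" where "vid A = Arrow A (\<one> A) A"
definition vtens :: "('a, 'b) arrow \<Rightarrow> ('a, 'b) arrow \<Rightarrow> ('a, 'b) arrow" (infixr "\<star>" 70) where
  "f \<star> g = Arrow (src f \<odot> src g) (mor f \<otimes> mor g) (tgt f \<odot> tgt g)"
definition va where "va A B D = Arrow ((A \<odot> B) \<odot> D) (\<a> A B D) (A \<odot> (B \<odot> D))"
definition vl where "vl A = Arrow (\<I> \<odot> A) (\<l> A) A"
definition vr where "vr A = Arrow (A \<odot> \<I>) (\<r> A) A"
definition vs where "vs A B = Arrow (A \<odot> B) (\<sigma> A B) (B \<odot> A)"

lemmas vdefs = acomp_def adag_def varr_def vid_def vtens_def va_def vl_def vr_def vs_def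

declare Unit_in_Obj [simp] TensorObj_in_Obj [simp]

lemma acomp_simps [simp]: "src (g \<bullet> f) = src f" "tgt (g \<bullet> f) = tgt g"
  "src (f\<^sup>\<circ>) = tgt f" "tgt (f\<^sup>\<circ>) = src f"
  by (simp_all add: acomp_def adag_def)

lemma v_simps [simp]: "src (vid A) = A" "tgt (vid A) = A"
  "src (f \<star> h) = src f \<odot> src h" "tgt (f \<star> h) = tgt f \<odot> tgt h"
  "src (va A B D) = (A \<odot> B) \<odot> D" "tgt (va A B D) = A \<odot> (B \<odot> D)"
  "src (vl A) = \<I> \<odot> A" "tgt (vl A) = A" "src (vr A) = A \<odot> \<I>" "tgt (vr A) = A"
  "src (vs A B) = A \<odot> B" "tgt (vs A B) = B \<odot> A"
  by (simp_all add: vdefs)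

lemma varr_simps [simp]:
  "\<lbrakk>varr f; varr g; tgt f = src g\<rbrakk> \<Longrightarrow> varr (g \<bullet> f)" "varr f \<Longrightarrow> varr (f\<^sup>\<circ>)"
  "A \<in> Obj C \<Longrightarrow> varr (vid A)" "\<lbrakk>varr f; varr g\<rbrakk> \<Longrightarrow> varr (f \<star> g)"
  "\<lbrakk>A \<in> Obj C; B \<in> Obj C; D \<in> Obj C\<rbrakk> \<Longrightarrow> varr (va A B D)"
  "A \<in> Obj C \<Longrightarrow> varr (vl A)" "A \<in> Obj C \<Longrightarrow> varr (vr A)" "\<lbrakk>A \<in> Obj C; B \<in> Obj C\<rbrakk> \<Longrightarrow> varr (vs A B)"
  using Assoc_unitary LeftUnit_unitary RightUnit_unitary Sym_unitary
  by (auto simp: vdefs unitary_def intro: Comp_in_Hom Dag_in_Hom Id_in_Hom TensorHom_in_Hom)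

lemma varr_obj [simp]: "varr f \<Longrightarrow> src f \<in> Obj C" "varr f \<Longrightarrow> tgt f \<in> Obj C"
  by (simp_all add: varr_def)

lemma v_assoc: "\<lbrakk>varr f; varr g; varr h; tgt f = src g; tgt g = src h\<rbrakk> \<Longrightarrow> (h \<bullet> g) \<bullet> f = h \<bullet> g \<bullet> f"
  unfolding vdefs using Comp_assoc[of "src f" "tgt f" "tgt g" "tgt h" "mor f" "mor g" "mor h"] by simp
lemma v_id: "\<lbrakk>varr f; tgt f = A\<rbrakk> \<Longrightarrow> vid A \<bullet> f = f" "\<lbrakk>varr f; src f = A\<rbrakk> \<Longrightarrow> f \<bullet> vid A = f"
  using Id_left[of "src f" "tgt f" "mor f"] Id_right[of "src f" "tgt f" "mor f"]
  by (cases f; force simp: vdefs)+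
lemma v_dag_dag [simp]: "varr f \<Longrightarrow> (f\<^sup>\<circ>)\<^sup>\<circ> = f"
  using Dag_Dag[of "src f" "tgt f" "mor f"] by (cases f) (simp add: vdefs)
lemma v_dag_id [simp]: "A \<in> Obj C \<Longrightarrow> (vid A)\<^sup>\<circ> = vid A"
  by (simp add: vdefs Dag_Id)
lemma v_dag_comp: "\<lbrakk>varr f; varr g; tgt f = src g\<rbrakk> \<Longrightarrow> (g \<bullet> f)\<^sup>\<circ> = f\<^sup>\<circ> \<bullet> g\<^sup>\<circ>"
  unfolding vdefs using Dag_Comp[of "src f" "tgt f" "tgt g" "mor f" "mor g"] by simp
lemma v_dag_tens: "\<lbrakk>varr f; varr g\<rbrakk> \<Longrightarrow> (f \<star> g)\<^sup>\<circ> = f\<^sup>\<circ> \<star> g\<^sup>\<circ>"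
  unfolding vdefs using Dag_TensorHom[of "src f" "tgt f" "src g" "tgt g" "mor f" "mor g"] by simp
lemma v_tens_id: "\<lbrakk>A \<in> Obj C; B \<in> Obj C\<rbrakk> \<Longrightarrow> vid A \<star> vid B = vid (A \<odot> B)"
  by (simp add: vdefs TensorHom_Id)
lemma v_tens_comp: "\<lbrakk>varr f; varr g; varr f'; varr g'; tgt f = src g; tgt f' = src g'\<rbrakk>
    \<Longrightarrow> (g \<star> g') \<bullet> (f \<star> f') = (g \<bullet> f) \<star> (g' \<bullet> f')"
  unfolding vdefs using TensorHom_Comp[of "src f" "tgt f" "tgt g" "src f'" "tgt f'" "tgt g'"
    "mor f" "mor g" "mor f'" "mor g'"] by simp
lemma v_unitary:
  "\<lbrakk>A \<in> Obj C; B \<in> Obj C; D \<in> Obj C\<rbrakk> \<Longrightarrow> (va A B D)\<^sup>\<circ> \<bullet> va A B D = vid ((A \<odot> B) \<odot> D)"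
  "\<lbrakk>A \<in> Obj C; B \<in> Obj C; D \<in> Obj C\<rbrakk> \<Longrightarrow> va A B D \<bullet> (va A B D)\<^sup>\<circ> = vid (A \<odot> (B \<odot> D))"
  "A \<in> Obj C \<Longrightarrow> (vl A)\<^sup>\<circ> \<bullet> vl A = vid (\<I> \<odot> A)" "A \<in> Obj C \<Longrightarrow> vl A \<bullet> (vl A)\<^sup>\<circ> = vid A"
  "A \<in> Obj C \<Longrightarrow> (vr A)\<^sup>\<circ> \<bullet> vr A = vid (A \<odot> \<I>)" "A \<in> Obj C \<Longrightarrow> vr A \<bullet> (vr A)\<^sup>\<circ> = vid A"
  "\<lbrakk>A \<in> Obj C; B \<in> Obj C\<rbrakk> \<Longrightarrow> (vs A B)\<^sup>\<circ> \<bullet> vs A B = vid (A \<odot> B)"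
  "\<lbrakk>A \<in> Obj C; B \<in> Obj C\<rbrakk> \<Longrightarrow> vs A B \<bullet> (vs A B)\<^sup>\<circ> = vid (B \<odot> A)"
  "\<lbrakk>A \<in> Obj C; B \<in> Obj C\<rbrakk> \<Longrightarrow> vs B A \<bullet> vs A B = vid (A \<odot> B)"
  using Assoc_unitary LeftUnit_unitary RightUnit_unitary Sym_unitary Sym_Sym
  by (simp_all add: vdefs unitary_def)
lemma v_natural:
  "\<lbrakk>varr f; varr g; varr h\<rbrakk> \<Longrightarrow> va (tgt f) (tgt g) (tgt h) \<bullet> ((f \<star> g) \<star> h) = (f \<star> (g \<star> h)) \<bullet> va (src f) (src g) (src h)"
  "varr f \<Longrightarrow> vl (tgt f) \<bullet> (vid \<I> \<star> f) = f \<bullet> vl (src f)"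
  "varr f \<Longrightarrow> vr (tgt f) \<bullet> (f \<star> vid \<I>) = f \<bullet> vr (src f)"
  "\<lbrakk>varr f; varr g\<rbrakk> \<Longrightarrow> vs (tgt f) (tgt g) \<bullet> (f \<star> g) = (g \<star> f) \<bullet> vs (src f) (src g)"
  unfolding vdefs
  using Assoc_natural[of "src f" "src g" "src h" "tgt f" "tgt g" "tgt h" "mor f" "mor g" "mor h"]
     LeftUnit_natural[of "src f" "tgt f"] RightUnit_natural[of "src f" "tgt f"]
     Sym_natural[of "src f" "src g" "tgt f" "tgt g"]
  by simp_all
lemma v_pentagon: "\<lbrakk>A \<in> Obj C; B \<in> Obj C; D \<in> Obj C; E \<in> Obj C\<rbrakk>
      \<Longrightarrow> va A B (D \<odot> E) \<bullet> va (A \<odot> B) D E = (vid A \<star> va B D E) \<bullet> va A (B \<odot> D) E \<bullet> (va A B D \<star> vid E)"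
  by (simp add: vdefs pentagon)
lemma v_triangle: "\<lbrakk>A \<in> Obj C; B \<in> Obj C\<rbrakk> \<Longrightarrow> (vid A \<star> vl B) \<bullet> va A \<I> B = vr A \<star> vid B"
  by (simp add: vdefs triangle)
lemma v_hexagon: "\<lbrakk>A \<in> Obj C; B \<in> Obj C; D \<in> Obj C\<rbrakk>
      \<Longrightarrow> va B D A \<bullet> vs A (B \<odot> D) \<bullet> va A B D = (vid B \<star> vs A D) \<bullet> va B A D \<bullet> (vs A B \<star> vid D)"
  by (simp add: vdefs hexagon)

lemma v_tail: "\<lbrakk>g \<bullet> f = h; varr f; varr g; tgt f = src g; varr e; tgt e = src f\<rbrakk> \<Longrightarrow> g \<bullet> f \<bullet> e = h \<bullet> e"
  by (metis v_assoc)
lemma v_tens_comp_tail: "\<lbrakk>varr f; varr g; varr f'; varr g'; tgt f = src g; tgt f' = src g'; varr e;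
    tgt e = src f \<odot> src f'\<rbrakk> \<Longrightarrow> (g \<star> g') \<bullet> (f \<star> f') \<bullet> e = ((g \<bullet> f) \<star> (g' \<bullet> f')) \<bullet> e"
  by (simp add: v_tens_comp[symmetric] v_assoc)
lemma v_whisker: "\<lbrakk>A \<in> Obj C; varr f; varr g; tgt f = src g\<rbrakk> \<Longrightarrow> vid A \<star> (g \<bullet> f) = (vid A \<star> g) \<bullet> (vid A \<star> f)"
   "\<lbrakk>A \<in> Obj C; varr f; varr g; tgt f = src g\<rbrakk> \<Longrightarrow> (g \<bullet> f) \<star> vid A = (g \<star> vid A) \<bullet> (f \<star> vid A)"
  by (simp_all add: v_tens_comp v_id)

lemma v_mono: "\<lbrakk>k \<bullet> f = k \<bullet> g; k' \<bullet> k = vid (src k); varr k; varr k'; src k' = tgt k; varr f; varr g; tgt f = src k; tgt g = src k\<rbrakk>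
    \<Longrightarrow> f = g"
  by (metis v_assoc v_id(1))
lemma v_epi: "\<lbrakk>f \<bullet> k = g \<bullet> k; k \<bullet> k' = vid (tgt k); varr k; varr k'; tgt k' = src k; varr f; varr g; src f = tgt k; src g = tgt k\<rbrakk>
    \<Longrightarrow> f = g"
  by (metis v_assoc v_id(2))

text \<open>The unitors are natural and invertible. The unit coherences below are proved by first
  tensoring them with \<open>\<I>\<close>, and this removes the extra factor.\<close>

lemma v_unit_faithful:
  assumes [simp]: "varr f" "varr g" "src f = src g" "tgt f = tgt g"
  shows "vid \<I> \<star> f = vid \<I> \<star> g \<Longrightarrow> f = g" "f \<star> vid \<I> = g \<star> vid \<I> \<Longrightarrow> f = g"
proof -
  assume "vid \<I> \<star> f = vid \<I> \<star> g"
  then have "f \<bullet> vl (src g) = g \<bullet> vl (src g)" using v_natural(2)[of f] v_natural(2)[of g] by simp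
  then show "f = g" by (rule v_epi[where k' = "(vl (src g))\<^sup>\<circ>"]) (simp_all add: v_unitary)
next
  assume "f \<star> vid \<I> = g \<star> vid \<I>"
  then have "f \<bullet> vr (src g) = g \<bullet> vr (src g)" using v_natural(3)[of f] v_natural(3)[of g] by simp
  then show "f = g" by (rule v_epi[where k' = "(vr (src g))\<^sup>\<circ>"]) (simp_all add: v_unitary)
qed

text \<open>The unit coherences of Kelly, which the axioms leave to be derived from pentagon and triangle.\<close>

lemma v_left_unit_tens:
  assumes [simp]: "A \<in> Obj C" "B \<in> Obj C"
  shows "vl (A \<odot> B) \<bullet> va \<I> A B = vl A \<star> vid B"
proof (rule v_unit_faithful(1))
  \<comment> \<open>The composite of two sides of the pentagon for \<open>\<I>\<close>,
    \<open>\<I>\<close>, \<open>A\<close>, \<open>B\<close>. Both sides of the claim are rewritten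
    with triangles after precomposition with it, and being invertible it cancels.\<close>
  let ?k = "va \<I> (\<I> \<odot> A) B \<bullet> (va \<I> \<I> A \<star> vid B)"
  have "(vid \<I> \<star> (vl (A \<odot> B) \<bullet> va \<I> A B)) \<bullet> ?k
      = (vid \<I> \<star> vl (A \<odot> B)) \<bullet> va \<I> \<I> (A \<odot> B) \<bullet> va (\<I> \<odot> \<I>) A B"
    by (simp add: v_pentagon v_whisker v_assoc)
  also have "\<dots> = (vr \<I> \<star> (vid A \<star> vid B)) \<bullet> va (\<I> \<odot> \<I>) A B"
    by (simp add: v_triangle[THEN v_tail] v_tens_id)
  also have "\<dots> = va \<I> A B \<bullet> ((vr \<I> \<star> vid A) \<star> vid B)"
    using v_natural(1)[of "vr \<I>" "vid A" "vid B"] by simp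
  also have "\<dots> = va \<I> A B \<bullet> (((vid \<I> \<star> vl A) \<star> vid B) \<bullet> (va \<I> \<I> A \<star> vid B))"
    by (simp add: v_triangle[symmetric] v_whisker)
  also have "\<dots> = (vid \<I> \<star> (vl A \<star> vid B)) \<bullet> ?k"
    using v_natural(1)[of "vid \<I>" "vl A" "vid B", THEN v_tail] by (simp add: v_assoc)
  finally show "vid \<I> \<star> (vl (A \<odot> B) \<bullet> va \<I> A B) = vid \<I> \<star> (vl A \<star> vid B)"
    by (rule v_epi[where k' = "((va \<I> \<I> A)\<^sup>\<circ> \<star> vid B) \<bullet> (va \<I> (\<I> \<odot> A) B)\<^sup>\<circ>"])
      (simp_all add: v_assoc v_tens_comp_tail v_unitary v_id v_tens_id)
qed simp_all

lemma v_right_unit_tens: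
  assumes [simp]: "A \<in> Obj C" "B \<in> Obj C"
  shows "(vid A \<star> vr B) \<bullet> va A B \<I> = vr (A \<odot> B)"
proof (rule v_unit_faithful(2))
  have "va A B \<I> \<bullet> (((vid A \<star> vr B) \<bullet> va A B \<I>) \<star> vid \<I>)
     = (vid A \<star> (vr B \<star> vid \<I>)) \<bullet> va A (B \<odot> \<I>) \<I> \<bullet> (va A B \<I> \<star> vid \<I>)"
    using v_natural(1)[of "vid A" "vr B" "vid \<I>", THEN v_tail] by (simp add: v_whisker v_assoc)
  also have "\<dots> = (vid A \<star> (vid B \<star> vl \<I>)) \<bullet> (va A B (\<I> \<odot> \<I>) \<bullet> va (A \<odot> B) \<I> \<I>)"
    by (simp add: v_pentagon v_triangle[symmetric] v_whisker v_assoc)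
  also have "\<dots> = va A B \<I> \<bullet> (vid (A \<odot> B) \<star> vl \<I>) \<bullet> va (A \<odot> B) \<I> \<I>"
    using v_natural(1)[of "vid A" "vid B" "vl \<I>", THEN v_tail] by (simp add: v_assoc v_tens_id)
  also have "\<dots> = va A B \<I> \<bullet> (vr (A \<odot> B) \<star> vid \<I>)"
    by (simp add: v_triangle)
  finally show "((vid A \<star> vr B) \<bullet> va A B \<I>) \<star> vid \<I> = vr (A \<odot> B) \<star> vid \<I>"
    by (rule v_mono[where k' = "(va A B \<I>)\<^sup>\<circ>"]) (simp_all add: v_unitary)
qed simp_all

lemma v_unit_unit: "vl \<I> = vr \<I>"
proof (rule v_unit_faithful(2))
  have "vl \<I> \<bullet> vl (\<I> \<odot> \<I>) = vl \<I> \<bullet> (vid \<I> \<star> vl \<I>)" using v_natural(2)[of "vl \<I>"] by simp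
  then have "vl (\<I> \<odot> \<I>) = vid \<I> \<star> vl \<I>"
    by (rule v_mono[where k' = "(vl \<I>)\<^sup>\<circ>"]) (simp_all add: v_unitary)
  then show "vl \<I> \<star> vid \<I> = vr \<I> \<star> vid \<I>"
    using v_left_unit_tens[of \<I> \<I>] v_triangle[of \<I> \<I>] by simp
qed simp_all

section \<open>Tensor words and their coherence isomorphisms\<close>

primrec ten :: "'a list \<Rightarrow> 'a" where
  "ten [] = \<I>" | "ten (x # xs) = x \<odot> ten xs"
primrec phi :: "'a list \<Rightarrow> 'a list \<Rightarrow> ('a, 'b) arrow" where
  "phi [] ys = vl (ten ys)"
| "phi (x # xs) ys = (vid x \<star> phi xs ys) \<bullet> va x (ten xs) (ten ys)"

definition objs :: "'a list \<Rightarrow> bool" where "objs xs \<longleftrightarrow> set xs \<subseteq> Obj C"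

lemma objs_simps [simp]: "objs []" "objs (x # xs) \<longleftrightarrow> x \<in> Obj C \<and> objs xs" "objs (xs @ ys) \<longleftrightarrow> objs xs \<and> objs ys"
  by (auto simp: objs_def)
lemma ten_obj [simp]: "objs xs \<Longrightarrow> ten xs \<in> Obj C"
  by (induction xs) auto

lemma phi_typing [simp]:
  "src (phi xs ys) = ten xs \<odot> ten ys" "tgt (phi xs ys) = ten (xs @ ys)"
  "objs xs \<Longrightarrow> objs ys \<Longrightarrow> varr (phi xs ys)"
  by (induction xs) auto

lemma phi_unitary:
  assumes [simp]: "objs ys"
  shows "objs xs \<Longrightarrow> (phi xs ys)\<^sup>\<circ> \<bullet> phi xs ys = vid (ten xs \<odot> ten ys)"
    "objs xs \<Longrightarrow> phi xs ys \<bullet> (phi xs ys)\<^sup>\<circ> = vid (ten (xs @ ys))"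
  by (induction xs) (auto simp: v_unitary v_dag_comp v_dag_tens v_assoc v_tens_comp_tail v_tens_comp
     v_id v_tens_id v_unitary[THEN v_tail])

lemma phi_Nil: "objs xs \<Longrightarrow> phi xs [] = vr (ten xs)"
  by (induction xs) (auto simp: v_unit_unit v_right_unit_tens)

text \<open>This is the reason why the tensor product of words is strictly associative. By induction
  on the first word: the empty word needs the derived left unit coherence, and adding a letter costs
  one pentagon.\<close>

lemma phi_assoc:
  assumes [simp]: "objs ys" "objs zs"
  shows "objs xs \<Longrightarrow> phi (xs @ ys) zs \<bullet> (phi xs ys \<star> vid (ten zs))
     = phi xs (ys @ zs) \<bullet> (vid (ten xs) \<star> phi ys zs) \<bullet> va (ten xs) (ten ys) (ten zs)"
proof (induction xs)
  case Nil
  have "phi ys zs \<bullet> vl (ten ys \<odot> ten zs) = vl (ten (ys @ zs)) \<bullet> (vid \<I> \<star> phi ys zs)"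
    using v_natural(2)[of "phi ys zs"] by simp
  from this[THEN v_tail] show ?case
    by (simp add: v_left_unit_tens[symmetric] v_assoc)
next
  case (Cons x xs)
  then have [simp]: "x \<in> Obj C" "objs xs" and IH: "phi (xs @ ys) zs \<bullet> (phi xs ys \<star> vid (ten zs))
     = phi xs (ys @ zs) \<bullet> (vid (ten xs) \<star> phi ys zs) \<bullet> va (ten xs) (ten ys) (ten zs)" by simp_all
  have "phi ((x # xs) @ ys) zs \<bullet> (phi (x # xs) ys \<star> vid (ten zs))
    = (vid x \<star> phi (xs @ ys) zs) \<bullet> (va x (ten (xs @ ys)) (ten zs) \<bullet> ((vid x \<star> phi xs ys) \<star> vid (ten zs)))
       \<bullet> (va x (ten xs) (ten ys) \<star> vid (ten zs))"
    by (simp add: v_whisker v_assoc)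
  also have "va x (ten (xs @ ys)) (ten zs) \<bullet> ((vid x \<star> phi xs ys) \<star> vid (ten zs))
      = (vid x \<star> (phi xs ys \<star> vid (ten zs))) \<bullet> va x (ten xs \<odot> ten ys) (ten zs)"
    using v_natural(1)[of "vid x" "phi xs ys" "vid (ten zs)"] by simp
  also have "(vid x \<star> phi (xs @ ys) zs) \<bullet> ((vid x \<star> (phi xs ys \<star> vid (ten zs))) \<bullet> va x (ten xs \<odot> ten ys) (ten zs))
       \<bullet> (va x (ten xs) (ten ys) \<star> vid (ten zs))
    = (vid x \<star> (phi (xs @ ys) zs \<bullet> (phi xs ys \<star> vid (ten zs)))) \<bullet> va x (ten xs \<odot> ten ys) (ten zs)
       \<bullet> (va x (ten xs) (ten ys) \<star> vid (ten zs))"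
    by (simp add: v_whisker v_assoc)
  also have "\<dots> = (vid x \<star> phi xs (ys @ zs)) \<bullet> (vid x \<star> (vid (ten xs) \<star> phi ys zs)) \<bullet>
      (va x (ten xs) (ten ys \<odot> ten zs) \<bullet> va (x \<odot> ten xs) (ten ys) (ten zs))"
    unfolding IH by (simp add: v_whisker v_assoc v_pentagon)
  also have "\<dots> = (vid x \<star> phi xs (ys @ zs)) \<bullet> va x (ten xs) (ten (ys @ zs)) \<bullet>
       (vid (x \<odot> ten xs) \<star> phi ys zs) \<bullet> va (x \<odot> ten xs) (ten ys) (ten zs)"
    using v_natural(1)[of "vid x" "vid (ten xs)" "phi ys zs", symmetric, THEN v_tail]
    by (simp add: v_tens_id v_assoc)
  finally show ?case by (simp add: v_assoc)
qed

end

text \<open>A tree is a bracketing of a tensor word. \<open>Tr t f s F\<close> below says that \<open>F\<close> is the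
  strictification of \<open>f: ev t \<rightarrow> ev s\<close>.\<close>

datatype 'x tree = Ut | Lf 'x | Nd "'x tree" "'x tree"

context dagger_symmetric_monoidal_category
begin

section \<open>The strict category of tensor words\<close>

definition und :: "('a list, 'b) arrow \<Rightarrow> ('a, 'b) arrow" where
  "und f = Arrow (ten (src f)) (mor f) (ten (tgt f))"
definition sarr :: "('a list, 'b) arrow \<Rightarrow> bool" where
  "sarr f \<longleftrightarrow> objs (src f) \<and> objs (tgt f) \<and> varr (und f)"
definition sid :: "'a list \<Rightarrow> ('a list, 'b) arrow" where
  "sid xs = Arrow xs (\<one> (ten xs)) xs"
definition stens :: "('a list, 'b) arrow \<Rightarrow> ('a list, 'b) arrow \<Rightarrow> ('a list, 'b) arrow" (infixr "\<parallel>" 70) where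
  "f \<parallel> g = Arrow (src f @ src g)
    (mor (phi (tgt f) (tgt g) \<bullet> (und f \<star> und g) \<bullet> (phi (src f) (src g))\<^sup>\<circ>)) (tgt f @ tgt g)"
definition ssym :: "'a list \<Rightarrow> 'a list \<Rightarrow> ('a list, 'b) arrow" where
  "ssym xs ys = Arrow (xs @ ys) (mor (phi ys xs \<bullet> vs (ten xs) (ten ys) \<bullet> (phi xs ys)\<^sup>\<circ>)) (ys @ xs)"

lemma s_simps [simp]: "src (sid xs) = xs" "tgt (sid xs) = xs" "src (f \<parallel> g) = src f @ src g"
  "tgt (f \<parallel> g) = tgt f @ tgt g" "src (ssym xs ys) = xs @ ys" "tgt (ssym xs ys) = ys @ xs"
  "src (und f) = ten (src f)" "tgt (und f) = ten (tgt f)"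
  by (simp_all add: sid_def stens_def ssym_def und_def)

lemma Arrow_mor: "src F = A \<Longrightarrow> tgt F = B \<Longrightarrow> Arrow A (mor F) B = F"
  by (cases F) simp

lemma und_simps [simp]: "und (g \<bullet> f) = und g \<bullet> und f" "und (f\<^sup>\<circ>) = (und f)\<^sup>\<circ>" "und (sid xs) = vid (ten xs)"
  "und (f \<parallel> g) = phi (tgt f) (tgt g) \<bullet> (und f \<star> und g) \<bullet> (phi (src f) (src g))\<^sup>\<circ>"
  "und (ssym xs ys) = phi ys xs \<bullet> vs (ten xs) (ten ys) \<bullet> (phi xs ys)\<^sup>\<circ>"
proof -
  show "und (g \<bullet> f) = und g \<bullet> und f" "und (f\<^sup>\<circ>) = (und f)\<^sup>\<circ>" "und (sid xs) = vid (ten xs)"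
    by (simp_all add: und_def acomp_def adag_def vid_def sid_def)
  show "und (f \<parallel> g) = phi (tgt f) (tgt g) \<bullet> (und f \<star> und g) \<bullet> (phi (src f) (src g))\<^sup>\<circ>"
    unfolding und_def[of "f \<parallel> g"] by (simp add: stens_def Arrow_mor)
  show "und (ssym xs ys) = phi ys xs \<bullet> vs (ten xs) (ten ys) \<bullet> (phi xs ys)\<^sup>\<circ>"
    unfolding und_def[of "ssym xs ys"] by (simp add: ssym_def Arrow_mor)
qed

lemma sarr_objs [simp]: "sarr f \<Longrightarrow> objs (src f)" "sarr f \<Longrightarrow> objs (tgt f)" "sarr f \<Longrightarrow> varr (und f)"
  by (simp_all add: sarr_def)

text \<open>All strict axioms are checked on the realisations \<open>und\<close>. The endpoints are
  compared as words in addition, since different words may have the same tensor product.\<close>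

lemma s_eqI: "\<lbrakk>src f = src g; tgt f = tgt g; und f = und g\<rbrakk> \<Longrightarrow> f = g"
  by (cases f; cases g) (simp add: und_def)

lemma sarr_simps [simp]:
  "\<lbrakk>sarr f; sarr g; tgt f = src g\<rbrakk> \<Longrightarrow> sarr (g \<bullet> f)" "sarr f \<Longrightarrow> sarr (f\<^sup>\<circ>)"
  "objs xs \<Longrightarrow> sarr (sid xs)" "\<lbrakk>sarr f; sarr g\<rbrakk> \<Longrightarrow> sarr (f \<parallel> g)"
  "\<lbrakk>objs xs; objs ys\<rbrakk> \<Longrightarrow> sarr (ssym xs ys)"
  unfolding sarr_def by auto

lemmas phi_tail = phi_unitary[THEN v_tail]

text \<open>\<open>phi_assoc\<close> on the target side and its adjoint on the source side leave one
  associator and its adjoint, which cancel by naturality.\<close>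

lemma stens_assoc:
  assumes [simp]: "sarr f" "sarr g" "sarr h"
  shows "(f \<parallel> g) \<parallel> h = f \<parallel> g \<parallel> h"
proof (rule s_eqI)
  let ?d = "va (ten (src f)) (ten (src g)) (ten (src h))"
  let ?c = "va (ten (tgt f)) (ten (tgt g)) (ten (tgt h))"
  have d: "((phi (src f) (src g))\<^sup>\<circ> \<star> vid (ten (src h))) \<bullet> (phi (src f @ src g) (src h))\<^sup>\<circ> =
     ?d\<^sup>\<circ> \<bullet> (vid (ten (src f)) \<star> (phi (src g) (src h))\<^sup>\<circ>) \<bullet> (phi (src f) (src g @ src h))\<^sup>\<circ>"
    using arg_cong[OF phi_assoc[of "src g" "src h" "src f"], of adag]
    by (simp add: v_dag_comp v_dag_tens v_assoc)
  have "und ((f \<parallel> g) \<parallel> h) = (phi (tgt f @ tgt g) (tgt h) \<bullet> (phi (tgt f) (tgt g) \<star> vid (ten (tgt h)))) \<bullet>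
     ((und f \<star> und g) \<star> und h) \<bullet> ((phi (src f) (src g))\<^sup>\<circ> \<star> vid (ten (src h))) \<bullet> (phi (src f @ src g) (src h))\<^sup>\<circ>"
    by (simp add: v_assoc v_tens_comp_tail v_id)
  also have "\<dots> = phi (tgt f) (tgt g @ tgt h) \<bullet> (vid (ten (tgt f)) \<star> phi (tgt g) (tgt h)) \<bullet>
     (?c \<bullet> ((und f \<star> und g) \<star> und h)) \<bullet> ?d\<^sup>\<circ> \<bullet> (vid (ten (src f)) \<star> (phi (src g) (src h))\<^sup>\<circ>) \<bullet> (phi (src f) (src g @ src h))\<^sup>\<circ>"
    unfolding d phi_assoc[of "tgt g" "tgt h" "tgt f", simplified] by (simp add: v_assoc phi_assoc)
  also have "?c \<bullet> ((und f \<star> und g) \<star> und h) = (und f \<star> (und g \<star> und h)) \<bullet> ?d"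
    using v_natural(1)[of "und f" "und g" "und h"] by simp
  also have "phi (tgt f) (tgt g @ tgt h) \<bullet> (vid (ten (tgt f)) \<star> phi (tgt g) (tgt h)) \<bullet>
     ((und f \<star> (und g \<star> und h)) \<bullet> ?d) \<bullet> ?d\<^sup>\<circ> \<bullet> (vid (ten (src f)) \<star> (phi (src g) (src h))\<^sup>\<circ>) \<bullet> (phi (src f) (src g @ src h))\<^sup>\<circ>
    = und (f \<parallel> g \<parallel> h)"
    by (simp add: v_assoc v_unitary[THEN v_tail] v_tens_comp_tail v_id)
  finally show "und ((f \<parallel> g) \<parallel> h) = und (f \<parallel> g \<parallel> h)" .
qed simp_all

lemma ssym_append:
  assumes [simp]: "objs a" "objs b" "objs c"
  shows "ssym a (b @ c) = (sid b \<parallel> ssym a c) \<bullet> (ssym a b \<parallel> sid c)"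
proof (rule s_eqI)
  let ?A = "ten a" and ?B = "ten b" and ?C = "ten c"
  \<comment> \<open>The coherence maps between the two crossings collapse to the single associator
    that the hexagon has in this place.\<close>
  have 1: "(vid ?B \<star> (phi a c)\<^sup>\<circ>) \<bullet> (phi b (a @ c))\<^sup>\<circ> \<bullet> phi (b @ a) c \<bullet> (phi b a \<star> vid ?C) = va ?B ?A ?C"
    by (simp add: phi_assoc phi_tail v_id v_tens_comp_tail phi_unitary v_tens_id)
  have 2: "((phi a b)\<^sup>\<circ> \<star> vid ?C) \<bullet> (phi (a @ b) c)\<^sup>\<circ> =
     (va ?A ?B ?C)\<^sup>\<circ> \<bullet> (vid ?A \<star> (phi b c)\<^sup>\<circ>) \<bullet> (phi a (b @ c))\<^sup>\<circ>"
    using arg_cong[OF phi_assoc[of b c a], of adag] by (simp add: v_dag_comp v_dag_tens v_assoc)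
  have "und ((sid b \<parallel> ssym a c) \<bullet> (ssym a b \<parallel> sid c)) =
     phi b (c @ a) \<bullet> (vid ?B \<star> phi c a) \<bullet> (vid ?B \<star> vs ?A ?C) \<bullet>
      ((vid ?B \<star> (phi a c)\<^sup>\<circ>) \<bullet> (phi b (a @ c))\<^sup>\<circ> \<bullet> phi (b @ a) c \<bullet> (phi b a \<star> vid ?C)) \<bullet>
      (vs ?A ?B \<star> vid ?C) \<bullet> ((phi a b)\<^sup>\<circ> \<star> vid ?C) \<bullet> (phi (a @ b) c)\<^sup>\<circ>"
    by (simp add: v_whisker v_assoc)
  also have "\<dots> = phi b (c @ a) \<bullet> (vid ?B \<star> phi c a) \<bullet> ((vid ?B \<star> vs ?A ?C) \<bullet> va ?B ?A ?C \<bullet>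
      (vs ?A ?B \<star> vid ?C)) \<bullet> (va ?A ?B ?C)\<^sup>\<circ> \<bullet> (vid ?A \<star> (phi b c)\<^sup>\<circ>) \<bullet> (phi a (b @ c))\<^sup>\<circ>"
    unfolding 1 2 by (simp add: v_assoc)
  also have "\<dots> = (phi (b @ c) a \<bullet> (phi b c \<star> vid ?A)) \<bullet> vs ?A (?B \<odot> ?C) \<bullet>
      (vid ?A \<star> (phi b c)\<^sup>\<circ>) \<bullet> (phi a (b @ c))\<^sup>\<circ>"
    unfolding v_hexagon[OF ten_obj[OF assms(1)] ten_obj[OF assms(2)] ten_obj[OF assms(3)], symmetric]
    by (simp add: v_assoc phi_assoc v_unitary[THEN v_tail] v_id)
  also have "\<dots> = phi (b @ c) a \<bullet> vs ?A (ten (b @ c)) \<bullet> (phi a (b @ c))\<^sup>\<circ>"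
    using v_natural(4)[of "vid ?A" "phi b c", symmetric, THEN v_tail]
    by (simp add: v_assoc v_tens_comp_tail phi_unitary v_id v_tens_id)
  finally show "und (ssym a (b @ c)) = und ((sid b \<parallel> ssym a c) \<bullet> (ssym a b \<parallel> sid c))"
    by simp
qed simp_all

sublocale S: strict_dsmc objs sarr src tgt sid acomp stens adag ssym
proof
  fix f g f' g' h :: "('a list, 'b) arrow" and a b c :: "'a list"
  show "objs [] " "objs (a @ b) \<longleftrightarrow> objs a \<and> objs b" by simp_all
  show "sarr f \<Longrightarrow> objs (src f)" "sarr f \<Longrightarrow> objs (tgt f)" by simp_all
  show "objs a \<Longrightarrow> sarr (sid a)" "src (sid a) = a" "tgt (sid a) = a" by simp_all
  show "\<lbrakk>sarr f; sarr g; tgt f = src g\<rbrakk> \<Longrightarrow> sarr (g \<bullet> f)" by simp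
  show "src (g \<bullet> f) = src f" "tgt (g \<bullet> f) = tgt g" by simp_all
  show "\<lbrakk>sarr f; sarr g; sarr h; tgt f = src g; tgt g = src h\<rbrakk> \<Longrightarrow> (h \<bullet> g) \<bullet> f = h \<bullet> g \<bullet> f"
    by (rule s_eqI) (simp_all add: v_assoc)
  show "\<lbrakk>sarr f; tgt f = a\<rbrakk> \<Longrightarrow> sid a \<bullet> f = f" "\<lbrakk>sarr f; src f = a\<rbrakk> \<Longrightarrow> f \<bullet> sid a = f"
    by (rule s_eqI; simp add: v_id)+
  show "sarr f \<Longrightarrow> sarr (f\<^sup>\<circ>)" "src (f\<^sup>\<circ>) = tgt f" "tgt (f\<^sup>\<circ>) = src f" by simp_all
  show "sarr f \<Longrightarrow> (f\<^sup>\<circ>)\<^sup>\<circ> = f" by (rule s_eqI) simp_all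
  show "objs a \<Longrightarrow> (sid a)\<^sup>\<circ> = sid a" by (rule s_eqI) simp_all
  show "\<lbrakk>sarr f; sarr g; tgt f = src g\<rbrakk> \<Longrightarrow> (g \<bullet> f)\<^sup>\<circ> = f\<^sup>\<circ> \<bullet> g\<^sup>\<circ>"
    by (rule s_eqI) (simp_all add: v_dag_comp)
  show "\<lbrakk>sarr f; sarr g\<rbrakk> \<Longrightarrow> sarr (f \<parallel> g)" "src (f \<parallel> g) = src f @ src g" "tgt (f \<parallel> g) = tgt f @ tgt g"
    by simp_all
  show "\<lbrakk>sarr f; sarr g\<rbrakk> \<Longrightarrow> (f \<parallel> g)\<^sup>\<circ> = f\<^sup>\<circ> \<parallel> g\<^sup>\<circ>"
    by (rule s_eqI) (simp_all add: v_dag_comp v_dag_tens v_assoc)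
  show "\<lbrakk>objs a; objs b\<rbrakk> \<Longrightarrow> sid a \<parallel> sid b = sid (a @ b)"
    by (rule s_eqI) (simp_all add: v_tens_id v_id phi_unitary)
  show "\<lbrakk>sarr f; sarr g; sarr f'; sarr g'; tgt f = src g; tgt f' = src g'\<rbrakk>
      \<Longrightarrow> (g \<parallel> g') \<bullet> (f \<parallel> f') = (g \<bullet> f) \<parallel> (g' \<bullet> f')"
    by (rule s_eqI) (simp_all add: v_assoc phi_tail v_id v_tens_comp_tail)
  show "\<lbrakk>sarr f; sarr g; sarr h\<rbrakk> \<Longrightarrow> (f \<parallel> g) \<parallel> h = f \<parallel> g \<parallel> h" by (rule stens_assoc)
  show "sid [] \<parallel> f = f" if [simp]: "sarr f"
  proof (rule s_eqI)
    show "und (sid [] \<parallel> f) = und f"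
      using v_natural(2)[of "und f", THEN v_tail] by (simp add: v_unitary v_id v_assoc)
  qed simp_all
  show "f \<parallel> sid [] = f" if [simp]: "sarr f"
  proof (rule s_eqI)
    show "und (f \<parallel> sid []) = und f"
      using v_natural(3)[of "und f", THEN v_tail] by (simp add: phi_Nil v_unitary v_id v_assoc)
  qed simp_all
  show "\<lbrakk>objs a; objs b\<rbrakk> \<Longrightarrow> sarr (ssym a b)" "src (ssym a b) = a @ b" "tgt (ssym a b) = b @ a" by simp_all
  \<comment> \<open>The opposite crossing and the dagger are both inverse to \<open>vs A B\<close>,
    so they coincide.\<close>
  have vsd: "(vs A B)\<^sup>\<circ> = vs B A" if [simp]: "A \<in> Obj C" "B \<in> Obj C" for A B
    by (rule v_epi[where k = "vs A B" and k' = "(vs A B)\<^sup>\<circ>"]) (simp_all add: v_unitary)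
  show "\<lbrakk>objs a; objs b\<rbrakk> \<Longrightarrow> (ssym a b)\<^sup>\<circ> = ssym b a"
    by (rule s_eqI) (simp_all add: v_dag_comp v_assoc vsd)
  show "\<lbrakk>objs a; objs b\<rbrakk> \<Longrightarrow> ssym b a \<bullet> ssym a b = sid (a @ b)"
    by (rule s_eqI) (simp_all add: v_assoc phi_tail phi_unitary v_id v_unitary[THEN v_tail])
  show "ssym (tgt f) (tgt g) \<bullet> (f \<parallel> g) = (g \<parallel> f) \<bullet> ssym (src f) (src g)" if [simp]: "sarr f" "sarr g"
    using v_natural(4)[of "und f" "und g", THEN v_tail]
    by (intro s_eqI) (simp_all add: v_assoc phi_tail v_id)
  show "\<lbrakk>objs a; objs b; objs c\<rbrakk> \<Longrightarrow> ssym a (b @ c) = (sid b \<parallel> ssym a c) \<bullet> (ssym a b \<parallel> sid c)"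
    by (rule ssym_append)
qed

section \<open>Translation of bracketed morphisms into the strict category\<close>

primrec ev :: "'a tree \<Rightarrow> 'a" where
  "ev Ut = \<I>" | "ev (Lf A) = A" | "ev (Nd t s) = ev t \<odot> ev s"
primrec fl :: "'x tree \<Rightarrow> 'x list" where
  "fl Ut = []" | "fl (Lf A) = [A]" | "fl (Nd t s) = fl t @ fl s"
text \<open>A one-letter word is realised as \<open>A \<odot> \<I>\<close> and not as
  \<open>A\<close>, hence the unitor at a leaf.\<close>

primrec can :: "'a tree \<Rightarrow> ('a, 'b) arrow" where
  "can Ut = vid \<I>" | "can (Lf A) = (vr A)\<^sup>\<circ>" | "can (Nd t s) = phi (fl t) (fl s) \<bullet> (can t \<star> can s)"

lemma ev_obj [simp]: "objs (fl t) \<Longrightarrow> ev t \<in> Obj C"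
  by (induction t) auto

lemma can_typing [simp]: "src (can t) = ev t" "tgt (can t) = ten (fl t)" "objs (fl t) \<Longrightarrow> varr (can t)"
  by (induction t) auto

lemma can_unitary: "objs (fl t) \<Longrightarrow> (can t)\<^sup>\<circ> \<bullet> can t = vid (ev t)"
   "objs (fl t) \<Longrightarrow> can t \<bullet> (can t)\<^sup>\<circ> = vid (ten (fl t))"
  by (induction t) (auto simp: v_id v_unitary v_dag_comp v_dag_tens v_assoc phi_tail v_tens_comp v_tens_id
      v_tens_comp_tail phi_unitary)

definition tr :: "'a tree \<Rightarrow> 'a tree \<Rightarrow> 'b \<Rightarrow> ('a list, 'b) arrow" where
  "tr t s f = Arrow (fl t) (mor (can s \<bullet> Arrow (ev t) f (ev s) \<bullet> (can t)\<^sup>\<circ>)) (fl s)"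

definition Tr :: "'a tree \<Rightarrow> 'b \<Rightarrow> 'a tree \<Rightarrow> ('a list, 'b) arrow \<Rightarrow> bool" where
  "Tr t f s F \<longleftrightarrow> objs (fl t) \<and> objs (fl s) \<and> f \<in> Hom C (ev t) (ev s) \<and> F = tr t s f"

lemma tr_simps [simp]: "src (tr t s f) = fl t" "tgt (tr t s f) = fl s"
  by (simp_all add: tr_def)

lemma und_tr: "und (tr t s f) = can s \<bullet> Arrow (ev t) f (ev s) \<bullet> (can t)\<^sup>\<circ>"
  unfolding und_def by (simp add: tr_def Arrow_mor)

lemma Tr_iff: "Tr t f s F \<longleftrightarrow> objs (fl t) \<and> objs (fl s) \<and> varr (Arrow (ev t) f (ev s)) \<and> src F = fl t \<and>
    tgt F = fl s \<and> und F = can s \<bullet> Arrow (ev t) f (ev s) \<bullet> (can t)\<^sup>\<circ>"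
proof -
  have "F = tr t s f" if "src F = fl t" "tgt F = fl s" "und F = can s \<bullet> Arrow (ev t) f (ev s) \<bullet> (can t)\<^sup>\<circ>"
  proof (rule s_eqI)
    show "src F = src (tr t s f)" "tgt F = tgt (tr t s f)" using that by simp_all
    show "und F = und (tr t s f)" unfolding und_tr by (rule that)
  qed
  then show ?thesis
    by (auto simp: Tr_def und_tr varr_def simp del: varr_obj)
qed

lemma tr_typing: assumes "Tr t f s F"
  shows "objs (fl t)" "objs (fl s)" "f \<in> Hom C (ev t) (ev s)" "sarr F" "src F = fl t" "tgt F = fl s"
proof -
  show "objs (fl t)" "objs (fl s)" "src F = fl t" "tgt F = fl s" using assms by (simp_all add: Tr_iff)
  show "f \<in> Hom C (ev t) (ev s)" using assms by (simp add: Tr_def)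
  show "sarr F" using assms unfolding Tr_iff sarr_def by auto
qed

lemma Tr_comp: assumes "Tr t f r F" "Tr r g s G" shows "Tr t (g \<cdot> f) s (G \<bullet> F)"
proof -
  have a: "Arrow (ev t) (g \<cdot> f) (ev s) = Arrow (ev r) g (ev s) \<bullet> Arrow (ev t) f (ev r)" by (simp add: acomp_def)
  show ?thesis using assms unfolding Tr_iff a
    by (simp add: v_assoc can_unitary[THEN v_tail] v_id)
qed

lemma Tr_tens: assumes "Tr t f s F" "Tr t' f' s' F'" shows "Tr (Nd t t') (f \<otimes> f') (Nd s s') (F \<parallel> F')"
proof -
  have a: "Arrow (ev t \<odot> ev t') (f \<otimes> f') (ev s \<odot> ev s') = Arrow (ev t) f (ev s) \<star> Arrow (ev t') f' (ev s')"
    by (simp add: vtens_def)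
  show ?thesis using assms unfolding Tr_iff
    by (simp add: a v_assoc v_tens_comp_tail v_dag_comp v_dag_tens)
qed

lemma Tr_dag: assumes "Tr t f s F" shows "Tr s (f\<^sup>\<dagger>) t (F\<^sup>\<circ>)"
proof -
  have a: "Arrow (ev s) (f\<^sup>\<dagger>) (ev t) = (Arrow (ev t) f (ev s))\<^sup>\<circ>" by (simp add: adag_def)
  show ?thesis using assms unfolding Tr_iff a by (simp add: v_assoc v_dag_comp)
qed

definition tree :: "'a tree \<Rightarrow> 'a \<Rightarrow> bool" where
  "tree t A \<longleftrightarrow> objs (fl t) \<and> ev t = A"

lemma tree_intros: "tree Ut \<I>" "A \<in> Obj C \<Longrightarrow> tree (Lf A) A" "\<lbrakk>tree t A; tree s B\<rbrakk> \<Longrightarrow> tree (Nd t s) (A \<odot> B)"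
  by (simp_all add: tree_def)

lemma Tr_id: "tree t A \<Longrightarrow> Tr t (\<one> A) t (sid (fl t))"
  using v_id(1)[of "(can t)\<^sup>\<circ>"] by (auto simp: Tr_iff tree_def can_unitary simp flip: vid_def)

text \<open>Rebracketing does not change the word, and the canonical maps of the two bracketings
  differ precisely by the associator, so the associator is translated to an identity.\<close>

lemma Tr_assoc: assumes "tree t A" "tree s B" "tree r D"
  shows "Tr (Nd (Nd t s) r) (\<a> A B D) (Nd t (Nd s r)) (sid (fl t @ fl s @ fl r))"
proof -
  have [simp]: "objs (fl t)" "objs (fl s)" "objs (fl r)" "ev t = A" "ev s = B" "ev r = D"
    using assms by (auto simp: tree_def)
  have [simp]: "A \<in> Obj C" "B \<in> Obj C" "D \<in> Obj C"
    using ev_obj[of t] ev_obj[of s] ev_obj[of r] by simp_all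
  have "can (Nd t (Nd s r)) \<bullet> va A B D = phi (fl t) (fl s @ fl r) \<bullet> (vid (ten (fl t)) \<star> phi (fl s) (fl r)) \<bullet>
     (can t \<star> (can s \<star> can r)) \<bullet> va A B D"
    by (simp add: v_assoc v_tens_comp_tail v_id)
  also have "\<dots> = (phi (fl t) (fl s @ fl r) \<bullet> (vid (ten (fl t)) \<star> phi (fl s) (fl r)) \<bullet>
      va (ten (fl t)) (ten (fl s)) (ten (fl r))) \<bullet> ((can t \<star> can s) \<star> can r)"
    using v_natural(1)[of "can t" "can s" "can r"] by (simp add: v_assoc)
  also have "\<dots> = can (Nd (Nd t s) r)"
    by (simp add: phi_assoc[symmetric]) (simp add: v_assoc v_tens_comp v_id)
  finally have "can (Nd t (Nd s r)) \<bullet> va A B D = can (Nd (Nd t s) r)" .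
  from this[THEN v_tail, of "(can (Nd (Nd t s) r))\<^sup>\<circ>"]
  have "can (Nd t (Nd s r)) \<bullet> va A B D \<bullet> (can (Nd (Nd t s) r))\<^sup>\<circ> = vid (ten (fl t @ fl s @ fl r))"
    using can_unitary(2)[of "Nd (Nd t s) r"] by simp
  moreover have "varr (Arrow (ev (Nd (Nd t s) r)) (\<a> A B D) (ev (Nd t (Nd s r))))"
    using varr_simps(5)[of A B D] by (simp add: va_def del: varr_simps)
  ultimately show ?thesis unfolding Tr_iff by (simp add: va_def)
qed

lemma Tr_left: assumes "tree t A" shows "Tr (Nd Ut t) (\<l> A) t (sid (fl t))"
proof -
  have [simp]: "objs (fl t)" "ev t = A" using assms by (auto simp: tree_def)
  have [simp]: "A \<in> Obj C" using ev_obj[of t] by simp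
  have "can t \<bullet> vl A \<bullet> (can (Nd Ut t))\<^sup>\<circ> = vid (ten (fl t))"
    using v_natural(2)[of "can t", symmetric, THEN v_tail]
    by (simp add: v_dag_comp v_dag_tens v_tens_comp_tail can_unitary v_id v_tens_id v_unitary v_assoc)
  moreover have "varr (Arrow (ev (Nd Ut t)) (\<l> A) (ev t))"
    using varr_simps(6)[of A] by (simp add: vl_def del: varr_simps)
  ultimately show ?thesis unfolding Tr_iff by (simp add: vl_def)
qed

lemma Tr_right: assumes "tree t A" shows "Tr (Nd t Ut) (\<r> A) t (sid (fl t))"
proof -
  have [simp]: "objs (fl t)" "ev t = A" using assms by (auto simp: tree_def)
  have [simp]: "A \<in> Obj C" using ev_obj[of t] by simp
  have "can t \<bullet> vr A \<bullet> (can (Nd t Ut))\<^sup>\<circ> = vid (ten (fl t))"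
    using v_natural(3)[of "can t", symmetric, THEN v_tail]
    by (simp add: v_dag_comp v_dag_tens v_tens_comp_tail can_unitary v_id v_tens_id v_unitary phi_Nil v_assoc)
  moreover have "varr (Arrow (ev (Nd t Ut)) (\<r> A) (ev t))"
    using varr_simps(7)[of A] by (simp add: vr_def del: varr_simps)
  ultimately show ?thesis unfolding Tr_iff by (simp add: vr_def)
qed

lemma Tr_sym: assumes "tree t A" "tree s B" shows "Tr (Nd t s) (\<sigma> A B) (Nd s t) (ssym (fl t) (fl s))"
proof -
  have [simp]: "objs (fl t)" "objs (fl s)" "ev t = A" "ev s = B"
    using assms by (auto simp: tree_def)
  have [simp]: "A \<in> Obj C" "B \<in> Obj C"
    using ev_obj[of t] ev_obj[of s] by simp_all
  have "can (Nd s t) \<bullet> vs A B \<bullet> (can (Nd t s))\<^sup>\<circ> = und (ssym (fl t) (fl s))"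
    using v_natural(4)[of "can t" "can s", symmetric, THEN v_tail]
    by (simp add: v_assoc v_dag_comp v_dag_tens v_tens_comp_tail can_unitary v_id v_tens_id)
  moreover have "varr (Arrow (ev (Nd t s)) (\<sigma> A B) (ev (Nd s t)))"
    using varr_simps(8)[of A B] by (simp add: vs_def del: varr_simps)
  ultimately show ?thesis unfolding Tr_iff by (simp add: vs_def)
qed

lemmas Tr_intros = Tr_comp Tr_tens Tr_dag Tr_id Tr_assoc Tr_left Tr_right Tr_sym tree_intros

text \<open>The canonical maps are invertible, so translation is injective between fixed
  bracketings. Equations can thus be transported in both directions.\<close>

lemma Tr_eq_iff: assumes "Tr t f s F" "Tr t g s G" shows "f = g \<longleftrightarrow> F = G"
proof
  have [simp]: "objs (fl t)" "objs (fl s)" "varr (Arrow (ev t) f (ev s))" "varr (Arrow (ev t) g (ev s))"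
    using assms by (simp_all add: Tr_iff)
  assume "F = G"
  then have "can s \<bullet> Arrow (ev t) f (ev s) \<bullet> (can t)\<^sup>\<circ> = can s \<bullet> Arrow (ev t) g (ev s) \<bullet> (can t)\<^sup>\<circ>"
    using assms by (simp add: Tr_iff)
  then have "Arrow (ev t) f (ev s) \<bullet> (can t)\<^sup>\<circ> = Arrow (ev t) g (ev s) \<bullet> (can t)\<^sup>\<circ>"
    by (rule v_mono[where k' = "(can s)\<^sup>\<circ>"]) (simp_all add: can_unitary)
  then have "Arrow (ev t) f (ev s) = Arrow (ev t) g (ev s)"
    by (rule v_epi[where k' = "can t"]) (simp_all add: can_unitary)
  then show "f = g" by simp
qed (use assms in \<open>simp add: Tr_def\<close>)

text \<open>Conversely, arrows constructed from strict data, such as roots of squares or the algebra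
  on a biproduct, are brought back to the given category.\<close>

lemma Tr_full: assumes "sarr F" "src F = fl t" "tgt F = fl s" obtains f where "Tr t f s F"
proof -
  have [simp]: "objs (fl t)" "objs (fl s)" using sarr_objs[OF assms(1)] assms by simp_all
  define V where "V = (can s)\<^sup>\<circ> \<bullet> und F \<bullet> can t"
  have V: "varr V" "src V = ev t" "tgt V = ev s" using assms by (simp_all add: V_def)
  have "can s \<bullet> V \<bullet> (can t)\<^sup>\<circ> = und F"
    using assms by (simp add: V_def v_assoc can_unitary v_id can_unitary[THEN v_tail])
  then have "Tr t (mor V) s F" using V assms by (simp add: Tr_iff Arrow_mor)
  then show thesis by (rule that)
qed

end

section \<open>Normalisable algebras and completely positive morphisms\<close>

context dagger_compact_structure
begin

text \<open>Applied first, this leaves the strict side schematic. The rules \<open>Tr_intros\<close>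
  then compute a strictification from the shape of the expression, and the last goal simplifies it
  to the form that is wanted.\<close>

lemma Tr_cong: "Tr t f s F \<Longrightarrow> F = G \<Longrightarrow> Tr t f s G" by simp

lemma Tr_tr: "\<lbrakk>tree t A; tree s B; f \<in> Hom C A B\<rbrakk> \<Longrightarrow> Tr t f s (tr t s f)"
  by (auto simp: Tr_def tree_def)

text \<open>The chosen dual of the whole object \<open>ev t\<close> enters as one opaque letter,
  whatever the shape of \<open>t\<close>. No relation between the duals of an object and of its
  tensor factors is built in.\<close>

definition eta :: "'o tree \<Rightarrow> ('o list, 'a) arrow" where
  "eta t = tr Ut (Nd (Lf (dual (ev t))) t) (\<eta> (ev t))"

lemma treeD: "tree t A \<Longrightarrow> objs (fl t)" "tree t A \<Longrightarrow> A \<in> Obj C"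
  using ev_obj by (auto simp: tree_def)

lemma Tr_eta: assumes "tree t A" shows "Tr Ut (\<eta> A) (Nd (Lf (dual A)) t) (eta t)"
proof -
  have "ev t = A" "A \<in> Obj C" using assms treeD by (auto simp: tree_def)
  then show ?thesis unfolding eta_def using assms
    by (auto intro!: Tr_tr tree_intros dual_in_Obj unit_in_Hom)
qed

lemma Tr_counit: assumes "tree t A"
  shows "Tr (Nd t (Lf (dual A))) (counit C dual \<eta> A) Ut ((eta t)\<^sup>\<circ> \<bullet> ssym (fl t) [dual A])"
proof -
  note ty = Tr_eta[OF assms] dual_in_Obj[OF treeD(2)[OF assms]]
  show ?thesis unfolding counit_def
    by (rule Tr_cong) ((rule ty assms Tr_intros)+, simp)
qed

lemmas s_cat = S.idt_left S.idt_right S.idt_tens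

lemma dual_pair_eta: assumes t: "tree t A" shows "S.dual_pair [dual A] (fl t) (eta t)"
proof -
  note ty = Tr_eta[OF t] dual_in_Obj[OF treeD(2)[OF t]] Tr_counit[OF t]
  note [simp] = tr_typing[OF Tr_eta[OF t]] treeD[OF t] ty(2)
  define e where "e = (eta t)\<^sup>\<circ> \<bullet> ssym (fl t) [dual A]"
  have [simp]: "sarr e" "src e = fl t @ [dual A]" "tgt e = []" by (simp_all add: e_def)
  have 1: "Tr t (\<l> A \<cdot> (counit C dual \<eta> A \<otimes> \<one> A) \<cdot> (\<a> A (dual A) A)\<^sup>\<dagger> \<cdot> (\<one> A \<otimes> \<eta> A) \<cdot> (\<r> A)\<^sup>\<dagger>) t
     ((e \<parallel> sid (fl t)) \<bullet> (sid (fl t) \<parallel> eta t))"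
    by (rule Tr_cong) ((rule ty t Tr_intros)+, simp add: s_cat e_def[symmetric])
  have 2: "Tr (Lf (dual A)) (\<r> (dual A) \<cdot> (\<one> (dual A) \<otimes> counit C dual \<eta> A) \<cdot> \<a> (dual A) A (dual A)
        \<cdot> (\<eta> A \<otimes> \<one> (dual A)) \<cdot> (\<l> (dual A))\<^sup>\<dagger>) (Lf (dual A))
     ((sid [dual A] \<parallel> e) \<bullet> (eta t \<parallel> sid [dual A]))"
    by (rule Tr_cong) ((rule ty t Tr_intros)+, simp add: s_cat e_def[symmetric])
  have 3: "(e \<parallel> sid (fl t)) \<bullet> (sid (fl t) \<parallel> eta t) = sid (fl t)"
    using 1 Tr_id[OF t] snake[of A] by (simp add: Tr_def)
  have 4: "(sid [dual A] \<parallel> e) \<bullet> (eta t \<parallel> sid [dual A]) = sid [dual A]"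
    using 2 Tr_id[of "Lf (dual A)" "dual A"] snake_dual[of A] by (simp add: Tr_def tree_def)
  show ?thesis unfolding S.dual_pair_def using 3 4 by (simp add: e_def)
qed

primrec rtree :: "'x list \<Rightarrow> 'x tree" where
  "rtree [] = Ut" | "rtree (x # xs) = Nd (Lf x) (rtree xs)"

lemma fl_rtree [simp]: "fl (rtree xs) = xs" by (induction xs) auto

lemma list_dual: "objs xs \<Longrightarrow> \<exists>d e. S.dual_pair d xs e"
  using dual_pair_eta[of "rtree xs"] by (auto simp: tree_def)

lemma frob_iff:
  assumes t: "tree t A" and m: "Tr (Nd t t) m t M" and u: "Tr Ut u t U"
  shows "dagger_frobenius_algebra C A m u \<longleftrightarrow> S.frob (fl t) M U"
proof -
  note [simp] = tr_typing[OF m] tr_typing[OF u] treeD[OF t]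
  have A: "ev t = A" using t by (simp add: tree_def)
  have 1: "m \<cdot> (m \<otimes> \<one> A) = m \<cdot> (\<one> A \<otimes> m) \<cdot> \<a> A A A \<longleftrightarrow> M \<bullet> (M \<parallel> sid (fl t)) = M \<bullet> (sid (fl t) \<parallel> M)"
    by (rule Tr_eq_iff[of "Nd (Nd t t) t" _ t]; rule Tr_cong) ((rule m u t Tr_intros)+, simp add: s_cat)+
  have 2: "m \<cdot> (u \<otimes> \<one> A) = \<l> A \<longleftrightarrow> M \<bullet> (U \<parallel> sid (fl t)) = sid (fl t)"
    by (rule Tr_eq_iff[of "Nd Ut t" _ t]; rule Tr_cong) ((rule m u t Tr_intros)+, simp add: s_cat)+
  have 3: "m \<cdot> (\<one> A \<otimes> u) = \<r> A \<longleftrightarrow> M \<bullet> (sid (fl t) \<parallel> U) = sid (fl t)"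
    by (rule Tr_eq_iff[of "Nd t Ut" _ t]; rule Tr_cong) ((rule m u t Tr_intros)+, simp add: s_cat)+
  have 4: "(m \<otimes> \<one> A) \<cdot> (\<a> A A A)\<^sup>\<dagger> \<cdot> (\<one> A \<otimes> m\<^sup>\<dagger>) = m\<^sup>\<dagger> \<cdot> m \<longleftrightarrow>
     (M \<parallel> sid (fl t)) \<bullet> (sid (fl t) \<parallel> M\<^sup>\<circ>) = M\<^sup>\<circ> \<bullet> M"
    by (rule Tr_eq_iff[of "Nd t t" _ "Nd t t"]; rule Tr_cong) ((rule m u t Tr_intros)+, simp add: s_cat)+
  have 5: "(\<one> A \<otimes> m) \<cdot> \<a> A A A \<cdot> (m\<^sup>\<dagger> \<otimes> \<one> A) = m\<^sup>\<dagger> \<cdot> m \<longleftrightarrow>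
     (sid (fl t) \<parallel> M) \<bullet> (M\<^sup>\<circ> \<parallel> sid (fl t)) = M\<^sup>\<circ> \<bullet> M"
    by (rule Tr_eq_iff[of "Nd t t" _ "Nd t t"]; rule Tr_cong) ((rule m u t Tr_intros)+, simp add: s_cat)+
  show ?thesis
    unfolding dagger_frobenius_algebra_def S.frob_def 1 2 3 4 using 5 tr_typing(3)[OF m] tr_typing(3)[OF u]
    by (simp add: A) metis
qed

lemma positive_iff:
  assumes t: "tree t A" and z: "Tr t z t Z"
  shows "positive C A z \<longleftrightarrow> S.positive_arr Z"
proof
  assume "positive C A z"
  then obtain B h where h: "B \<in> Obj C" "h \<in> Hom C A B" "z = h\<^sup>\<dagger> \<cdot> h" by (auto simp: positive_def)
  have H: "Tr t h (Lf B) (tr t (Lf B) h)" using t h by (auto intro!: Tr_tr tree_intros)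
  have "Tr t (h\<^sup>\<dagger> \<cdot> h) t ((tr t (Lf B) h)\<^sup>\<circ> \<bullet> tr t (Lf B) h)" by (rule H Tr_intros)+
  then have "Z = (tr t (Lf B) h)\<^sup>\<circ> \<bullet> tr t (Lf B) h" using z h by (simp add: Tr_def)
  then show "S.positive_arr Z" using tr_typing(4)[OF H] by (auto simp: S.positive_arr_def)
next
  assume "S.positive_arr Z"
  then obtain H where H: "sarr H" "Z = H\<^sup>\<circ> \<bullet> H" by (auto simp: S.positive_arr_def)
  then have sH: "src H = fl t" using tr_typing(5)[OF z] by simp
  \<comment> \<open>A strict root may end in any word; its bracketing to the right supplies an
    object of the given category.\<close>
  obtain h where h: "Tr t h (rtree (tgt H)) H"
    by (rule Tr_full[of H t "rtree (tgt H)"]) (use H sH in auto)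
  have "Tr t (h\<^sup>\<dagger> \<cdot> h) t (H\<^sup>\<circ> \<bullet> H)" by (rule h Tr_intros)+
  then have "z = h\<^sup>\<dagger> \<cdot> h" using Tr_eq_iff[OF z] H by simp
  moreover have "h \<in> Hom C A (ev (rtree (tgt H)))" "ev (rtree (tgt H)) \<in> Obj C"
    using tr_typing[OF h] t by (auto simp: tree_def)
  ultimately show "positive C A z" by (auto simp: positive_def)
qed

lemma Tr_action:
  assumes t: "tree t A" and m: "Tr (Nd t t) m t M"
  shows "Tr t (action C dual \<eta> A m) (Nd (Lf (dual A)) t) (S.act [dual A] (fl t) (eta t) M)"
proof -
  note ty = Tr_eta[OF t] dual_in_Obj[OF treeD(2)[OF t]]
  note [simp] = tr_typing[OF Tr_eta[OF t]] treeD[OF t] ty(2) tr_typing[OF m]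
  show ?thesis unfolding action_def S.act_def
    by (rule Tr_cong) ((rule ty m t Tr_intros)+, simp add: s_cat)
qed

lemma nalg_iff:
  assumes t: "tree t A" and m: "Tr (Nd t t) m t M" and u: "Tr Ut u t U" and z: "Tr t z t Z"
  shows "dagger_frobenius_algebra C A m u \<and> normaliser C dual \<eta> A m u z \<longleftrightarrow> S.nalg (fl t) M U Z"
proof -
  note ty = Tr_eta[OF t] dual_in_Obj[OF treeD(2)[OF t]] Tr_action[OF t m]
  note [simp] = tr_typing[OF m] tr_typing[OF u] tr_typing[OF z] treeD[OF t]
  have A: "ev t = A" using t by (simp add: tree_def)
  have zA: "z \<in> Hom C A A" using tr_typing(3)[OF z] by (simp add: A)
  have 1: "z \<cdot> m = m \<cdot> (z \<otimes> \<one> A) \<longleftrightarrow> Z \<bullet> M = M \<bullet> (Z \<parallel> sid (fl t))"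
    by (rule Tr_eq_iff[of "Nd t t" _ t]) (rule m z t Tr_intros)+
  have 2: "z \<cdot> m = m \<cdot> (\<one> A \<otimes> z) \<longleftrightarrow> Z \<bullet> M = M \<bullet> (sid (fl t) \<parallel> Z)"
    by (rule Tr_eq_iff[of "Nd t t" _ t]) (rule m z t Tr_intros)+
  have 3: "(\<eta> A)\<^sup>\<dagger> \<cdot> action C dual \<eta> A m \<cdot> z \<cdot> z = u\<^sup>\<dagger> \<longleftrightarrow>
      (eta t)\<^sup>\<circ> \<bullet> S.act [dual A] (fl t) (eta t) M \<bullet> Z \<bullet> Z = U\<^sup>\<circ>"
    by (rule Tr_eq_iff[of t _ Ut]) (rule ty u z t Tr_intros)+
  \<comment> \<open>The strict notion records invertibility only through the loop equation, from
    which the inverse is read off.\<close>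
  have 4: "isomorphism C A A z" if n: "S.nalg (fl t) M U Z"
  proof -
    have 1: "Tr t (m \<cdot> m\<^sup>\<dagger> \<cdot> z) t (M \<bullet> M\<^sup>\<circ> \<bullet> Z)" by (rule m z t Tr_intros)+
    have 2: "(m \<cdot> m\<^sup>\<dagger> \<cdot> z) \<cdot> z = \<one> A"
      by (rule Tr_eq_iff[THEN iffD2, OF _ _ S.nalg_inverse(1)[OF n]]) (rule m z t Tr_intros)+
    have 3: "z \<cdot> (m \<cdot> m\<^sup>\<dagger> \<cdot> z) = \<one> A"
      by (rule Tr_eq_iff[THEN iffD2, OF _ _ S.nalg_inverse(2)[OF n]]) (rule m z t Tr_intros)+
    show ?thesis unfolding isomorphism_def using tr_typing(3)[OF 1] zA 2 3
      by (auto simp: A intro!: bexI[of _ "m \<cdot> m\<^sup>\<dagger> \<cdot> z"])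
  qed
  show ?thesis
  proof
    assume n: "S.nalg (fl t) M U Z"
    then have "(eta t)\<^sup>\<circ> \<bullet> S.act [dual A] (fl t) (eta t) M \<bullet> Z \<bullet> Z = U\<^sup>\<circ>"
      by (subst S.normaliser_iff[OF dual_pair_eta[OF t], of M U Z]) (auto simp: S.nalg_def)
    with n show "dagger_frobenius_algebra C A m u \<and> normaliser C dual \<eta> A m u z"
      using 4 zA by (auto simp: normaliser_def central_def frob_iff[OF t m u] positive_iff[OF t z] 1 2 3 S.nalg_def)
  next
    assume n: "dagger_frobenius_algebra C A m u \<and> normaliser C dual \<eta> A m u z"
    then have f: "S.frob (fl t) M U" "S.positive_arr Z" "Z \<bullet> M = M \<bullet> (Z \<parallel> sid (fl t))" "Z \<bullet> M = M \<bullet> (sid (fl t) \<parallel> Z)"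
       "(eta t)\<^sup>\<circ> \<bullet> S.act [dual A] (fl t) (eta t) M \<bullet> Z \<bullet> Z = U\<^sup>\<circ>"
      using 1 2 3 by (auto simp: normaliser_def central_def frob_iff[OF t m u] positive_iff[OF t z])
    then show "S.nalg (fl t) M U Z" unfolding S.nalg_def
      using S.normaliser_iff[OF dual_pair_eta[OF t] f(1), of Z] by auto
  qed
qed

section \<open>Complete positivity as positivity of the Choi morphism\<close>

lemma conjugate_slide:
  assumes t: "tree t A" and s: "tree s B" and X: "X \<in> Obj C" and g: "Tr t g (Nd (Lf X) s) G"
  obtains GS where
    "Tr (Lf (dual A)) (dual_tensor C dual \<eta> X B \<cdot> conjugate C dual \<eta> A (X \<odot> B) g)
        (Nd (Lf (dual B)) (Lf (dual X))) GS"
    "(GS \<parallel> sid (fl t)) \<bullet> eta t = (sid [dual B, dual X] \<parallel> G\<^sup>\<circ>) \<bullet>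
        (sid [dual B] \<parallel> eta (Lf X) \<parallel> sid (fl s)) \<bullet> eta s"
proof -
  let ?y = "Nd (Lf X) s" and ?D = "dual (X \<odot> B)" and ?a = "fl t"
  have y: "tree ?y (X \<odot> B)" and x: "tree (Lf X) X" using s X by (auto intro: tree_intros)
  note o = X treeD(2)[OF t] treeD(2)[OF s] treeD(2)[OF y]
  note ty = t s y x g o dual_in_Obj[OF o(1)] dual_in_Obj[OF o(2)] dual_in_Obj[OF o(3)] dual_in_Obj[OF o(4)]
    Tr_eta[OF t] Tr_eta[OF s] Tr_eta[OF y] Tr_eta[OF x] Tr_counit[OF t] Tr_counit[OF y]
  note [simp] = tr_typing[OF Tr_eta[OF t]] tr_typing[OF Tr_eta[OF s]] tr_typing[OF Tr_eta[OF y]]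
    tr_typing[OF Tr_eta[OF x]] treeD[OF t] treeD[OF s] X ty(10-13) tr_typing[OF g]
  define N where "N = (sid [dual B] \<parallel> eta (Lf X) \<parallel> sid (fl s)) \<bullet> eta s"
  have N [simp]: "sarr N" "src N = []" "tgt N = [dual B, dual X] @ (X # fl s)" by (simp_all add: N_def)
  have tN: "Tr Ut (nested_unit C dual \<eta> X B) (Nd (Nd (Lf (dual B)) (Lf (dual X))) ?y) N"
    unfolding nested_unit_def N_def
    by (rule Tr_cong) ((rule ty Tr_intros)+, simp add: s_cat)
  define DT where "DT = (sid [dual B, dual X] \<parallel> ((eta ?y)\<^sup>\<circ> \<bullet> ssym (fl ?y) [?D])) \<bullet> (N \<parallel> sid [?D])"
  have tDT: "Tr (Lf ?D) (dual_tensor C dual \<eta> X B) (Nd (Lf (dual B)) (Lf (dual X))) DT"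
    unfolding dual_tensor_def DT_def
    by (rule Tr_cong) ((rule tN ty Tr_intros)+, simp add: s_cat)
  define CJ where "CJ = (sid [?D] \<parallel> ((eta t)\<^sup>\<circ> \<bullet> ssym ?a [dual A])) \<bullet> (sid [?D] \<parallel> G\<^sup>\<circ> \<parallel> sid [dual A]) \<bullet>
    (eta ?y \<parallel> sid [dual A])"
  have tCJ: "Tr (Lf (dual A)) (conjugate C dual \<eta> A (X \<odot> B) g) (Lf ?D) CJ"
    unfolding conjugate_def transpose_def CJ_def
    by (rule Tr_cong) ((rule ty Tr_intros)+, simp add: s_cat)
  \<comment> \<open>The chosen dual of \<open>X \<odot> B\<close> is internal to this composite, and
    sliding removes it. What is left is the equation by which \<open>cp_iff_square\<close>
    recognises the conjugate of \<open>g\<close>.\<close>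
  have "((DT \<bullet> CJ) \<parallel> sid ?a) \<bullet> eta t = (sid [dual B, dual X] \<parallel> G\<^sup>\<circ>) \<bullet> N"
    unfolding DT_def CJ_def
    by (rule S.transpose_slide[OF dual_pair_eta[OF y] dual_pair_eta[OF t]]) simp_all
  with Tr_comp[OF tCJ tDT] show thesis by (intro that[of "DT \<bullet> CJ"]) (simp_all add: N_def)
qed

lemma Tr_contract:
  assumes s: "tree s B" and X: "X \<in> Obj C"
  shows "Tr (Nd (Nd (Lf (dual B)) (Lf (dual X))) (Nd (Lf X) s)) (contract C dual \<eta> X B) (Nd (Lf (dual B)) s)
    (sid [dual B] \<parallel> (eta (Lf X))\<^sup>\<circ> \<parallel> sid (fl s))"
proof -
  have x: "tree (Lf X) X" using X by (auto intro: tree_intros)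
  note ty = s x X treeD(2)[OF s] dual_in_Obj[OF X] dual_in_Obj[OF treeD(2)[OF s]] Tr_eta[OF x]
  note [simp] = tr_typing[OF Tr_eta[OF x]] treeD[OF s] ty
  show ?thesis unfolding contract_def
    by (rule Tr_cong) ((rule ty Tr_intros)+, simp add: s_cat)
qed

text \<open>A witness \<open>g\<close> of complete positivity yields a root of the Choi morphism by
  \<open>cp_iff_square\<close>, and \<open>square_unbend\<close> turns a root back into a
  witness.\<close>

lemma cp_iff_choi:
  assumes t: "tree t A" and s: "tree s B"
    and m: "Tr (Nd t t) m t M" and n: "Tr (Nd s s) n s N" and f: "Tr t f s F"
    and na: "S.nalg (fl t) M U Z" and nb: "S.nalg (fl s) N V W"
  shows "completely_positive C dual \<eta> A B (action C dual \<eta> B n \<cdot> f \<cdot> (action C dual \<eta> A m)\<^sup>\<dagger>)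
     \<longleftrightarrow> S.positive_arr (S.choi M N F)"
proof -
  note fa = S.nalg_typing(1)[OF na] and fb = S.nalg_typing(1)[OF nb]
  have o: "A \<in> Obj C" "B \<in> Obj C" "dual A \<in> Obj C" "dual B \<in> Obj C"
    using treeD[OF t] treeD[OF s] dual_in_Obj by auto
  note ty = t s f o Tr_action[OF t m] Tr_action[OF s n]
  note [simp] = treeD[OF t] treeD[OF s] o tr_typing[OF f] S.frob_typing[OF fa] S.frob_typing[OF fb]
  have evs: "ev t = A" "ev s = B" using t s by (simp_all add: tree_def)
  let ?k = "action C dual \<eta> B n \<cdot> f \<cdot> (action C dual \<eta> A m)\<^sup>\<dagger>"
  define K where "K = S.act [dual B] (fl s) (eta s) N \<bullet> F \<bullet> (S.act [dual A] (fl t) (eta t) M)\<^sup>\<circ>"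
  have k: "Tr (Nd (Lf (dual A)) t) ?k (Nd (Lf (dual B)) s) K"
    unfolding K_def by (rule ty Tr_intros)+
  have khom: "?k \<in> Hom C (dual A \<odot> A) (dual B \<odot> B)" using tr_typing(3)[OF k] by (simp add: evs)
  have sq: "\<exists>GS. (?k = contract C dual \<eta> X B \<cdot> ((dual_tensor C dual \<eta> X B \<cdot> conjugate C dual \<eta> A (X \<odot> B) g) \<otimes> g)
      \<longleftrightarrow> S.choi M N F = ((sid [X] \<parallel> S.cap N V) \<bullet> (G \<parallel> sid (fl s)))\<^sup>\<circ> \<bullet> (sid [X] \<parallel> S.cap N V) \<bullet> (G \<parallel> sid (fl s)))"
    if X: "X \<in> Obj C" and g: "Tr t g (Nd (Lf X) s) G" for X g G
  proof -
    have x: "tree (Lf X) X" using X by (auto intro: tree_intros)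
    obtain GS where GS: "Tr (Lf (dual A)) (dual_tensor C dual \<eta> X B \<cdot> conjugate C dual \<eta> A (X \<odot> B) g)
        (Nd (Lf (dual B)) (Lf (dual X))) GS"
      and sl: "(GS \<parallel> sid (fl t)) \<bullet> eta t = (sid [dual B, dual X] \<parallel> G\<^sup>\<circ>) \<bullet>
        (sid [dual B] \<parallel> eta (Lf X) \<parallel> sid (fl s)) \<bullet> eta s"
      by (rule conjugate_slide[OF t s X g])
    have "Tr (Nd (Lf (dual A)) t) (contract C dual \<eta> X B \<cdot> ((dual_tensor C dual \<eta> X B \<cdot> conjugate C dual \<eta> A (X \<odot> B) g) \<otimes> g))
       (Nd (Lf (dual B)) s) ((sid [dual B] \<parallel> (eta (Lf X))\<^sup>\<circ> \<parallel> sid (fl s)) \<bullet> (GS \<parallel> G))"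
      by (rule GS g Tr_contract[OF s X] Tr_intros)+
    from Tr_eq_iff[OF k this] show ?thesis unfolding K_def
      using S.cp_iff_square[OF dual_pair_eta[OF t] fa dual_pair_eta[OF s] fb dual_pair_eta[OF x] S.nalg_laws(1)[OF nb],
         of F G GS] tr_typing[OF g] tr_typing[OF GS] sl by simp
  qed
  show ?thesis
  proof
    assume "completely_positive C dual \<eta> A B ?k"
    then obtain X g where X: "X \<in> Obj C" and g: "g \<in> Hom C A (X \<odot> B)"
      and e: "?k = contract C dual \<eta> X B \<cdot> ((dual_tensor C dual \<eta> X B \<cdot> conjugate C dual \<eta> A (X \<odot> B) g) \<otimes> g)"
      unfolding completely_positive_def by blast
    have G: "Tr t g (Nd (Lf X) s) (tr t (Nd (Lf X) s) g)"
      using t s X g by (auto intro!: Tr_tr tree_intros)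
    then have "S.choi M N F = ((sid [X] \<parallel> S.cap N V) \<bullet> (tr t (Nd (Lf X) s) g \<parallel> sid (fl s)))\<^sup>\<circ> \<bullet>
       (sid [X] \<parallel> S.cap N V) \<bullet> (tr t (Nd (Lf X) s) g \<parallel> sid (fl s))"
      using sq[OF X G] e by simp
    then show "S.positive_arr (S.choi M N F)"
      using tr_typing[OF G] X by (auto intro!: S.positive_arr_square)
  next
    assume "S.positive_arr (S.choi M N F)"
    then obtain H where H: "sarr H" "S.choi M N F = H\<^sup>\<circ> \<bullet> H" by (auto simp: S.positive_arr_def)
    have "src (S.choi M N F) = fl t @ fl s" by simp
    then have sH: "src H = fl t @ fl s" using H by simp
    obtain h where h: "Tr (Nd t s) h (rtree (tgt H)) H"
      by (rule Tr_full[of H "Nd t s" "rtree (tgt H)"]) (use H sH in auto)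
    \<comment> \<open>The root ends in a word, but the definition of complete positivity asks for a
      single ancilla object. Translating the same \<open>h\<close> with the one-letter target
      \<open>X\<close> changes the root and not its square.\<close>
    define X where "X = ev (rtree (tgt H))"
    have X: "X \<in> Obj C" using tr_typing[OF h] by (simp add: X_def)
    have "h \<in> Hom C (A \<odot> B) X" using tr_typing(3)[OF h] by (simp add: X_def evs)
    define H' where "H' = tr (Nd t s) (Lf X) h"
    have h': "Tr (Nd t s) h (Lf X) H'" unfolding H'_def
      using \<open>h \<in> _\<close> t s X by (intro Tr_tr[of _ "A \<odot> B"]) (auto intro: tree_intros)
    have "Tr (Nd t s) (h\<^sup>\<dagger> \<cdot> h) (Nd t s) (H\<^sup>\<circ> \<bullet> H)" by (rule h Tr_intros)+
    moreover have "Tr (Nd t s) (h\<^sup>\<dagger> \<cdot> h) (Nd t s) (H'\<^sup>\<circ> \<bullet> H')" by (rule h' Tr_intros)+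
    ultimately have c: "S.choi M N F = H'\<^sup>\<circ> \<bullet> H'" using H by (simp add: Tr_def)
    note [simp] = tr_typing[OF h'] X
    define G where "G = (H' \<parallel> sid (fl s)) \<bullet> (sid (fl t) \<parallel> S.cup N V)"
    have [simp]: "sarr G" "src G = fl t" "tgt G = X # fl s" by (simp_all add: G_def)
    obtain g where g: "Tr t g (Nd (Lf X) s) G"
      by (rule Tr_full[of G t "Nd (Lf X) s"]) auto
    have "(sid [X] \<parallel> S.cap N V) \<bullet> (G \<parallel> sid (fl s)) = H'"
      unfolding G_def by (rule S.square_unbend[OF fb]) simp_all
    then have "?k = contract C dual \<eta> X B \<cdot> ((dual_tensor C dual \<eta> X B \<cdot> conjugate C dual \<eta> A (X \<odot> B) g) \<otimes> g)"
      using sq[OF X g] c by simp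
    moreover have "g \<in> Hom C A (X \<odot> B)" using tr_typing(3)[OF g] by (simp add: evs)
    ultimately show "completely_positive C dual \<eta> A B ?k"
      unfolding completely_positive_def using khom X by blast
  qed
qed

section \<open>Objects and morphisms of CP* in terms of strict algebras\<close>

lemma cpstar_obj_nalg:
  assumes P: "(A, m, u, z) \<in> cpstar_obj C dual \<eta>" and t: "tree t A"
  obtains M U Z where "Tr (Nd t t) m t M" "Tr Ut u t U" "Tr t z t Z" "S.nalg (fl t) M U Z"
proof -
  have d: "dagger_frobenius_algebra C A m u" "normaliser C dual \<eta> A m u z"
    using P by (auto simp: cpstar_obj_def)
  then have "m \<in> Hom C (A \<odot> A) A" "u \<in> Hom C \<I> A" "z \<in> Hom C A A"
    by (auto simp: dagger_frobenius_algebra_def normaliser_def central_def)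
  then have T: "Tr (Nd t t) m t (tr (Nd t t) t m)" "Tr Ut u t (tr Ut t u)" "Tr t z t (tr t t z)"
    using t by (auto intro!: Tr_tr tree_intros)
  show thesis using that[OF T] nalg_iff[OF t T] d by blast
qed

lemma cpstar_objI:
  assumes "tree t A" "Tr (Nd t t) m t M" "Tr Ut u t U" "Tr t z t Z" "S.nalg (fl t) M U Z"
  shows "(A, m, u, z) \<in> cpstar_obj C dual \<eta>"
  using nalg_iff[OF assms(1-4)] assms(5) by (simp add: cpstar_obj_def)

lemma cpstar_hom_iff:
  assumes "tree t A" "tree s B"
    and "Tr (Nd t t) m t M" "S.nalg (fl t) M U Z" "Tr (Nd s s) n s N" "S.nalg (fl s) N V W"
    and f: "Tr t f s F"
  shows "f \<in> cpstar_hom C dual \<eta> (A, m, u, z) (B, n, v, w) \<longleftrightarrow> S.positive_arr (S.choi M N F)"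
  using cp_iff_choi[OF assms(1,2,3,5) f assms(4,6)] tr_typing(3)[OF f] assms(1,2)
  by (simp add: cpstar_hom_def tree_def)

subsection \<open>Compact structure\<close>

abbreviation (input) "K \<equiv> cpstar C dual \<eta>"
abbreviation (input) "\<O> \<equiv> cpstar_obj C dual \<eta>"
abbreviation (input) "\<H> \<equiv> cpstar_hom C dual \<eta>"

lemma cpstar_simps:
  "Obj K = \<O>" "Hom K = \<H>" "Id K P = \<one> (fst P)" "Comp K = Comp C" "Dag K = Dag C"
  "TensorObj K = cpstar_tensor C" "TensorHom K = TensorHom C" "Unit K = (\<I>, \<l> \<I>, \<one> \<I>, \<one> \<I>)"
  "Assoc K P Q R = \<a> (fst P) (fst Q) (fst R)" "LeftUnit K P = \<l> (fst P)" "RightUnit K P = \<r> (fst P)"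
  "Sym K P Q = \<sigma> (fst P) (fst Q)"
  by (simp_all add: cpstar_def)

lemma cp_objD: "P \<in> \<O> \<Longrightarrow> fst P \<in> Obj C"
  by (auto simp: cpstar_obj_def dagger_frobenius_algebra_def)
lemma cp_homD: "f \<in> \<H> P Q \<Longrightarrow> f \<in> Hom C (fst P) (fst Q)"
  by (auto simp: cpstar_hom_def split: prod.splits)
lemma fst_tensor [simp]: "fst (cpstar_tensor C P Q) = fst P \<odot> fst Q"
  by (auto simp: cpstar_tensor_def split: prod.splits)

text \<open>The bracketing \<open>t\<close> of the carrier is left free: a tensor product of
  algebras can then be treated on the word of its factors, where its multiplication has the strict
  form, and \<open>alg_hom_iff\<close> decides its hom-sets there.\<close>

definition alg :: "('o, 'a) algebra \<Rightarrow> 'o tree \<Rightarrow> ('o list, 'a) arrow \<Rightarrow> ('o list, 'a) arrow \<Rightarrow> ('o list, 'a) arrow \<Rightarrow> bool" where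
  "alg P t M U Z \<longleftrightarrow> tree t (fst P) \<and> Tr (Nd t t) (fst (snd P)) t M \<and> Tr Ut (fst (snd (snd P))) t U \<and>
    Tr t (snd (snd (snd P))) t Z \<and> S.nalg (fl t) M U Z"

lemma algD:
  assumes "alg P t M U Z"
  shows "tree t (fst P)" "Tr (Nd t t) (fst (snd P)) t M" "Tr Ut (fst (snd (snd P))) t U"
    "Tr t (snd (snd (snd P))) t Z" "S.nalg (fl t) M U Z" "S.frob (fl t) M U" "P \<in> \<O>"
proof -
  show 1: "tree t (fst P)" "Tr (Nd t t) (fst (snd P)) t M" "Tr Ut (fst (snd (snd P))) t U"
    "Tr t (snd (snd (snd P))) t Z" "S.nalg (fl t) M U Z"
    using assms by (simp_all add: alg_def)
  show "S.frob (fl t) M U" by (rule S.nalg_typing(1)[OF 1(5)])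
  show "P \<in> \<O>" using cpstar_objI[OF 1] by simp
qed

lemma algE:
  assumes P: "P \<in> \<O>" and t: "tree t (fst P)"
  obtains M U Z where "alg P t M U Z"
proof -
  have "(fst P, fst (snd P), fst (snd (snd P)), snd (snd (snd P))) \<in> \<O>" using P by simp
  from cpstar_obj_nalg[OF this t] obtain M U Z where
    "Tr (Nd t t) (fst (snd P)) t M" "Tr Ut (fst (snd (snd P))) t U" "Tr t (snd (snd (snd P))) t Z"
    "S.nalg (fl t) M U Z" .
  with t show thesis by (intro that[of M U Z]) (simp add: alg_def)
qed

lemma alg_leaf: assumes P: "P \<in> \<O>" obtains M U Z where "alg P (Lf (fst P)) M U Z"
  using algE[OF P tree_intros(2)[OF cp_objD[OF P]]] .

lemma alg_hom_iff:
  assumes "alg P t M U Z" "alg Q s N V W" "Tr t f s F"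
  shows "f \<in> \<H> P Q \<longleftrightarrow> S.positive_arr (S.choi M N F)"
  using cpstar_hom_iff[OF algD(1)[OF assms(1)] algD(1)[OF assms(2)] algD(2,5)[OF assms(1)] algD(2,5)[OF assms(2)] assms(3)]
  by (metis prod.collapse)

lemma Tr_hom: "\<lbrakk>f \<in> \<H> P Q; alg P t M U Z; alg Q s N V W\<rbrakk> \<Longrightarrow> Tr t f s (tr t s f)"
  by (rule Tr_tr[OF _ _ cp_homD]) (auto simp: alg_def)

lemma cp_comp:
  assumes "P \<in> \<O>" "Q \<in> \<O>" "R \<in> \<O>" and f: "f \<in> \<H> P Q" and g: "g \<in> \<H> Q R"
  shows "g \<cdot> f \<in> \<H> P R"
proof -
  obtain M U Z where p: "alg P (Lf (fst P)) M U Z" by (rule alg_leaf[OF assms(1)])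
  obtain N V W where q: "alg Q (Lf (fst Q)) N V W" by (rule alg_leaf[OF assms(2)])
  obtain L X Y where r: "alg R (Lf (fst R)) L X Y" by (rule alg_leaf[OF assms(3)])
  note F = Tr_hom[OF f p q] and G = Tr_hom[OF g q r]
  show ?thesis unfolding alg_hom_iff[OF p r Tr_comp[OF F G]]
    using S.choi_comp_positive[OF algD(5)[OF p] algD(5)[OF q] algD(5)[OF r]]
      alg_hom_iff[OF p q F] alg_hom_iff[OF q r G] f g tr_typing[OF F] tr_typing[OF G] by simp
qed

lemma cp_dag:
  assumes "P \<in> \<O>" "Q \<in> \<O>" and f: "f \<in> \<H> P Q"
  shows "f\<^sup>\<dagger> \<in> \<H> Q P"
proof -
  obtain M U Z where p: "alg P (Lf (fst P)) M U Z" by (rule alg_leaf[OF assms(1)])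
  obtain N V W where q: "alg Q (Lf (fst Q)) N V W" by (rule alg_leaf[OF assms(2)])
  note F = Tr_hom[OF f p q]
  obtain h where h: "sarr h" "S.choi M N (tr (Lf (fst P)) (Lf (fst Q)) f) = h\<^sup>\<circ> \<bullet> h"
    using alg_hom_iff[OF p q F] f by (auto simp: S.positive_arr_def)
  obtain d e where "S.dual_pair d (tgt h) e" using list_dual[of "tgt h"] h by auto
  then have "S.positive_arr (S.choi N M ((tr (Lf (fst P)) (Lf (fst Q)) f)\<^sup>\<circ>))"
    by (intro S.choi_dag[OF algD(6)[OF p] algD(6)[OF q] S.nalg_laws(1)[OF algD(5)[OF p]]
         S.nalg_laws(1)[OF algD(5)[OF q]] _ _ _ h]) (use tr_typing[OF F] in auto)
  then show ?thesis unfolding alg_hom_iff[OF q p Tr_dag[OF F]] .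
qed

lemma Tr_interchange:
  assumes t: "tree t A" and s: "tree s B"
  shows "Tr (Nd (Nd t s) (Nd t s)) (interchange C A B) (Nd (Nd t t) (Nd s s)) (S.exchange (fl t) (fl s) (fl t) (fl s))"
proof -
  note [simp] = treeD[OF t] treeD[OF s]
  show ?thesis unfolding interchange_def S.exchange_def
    by (rule Tr_cong) ((rule t s Tr_intros)+, simp add: s_cat)
qed

lemma alg_tensor:
  assumes P: "alg P t M U Z" and Q: "alg Q s N V W"
  shows "alg (cpstar_tensor C P Q) (Nd t s) ((M \<parallel> N) \<bullet> S.exchange (fl t) (fl s) (fl t) (fl s)) (U \<parallel> V) (Z \<parallel> W)"
proof -
  note t = algD(1-5)[OF P] and s = algD(1-5)[OF Q]
  note [simp] = treeD[OF t(1)] treeD[OF s(1)] tr_typing[OF t(3)] tr_typing[OF s(3)]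
  have e: "cpstar_tensor C P Q = (fst P \<odot> fst Q, (fst (snd P) \<otimes> fst (snd Q)) \<cdot> interchange C (fst P) (fst Q),
     (fst (snd (snd P)) \<otimes> fst (snd (snd Q))) \<cdot> (\<l> \<I>)\<^sup>\<dagger>, snd (snd (snd P)) \<otimes> snd (snd (snd Q)))"
    by (auto simp: cpstar_tensor_def split: prod.splits)
  have 0: "tree (Nd t s) (fst P \<odot> fst Q)" using t s by (auto intro: tree_intros)
  have 1: "Tr (Nd (Nd t s) (Nd t s)) ((fst (snd P) \<otimes> fst (snd Q)) \<cdot> interchange C (fst P) (fst Q)) (Nd t s)
     ((M \<parallel> N) \<bullet> S.exchange (fl t) (fl s) (fl t) (fl s))"
    by (rule t s Tr_interchange Tr_intros)+
  have 2: "Tr Ut ((fst (snd (snd P)) \<otimes> fst (snd (snd Q))) \<cdot> (\<l> \<I>)\<^sup>\<dagger>) (Nd t s) (U \<parallel> V)"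
    by (rule Tr_cong) ((rule t s Tr_intros)+, simp add: s_cat)
  have 3: "Tr (Nd t s) (snd (snd (snd P)) \<otimes> snd (snd (snd Q))) (Nd t s) (Z \<parallel> W)" by (rule t s Tr_intros)+
  show ?thesis unfolding alg_def e using 0 1 2 3 S.nalg_tens[OF t(5) s(5)] by simp
qed

lemma cp_tensor_obj: assumes "P \<in> \<O>" "Q \<in> \<O>" shows "cpstar_tensor C P Q \<in> \<O>"
proof -
  obtain M U Z where p: "alg P (Lf (fst P)) M U Z" by (rule alg_leaf[OF assms(1)])
  obtain N V W where q: "alg Q (Lf (fst Q)) N V W" by (rule alg_leaf[OF assms(2)])
  show ?thesis by (rule algD(7)[OF alg_tensor[OF p q]])
qed

lemma cp_tensor_hom:
  assumes "P \<in> \<O>" "Q \<in> \<O>" "P' \<in> \<O>" "Q' \<in> \<O>" and f: "f \<in> \<H> P Q" and g: "g \<in> \<H> P' Q'"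
  shows "f \<otimes> g \<in> \<H> (cpstar_tensor C P P') (cpstar_tensor C Q Q')"
proof -
  obtain M U Z where p: "alg P (Lf (fst P)) M U Z" by (rule alg_leaf[OF assms(1)])
  obtain N V W where q: "alg Q (Lf (fst Q)) N V W" by (rule alg_leaf[OF assms(2)])
  obtain M' U' Z' where p': "alg P' (Lf (fst P')) M' U' Z'" by (rule alg_leaf[OF assms(3)])
  obtain N' V' W' where q': "alg Q' (Lf (fst Q')) N' V' W'" by (rule alg_leaf[OF assms(4)])
  note F = Tr_hom[OF f p q] and G = Tr_hom[OF g p' q']
  show ?thesis
    unfolding alg_hom_iff[OF alg_tensor[OF p p'] alg_tensor[OF q q'] Tr_tens[OF F G]]
    by (rule S.choi_tens_positive[OF algD(6)[OF p] algD(6)[OF q] algD(6)[OF p'] algD(6)[OF q']])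
      (use alg_hom_iff[OF p q F] alg_hom_iff[OF p' q' G] f g tr_typing[OF F] tr_typing[OF G] in simp_all)
qed

lemma alg_unit: "alg (\<I>, \<l> \<I>, \<one> \<I>, \<one> \<I>) Ut (sid []) (sid []) (sid [])"
  using Tr_left[of Ut \<I>] Tr_id[of Ut \<I>] S.nalg_unit by (simp add: alg_def tree_intros)

lemma cp_unitary_hom:
  assumes "alg P t M U Z" "alg Q s N V W" "Tr t f s F"
    and "F\<^sup>\<circ> \<bullet> F = sid (fl t)" "F \<bullet> F\<^sup>\<circ> = sid (fl s)" "F \<bullet> M = N \<bullet> (F \<parallel> F)"
  shows "f \<in> \<H> P Q"
  unfolding alg_hom_iff[OF assms(1-3)]
  by (rule S.choi_unitary_hom[OF algD(6)[OF assms(1)] algD(6)[OF assms(2)] _ _ _ assms(4-6)])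
    (use tr_typing[OF assms(3)] in auto)

text \<open>Associators and unitors are translated to identities. For these, membership in a hom-set
  of CP* amounts to the two algebras having the same strict multiplication.\<close>

lemma cp_coherence_hom:
  assumes "alg P t M U Z" "alg Q s M V W" "Tr t f s (sid (fl t))"
  shows "f \<in> \<H> P Q"
proof -
  have [simp]: "fl s = fl t" using tr_typing[OF assms(3)] by simp
  show ?thesis by (rule cp_unitary_hom[OF assms])
    (use S.nalg_typing[OF algD(5)[OF assms(1)]] in \<open>simp_all add: s_cat\<close>)
qed

lemma cp_id: "P \<in> \<O> \<Longrightarrow> \<one> (fst P) \<in> \<H> P P"
  by (erule alg_leaf) (rule cp_coherence_hom, auto intro: Tr_id algD)

lemma cp_assoc:
  assumes "P \<in> \<O>" "Q \<in> \<O>" "R \<in> \<O>"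
  shows "\<a> (fst P) (fst Q) (fst R) \<in> \<H> (cpstar_tensor C (cpstar_tensor C P Q) R) (cpstar_tensor C P (cpstar_tensor C Q R))"
proof -
  obtain M U Z where p: "alg P (Lf (fst P)) M U Z" by (rule alg_leaf[OF assms(1)])
  obtain N V W where q: "alg Q (Lf (fst Q)) N V W" by (rule alg_leaf[OF assms(2)])
  obtain L X Y where r: "alg R (Lf (fst R)) L X Y" by (rule alg_leaf[OF assms(3)])
  note PQR = alg_tensor[OF alg_tensor[OF p q] r]
    alg_tensor[OF p alg_tensor[OF q r]]
  show ?thesis
    by (rule cp_coherence_hom[OF _ PQR(2) Tr_cong[OF Tr_assoc[OF algD(1)[OF p] algD(1)[OF q] algD(1)[OF r]]]])
      (use PQR(1) S.tens_mult_assoc[OF algD(6)[OF p] algD(6)[OF q] algD(6)[OF r]] in simp_all)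
qed

lemma cp_left: assumes "P \<in> \<O>" shows "\<l> (fst P) \<in> \<H> (cpstar_tensor C (\<I>, \<l> \<I>, \<one> \<I>, \<one> \<I>) P) P"
proof -
  obtain M U Z where p: "alg P (Lf (fst P)) M U Z" by (rule alg_leaf[OF assms(1)])
  note [simp] = S.frob_typing[OF algD(6)[OF p]] cp_objD[OF assms(1)]
  have "(sid [] \<parallel> M) \<bullet> S.exchange [] (fl (Lf (fst P))) [] (fl (Lf (fst P))) = M"
    by (simp add: S.exchange_def s_cat)
  then show ?thesis
    by (intro cp_coherence_hom[OF _ p Tr_cong[OF Tr_left[OF algD(1)[OF p]]]])
      (use alg_tensor[OF alg_unit p] in simp_all)
qed

lemma cp_right: assumes "P \<in> \<O>" shows "\<r> (fst P) \<in> \<H> (cpstar_tensor C P (\<I>, \<l> \<I>, \<one> \<I>, \<one> \<I>)) P"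
proof -
  obtain M U Z where p: "alg P (Lf (fst P)) M U Z" by (rule alg_leaf[OF assms(1)])
  note [simp] = S.frob_typing[OF algD(6)[OF p]] cp_objD[OF assms(1)]
  have "(M \<parallel> sid []) \<bullet> S.exchange (fl (Lf (fst P))) [] (fl (Lf (fst P))) [] = M"
    by (simp add: S.exchange_def s_cat)
  then show ?thesis
    by (intro cp_coherence_hom[OF _ p Tr_cong[OF Tr_right[OF algD(1)[OF p]]]])
      (use alg_tensor[OF p alg_unit] in simp_all)
qed

lemma cp_sym:
  assumes "P \<in> \<O>" "Q \<in> \<O>"
  shows "\<sigma> (fst P) (fst Q) \<in> \<H> (cpstar_tensor C P Q) (cpstar_tensor C Q P)"
proof -
  obtain M U Z where p: "alg P (Lf (fst P)) M U Z" by (rule alg_leaf[OF assms(1)])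
  obtain N V W where q: "alg Q (Lf (fst Q)) N V W" by (rule alg_leaf[OF assms(2)])
  note [simp] = S.frob_typing[OF algD(6)[OF p]] S.frob_typing[OF algD(6)[OF q]] cp_objD[OF assms(1)] cp_objD[OF assms(2)]
  show ?thesis
    by (rule cp_unitary_hom[OF alg_tensor[OF p q] alg_tensor[OF q p] Tr_sym[OF algD(1)[OF p] algD(1)[OF q]]])
      (use S.tens_mult_sym[OF algD(6)[OF p] algD(6)[OF q]] S.sym_sym in simp_all)
qed

section \<open>Dual objects in CP*\<close>

definition opposite :: "('o, 'a) algebra \<Rightarrow> ('o, 'a) algebra" where
  "opposite P = (fst P, fst (snd P) \<cdot> \<sigma> (fst P) (fst P), snd (snd P))"
definition cup_arr :: "('o, 'a) algebra \<Rightarrow> 'a" where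
  "cup_arr P = (fst (snd P))\<^sup>\<dagger> \<cdot> fst (snd (snd P))"

lemma fst_opposite [simp]: "fst (opposite P) = fst P" by (simp add: opposite_def)

lemma alg_opposite:
  assumes P: "alg P t M U Z"
  shows "alg (opposite P) t (M \<bullet> ssym (fl t) (fl t)) U Z"
proof -
  note t = algD(1-5)[OF P]
  have "Tr (Nd t t) (fst (snd P) \<cdot> \<sigma> (fst P) (fst P)) t (M \<bullet> ssym (fl t) (fl t))" by (rule t Tr_intros)+
  then show ?thesis using t S.nalg_opposite[OF t(5)] by (simp add: alg_def opposite_def)
qed

lemma cp_cup:
  assumes "P \<in> \<O>"
  shows "cup_arr P \<in> \<H> (\<I>, \<l> \<I>, \<one> \<I>, \<one> \<I>) (cpstar_tensor C (opposite P) P)"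
proof -
  obtain M U Z where p: "alg P (Lf (fst P)) M U Z" by (rule alg_leaf[OF assms(1)])
  note t = algD(1-5)[OF p]
  have c: "Tr Ut (cup_arr P) (Nd (Lf (fst P)) (Lf (fst P))) (S.cup M U)"
    unfolding cup_arr_def by (rule t Tr_intros)+
  show ?thesis unfolding alg_hom_iff[OF alg_unit alg_tensor[OF alg_opposite[OF p] p] c]
    using S.choi_cup[OF t(5)] S.positive_arr_square[of M] S.nalg_typing[OF t(5)] by simp
qed

text \<open>An algebra and its dual share the carrier, so the snake equations are those of the
  Frobenius self-duality. The crossing in the counit \<open>\<epsilon>\<close> is absorbed by
  symmetry of the algebra, which makes it the cap.\<close>

lemma cp_snake:
  assumes "P \<in> \<O>"
  defines "A \<equiv> fst P" and "\<epsilon> \<equiv> (cup_arr P)\<^sup>\<dagger> \<cdot> \<sigma> (fst P) (fst P)"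
  shows "\<l> A \<cdot> (\<epsilon> \<otimes> \<one> A) \<cdot> (\<a> A A A)\<^sup>\<dagger> \<cdot> (\<one> A \<otimes> cup_arr P) \<cdot> (\<r> A)\<^sup>\<dagger> = \<one> A"
    and "\<r> A \<cdot> (\<one> A \<otimes> \<epsilon>) \<cdot> \<a> A A A \<cdot> (cup_arr P \<otimes> \<one> A) \<cdot> (\<l> A)\<^sup>\<dagger> = \<one> A"
proof -
  obtain M U Z where p: "alg P (Lf A) M U Z" unfolding A_def by (rule alg_leaf[OF assms(1)])
  note t = algD(1-5)[OF p, folded A_def] and n = S.nalg_typing[OF algD(5)[OF p]] and fr = algD(6)[OF p]
  note [simp] = n treeD[OF t(1)]
  have c: "Tr Ut (cup_arr P) (Nd (Lf A) (Lf A)) (S.cup M U)"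
    unfolding cup_arr_def by (rule t Tr_intros)+
  have e: "Tr (Nd (Lf A) (Lf A)) \<epsilon> Ut (S.cap M U)"
    unfolding \<epsilon>_def A_def[symmetric]
    by (rule Tr_cong) ((rule c t Tr_intros)+,
      use S.nalg_laws(1)[OF t(5)] in \<open>simp add: S.dag_comp S.comp_assoc\<close>)
  show "\<l> A \<cdot> (\<epsilon> \<otimes> \<one> A) \<cdot> (\<a> A A A)\<^sup>\<dagger> \<cdot> (\<one> A \<otimes> cup_arr P) \<cdot> (\<r> A)\<^sup>\<dagger> = \<one> A"
    by (rule Tr_eq_iff[THEN iffD2, OF _ _ S.snake_right[OF fr]]; rule Tr_cong) ((rule c e t Tr_intros)+, simp add: s_cat)+
  show "\<r> A \<cdot> (\<one> A \<otimes> \<epsilon>) \<cdot> \<a> A A A \<cdot> (cup_arr P \<otimes> \<one> A) \<cdot> (\<l> A)\<^sup>\<dagger> = \<one> A"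
    by (rule Tr_eq_iff[THEN iffD2, OF _ _ S.snake_left[OF fr]]; rule Tr_cong) ((rule c e t Tr_intros)+, simp add: s_cat)+
qed

lemma cp_unitary:
  assumes "v \<in> \<H> P Q" "unitary C (fst P) (fst Q) v"
  shows "unitary K P Q v"
  using assms by (simp add: unitary_def cpstar_simps)

text \<open>The operations on morphisms are those of the given category, so the equations are
  inherited. The content lies in membership of composites, daggers, tensor products, coherence maps
  and cups in the smaller hom-sets, which the lemmas above supply.\<close>

lemma cpstar_dagger_compact: "dagger_compact_structure K opposite cup_arr"
proof -
  have "category K"
    by (unfold_locales; unfold cpstar_simps)
      (blast intro: cp_id cp_comp Comp_assoc Id_left Id_right cp_objD cp_homD)+
  then interpret K: category K .
  have "dagger_category K"
    by (unfold_locales; unfold cpstar_simps)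
      (blast intro: cp_dag Dag_Dag Dag_Id Dag_Comp cp_objD cp_homD)+
  then interpret K: dagger_category K .
  have "dagger_symmetric_monoidal_category K"
  proof (unfold_locales; unfold cpstar_simps fst_tensor fst_conv)
    fix A B D E A' B' D' :: "('o, 'a) algebra" and f g f' g' h
    show "(\<I>, \<l> \<I>, \<one> \<I>, \<one> \<I>) \<in> \<O>" by (rule algD(7)[OF alg_unit])
    show "\<lbrakk>A \<in> \<O>; B \<in> \<O>\<rbrakk> \<Longrightarrow> cpstar_tensor C A B \<in> \<O>" by (rule cp_tensor_obj)
    show "\<lbrakk>A \<in> \<O>; B \<in> \<O>; A' \<in> \<O>; B' \<in> \<O>; f \<in> \<H> A B; g \<in> \<H> A' B'\<rbrakk>
      \<Longrightarrow> f \<otimes> g \<in> \<H> (cpstar_tensor C A A') (cpstar_tensor C B B')" by (rule cp_tensor_hom)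
    show "\<lbrakk>A \<in> \<O>; B \<in> \<O>\<rbrakk> \<Longrightarrow> \<one> (fst A) \<otimes> \<one> (fst B) = \<one> (fst A \<odot> fst B)"
      by (simp add: TensorHom_Id cp_objD)
    show "\<lbrakk>A \<in> \<O>; B \<in> \<O>; D \<in> \<O>; A' \<in> \<O>; B' \<in> \<O>; D' \<in> \<O>; f \<in> \<H> A B; g \<in> \<H> B D; f' \<in> \<H> A' B'; g' \<in> \<H> B' D'\<rbrakk>
      \<Longrightarrow> (g \<cdot> f) \<otimes> (g' \<cdot> f') = (g \<otimes> g') \<cdot> (f \<otimes> f')"
      by (blast intro: TensorHom_Comp cp_objD cp_homD)
    show "\<lbrakk>A \<in> \<O>; B \<in> \<O>; A' \<in> \<O>; B' \<in> \<O>; f \<in> \<H> A B; g \<in> \<H> A' B'\<rbrakk>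
      \<Longrightarrow> (f \<otimes> g)\<^sup>\<dagger> = f\<^sup>\<dagger> \<otimes> g\<^sup>\<dagger>"
      by (blast intro: Dag_TensorHom cp_objD cp_homD)
    show "\<lbrakk>A \<in> \<O>; B \<in> \<O>; D \<in> \<O>\<rbrakk> \<Longrightarrow> unitary K (cpstar_tensor C (cpstar_tensor C A B) D)
       (cpstar_tensor C A (cpstar_tensor C B D)) (\<a> (fst A) (fst B) (fst D))"
      by (rule cp_unitary, rule cp_assoc) (simp_all add: Assoc_unitary cp_objD)
    show "A \<in> \<O> \<Longrightarrow> unitary K (cpstar_tensor C (\<I>, \<l> \<I>, \<one> \<I>, \<one> \<I>) A) A (\<l> (fst A))"
      by (rule cp_unitary, rule cp_left) (simp_all add: LeftUnit_unitary cp_objD)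
    show "A \<in> \<O> \<Longrightarrow> unitary K (cpstar_tensor C A (\<I>, \<l> \<I>, \<one> \<I>, \<one> \<I>)) A (\<r> (fst A))"
      by (rule cp_unitary, rule cp_right) (simp_all add: RightUnit_unitary cp_objD)
    show "\<lbrakk>A \<in> \<O>; B \<in> \<O>\<rbrakk> \<Longrightarrow> unitary K (cpstar_tensor C A B) (cpstar_tensor C B A) (\<sigma> (fst A) (fst B))"
      by (rule cp_unitary, rule cp_sym) (simp_all add: Sym_unitary cp_objD)
    show "\<lbrakk>A \<in> \<O>; B \<in> \<O>; D \<in> \<O>; A' \<in> \<O>; B' \<in> \<O>; D' \<in> \<O>; f \<in> \<H> A A'; g \<in> \<H> B B'; h \<in> \<H> D D'\<rbrakk>
      \<Longrightarrow> \<a> (fst A') (fst B') (fst D') \<cdot> ((f \<otimes> g) \<otimes> h) = (f \<otimes> (g \<otimes> h)) \<cdot> \<a> (fst A) (fst B) (fst D)"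
      by (blast intro: Assoc_natural cp_objD cp_homD)
    show "\<lbrakk>A \<in> \<O>; B \<in> \<O>; f \<in> \<H> A B\<rbrakk> \<Longrightarrow> \<l> (fst B) \<cdot> (\<one> \<I> \<otimes> f) = f \<cdot> \<l> (fst A)"
      by (blast intro: LeftUnit_natural cp_objD cp_homD)
    show "\<lbrakk>A \<in> \<O>; B \<in> \<O>; f \<in> \<H> A B\<rbrakk> \<Longrightarrow> \<r> (fst B) \<cdot> (f \<otimes> \<one> \<I>) = f \<cdot> \<r> (fst A)"
      by (blast intro: RightUnit_natural cp_objD cp_homD)
    show "\<lbrakk>A \<in> \<O>; B \<in> \<O>; A' \<in> \<O>; B' \<in> \<O>; f \<in> \<H> A A'; g \<in> \<H> B B'\<rbrakk>
      \<Longrightarrow> \<sigma> (fst A') (fst B') \<cdot> (f \<otimes> g) = (g \<otimes> f) \<cdot> \<sigma> (fst A) (fst B)"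
      by (blast intro: Sym_natural cp_objD cp_homD)
    show "\<lbrakk>A \<in> \<O>; B \<in> \<O>; D \<in> \<O>; E \<in> \<O>\<rbrakk>
      \<Longrightarrow> \<a> (fst A) (fst B) (fst D \<odot> fst E) \<cdot> \<a> (fst A \<odot> fst B) (fst D) (fst E)
        = (\<one> (fst A) \<otimes> \<a> (fst B) (fst D) (fst E)) \<cdot> \<a> (fst A) (fst B \<odot> fst D) (fst E) \<cdot> (\<a> (fst A) (fst B) (fst D) \<otimes> \<one> (fst E))"
      by (simp add: pentagon cp_objD)
    show "\<lbrakk>A \<in> \<O>; B \<in> \<O>\<rbrakk>
      \<Longrightarrow> (\<one> (fst A) \<otimes> \<l> (fst B)) \<cdot> \<a> (fst A) \<I> (fst B) = \<r> (fst A) \<otimes> \<one> (fst B)"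
      by (simp add: triangle cp_objD)
    show "\<lbrakk>A \<in> \<O>; B \<in> \<O>; D \<in> \<O>\<rbrakk>
      \<Longrightarrow> \<a> (fst B) (fst D) (fst A) \<cdot> \<sigma> (fst A) (fst B \<odot> fst D) \<cdot> \<a> (fst A) (fst B) (fst D)
        = (\<one> (fst B) \<otimes> \<sigma> (fst A) (fst D)) \<cdot> \<a> (fst B) (fst A) (fst D) \<cdot> (\<sigma> (fst A) (fst B) \<otimes> \<one> (fst D))"
      by (simp add: hexagon cp_objD)
    show "\<lbrakk>A \<in> \<O>; B \<in> \<O>\<rbrakk> \<Longrightarrow> \<sigma> (fst B) (fst A) \<cdot> \<sigma> (fst A) (fst B) = \<one> (fst A \<odot> fst B)"
      by (simp add: Sym_Sym cp_objD)
  qed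
  then interpret K: dagger_symmetric_monoidal_category K .
  show ?thesis
  proof (unfold_locales; unfold cpstar_simps fst_tensor fst_conv fst_opposite counit_def)
    fix A :: "('o, 'a) algebra" assume A: "A \<in> \<O>"
    show "opposite A \<in> \<O>" using A by (rule alg_leaf) (rule algD(7)[OF alg_opposite])
    show "cup_arr A \<in> \<H> (\<I>, \<l> \<I>, \<one> \<I>, \<one> \<I>) (cpstar_tensor C (opposite A) A)" by (rule cp_cup[OF A])
    let ?A = "fst A" and ?e = "(cup_arr A)\<^sup>\<dagger> \<cdot> \<sigma> (fst A) (fst A)"
    show "\<l> ?A \<cdot> (?e \<otimes> \<one> ?A) \<cdot> (\<a> ?A ?A ?A)\<^sup>\<dagger> \<cdot> (\<one> ?A \<otimes> cup_arr A) \<cdot> (\<r> ?A)\<^sup>\<dagger> = \<one> ?A"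
      "\<r> ?A \<cdot> (\<one> ?A \<otimes> ?e) \<cdot> \<a> ?A ?A ?A \<cdot> (cup_arr A \<otimes> \<one> ?A) \<cdot> (\<l> ?A)\<^sup>\<dagger> = \<one> ?A"
      by (rule cp_snake[OF A])+
  qed
qed

subsection \<open>Dagger biproducts\<close>

lemma s_has_duals: "S.has_duals"
  using list_dual by (auto simp: S.has_duals_def)

lemma tree_rtree: "objs xs \<Longrightarrow> tree (rtree xs) (ev (rtree xs))"
  by (simp add: tree_def)

section \<open>Zero objects and biproducts among tensor words\<close>

lemma zobj_leaf:
  assumes "zero_object C Z" shows "S.zobj [Z]"
proof -
  have Z: "Z \<in> Obj C" and u: "\<And>A. A \<in> Obj C \<Longrightarrow> \<exists>!f. f \<in> Hom C A Z"
    using assms by (auto simp: zero_object_def)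
  note tZ = tree_intros(2)[OF Z]
  show ?thesis unfolding S.zobj_def
  proof (intro conjI allI impI)
    show "objs [Z]" using Z by simp
    fix a assume a: "objs a"
    note ta = tree_rtree[OF a]
    obtain f where "f \<in> Hom C (ev (rtree a)) Z" using u[OF treeD(2)[OF ta]] by blast
    from tr_typing[OF Tr_tr[OF ta tZ this]] show "\<exists>f. sarr f \<and> src f = a \<and> tgt f = [Z]"
      by (intro exI[of _ "tr (rtree a) (Lf Z) f"]) simp
  next
    fix F G assume FG: "sarr F \<and> sarr G \<and> src F = src G \<and> tgt F = [Z] \<and> tgt G = [Z]"
    then have ta: "tree (rtree (src G)) (ev (rtree (src G)))" by (intro tree_rtree) simp
    obtain f where f: "Tr (rtree (src G)) f (Lf Z) F" by (rule Tr_full[of F "rtree (src G)" "Lf Z"]) (use FG in auto)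
    obtain g where g: "Tr (rtree (src G)) g (Lf Z) G" by (rule Tr_full[of G "rtree (src G)" "Lf Z"]) (use FG in auto)
    have "f = g" using u[OF treeD(2)[OF ta]] tr_typing(3)[OF f] tr_typing(3)[OF g] by auto
    then show "F = G" using f g by (simp add: Tr_def)
  qed
qed

lemma zero_morphism_zarr:
  assumes "zero_morphism C A B f" "tree t A" "tree s B" "Tr t f s F"
  shows "S.zarr F"
proof -
  obtain Z g h where Z: "zero_object C Z" and g: "g \<in> Hom C A Z" and h: "h \<in> Hom C Z B" and f: "f = h \<cdot> g"
    using assms(1) by (auto simp: zero_morphism_def)
  have tZ: "tree (Lf Z) Z" using Z by (auto simp: zero_object_def intro: tree_intros)
  note G = Tr_tr[OF assms(2) tZ g] and H = Tr_tr[OF tZ assms(3) h]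
  have "F = tr (Lf Z) s h \<bullet> tr t (Lf Z) g" using Tr_comp[OF G H] assms(4) f by (simp add: Tr_def)
  then show ?thesis unfolding S.zarr_def
    using tr_typing[OF G] tr_typing[OF H] zobj_leaf[OF Z]
    by (intro exI[of _ "tr t (Lf Z) g"] exI[of _ "tr (Lf Z) s h"]) simp
qed

text \<open>The biproduct object becomes a single letter, but the summands may be bracketed words.
  \<open>bip_exists\<close> depends on this, because it has to form biproducts of the arbitrary
  codomains of roots.\<close>

lemma bip_leaf:
  assumes b: "biproduct C A B S iA iB (iA\<^sup>\<dagger>) (iB\<^sup>\<dagger>)" and tA: "tree (t True) A" and tB: "tree (t False) B"
  defines "i \<equiv> \<lambda>k. tr (t k) (Lf S) (if k then iA else iB)"
  shows "S.bip [S] (\<lambda>k. fl (t k)) i"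
proof -
  have S: "S \<in> Obj C" and iA: "iA \<in> Hom C A S" and iB: "iB \<in> Hom C B S"
    and P: "\<And>X f g. \<lbrakk>X \<in> Obj C; f \<in> Hom C X A; g \<in> Hom C X B\<rbrakk> \<Longrightarrow> \<exists>!h. h \<in> Hom C X S \<and> iA\<^sup>\<dagger> \<cdot> h = f \<and> iB\<^sup>\<dagger> \<cdot> h = g"
    and Q: "\<And>X f g. \<lbrakk>X \<in> Obj C; f \<in> Hom C A X; g \<in> Hom C B X\<rbrakk> \<Longrightarrow> \<exists>!h. h \<in> Hom C S X \<and> h \<cdot> iA = f \<and> h \<cdot> iB = g"
    and one: "iA\<^sup>\<dagger> \<cdot> iA = \<one> A" "iB\<^sup>\<dagger> \<cdot> iB = \<one> B"
    and zero: "zero_morphism C B A (iA\<^sup>\<dagger> \<cdot> iB)" "zero_morphism C A B (iB\<^sup>\<dagger> \<cdot> iA)"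
    using b unfolding biproduct_def by auto
  note tS = tree_intros(2)[OF S]
  have I: "Tr (t True) iA (Lf S) (i True)" "Tr (t False) iB (Lf S) (i False)"
    unfolding i_def using Tr_tr[OF tA tS iA] Tr_tr[OF tB tS iB] by simp_all
  have tk: "sarr (i k)" "src (i k) = fl (t k)" "tgt (i k) = [S]" for k
    using tr_typing[OF I(1)] tr_typing[OF I(2)] by (cases k; simp)+
  note tree1 = tA tB
  show ?thesis unfolding S.bip_def
  proof (intro conjI allI impI)
    show "objs [S]" using S by simp
    fix k
    show "objs (fl (t k))" using treeD(1)[OF tA] treeD(1)[OF tB] by (cases k) simp_all
    show "sarr (i k)" "src (i k) = fl (t k)" "tgt (i k) = [S]" by (rule tk)+
    have "(i True)\<^sup>\<circ> \<bullet> i True = sid (fl (t True))"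
      by (rule Tr_eq_iff[THEN iffD1, OF _ _ one(1)]) (rule I tree1 Tr_intros)+
    moreover have "(i False)\<^sup>\<circ> \<bullet> i False = sid (fl (t False))"
      by (rule Tr_eq_iff[THEN iffD1, OF _ _ one(2)]) (rule I tree1 Tr_intros)+
    ultimately show "(i k)\<^sup>\<circ> \<bullet> i k = sid (fl (t k))" by (cases k) simp_all
    fix j :: bool assume "j \<noteq> k"
    have "S.zarr ((i True)\<^sup>\<circ> \<bullet> i False)"
      by (rule zero_morphism_zarr[OF zero(1) tB tA]) (rule I tree1 Tr_intros)+
    moreover have "S.zarr ((i False)\<^sup>\<circ> \<bullet> i True)"
      by (rule zero_morphism_zarr[OF zero(2) tA tB]) (rule I tree1 Tr_intros)+
    ultimately show "S.zarr ((i j)\<^sup>\<circ> \<bullet> i k)" using \<open>j \<noteq> k\<close> by (cases j; cases k) simp_all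
  next
    fix F G assume F: "sarr F" "src F = [S]" and G: "sarr G" "src G = [S]" and c: "tgt F = tgt G"
      and e: "\<forall>k. F \<bullet> i k = G \<bullet> i k"
    let ?x = "rtree (tgt G)"
    have tx: "tree ?x (ev ?x)" using G by (intro tree_rtree) simp
    obtain f where f: "Tr (Lf S) f ?x F" by (rule Tr_full[of F "Lf S" ?x]) (use F c in auto)
    obtain g where g: "Tr (Lf S) g ?x G" by (rule Tr_full[of G "Lf S" ?x]) (use G c in auto)
    have fg: "f \<in> Hom C S (ev ?x)" "g \<in> Hom C S (ev ?x)" using tr_typing(3)[OF f] tr_typing(3)[OF g] by simp_all
    have "f \<cdot> iA = g \<cdot> iA" using Tr_eq_iff[OF Tr_comp[OF I(1) f] Tr_comp[OF I(1) g]] e by simp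
    moreover have "f \<cdot> iB = g \<cdot> iB" using Tr_eq_iff[OF Tr_comp[OF I(2) f] Tr_comp[OF I(2) g]] e by simp
    moreover have "g \<cdot> iA \<in> Hom C A (ev ?x)" "g \<cdot> iB \<in> Hom C B (ev ?x)"
      using tr_typing(3)[OF Tr_comp[OF I(1) g]] tr_typing(3)[OF Tr_comp[OF I(2) g]] tA tB by (simp_all add: tree_def)
    ultimately have "f = g" using Q[OF treeD(2)[OF tx]] fg by metis
    then show "F = G" using f g by (simp add: Tr_def)
  next
    fix x F assume x: "objs x" and F: "\<forall>k. sarr (F k) \<and> src (F k) = x \<and> tgt (F k) = fl (t k)"
    let ?x = "rtree x"
    note tx = tree_rtree[OF x]
    obtain f where f: "Tr ?x f (t True) (F True)" by (rule Tr_full[of "F True" ?x "t True"]) (use F in auto)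
    obtain g where g: "Tr ?x g (t False) (F False)" by (rule Tr_full[of "F False" ?x "t False"]) (use F in auto)
    have "f \<in> Hom C (ev ?x) A" "g \<in> Hom C (ev ?x) B" using tr_typing(3)[OF f] tr_typing(3)[OF g] tA tB by (simp_all add: tree_def)
    from P[OF treeD(2)[OF tx] this] obtain h where h: "h \<in> Hom C (ev ?x) S" "iA\<^sup>\<dagger> \<cdot> h = f" "iB\<^sup>\<dagger> \<cdot> h = g" by blast
    note H = Tr_tr[OF tx tS h(1)]
    have "(i True)\<^sup>\<circ> \<bullet> tr ?x (Lf S) h = F True"
      using Tr_comp[OF H Tr_dag[OF I(1)]] f h(2) by (simp add: Tr_def)
    moreover have "(i False)\<^sup>\<circ> \<bullet> tr ?x (Lf S) h = F False"
      using Tr_comp[OF H Tr_dag[OF I(2)]] g h(3) by (simp add: Tr_def)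
    ultimately have "\<forall>k. (i k)\<^sup>\<circ> \<bullet> tr ?x (Lf S) h = F k" by (auto simp: all_bool_eq)
    with tr_typing[OF H] show "\<exists>h. sarr h \<and> src h = x \<and> tgt h = [S] \<and> (\<forall>k. (i k)\<^sup>\<circ> \<bullet> h = F k)"
      by (intro exI[of _ "tr ?x (Lf S) h"]) simp
  qed
qed

lemma bip_exists:
  assumes "has_dagger_biproducts C" and y: "\<And>k. objs (y k)"
  shows "\<exists>t j. S.bip t y j"
proof -
  let ?t = "\<lambda>k. rtree (y k)"
  have t: "tree (?t k) (ev (?t k))" for k by (rule tree_rtree[OF y])
  obtain R iA iB where "biproduct C (ev (?t True)) (ev (?t False)) R iA iB (iA\<^sup>\<dagger>) (iB\<^sup>\<dagger>)"
    using assms(1) treeD(2)[OF t[of True]] treeD(2)[OF t[of False]] unfolding has_dagger_biproducts_def by blast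
  from bip_leaf[of _ _ R iA iB ?t, OF this t t] show ?thesis by (auto simp: fl_rtree)
qed

section \<open>The zero object and the biproducts of CP*\<close>

lemma cpstar_zero_object:
  assumes "zero_object C Z"
  obtains m u where "zero_object K (Z, m, u, \<one> Z)"
proof -
  have Z: "Z \<in> Obj C" and U: "\<And>A. A \<in> Obj C \<Longrightarrow> (\<exists>!f. f \<in> Hom C A Z) \<and> (\<exists>!f. f \<in> Hom C Z A)"
    using assms by (auto simp: zero_object_def)
  note tZ = tree_intros(2)[OF Z]
  obtain m where m: "m \<in> Hom C (Z \<odot> Z) Z" using U[of "Z \<odot> Z"] Z by auto
  obtain u where u: "u \<in> Hom C \<I> Z" using U[of \<I>] by auto
  let ?Z = "(Z, m, u, \<one> Z)"
  have M: "Tr (Nd (Lf Z) (Lf Z)) m (Lf Z) (tr (Nd (Lf Z) (Lf Z)) (Lf Z) m)"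
    using tZ m by (auto intro!: Tr_tr tree_intros)
  have u': "Tr Ut u (Lf Z) (tr Ut (Lf Z) u)" using tZ u by (auto intro!: Tr_tr tree_intros)
  have z: "alg ?Z (Lf Z) (tr (Nd (Lf Z) (Lf Z)) (Lf Z) m) (tr Ut (Lf Z) u) (sid [Z])"
    using S.nalg_zero[OF s_has_duals zobj_leaf[OF assms], of "tr (Nd (Lf Z) (Lf Z)) (Lf Z) m" "tr Ut (Lf Z) u"]
      tr_typing[OF M] tr_typing[OF u'] M u' tZ Tr_id[OF tZ] by (simp add: alg_def)
  have zO: "?Z \<in> \<O>" by (rule algD(7)[OF z])
  have hom: "f\<^sup>\<dagger> \<in> \<H> ?Z P" "f \<in> \<H> P ?Z" if P: "P \<in> \<O>" and f: "f \<in> Hom C (fst P) Z" for P f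
  proof -
    obtain M' U' Z' where p: "alg P (Lf (fst P)) M' U' Z'" by (rule alg_leaf[OF P])
    note F = Tr_tr[OF algD(1)[OF p] tZ f]
    \<comment> \<open>The Choi morphism of an arrow out of the zero algebra is an endomorphism of an
      initial word, so this direction comes first; the other one follows by
      \<open>cp_dag\<close>.\<close>
    show 1: "f\<^sup>\<dagger> \<in> \<H> ?Z P" unfolding alg_hom_iff[OF z p Tr_dag[OF F]]
      by (rule S.choi_zero[OF s_has_duals zobj_leaf[OF assms] _ algD(5)[OF p]])
        (use algD(5)[OF z] tr_typing[OF F] in auto)
    show "f \<in> \<H> P ?Z" using cp_dag[OF zO P 1] Dag_Dag[OF cp_objD[OF P] Z f] by simp
  qed
  have "zero_object K ?Z" unfolding zero_object_def cpstar_simps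
  proof (intro conjI ballI zO)
    fix P assume P: "P \<in> \<O>"
    note oP = cp_objD[OF P]
    obtain f where f: "f \<in> Hom C (fst P) Z" using U[OF oP] by blast
    show "\<exists>!f. f \<in> \<H> P ?Z"
    proof (rule ex1I[of _ f])
      show "f \<in> \<H> P ?Z" by (rule hom(2)[OF P f])
      show "g = f" if "g \<in> \<H> P ?Z" for g using cp_homD[OF that] U[OF oP] f by auto
    qed
    show "\<exists>!f. f \<in> \<H> ?Z P"
    proof (rule ex1I[of _ "f\<^sup>\<dagger>"])
      show "f\<^sup>\<dagger> \<in> \<H> ?Z P" by (rule hom(1)[OF P f])
      show "g = f\<^sup>\<dagger>" if "g \<in> \<H> ?Z P" for g
        using cp_homD[OF that] cp_homD[OF hom(1)[OF P f]] U[OF oP] by auto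
    qed
  qed
  then show thesis by (rule that)
qed

lemma zero_morphism_unique:
  assumes "zero_morphism C A B f" "zero_morphism C A B g" "A \<in> Obj C" "B \<in> Obj C"
  shows "f = g"
proof -
  have tA: "tree (Lf A) A" and tB: "tree (Lf B) B" using assms by (auto intro: tree_intros)
  have hom: "h \<in> Hom C A B" if "zero_morphism C A B h" for h
    using that assms(3,4) by (auto simp: zero_morphism_def zero_object_def intro: Comp_in_Hom)
  note F = Tr_tr[OF tA tB hom[OF assms(1)]] and G = Tr_tr[OF tA tB hom[OF assms(2)]]
  show ?thesis unfolding Tr_eq_iff[OF F G]
    by (rule S.zarr_unique[OF zero_morphism_zarr[OF assms(1) tA tB F] zero_morphism_zarr[OF assms(2) tA tB G]])
      simp_all
qed

text \<open>A factorisation in the given category does not serve directly, as its two halves must be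
  morphisms of CP*. The zero algebra provides such halves, and uniqueness of zero morphisms
  identifies their composite with \<open>f\<close>.\<close>

lemma cpstar_zero_morphism:
  assumes "zero_object C Z" "P \<in> \<O>" "Q \<in> \<O>" "zero_morphism C (fst P) (fst Q) f"
  shows "zero_morphism K P Q f"
proof -
  obtain m u where z: "zero_object K (Z, m, u, \<one> Z)" by (rule cpstar_zero_object[OF assms(1)])
  from z have "\<exists>g. g \<in> \<H> P (Z, m, u, \<one> Z)" "\<exists>h. h \<in> \<H> (Z, m, u, \<one> Z) Q"
    using assms(2,3) unfolding zero_object_def cpstar_simps by meson+
  then obtain g h where g: "g \<in> \<H> P (Z, m, u, \<one> Z)" and h: "h \<in> \<H> (Z, m, u, \<one> Z) Q" by blast
  have "zero_morphism C (fst P) (fst Q) (h \<cdot> g)"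
    unfolding zero_morphism_def
    by (intro exI[of _ Z] exI[of _ g] exI[of _ h]) (use cp_homD[OF g] cp_homD[OF h] assms(1) in simp)
  then have "f = h \<cdot> g"
    by (rule zero_morphism_unique[OF assms(4) _ cp_objD[OF assms(2)] cp_objD[OF assms(3)]])
  then show ?thesis unfolding zero_morphism_def cpstar_simps
    by (intro exI[of _ "(Z, m, u, \<one> Z)"] exI[of _ g] exI[of _ h]) (simp add: z g h)
qed

text \<open>Mediating morphisms exist and are unique in the given category, so it remains to see
  that they lie in CP*. For pairings this is \<open>choi_bip_pairing\<close>; the dagger of a
  copairing is the pairing of the daggers, and \<open>cp_dag\<close> leads back.\<close>

lemma cpstar_biproduct:
  assumes hb: "has_dagger_biproducts C" and P: "P \<in> \<O>" and Q: "Q \<in> \<O>"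
  shows "\<exists>R iA iB pA pB. biproduct K P Q R iA iB pA pB \<and> pA = iA\<^sup>\<dagger> \<and> pB = iB\<^sup>\<dagger>"
proof -
  obtain Z where Z: "zero_object C Z" using hb by (auto simp: has_dagger_biproducts_def)
  obtain R iA iB where b: "biproduct C (fst P) (fst Q) R iA iB (iA\<^sup>\<dagger>) (iB\<^sup>\<dagger>)"
    using hb cp_objD[OF P] cp_objD[OF Q] unfolding has_dagger_biproducts_def by blast
  have R: "R \<in> Obj C" and iA: "iA \<in> Hom C (fst P) R" and iB: "iB \<in> Hom C (fst Q) R"
    and uP: "\<And>X f g. \<lbrakk>X \<in> Obj C; f \<in> Hom C X (fst P); g \<in> Hom C X (fst Q)\<rbrakk>
       \<Longrightarrow> \<exists>!h. h \<in> Hom C X R \<and> iA\<^sup>\<dagger> \<cdot> h = f \<and> iB\<^sup>\<dagger> \<cdot> h = g"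
    and uQ: "\<And>X f g. \<lbrakk>X \<in> Obj C; f \<in> Hom C (fst P) X; g \<in> Hom C (fst Q) X\<rbrakk>
       \<Longrightarrow> \<exists>!h. h \<in> Hom C R X \<and> h \<cdot> iA = f \<and> h \<cdot> iB = g"
    and one: "iA\<^sup>\<dagger> \<cdot> iA = \<one> (fst P)" "iB\<^sup>\<dagger> \<cdot> iB = \<one> (fst Q)"
    and zero: "zero_morphism C (fst Q) (fst P) (iA\<^sup>\<dagger> \<cdot> iB)" "zero_morphism C (fst P) (fst Q) (iB\<^sup>\<dagger> \<cdot> iA)"
    using b unfolding biproduct_def by auto
  note tR = tree_intros(2)[OF R]
  define X where "X k = (if k then P else Q)" for k
  define \<iota>V where "\<iota>V k = (if k then iA else iB)" for k
  have XO: "X k \<in> \<O>" for k using P Q by (simp add: X_def)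
  define t where "t k = Lf (fst (X k))" for k
  have "\<forall>k. \<exists>M U Z. alg (X k) (t k) M U Z" using alg_leaf[OF XO] unfolding t_def by metis
  then obtain M U Y where a: "\<And>k. alg (X k) (t k) (M k) (U k) (Y k)" by metis
  define i where "i k = tr (t k) (Lf R) (\<iota>V k)" for k
  have bp: "S.bip [R] (\<lambda>k. fl (t k)) i"
    using bip_leaf[OF b, of t] algD(1)[OF a[of True]] algD(1)[OF a[of False]]
    by (simp add: X_def i_def[abs_def] \<iota>V_def)
  have I: "Tr (t k) (\<iota>V k) (Lf R) (i k)" for k
    unfolding i_def by (rule Tr_tr[OF algD(1)[OF a] tR]) (simp add: X_def \<iota>V_def iA iB)
  have n: "S.nalg (fl (t k)) (M k) (U k) (Y k)" for k by (rule algD(5)[OF a])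
  note ex = bip_exists[OF hb] and hd = s_has_duals
  obtain M' U' Z' where ba: "S.bip_alg [R] i M U Y M' U' Z'" by (rule S.bip_alg_exists[OF bp n])
  have nR: "S.nalg [R] M' U' Z'" by (rule S.nalg_bip[OF hd bp ex n ba])
  note ty = S.nalg_typing[OF nR]
  obtain m where m: "Tr (Nd (Lf R) (Lf R)) m (Lf R) M'" by (rule Tr_full[of M' "Nd (Lf R) (Lf R)" "Lf R"]) (use ty in auto)
  obtain u where u: "Tr Ut u (Lf R) U'" by (rule Tr_full[of U' Ut "Lf R"]) (use ty in auto)
  obtain z where z: "Tr (Lf R) z (Lf R) Z'" by (rule Tr_full[of Z' "Lf R" "Lf R"]) (use ty in auto)
  let ?R = "(R, m, u, z)"
  have aR: "alg ?R (Lf R) M' U' Z'" using tR m u z nR by (simp add: alg_def)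
  have RO: "?R \<in> \<O>" by (rule algD(7)[OF aR])
  have iH: "\<iota>V k \<in> \<H> (X k) ?R" for k
    unfolding alg_hom_iff[OF a aR I] by (rule S.choi_bip_injection[OF hd bp n ba])
  have iAH: "iA \<in> \<H> P ?R" and iBH: "iB \<in> \<H> Q ?R" using iH[of True] iH[of False] by (simp_all add: X_def \<iota>V_def)
  have pair: "h \<in> \<H> W ?R" if W: "W \<in> \<O>" and h: "h \<in> Hom C (fst W) R"
    and f: "iA\<^sup>\<dagger> \<cdot> h \<in> \<H> W P" and g: "iB\<^sup>\<dagger> \<cdot> h \<in> \<H> W Q" for W h
  proof -
    obtain N V Y' where w: "alg W (Lf (fst W)) N V Y'" by (rule alg_leaf[OF W])
    note H = Tr_tr[OF algD(1)[OF w] tR h]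
    have fk: "(\<iota>V k)\<^sup>\<dagger> \<cdot> h \<in> \<H> W (X k)" for k using f g by (simp add: X_def \<iota>V_def)
    show ?thesis unfolding alg_hom_iff[OF w aR H]
      by (rule S.choi_bip_pairing[OF hd bp ex n ba algD(5)[OF w]])
        (use tr_typing[OF H] fk[unfolded alg_hom_iff[OF w a Tr_comp[OF H Tr_dag[OF I]]]] in simp_all)
  qed
  have "biproduct K P Q ?R iA iB (iA\<^sup>\<dagger>) (iB\<^sup>\<dagger>)"
    unfolding biproduct_def cpstar_simps
  proof (intro conjI ballI)
    show "?R \<in> \<O>" "iA \<in> \<H> P ?R" "iB \<in> \<H> Q ?R" by (rule RO iAH iBH)+
    show "iA\<^sup>\<dagger> \<in> \<H> ?R P" "iB\<^sup>\<dagger> \<in> \<H> ?R Q"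
      by (rule cp_dag[OF P RO iAH] cp_dag[OF Q RO iBH])+
    show "iA\<^sup>\<dagger> \<cdot> iA = \<one> (fst P)" "iB\<^sup>\<dagger> \<cdot> iB = \<one> (fst Q)" by (rule one)+
    show "zero_morphism K Q P (iA\<^sup>\<dagger> \<cdot> iB)" "zero_morphism K P Q (iB\<^sup>\<dagger> \<cdot> iA)"
      by (rule cpstar_zero_morphism[OF Z Q P zero(1)] cpstar_zero_morphism[OF Z P Q zero(2)])+
  next
    fix W f g assume W: "W \<in> \<O>" and f: "f \<in> \<H> W P" and g: "g \<in> \<H> W Q"
    from uP[OF cp_objD[OF W] cp_homD[OF f] cp_homD[OF g]]
    obtain h where h: "h \<in> Hom C (fst W) R" "iA\<^sup>\<dagger> \<cdot> h = f" "iB\<^sup>\<dagger> \<cdot> h = g"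
      and uniq: "\<And>h'. h' \<in> Hom C (fst W) R \<Longrightarrow> iA\<^sup>\<dagger> \<cdot> h' = f \<Longrightarrow> iB\<^sup>\<dagger> \<cdot> h' = g \<Longrightarrow> h' = h" by blast
    show "\<exists>!h. h \<in> \<H> W ?R \<and> iA\<^sup>\<dagger> \<cdot> h = f \<and> iB\<^sup>\<dagger> \<cdot> h = g"
    proof (rule ex1I[of _ h])
      have "h \<in> \<H> W ?R" by (rule pair[OF W h(1)]) (simp_all add: h f g)
      then show "h \<in> \<H> W ?R \<and> iA\<^sup>\<dagger> \<cdot> h = f \<and> iB\<^sup>\<dagger> \<cdot> h = g" using h by simp
      fix h' assume h': "h' \<in> \<H> W ?R \<and> iA\<^sup>\<dagger> \<cdot> h' = f \<and> iB\<^sup>\<dagger> \<cdot> h' = g"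
      then have "h' \<in> Hom C (fst W) R" using cp_homD[of h' W ?R] by simp
      then show "h' = h" using h' by (intro uniq) simp_all
    qed
  next
    fix W f g assume W: "W \<in> \<O>" and f: "f \<in> \<H> P W" and g: "g \<in> \<H> Q W"
    note o = cp_objD[OF P] cp_objD[OF Q] cp_objD[OF W]
    from uQ[OF o(3) cp_homD[OF f] cp_homD[OF g]]
    obtain h where h: "h \<in> Hom C R (fst W)" "h \<cdot> iA = f" "h \<cdot> iB = g"
      and uniq: "\<And>h'. h' \<in> Hom C R (fst W) \<Longrightarrow> h' \<cdot> iA = f \<Longrightarrow> h' \<cdot> iB = g \<Longrightarrow> h' = h" by blast
    have "iA\<^sup>\<dagger> \<cdot> h\<^sup>\<dagger> = f\<^sup>\<dagger>" "iB\<^sup>\<dagger> \<cdot> h\<^sup>\<dagger> = g\<^sup>\<dagger>"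
      using Dag_Comp[OF o(1) R o(3) iA h(1)] Dag_Comp[OF o(2) R o(3) iB h(1)] h by simp_all
    then have "h\<^sup>\<dagger> \<in> \<H> W ?R"
      using pair[OF W Dag_in_Hom[OF R o(3) h(1)]] cp_dag[OF P W f] cp_dag[OF Q W g] by simp
    from cp_dag[OF W RO this] have hH: "h \<in> \<H> ?R W" using Dag_Dag[OF R o(3) h(1)] by simp
    show "\<exists>!h. h \<in> \<H> ?R W \<and> h \<cdot> iA = f \<and> h \<cdot> iB = g"
    proof (rule ex1I[of _ h])
      show "h \<in> \<H> ?R W \<and> h \<cdot> iA = f \<and> h \<cdot> iB = g" using h hH by simp
      fix h' assume h': "h' \<in> \<H> ?R W \<and> h' \<cdot> iA = f \<and> h' \<cdot> iB = g"
      then have "h' \<in> Hom C R (fst W)" using cp_homD[of h' ?R W] by simp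
      then show "h' = h" using h' by (intro uniq) simp_all
    qed
  qed
  then show ?thesis by blast
qed

lemma cpstar_has_dagger_biproducts:
  assumes "has_dagger_biproducts C" shows "has_dagger_biproducts K"
proof -
  obtain Z where "zero_object C Z" using assms by (auto simp: has_dagger_biproducts_def)
  then obtain m u where "zero_object K (Z, m, u, \<one> Z)" by (rule cpstar_zero_object)
  then show ?thesis using cpstar_biproduct[OF assms]
    unfolding has_dagger_biproducts_def[of K] cpstar_simps by blast
qed

end

theorem theorem3p2:
  fixes V :: "('o, 'a) dsm_structure" and dual :: "'o \<Rightarrow> 'o" and \<eta> :: "'o \<Rightarrow> 'a"
  assumes "dagger_compact_structure V dual \<eta>"
    and "has_dagger_biproducts V"
  shows "dagger_compact_category (cpstar V dual \<eta>) \<and> has_dagger_biproducts (cpstar V dual \<eta>)"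
proof -
  interpret dagger_compact_structure V dual \<eta> by (rule assms(1))
  show ?thesis unfolding dagger_compact_category_def
    using cpstar_dagger_compact cpstar_has_dagger_biproducts[OF assms(2)] by blast
qed

end
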